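(* There exists a metric measure space $(X,d,\mathfrak m)$ that is an infinitesimally Hilbertian, $\mathfrak m$-rectifiable, Ahlfors regular PI space, and a point $\bar x\in X$, such that the pmGH-tangent cone $\mathrm{Tan}_{\bar x}(X,d,\mathfrak m)$ contains an infinitesimally non-Hilbertian element. In addition, one can require that $(X\setminus\{\bar x\},d,\mathfrak m)$ is a Riemannian manifold.
   Context: A metric measure space $(X,d,\mathfrak m)$ is a complete separable metric space $(X,d)$ with a boundedly-finite Borel measure $\mathfrak m\ge 0$. $B_r(x)$ denotes the open ball and $\mathcal H^n$ the $n$-dimensional Hausdorff measure of $(X,d)$. Sobolev space: for $f\colon X\to\mathbb R$ Lipschitz, the slope is $\mathrm{lip}(f)(x)=\limsup_{y\to x}|f(y)-f(x)|/d(y,x)$ if $x$ is an accumulation point, and $0$ otherwise. $f\in L^2(\mathfrak m)$ belongs to $H^{1,2}(X)$ if there are boundedly-supported Lipschitz functions $f_n\to f$ in $L^2(\mathfrak m)$ with $\sup_n\int \mathrm{lip}(f_n)^2\,d\mathfrak m<\infty$. The norm is $\|f\|_{H^{1,2}(X)}=\big(\int|f|^2\,d\mathfrak m+\inf_{(f_n)}\liminf_n\int\mathrm{lip}(f_n)^2\,d\mathfrak m\big)^{1/2}$, the infimum being over all sequences of boundedly-supported Lipschitz functions converging to $f$ in $L^2(\mathfrak m)$. This is a Banach space; $(X,d,\mathfrak m)$ is infinitesimally Hilbertian if $H^{1,2}(X)$ is a Hilbert space, and infinitesimally non-Hilbertian otherwise. Rectifiability: $(X,d,\mathfrak m)$ is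 $\mathfrak m$-rectifiable if there are countably many Borel sets $U_i\subset X$, forming a partition of $X$ up to $\mathfrak m$-null sets, integers $n_i\in\mathbb N$ (not assumed bounded) and maps $\varphi_i\colon U_i\to\mathbb R^{n_i}$ that are biLipschitz onto their images, with $\mathfrak m|_{U_i}\ll\mathcal H^{n_i}$. Ahlfors regularity: there are $k\ge1$ and $\alpha\ge1$ with $\alpha^{-1}r^k\le\mathfrak m(B_r(x))\le\alpha r^k$ for all $x\in X$, $r\in(0,\mathrm{diam}(X))$. PI space: $(X,d,\mathfrak m)$ is doubling (there is $C\ge1$ with $\mathfrak m(B_{2r}(x))\le C\,\mathfrak m(B_r(x))$ for all $x\in X$, $r>0$) and supports a weak $(1,2)$-Poincaré inequality: there are $C>0$, $\lambda\ge1$ such that for every boundedly-supported Lipschitz $f\colon X\to\mathbb R$, all $x\in X$ and $r>0$, writing $⨍_{B}g=\mathfrak m(B)^{-1}\int_B g\,d\mathfrak m$ for averages, $⨍_{B_r(x)}\big|f-⨍_{B_r(x)}f\big|\le Cr\big(⨍_{B_{\lambda r}(x)}\mathrm{lip}(f)^2\big)^{1/2}$. Tangent cones: a pointed metric measure space $(Y,d_Y,\mathfrak m_Y,q)$ is a metric measure space with a point $q\in\mathrm{spt}(\mathfrak m_Y)$. For $p\in\mathrm{spt}(\mathfrak m)$, it belongs to $\mathrm{Tan}_p(X,d,\mathfrak m)$ if there is a sequence $r_k\searrow0$ such that $(X,d/r_k,\mathfrak m/\mathfrak m(B_{r_k}(p)),p)\to(Y,d_Y,\mathfrak m_Y,q)$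 in the pointed measured Gromov–Hausdorff sense, i.e.: for every $\varepsilon\in(0,1)$ and a.e. $R>1$ there are $\bar k$ and Borel maps $\psi^k\colon B_{Rr_k}(p)\to Y$, $k\ge\bar k$, with (i) $\psi^k(p)=q$; (ii) $|d(x,y)-r_k d_Y(\psi^k(x),\psi^k(y))|\le\varepsilon r_k$ for all $x,y\in B_{Rr_k}(p)$; (iii) $B_{R-\varepsilon}(q)$ is contained in the open $\varepsilon$-neighbourhood of $\psi^k(B_{Rr_k}(p))$; (iv) $\mathfrak m(B_{r_k}(p))^{-1}\psi^k_\#(\mathfrak m|_{B_{Rr_k}(p)})\rightharpoonup\mathfrak m_Y|_{B_R(q)}$ as $k\to\infty$ in duality with bounded continuous functions on $Y$ with bounded support. "$(X\setminus\{\bar x\},d,\mathfrak m)$ is a Riemannian manifold" means that $X\setminus\{\bar x\}$ carries the structure of a smooth manifold with a smooth Riemannian metric whose induced length distance is the restriction of $d$ and whose volume measure is the restriction of $\mathfrak m$. *)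

theory Defs
  imports "HOL-Analysis.Analysis"
begin

section \<open>Metric measure spaces\<close>

text \<open>
  A complete separable metric space has at most continuum many points, so up to isometry
  every metric measure space is carried by a subset of the type \<open>nat \<Rightarrow> real\<close>; distance and
  measure on it are unrelated to the standard ones of that type.
\<close>

definition borel_sets_of :: "'a metric \<Rightarrow> 'a set set" where
  "borel_sets_of X = sigma_sets (mspace X) {U. openin (mtopology_of X) U}"

definition metric_measure_space :: "'a metric \<Rightarrow> 'a measure \<Rightarrow> bool" where
  "metric_measure_space X m \<longleftrightarrow>
     mcomplete_of X \<and> separable_space (mtopology_of X) \<and>
     space m = mspace X \<and> sets m = borel_sets_of X \<and>
     (\<forall>x\<in>mspace X. \<forall>r. emeasure m (mball_of X x r) < \<infinity>)"

definition spt :: "'a metric \<Rightarrow> 'a measure \<Rightarrow> 'a set" where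
  "spt X m = {x \<in> mspace X. \<forall>r>0. emeasure m (mball_of X x r) > 0}"

definition set_diam :: "'a metric \<Rightarrow> 'a set \<Rightarrow> ennreal" where
  "set_diam X S = (SUP x\<in>S. SUP y\<in>S. ennreal (mdist X x y))"

definition bounded_support :: "'a metric \<Rightarrow> ('a \<Rightarrow> real) \<Rightarrow> bool" where
  "bounded_support X f \<longleftrightarrow> Metric_space.mbounded (mspace X) (mdist X) {x \<in> mspace X. f x \<noteq> 0}"

definition Lip_bs :: "'a metric \<Rightarrow> ('a \<Rightarrow> real) set" where
  "Lip_bs X = {f. Lipschitz_continuous_map X euclidean_metric f \<and> bounded_support X f}"


section \<open>Sobolev space and infinitesimal Hilbertianity\<close>

definition slope :: "'a metric \<Rightarrow> ('a \<Rightarrow> real) \<Rightarrow> 'a \<Rightarrow> ennreal" where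
  "slope X f x =
     (if x \<in> mtopology_of X derived_set_of mspace X
      then Limsup (atin (mtopology_of X) x) (\<lambda>y. ennreal (\<bar>f y - f x\<bar> / mdist X y x))
      else 0)"

definition L2_sqnorm :: "'a measure \<Rightarrow> ('a \<Rightarrow> real) \<Rightarrow> ennreal" where
  "L2_sqnorm m f = (\<integral>\<^sup>+x. ennreal ((f x)\<^sup>2) \<partial>m)"

definition L2 :: "'a measure \<Rightarrow> ('a \<Rightarrow> real) set" where
  "L2 m = {f \<in> borel_measurable m. L2_sqnorm m f < \<infinity>}"

definition approximating :: "'a metric \<Rightarrow> 'a measure \<Rightarrow> ('a \<Rightarrow> real) \<Rightarrow> (nat \<Rightarrow> 'a \<Rightarrow> real) \<Rightarrow> bool" where
  "approximating X m f F \<longleftrightarrow>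
     (\<forall>n. F n \<in> Lip_bs X) \<and> (\<lambda>n. L2_sqnorm m (\<lambda>x. F n x - f x)) \<longlonglongrightarrow> 0"

definition slope_energy :: "'a metric \<Rightarrow> 'a measure \<Rightarrow> ('a \<Rightarrow> real) \<Rightarrow> ennreal" where
  "slope_energy X m f = (\<integral>\<^sup>+x. (slope X f x)\<^sup>2 \<partial>m)"

text \<open>
  Elements of the Sobolev space are represented by Borel functions; functions that agree
  almost everywhere are at norm distance zero.
\<close>

definition H12 :: "'a metric \<Rightarrow> 'a measure \<Rightarrow> ('a \<Rightarrow> real) set" where
  "H12 X m = {f \<in> L2 m. \<exists>F. approximating X m f F \<and> (SUP n. slope_energy X m (F n)) < \<infinity>}"

definition H12_norm :: "'a metric \<Rightarrow> 'a measure \<Rightarrow> ('a \<Rightarrow> real) \<Rightarrow> real" where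
  "H12_norm X m f =
     sqrt (enn2real (L2_sqnorm m f +
       (INF F\<in>{F. approximating X m f F}. liminf (\<lambda>n. slope_energy X m (F n)))))"

text \<open>
  \<open>Hilbert_space_on H N\<close>: the vector space of functions \<open>H\<close>, with functions at \<open>N\<close>-distance
  zero identified, is complete and its norm \<open>N\<close> is induced by an inner product. A symmetric
  bilinear \<open>B\<close> with \<open>B f f = (N f)\<^sup>2\<close> is positive semidefinite, so by Cauchy-Schwarz it descends
  to the quotient, where it is positive definite.
\<close>

definition Hilbert_space_on :: "('a \<Rightarrow> real) set \<Rightarrow> (('a \<Rightarrow> real) \<Rightarrow> real) \<Rightarrow> bool" where
  "Hilbert_space_on H N \<longleftrightarrow>
     (\<exists>B :: ('a \<Rightarrow> real) \<Rightarrow> ('a \<Rightarrow> real) \<Rightarrow> real.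
        (\<forall>f\<in>H. \<forall>g\<in>H. B f g = B g f) \<and>
        (\<forall>f\<in>H. \<forall>g\<in>H. \<forall>h\<in>H. B (\<lambda>x. f x + g x) h = B f h + B g h) \<and>
        (\<forall>c. \<forall>f\<in>H. \<forall>g\<in>H. B (\<lambda>x. c * f x) g = c * B f g) \<and>
        (\<forall>f\<in>H. B f f = (N f)\<^sup>2)) \<and>
     (\<forall>F :: nat \<Rightarrow> 'a \<Rightarrow> real.
        (\<forall>n. F n \<in> H) \<and>
        (\<forall>e>0. \<exists>K. \<forall>i\<ge>K. \<forall>j\<ge>K. N (\<lambda>x. F i x - F j x) < e) \<longrightarrow>
        (\<exists>f\<in>H. (\<lambda>n. N (\<lambda>x. F n x - f x)) \<longlonglongrightarrow> 0))"

definition infinitesimally_Hilbertian :: "'a metric \<Rightarrow> 'a measure \<Rightarrow> bool" where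
  "infinitesimally_Hilbertian X m \<longleftrightarrow> Hilbert_space_on (H12 X m) (H12_norm X m)"


section \<open>Rectifiability\<close>

text \<open>
  The Euclidean space of a dimension \<open>n\<close> that may vary inside a formula: functions
  on \<open>{..<n}\<close>, extensional so that they match the product measure \<open>PiM {..<n} (\<lambda>_. lborel)\<close>.
\<close>

definition eucl :: "nat \<Rightarrow> (nat \<Rightarrow> real) metric" where
  "eucl n = metric (PiE {..<n} (\<lambda>_. UNIV), \<lambda>x y. L2_set (\<lambda>i. x i - y i) {..<n})"

lemma Metric_space_eucl:
  fixes n :: nat
  shows "Metric_space (PiE {..<n} (\<lambda>_. UNIV)) (\<lambda>x y. L2_set (\<lambda>i. x i - y i) {..<n})"
proof
  fix x y z :: "nat \<Rightarrow> real"
  show "0 \<le> L2_set (\<lambda>i. x i - y i) {..<n}"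
    by (rule L2_set_nonneg)
  show "L2_set (\<lambda>i. x i - y i) {..<n} = L2_set (\<lambda>i. y i - x i) {..<n}"
    by (simp add: L2_set_def power2_commute)
  show "L2_set (\<lambda>i. x i - z i) {..<n} \<le> L2_set (\<lambda>i. x i - y i) {..<n} + L2_set (\<lambda>i. y i - z i) {..<n}"
    using L2_set_triangle_ineq[of "\<lambda>i. x i - y i" "\<lambda>i. y i - z i" "{..<n}"] by simp
  show "L2_set (\<lambda>i. x i - y i) {..<n} = 0 \<longleftrightarrow> x = y"
    if "x \<in> PiE {..<n} (\<lambda>_. UNIV)" "y \<in> PiE {..<n} (\<lambda>_. UNIV)"
    using that by (auto simp: L2_set_eq_0_iff intro: PiE_ext)
qed

lemma mspace_eucl [simp]: "mspace (eucl n) = PiE {..<n} (\<lambda>_. UNIV)"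
  by (simp add: eucl_def Metric_space.mspace_metric[OF Metric_space_eucl])

lemma mdist_eucl [simp]: "mdist (eucl n) x y = L2_set (\<lambda>i. x i - y i) {..<n}"
  by (simp add: eucl_def Metric_space.mdist_metric[OF Metric_space_eucl])

definition biLipschitz_on :: "'a metric \<Rightarrow> 'b metric \<Rightarrow> 'a set \<Rightarrow> ('a \<Rightarrow> 'b) \<Rightarrow> bool" where
  "biLipschitz_on X Y U \<phi> \<longleftrightarrow>
     \<phi> ` U \<subseteq> mspace Y \<and>
     (\<exists>L\<ge>1. \<forall>x\<in>U. \<forall>y\<in>U.
        mdist X x y / L \<le> mdist Y (\<phi> x) (\<phi> y) \<and> mdist Y (\<phi> x) (\<phi> y) \<le> L * mdist X x y)"

text \<open>
  The case distinction matters only for \<open>n = 0\<close>, where \<open>0 ^ 0 = 1\<close>: the empty set has weight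
  zero and the zero-dimensional Hausdorff measure is the counting measure.
\<close>

definition hausdorff_measure :: "'a metric \<Rightarrow> nat \<Rightarrow> 'a set \<Rightarrow> ennreal" where
  "hausdorff_measure X n S =
     (SUP \<delta>\<in>{0<..}.
       INF C\<in>{C :: nat \<Rightarrow> 'a set. S \<subseteq> (\<Union>i. C i) \<and>
                (\<forall>i. C i \<subseteq> mspace X \<and> set_diam X (C i) \<le> ennreal \<delta>)}.
         (\<Sum>i. if C i = {} then 0
              else ennreal (unit_ball_vol (real n)) * (set_diam X (C i) / 2) ^ n))"

definition rectifiable :: "'a metric \<Rightarrow> 'a measure \<Rightarrow> bool" where
  "rectifiable X m \<longleftrightarrow>
     (\<exists>(U :: nat \<Rightarrow> 'a set) (n :: nat \<Rightarrow> nat) (\<phi> :: nat \<Rightarrow> 'a \<Rightarrow> nat \<Rightarrow> real).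
        (\<forall>i. U i \<in> sets m) \<and>
        (\<forall>i j. i \<noteq> j \<longrightarrow> emeasure m (U i \<inter> U j) = 0) \<and>
        emeasure m (mspace X - (\<Union>i. U i)) = 0 \<and>
        (\<forall>i. biLipschitz_on X (eucl (n i)) (U i) (\<phi> i)) \<and>
        (\<forall>i. \<forall>A\<in>sets m. A \<subseteq> U i \<and> hausdorff_measure X (n i) A = 0 \<longrightarrow> emeasure m A = 0))"


section \<open>Ahlfors regularity and PI spaces\<close>

definition Ahlfors_regular :: "'a metric \<Rightarrow> 'a measure \<Rightarrow> bool" where
  "Ahlfors_regular X m \<longleftrightarrow>
     (\<exists>(k::real)\<ge>1. \<exists>(\<alpha>::real)\<ge>1. \<forall>x\<in>mspace X. \<forall>r>0. ennreal r < set_diam X (mspace X) \<longrightarrow>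
        ennreal (r powr k / \<alpha>) \<le> emeasure m (mball_of X x r) \<and>
        emeasure m (mball_of X x r) \<le> ennreal (\<alpha> * r powr k))"

definition doubling :: "'a metric \<Rightarrow> 'a measure \<Rightarrow> bool" where
  "doubling X m \<longleftrightarrow>
     (\<exists>C\<ge>1. \<forall>x\<in>mspace X. \<forall>r>0.
        emeasure m (mball_of X x (2 * r)) \<le> ennreal C * emeasure m (mball_of X x r))"

definition average :: "'a measure \<Rightarrow> 'a set \<Rightarrow> ('a \<Rightarrow> real) \<Rightarrow> real" where
  "average m B f = (LINT x:B|m. f x) / measure m B"

definition nn_average :: "'a measure \<Rightarrow> 'a set \<Rightarrow> ('a \<Rightarrow> ennreal) \<Rightarrow> ennreal" where
  "nn_average m B g = (\<integral>\<^sup>+x\<in>B. g x \<partial>m) / emeasure m B"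

text \<open>
  The slope of a Lipschitz function is bounded by its Lipschitz constant, so the average
  under the root is finite and \<open>enn2real\<close> is harmless.
\<close>

definition weak_Poincare_1_2 :: "'a metric \<Rightarrow> 'a measure \<Rightarrow> bool" where
  "weak_Poincare_1_2 X m \<longleftrightarrow>
     (\<exists>C>0. \<exists>\<Lambda>\<ge>1. \<forall>f\<in>Lip_bs X. \<forall>x\<in>mspace X. \<forall>r>0.
        nn_average m (mball_of X x r) (\<lambda>y. ennreal \<bar>f y - average m (mball_of X x r) f\<bar>)
        \<le> ennreal (C * r *
            sqrt (enn2real (nn_average m (mball_of X x (\<Lambda> * r)) (\<lambda>y. (slope X f y)\<^sup>2)))))"

definition PI_space :: "'a metric \<Rightarrow> 'a measure \<Rightarrow> bool" where
  "PI_space X m \<longleftrightarrow> doubling X m \<and> weak_Poincare_1_2 X m"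


section \<open>Tangent cones\<close>

definition pointed_mms :: "'a metric \<Rightarrow> 'a measure \<Rightarrow> 'a \<Rightarrow> bool" where
  "pointed_mms Y \<mu> q \<longleftrightarrow> metric_measure_space Y \<mu> \<and> q \<in> spt Y \<mu>"

definition Cbs :: "'a metric \<Rightarrow> ('a \<Rightarrow> real) set" where
  "Cbs Y = {h. continuous_map (mtopology_of Y) euclideanreal h \<and> bounded (h ` mspace Y) \<and>
              bounded_support Y h}"

text \<open>
  \<open>blowup_converges X m p r Y \<mu> q\<close>: the rescalings of \<open>X\<close> at \<open>p\<close> by the factors \<open>r k\<close>, with
  \<open>m\<close> normalised on the ball of radius \<open>r k\<close>, converge to \<open>(Y, \<mu>, q)\<close> in the pointed measured
  Gromov-Hausdorff sense.
\<close>

definition blowup_converges ::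
  "'a metric \<Rightarrow> 'a measure \<Rightarrow> 'a \<Rightarrow> (nat \<Rightarrow> real) \<Rightarrow> 'b metric \<Rightarrow> 'b measure \<Rightarrow> 'b \<Rightarrow> bool" where
  "blowup_converges X m p r Y \<mu> q \<longleftrightarrow>
     (\<forall>\<epsilon>. 0 < \<epsilon> \<and> \<epsilon> < 1 \<longrightarrow>
       (AE R in lborel. R > 1 \<longrightarrow>
         (\<exists>(K::nat) (\<psi> :: nat \<Rightarrow> 'a \<Rightarrow> 'b).
           (\<forall>k\<ge>K.
              \<psi> k \<in> measurable (restrict_space m (mball_of X p (R * r k))) \<mu> \<and>
              \<psi> k p = q \<and>
              (\<forall>x\<in>mball_of X p (R * r k). \<forall>y\<in>mball_of X p (R * r k).
                 \<bar>mdist X x y - r k * mdist Y (\<psi> k x) (\<psi> k y)\<bar> \<le> \<epsilon> * r k) \<and>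
              mball_of Y q (R - \<epsilon>) \<subseteq>
                {y \<in> mspace Y. \<exists>x\<in>mball_of X p (R * r k). mdist Y y (\<psi> k x) < \<epsilon>}) \<and>
           (\<forall>h\<in>Cbs Y.
              (\<lambda>k. (LINT y|distr (restrict_space m (mball_of X p (R * r k))) \<mu> (\<psi> k). h y)
                     / measure m (mball_of X p (r k)))
              \<longlonglongrightarrow> (LINT y:mball_of Y q R|\<mu>. h y)))))"

definition Tan :: "'a metric \<Rightarrow> 'a measure \<Rightarrow> 'a \<Rightarrow> ('b metric \<times> 'b measure \<times> 'b) set" where
  "Tan X m p =
     {(Y, \<mu>, q). p \<in> spt X m \<and> pointed_mms Y \<mu> q \<and>
        (\<exists>r :: nat \<Rightarrow> real. (\<forall>k. r k > 0) \<and> decseq r \<and> r \<longlonglongrightarrow> 0 \<and> blowup_converges X m p r Y \<mu> q)}"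


section \<open>Riemannian manifolds\<close>

definition partial_deriv :: "nat \<Rightarrow> ((nat \<Rightarrow> real) \<Rightarrow> real) \<Rightarrow> (nat \<Rightarrow> real) \<Rightarrow> real" where
  "partial_deriv i f x = deriv (\<lambda>t. f (x(i := t))) (x i)"

text \<open>\<open>Ck n V k f\<close>: all partial derivatives of \<open>f\<close> up to order \<open>k\<close> exist and are continuous on
  the open set \<open>V\<close> of the \<open>n\<close>-dimensional Euclidean space.\<close>

primrec Ck :: "nat \<Rightarrow> (nat \<Rightarrow> real) set \<Rightarrow> nat \<Rightarrow> ((nat \<Rightarrow> real) \<Rightarrow> real) \<Rightarrow> bool" where
  "Ck n V 0 f \<longleftrightarrow> continuous_map (subtopology (mtopology_of (eucl n)) V) euclideanreal f"
| "Ck n V (Suc k) f \<longleftrightarrow>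
     continuous_map (subtopology (mtopology_of (eucl n)) V) euclideanreal f \<and>
     (\<forall>i<n. (\<forall>x\<in>V. (\<lambda>t. f (x(i := t))) field_differentiable at (x i)) \<and>
            Ck n V k (partial_deriv i f))"

definition smooth_on :: "nat \<Rightarrow> (nat \<Rightarrow> real) set \<Rightarrow> ((nat \<Rightarrow> real) \<Rightarrow> real) \<Rightarrow> bool" where
  "smooth_on n V f \<longleftrightarrow> (\<forall>k. Ck n V k f)"

type_synonym 'a chart = "'a set \<times> ('a \<Rightarrow> nat \<Rightarrow> real)"

definition transition :: "'a chart \<Rightarrow> 'a chart \<Rightarrow> (nat \<Rightarrow> real) \<Rightarrow> nat \<Rightarrow> real" where
  "transition c c' = (\<lambda>z. snd c' (inv_into (fst c) (snd c) z))"

definition smooth_manifold :: "'a topology \<Rightarrow> nat \<Rightarrow> 'a chart set \<Rightarrow> bool" where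
  "smooth_manifold T n \<A> \<longleftrightarrow>
     Hausdorff_space T \<and> second_countable T \<and>
     (\<Union>(U, \<phi>)\<in>\<A>. U) = topspace T \<and>
     (\<forall>(U, \<phi>)\<in>\<A>.
        openin T U \<and> openin (mtopology_of (eucl n)) (\<phi> ` U) \<and>
        homeomorphic_map (subtopology T U) (subtopology (mtopology_of (eucl n)) (\<phi> ` U)) \<phi>) \<and>
     (\<forall>(U, \<phi>)\<in>\<A>. \<forall>(V, \<psi>)\<in>\<A>. \<forall>j<n.
        smooth_on n (\<phi> ` (U \<inter> V)) (\<lambda>z. transition (U, \<phi>) (V, \<psi>) z j))"

text \<open>
  A Riemannian metric is given by its coefficients \<open>g (U, \<phi>) z i j\<close> in every chart, at the point
  with coordinates \<open>z\<close>, subject to the transformation law of a covariant 2-tensor.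
\<close>

type_synonym 'a metric_coeffs = "'a chart \<Rightarrow> (nat \<Rightarrow> real) \<Rightarrow> nat \<Rightarrow> nat \<Rightarrow> real"

definition Riemannian_metric :: "nat \<Rightarrow> 'a chart set \<Rightarrow> 'a metric_coeffs \<Rightarrow> bool" where
  "Riemannian_metric n \<A> g \<longleftrightarrow>
     (\<forall>(U, \<phi>)\<in>\<A>.
        (\<forall>i<n. \<forall>j<n. smooth_on n (\<phi> ` U) (\<lambda>z. g (U, \<phi>) z i j)) \<and>
        (\<forall>z\<in>\<phi> ` U.
           (\<forall>i<n. \<forall>j<n. g (U, \<phi>) z i j = g (U, \<phi>) z j i) \<and>
           (\<forall>v :: nat \<Rightarrow> real. (\<exists>i<n. v i \<noteq> 0) \<longrightarrow>
              (\<Sum>i<n. \<Sum>j<n. g (U, \<phi>) z i j * v i * v j) > 0))) \<and>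
     (\<forall>(U, \<phi>)\<in>\<A>. \<forall>(V, \<psi>)\<in>\<A>. \<forall>x\<in>U \<inter> V. \<forall>i<n. \<forall>j<n.
        g (U, \<phi>) (\<phi> x) i j =
          (\<Sum>k<n. \<Sum>l<n. g (V, \<psi>) (\<psi> x) k l
             * partial_deriv i (\<lambda>z. transition (U, \<phi>) (V, \<psi>) z k) (\<phi> x)
             * partial_deriv j (\<lambda>z. transition (U, \<phi>) (V, \<psi>) z l) (\<phi> x)))"

text \<open>
  As in \<^const>\<open>piecewise_C1_differentiable_on\<close>, finitely many times are exempted from
  differentiability; these may include the endpoints 0 and 1.
\<close>

definition piecewise_C1_curve :: "'a topology \<Rightarrow> nat \<Rightarrow> 'a chart set \<Rightarrow> (real \<Rightarrow> 'a) \<Rightarrow> bool" where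
  "piecewise_C1_curve T n \<A> \<gamma> \<longleftrightarrow>
     continuous_map (top_of_set {0..1}) T \<gamma> \<and>
     (\<exists>S. finite S \<and>
        (\<forall>(U, \<phi>)\<in>\<A>. \<forall>i<n. (\<lambda>t. \<phi> (\<gamma> t) i) C1_differentiable_on ({t \<in> {0..1}. \<gamma> t \<in> U} - S)))"

text \<open>The speed does not depend on the chosen chart, by the transformation law.\<close>

definition curve_speed :: "nat \<Rightarrow> 'a chart set \<Rightarrow> 'a metric_coeffs \<Rightarrow> (real \<Rightarrow> 'a) \<Rightarrow> real \<Rightarrow> real" where
  "curve_speed n \<A> g \<gamma> t =
     (let c = (SOME c. c \<in> \<A> \<and> \<gamma> t \<in> fst c); \<phi> = snd c in
      sqrt (\<Sum>i<n. \<Sum>j<n. g c (\<phi> (\<gamma> t)) i j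
              * deriv (\<lambda>s. \<phi> (\<gamma> s) i) t * deriv (\<lambda>s. \<phi> (\<gamma> s) j) t))"

definition curve_length :: "nat \<Rightarrow> 'a chart set \<Rightarrow> 'a metric_coeffs \<Rightarrow> (real \<Rightarrow> 'a) \<Rightarrow> ennreal" where
  "curve_length n \<A> g \<gamma> = (\<integral>\<^sup>+t\<in>{0..1}. ennreal (curve_speed n \<A> g \<gamma> t) \<partial>lborel)"

definition length_distance ::
  "'a topology \<Rightarrow> nat \<Rightarrow> 'a chart set \<Rightarrow> 'a metric_coeffs \<Rightarrow> 'a \<Rightarrow> 'a \<Rightarrow> ennreal" where
  "length_distance T n \<A> g x y =
     (INF \<gamma>\<in>{\<gamma>. piecewise_C1_curve T n \<A> \<gamma> \<and> \<gamma> 0 = x \<and> \<gamma> 1 = y}. curve_length n \<A> g \<gamma>)"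

text \<open>The library determinant needs a type of indices; this is the same Leibniz formula.\<close>

definition det_n :: "nat \<Rightarrow> (nat \<Rightarrow> nat \<Rightarrow> real) \<Rightarrow> real" where
  "det_n n G = (\<Sum>p | p permutes {..<n}. of_int (sign p) * (\<Prod>i<n. G i (p i)))"

definition is_volume_measure :: "nat \<Rightarrow> 'a chart set \<Rightarrow> 'a metric_coeffs \<Rightarrow> 'a measure \<Rightarrow> bool" where
  "is_volume_measure n \<A> g \<mu> \<longleftrightarrow>
     (\<forall>(U, \<phi>)\<in>\<A>. \<forall>A\<in>sets \<mu>. A \<subseteq> U \<longrightarrow>
        emeasure \<mu> A =
          (\<integral>\<^sup>+z\<in>\<phi> ` A. ennreal (sqrt (det_n n (g (U, \<phi>) z))) \<partial>(PiM {..<n} (\<lambda>_. lborel))))"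

definition Riemannian_manifold :: "'a metric \<Rightarrow> 'a measure \<Rightarrow> bool" where
  "Riemannian_manifold Z \<mu> \<longleftrightarrow>
     (\<exists>n \<A> g.
        smooth_manifold (mtopology_of Z) n \<A> \<and> Riemannian_metric n \<A> g \<and>
        (\<forall>x\<in>mspace Z. \<forall>y\<in>mspace Z.
           length_distance (mtopology_of Z) n \<A> g x y = ennreal (mdist Z x y)) \<and>
        is_volume_measure n \<A> g \<mu>)"

end

theory Submission
  imports Defs "HOL-Complex_Analysis.Great_Picard"
begin

text \<open>
  The metric is \<open>om^2 |dz|^2\<close> on the punctured plane with \<open>om^2 = 1 + (1 + sin (1 / |z|^2))^2\<close>. As
  \<open>1 \<le> om \<le> 3\<close>, it is comparable to the Euclidean metric, which yields Ahlfors regularity,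
  rectifiability and the Poincare inequality. In dimension two the Dirichlet energy is conformally
  invariant, so the Cheeger energy is the limit of the quadratic forms obtained by mollification, and
  the Sobolev space is Hilbertian.

  Distances are handled by duality: \<open>d x y\<close> is the supremum of \<open>|u x - u y|\<close> over the functions
  \<open>u\<close> whose slope is at most \<open>om\<close>. Under blow-up at the origin a subsequence of the distances
  converges, and by a Riemann--Lebesgue argument the measures converge to a multiple of Lebesgue
  measure. The circles on which \<open>om = 1\<close> become dense, so in the limit arcs of circles have Euclidean
  length. On the other hand, since \<open>(1 + sin t) a + b \<le> om |v|\<close> for the radial and tangential
  parts \<open>a\<close>, \<open>b\<close> of a vector \<open>v\<close>, every \<open>u\<close> with
  \<open>|u w - u z| \<le> ||w| - |z|| + |z| |Arg (w / z)|\<close> is 1-Lipschitz in the limit.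
  Hence a radial tent of slope \<open>1/2\<close> and a tangential wave of slope close to \<open>1\<close> on an annulus have
  a sum and a difference of slope at most \<open>1\<close>, and the parallelogram identity fails.
\<close>

text \<open>The limit distance is never computed. Upper bounds on distances bound Cheeger energies
  from below, and lower bounds bound them from above. So \<open>dY_arc\<close> serves the wave,
  \<open>radial_test_le\<close> the sum and the difference, and comparability with the norm the
  tent. The obstacle is that the Cheeger energy is a relaxation: a lower bound must hold for every
  approximating sequence. It comes from L2 difference quotients along measure preserving flows
  (rotations, translations), which are stable under L2 limits. Likewise quadratic forms of mollified
  functions, continuous on L2, replace weak gradients. The conformal factor is the norm of the pair
  (h, 1) with h = 1 + sin (1 / |z|^2), so the bound on h * a + b is the Cauchy--Schwarz inequality.
  Moreover h vanishes on circles accumulating at 0, and up to O(\<rho>^2) it is the derivative of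
  \<open>sig\<close>, which is asymptotic to the identity. Tangential motion can use the cheap
  circles; radial motion must cross all circles.\<close>

notation LIMSEQ ("((_)/ ----> (_))" [60, 60] 60)

abbreviation nnL (binder "NN" 10)
 where "nnL f \<equiv> nn_integral lborel f"

abbreviation LL (binder "LB" 10)
 where "LL f \<equiv> lebesgue_integral lborel f"

abbreviation invS :: "nat \<Rightarrow> real"
 where "invS n \<equiv> 1 / real (Suc n)"

lemmas inverse_Suc_tendsto = LIMSEQ_inverse_real_of_nat[unfolded inverse_eq_divide]

section \<open>Planar Lebesgue measure and square integrable functions\<close>

lemma lborel_complex: "(lborel :: complex measure) = distr (lborel \<Otimes>\<^sub>M lborel) borel (\<lambda>(x,y). Complex x y)"
proof (rule lborel_eqI)
 have m[measurable]: "(\<lambda>(x,y). Complex x y) \<in> lborel \<Otimes>\<^sub>M lborel \<rightarrow>\<^sub>M borel"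
  unfolding lborel_prod by (simp add: borel_measurable_continuous_onI Complex_eq case_prod_unfold continuous_intros)
 fix l u :: complex assume le0: "\<And>b. b \<in> Basis \<Longrightarrow> l \<bullet> b \<le> u \<bullet> b"
 have le: "Re l \<le> Re u" "Im l \<le> Im u"
  using le0[of 1] le0[of \<i>] by auto
 have "(\<lambda>(x,y). Complex x y) -` box l u \<inter> space (lborel \<Otimes>\<^sub>M lborel) = {Re l<..<Re u} \<times> {Im l<..<Im u}"
  by (auto simp: in_box_complex_iff space_pair_measure)
 then show "emeasure (distr (lborel \<Otimes>\<^sub>M lborel) borel (\<lambda>(x,y). Complex x y)) (box l u) = (\<Prod>b\<in>Basis. (u - l) \<bullet> b)"
  using le by (simp add: emeasure_distr lborel.emeasure_pair_measure_Times Basis_complex_def ennreal_mult)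
qed simp

lemma nn_integral_lborel_complex:
 assumes [measurable]: "f \<in> borel_measurable (borel :: complex measure)"
 shows "(NN z. f z) = (NN x. NN y. f (Complex x y))"
proof -
 have m[measurable]: "(\<lambda>(x,y). Complex x y) \<in> lborel \<Otimes>\<^sub>M lborel \<rightarrow>\<^sub>M borel"
  unfolding lborel_prod by (simp add: borel_measurable_continuous_onI Complex_eq case_prod_unfold continuous_intros)
 have "(NN z. f z) = (\<integral>\<^sup>+p. f (case p of (x,y) \<Rightarrow> Complex x y) \<partial>(lborel \<Otimes>\<^sub>M lborel))"
  by (subst lborel_complex, subst nn_integral_distr) (auto intro: m)
 also have "\<dots> = (NN x. NN y. f (Complex x y))"
  by (subst lborel.nn_integral_fst[symmetric]) (auto)
 finally show ?thesis .
qed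

lemma ball2: "(\<forall>i\<in>{..<2::nat}. P i) \<longleftrightarrow> P 0 \<and> P 1"
 by (auto simp: less_2_cases_iff)

text \<open>Riemannian volume is stated against the product measure over \<open>{..<2}\<close>,
  whereas the analysis uses \<open>lborel\<close> on the complex plane; this links the two.\<close>

lemma lborel_complex_PiM:
 "(lborel :: complex measure) = distr (PiM {..<2::nat} (\<lambda>_. lborel)) borel (\<lambda>f. Complex (f 0) (f 1))"
proof (rule lborel_eqI)
 interpret product_sigma_finite "\<lambda>_::nat. lborel :: real measure" ..
 have [measurable]: "(\<lambda>f. f i) \<in> PiM {..<2::nat} (\<lambda>_. lborel) \<rightarrow>\<^sub>M (borel :: real measure)" if "i < 2" for i
  using measurable_component_singleton[of i "{..<2}" "\<lambda>_. lborel :: real measure"] that by simp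
 have m[measurable]: "(\<lambda>f. Complex (f 0) (f 1)) \<in> PiM {..<2::nat} (\<lambda>_. lborel) \<rightarrow>\<^sub>M borel"
  unfolding Complex_eq by simp
 fix l u :: complex assume le0: "\<And>b. b \<in> Basis \<Longrightarrow> l \<bullet> b \<le> u \<bullet> b"
 have le: "Re l \<le> Re u" "Im l \<le> Im u"
  using le0[of 1] le0[of \<i>] by auto
 let ?P = "PiM {..<2::nat} (\<lambda>_. lborel :: real measure)"
 have "emeasure (distr ?P borel (\<lambda>f. Complex (f 0) (f 1))) (box l u)
   = emeasure ?P ((\<lambda>f. Complex (f 0) (f 1)) -` box l u \<inter> space ?P)"
  by (rule emeasure_distr[OF m]) simp
 also have "(\<lambda>f. Complex (f 0) (f 1)) -` box l u \<inter> space ?P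
  = PiE {..<2} (\<lambda>i. if i = 0 then {Re l<..<Re u} else {Im l<..<Im u})"
  by (intro set_eqI) (simp add: in_box_complex_iff space_PiM PiE_iff ball2 conj_ac)
 also have "emeasure ?P \<dots> = (\<Prod>i<2::nat. emeasure lborel (if i = 0 then {Re l<..<Re u} else {Im l<..<Im u}))"
  by (rule emeasure_PiM) auto
 also have "\<dots> = ennreal (Re u - Re l) * ennreal (Im u - Im l)"
  using le by (simp add: numeral_2_eq_2)
 finally show "emeasure (distr ?P borel (\<lambda>f. Complex (f 0) (f 1))) (box l u) = (\<Prod>b\<in>Basis. (u - l) \<bullet> b)"
  using le by (simp add: Basis_complex_def ennreal_mult)
qed simp

lemma nn_integral_lborel_add:
 fixes a :: "'a::euclidean_space"
 assumes "f \<in> borel_measurable borel"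
 shows "(NN z. f (a + z)) = (NN z. f z)"
proof -
 have "(NN z. f z) = (\<integral>\<^sup>+z. f z \<partial>distr lborel borel ((+) a))"
  by (simp add: lborel_distr_plus)
 also have "\<dots> = (NN z. f (a + z))"
  using assms by (subst nn_integral_distr) auto
 finally show ?thesis ..
qed

text \<open>A shear translates each horizontal line, so Fubini's theorem and translation invariance
  on the line suffice.\<close>

lemma nn_integral_shear1:
 assumes [measurable]: "f \<in> borel_measurable (borel :: complex measure)"
 shows "(NN z. f (Complex (Re z + c * Im z) (Im z))) = (NN z. f z)"
proof -
 have [measurable]: "(\<lambda>p. Complex (fst p) (snd p)) \<in> borel \<Otimes>\<^sub>M borel \<rightarrow>\<^sub>M borel"
  unfolding Complex_eq by simp
 have [measurable]: "(\<lambda>(x,y). Complex (x + c * y) y) \<in> borel \<Otimes>\<^sub>M borel \<rightarrow>\<^sub>M borel"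
  "(\<lambda>(x,y). Complex x y) \<in> borel \<Otimes>\<^sub>M borel \<rightarrow>\<^sub>M borel"
  "(\<lambda>x. Complex x y) \<in> borel \<rightarrow>\<^sub>M borel" for y
  unfolding Complex_eq by auto
 have "(NN z. f (Complex (Re z + c * Im z) (Im z))) = (NN x. NN y. f (Complex (x + c * y) y))"
  unfolding Complex_eq by (subst nn_integral_lborel_complex) (auto simp: Complex_eq)
 also have "\<dots> = (NN y. NN x. f (Complex (x + c * y) y))"
  by (rule lborel_pair.Fubini') (auto)
 also have "\<dots> = (NN y. NN x. f (Complex x y))"
  by (subst nn_integral_lborel_add[symmetric, of "\<lambda>x. f (Complex x y)" "c * y" for y]) (auto simp: add.commute)
 also have "\<dots> = (NN x. NN y. f (Complex x y))"
  by (rule lborel_pair.Fubini'[symmetric]) (auto)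
 finally show ?thesis by (simp add: nn_integral_lborel_complex)
qed

lemma nn_integral_shear2:
 assumes [measurable]: "f \<in> borel_measurable (borel :: complex measure)"
 shows "(NN z. f (Complex (Re z) (Im z + c * Re z))) = (NN z. f z)"
proof -
 have [measurable]: "(\<lambda>x. Complex y x) \<in> borel \<rightarrow>\<^sub>M borel" for y
  unfolding Complex_eq by simp
 have "(NN z. f (Complex (Re z) (Im z + c * Re z))) = (NN x. NN y. f (Complex x (y + c * x)))"
  unfolding Complex_eq by (subst nn_integral_lborel_complex) (auto simp: Complex_eq)
 also have "\<dots> = (NN x. NN y. f (Complex x y))"
  by (subst nn_integral_lborel_add[symmetric, of "\<lambda>y. f (Complex x y)" "c * x" for x]) (auto simp: add.commute)
 finally show ?thesis by (simp add: nn_integral_lborel_complex)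
qed

text \<open>A rotation by an angle in \<open>(-\<pi>, \<pi>)\<close> is the product of three shears.\<close>

lemma nn_integral_rotation:
 assumes [measurable]: "f \<in> borel_measurable (borel :: complex measure)"
 shows "(NN z. f (cis t * z)) = (NN z. f z)"
proof -
 have small: "(NN z. f (cis t * z)) = (NN z. f z)"
  if cos: "cos (t/2) \<noteq> 0" and [measurable]: "f \<in> borel_measurable (borel :: complex measure)" for t f
 proof -
  \<comment> \<open>The coefficients of the factorisation of a rotation into shears;
    \<open>a\<close> is singular only at odd multiples of pi.\<close>
  define a where "a = - tan (t/2)"
  define b where "b = sin t"
  have [measurable]: "(\<lambda>z. Complex (Re z + a * Im z) (Im z)) \<in> borel \<rightarrow>\<^sub>M borel"
   "(\<lambda>z. Complex (Re z) (Im z + b * Re z)) \<in> borel \<rightarrow>\<^sub>M borel"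
   unfolding Complex_eq by auto
  have s: "sin t = 2 * sin (t/2) * cos (t/2)" using sin_double[of "t/2"] by simp
  have c: "cos t = 1 - 2 * (sin (t/2))^2" using cos_double_sin[of "t/2"] by simp
  have ab: "1 + a * b = cos t" using cos by (simp add: a_def b_def s c tan_def power2_eq_square)
  have aab: "a * (2 + a * b) = - sin t"
  proof -
   have "a * (2 + a * b) = a * (1 + cos t)" using ab by simp
   also have "1 + cos t = 2 * (cos (t/2))^2" using cos_double_cos[of "t/2"] by simp
   also have "a * \<dots> = - sin t" using cos by (simp add: a_def s tan_def power2_eq_square)
   finally show ?thesis .
  qed
  let ?A = "\<lambda>z. Complex (Re z + a * Im z) (Im z)" and ?B = "\<lambda>z. Complex (Re z) (Im z + b * Re z)"
  have eq: "?A (?B (?A z)) = cis t * z" for z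
  proof (rule complex_eqI)
   have "Re (?A (?B (?A z))) = (1 + a * b) * Re z + a * (2 + a * b) * Im z"
    by (simp add: algebra_simps)
   then show "Re (?A (?B (?A z))) = Re (cis t * z)" unfolding ab aab by simp
   have "Im (?A (?B (?A z))) = b * Re z + (1 + a * b) * Im z"
    by (simp add: algebra_simps)
   then show "Im (?A (?B (?A z))) = Im (cis t * z)" unfolding ab by (simp add: b_def)
  qed
  have "(NN z. f (?A (?B (?A z)))) = (NN z. f z)"
   by (subst nn_integral_shear1[where f = "\<lambda>z. f (?A (?B z))"], measurable,
     subst nn_integral_shear2[where f = "\<lambda>z. f (?A z)"], measurable,
     rule nn_integral_shear1, measurable)
  then show ?thesis unfolding eq .
 qed
 show ?thesis
 proof (cases "cos (t/2) = 0")
  case False then show ?thesis using small by simp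
 next
  case True
  \<comment> \<open>Half of an exceptional angle is not exceptional: if its cosine vanished as well,
    the doubling formula would read 0 = - 1. So the rotation by t / 2 is applied twice.\<close>
  have "cos (t/2) = 2 * (cos (t/2/2))^2 - 1" using cos_double_cos[of "t/2/2"] by simp
  then have ne: "cos (t/2/2) \<noteq> 0" using True by auto
  have eq: "cis t * z = cis (t/2) * (cis (t/2) * z)" for z
   unfolding mult.assoc[symmetric] cis_mult by simp
  have "(NN z. f (cis t * z)) = (NN z. f (cis (t/2) * (cis (t/2) * z)))"
   by (simp only: eq)
  also have "\<dots> = (NN z. f z)"
   using small[OF ne, of "\<lambda>z. f (cis (t/2) * z)"] small[OF ne, of f] by simp
  finally show ?thesis .
 qed
qed

text \<open>Reverse Fatou replaces Lebesgue's differentiation theorem here.\<close>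

lemma Lipschitz_difference_le_nn_integral:
 fixes h :: "real \<Rightarrow> real"
 assumes lip: "\<And>s t. \<bar>h s - h t\<bar> \<le> L * \<bar>s - t\<bar>" and ab: "a \<le> b"
  and k: "\<And>t. t \<in> {a..b} \<Longrightarrow> limsup (\<lambda>n. ennreal (\<bar>h (t + 1 / Suc n) - h t\<bar> * Suc n)) \<le> k t"
 shows "ennreal \<bar>h b - h a\<bar> \<le> (\<integral>\<^sup>+t\<in>{a..b}. k t \<partial>lborel)"
proof -
 have L0: "0 \<le> L" using lip[of 1 0] by simp
 have "L-lipschitz_on UNIV h"
  using lip L0 by (intro lipschitz_onI) (auto simp: dist_real_def)
 then have cont: "continuous_on UNIV h" by (rule lipschitz_on_continuous_on)
 then have hm[measurable]: "h \<in> borel_measurable borel" by (rule borel_measurable_continuous_onI)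
 \<comment> \<open>The antiderivative \<open>H\<close> turns the integral of a difference quotient
   of \<open>h\<close> over \<open>{a..b}\<close> into difference quotients of \<open>H\<close> at
   the two endpoints. The interval is enlarged so that t + e n stays in its interior.\<close>
 obtain H where H: "\<And>t. t \<in> {a-1..b+2} \<Longrightarrow> (H has_vector_derivative h t) (at t within {a-1..b+2})"
  using antiderivative_continuous[OF continuous_on_subset[OF cont subset_UNIV]] by auto
 have H': "(H has_real_derivative h t) (at t)" if "t \<in> {a..b+1}" for t
 proof -
  have "(H has_vector_derivative h t) (at t within {a-1..b+2})" using H that by auto
  moreover have "at t within {a-1..b+2} = at t" using that by (intro at_within_interior) auto
  ultimately show ?thesis by (simp add: has_real_derivative_iff_has_vector_derivative)
 qed
 define e where "e = (\<lambda>n::nat. invS n)"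
 have e: "0 < e n" "e n \<le> 1" "e n * Suc n = 1" for n by (auto simp: e_def)
 have e0: "e ----> 0" unfolding e_def by (rule inverse_Suc_tendsto)
 define Q where "Q = (\<lambda>n t. (h (t + e n) - h t) * Suc n)"
 have Qc: "continuous_on {a..b} (Q n)" for n
  unfolding Q_def by (intro continuous_intros continuous_on_compose2[OF cont]) auto
 have Qm[measurable]: "Q n \<in> borel_measurable borel" for n unfolding Q_def by simp
 define I where "I = (\<lambda>n. (LINT t:{a..b}|lborel. Q n t))"
 have I: "I n = (H (b + e n) - H b) / e n - (H (a + e n) - H a) / e n" for n
 proof -
  have "((\<lambda>t. (H (t + e n) - H t) * Suc n) has_real_derivative Q n t) (at t within {a..b})" if "t \<in> {a..b}" for t
  proof -
   have "((\<lambda>t. H (t + e n)) has_real_derivative h (t + e n)) (at t)"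
    using H'[of "t + e n"] that e[of n] by (subst DERIV_shift[symmetric]) auto
   then have "((\<lambda>t. (H (t + e n) - H t) * Suc n) has_real_derivative Q n t) (at t)"
    unfolding Q_def using H'[of t] that
    by (intro DERIV_cmult_right DERIV_diff) auto
   then show ?thesis by (rule has_field_derivative_at_within)
  qed
  then have "(Q n has_integral (H (b + e n) - H b) * Suc n - (H (a + e n) - H a) * Suc n) {a..b}"
   by (intro fundamental_theorem_of_calculus ab) (simp add: has_real_derivative_iff_has_vector_derivative)
  moreover have "I n = integral {a..b} (Q n)"
   unfolding I_def using borel_integrable_atLeastAtMost'[OF Qc] by (rule set_borel_integral_eq_integral)
  moreover have "x * Suc n = x / e n" for x :: real by (simp add: e_def)
  ultimately show ?thesis by auto
 qed
 have lim1: "(\<lambda>n. (H (c + e n) - H c) / e n) ----> h c" if "c \<in> {a..b}" for c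
 proof -
  have "((\<lambda>y. (H (c + y) - H c) / y) \<longlongrightarrow> h c) (at 0)" using H'[of c] that unfolding DERIV_def by auto
  moreover have "filterlim e (at 0) sequentially"
   using e0 e(1) by (auto simp: filterlim_at less_imp_neq[THEN not_sym] intro!: eventuallyI)
  ultimately show ?thesis by (rule filterlim_compose)
 qed
 have "I ----> h b - h a" unfolding I using ab by (intro tendsto_diff lim1) auto
 then have "(\<lambda>n. ennreal \<bar>I n\<bar>) ----> ennreal \<bar>h b - h a\<bar>" by (intro tendsto_intros)
 then have "ennreal \<bar>h b - h a\<bar> = limsup (\<lambda>n. ennreal \<bar>I n\<bar>)"
  by (rule lim_imp_Limsup[symmetric, rotated]) simp
 also have "\<dots> \<le> limsup (\<lambda>n. NN t. ennreal \<bar>Q n t\<bar> * indicator {a..b} t)"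
 proof (intro Limsup_mono always_eventually allI)
  fix n
  have "ennreal (norm (I n)) \<le> (NN t. ennreal (norm (indicator {a..b} t *\<^sub>R Q n t)))"
   unfolding I_def set_lebesgue_integral_def
   by (rule integral_norm_bound_ennreal) (use borel_integrable_atLeastAtMost'[OF Qc] in \<open>simp add: set_integrable_def\<close>)
  also have "\<dots> = (NN t. ennreal \<bar>Q n t\<bar> * indicator {a..b} t)"
   by (intro nn_integral_cong) (auto split: split_indicator)
  finally show "ennreal \<bar>I n\<bar> \<le> \<dots>" by simp
 qed
 \<comment> \<open>Reverse Fatou needs an integrable majorant; the Lipschitz constant on a bounded
   interval provides it.\<close>
 also have "\<dots> \<le> (NN t. limsup (\<lambda>n. ennreal \<bar>Q n t\<bar> * indicator {a..b} t))"
 proof (rule nn_integral_limsup[where w = "\<lambda>t. ennreal L * indicator {a..b} t"])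
  fix n
  have "\<bar>Q n t\<bar> \<le> L" for t
  proof -
   have "\<bar>Q n t\<bar> = \<bar>h (t + e n) - h t\<bar> * Suc n" by (simp add: Q_def abs_mult)
   also have "\<dots> \<le> L * e n * Suc n" using lip[of "t + e n" t] e[of n] by simp
   finally show ?thesis using e(3)[of n] by (simp add: mult.assoc)
  qed
  then show "AE t in lborel. ennreal \<bar>Q n t\<bar> * indicator {a..b} t \<le> ennreal L * indicator {a..b} t"
   by (intro AE_I2) (auto split: split_indicator intro: ennreal_leI)
  show "(NN t. ennreal L * indicator {a..b} t) < \<infinity>"
   by (simp add: nn_integral_cmult_indicator ennreal_mult_less_top emeasure_bounded_finite[unfolded infinity_ennreal_def])
 qed measurable
 also have "\<dots> \<le> (\<integral>\<^sup>+t\<in>{a..b}. k t \<partial>lborel)"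
  by (intro nn_integral_mono) (use k in \<open>auto simp: Q_def e_def abs_mult Limsup_const split: split_indicator\<close>)
 finally show ?thesis .
qed

text \<open>The points where \<phi> lies below the line of slope \<open>e\<close> through its value
  at \<open>a\<close> form a compact set. The largest of them is \<open>b\<close>, because at a
  smaller one the local estimate continues the inequality to the right. Then \<open>e\<close> tends
  to 0.\<close>

lemma antimono_of_local:
 fixes \<phi> :: "real \<Rightarrow> real"
 assumes ab: "a \<le> b" and cont: "continuous_on {a..b} \<phi>"
  and loc: "\<And>t e. t \<in> {a..<b} \<Longrightarrow> e > 0 \<Longrightarrow> \<forall>\<^sub>F s in at_right t. \<phi> s - \<phi> t \<le> e * (s - t)"
 shows "\<phi> b \<le> \<phi> a"
proof -
 have main: "\<phi> b - \<phi> a \<le> e * (b - a)" if "e > 0" for e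
 proof -
  define A where "A = {t\<in>{a..b}. \<phi> t \<le> \<phi> a + e * (t - a)}"
  have "closed A" unfolding A_def
   by (intro continuous_on_closed_Collect_le continuous_intros cont)
  moreover have "bounded A" by (rule bounded_subset[OF bounded_closed_interval[of a b]]) (auto simp: A_def)
  ultimately have "compact A" by (simp add: compact_eq_bounded_closed)
  moreover have "a \<in> A" using ab by (auto simp: A_def)
  ultimately obtain c where c: "c \<in> A" "\<And>t. t \<in> A \<Longrightarrow> t \<le> c"
   using compact_attains_sup[of A] by auto
  have "c = b"
  proof (rule ccontr)
   assume "c \<noteq> b"
   then have cb: "c \<in> {a..<b}" using c by (auto simp: A_def)
   have "\<forall>\<^sub>F s in at_right c. s \<in> {c<..<b}"
    using cb by (intro eventually_at_right_real) auto
   with loc[OF cb \<open>e > 0\<close>] have "\<forall>\<^sub>F s in at_right c. \<phi> s - \<phi> c \<le> e * (s - c) \<and> s \<in> {c<..<b}"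
    by (rule eventually_conj)
   then obtain s where s: "\<phi> s - \<phi> c \<le> e * (s - c)" "s \<in> {c<..<b}"
    using eventually_happens'[OF trivial_limit_at_right_real] by auto
   then have "s \<in> A" using c(1) by (auto simp: A_def algebra_simps)
   then show False using c(2) s by force
  qed
  then show ?thesis using c(1) by (simp add: A_def)
 qed
 show ?thesis
 proof (rule field_le_epsilon)
  fix e :: real assume "e > 0"
  then have "\<phi> b - \<phi> a \<le> e / (1 + (b - a)) * (b - a)" using ab by (intro main) auto
  also have "\<dots> \<le> e" using ab \<open>e > 0\<close> by (simp add: field_simps)
  finally show "\<phi> b \<le> \<phi> a + e" by simp
 qed
qed

text \<open>For curves that are differentiable only off a finite set. Each exceptional point cuts
  the interval in two, and continuity recovers the left endpoint, where no local estimate is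
  available.\<close>

lemma antimono_of_local_finite:
 fixes \<phi> :: "real \<Rightarrow> real"
 assumes "finite S" "a \<le> b" "continuous_on {a..b} \<phi>"
  and "\<And>t e. t \<in> {a<..<b} - S \<Longrightarrow> e > 0 \<Longrightarrow> \<forall>\<^sub>F s in at_right t. \<phi> s - \<phi> t \<le> e * (s - t)"
 shows "\<phi> b \<le> \<phi> a"
 using assms
proof (induction S arbitrary: a b rule: finite_induct)
 case empty
 show ?case
 proof (cases "a < b")
  case True
  show ?thesis
  proof (rule tendsto_lowerbound)
   show "(\<phi> \<longlongrightarrow> \<phi> a) (at_right a)" by (rule continuous_on_Icc_at_rightD[OF empty(2) True])
   have "\<forall>\<^sub>F t in at_right a. t \<in> {a<..<b}" using True by (rule eventually_at_right_real)
   then show "\<forall>\<^sub>F t in at_right a. \<phi> b \<le> \<phi> t"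
    by eventually_elim (rule antimono_of_local, use empty in \<open>auto intro: continuous_on_subset\<close>)
  qed simp
 qed (use empty in simp)
next
 case (insert c S)
 show ?case
 proof (cases "c \<in> {a<..<b}")
  case True
  then have "\<phi> b \<le> \<phi> c" "\<phi> c \<le> \<phi> a"
   using insert.prems by (intro insert.IH; auto intro: continuous_on_subset)+
  then show ?thesis by simp
 qed (use insert in auto)
qed

section \<open>Square integrable functions and completeness of L2\<close>

lemma L2_integrable: assumes "f \<in> L2 M" shows "integrable M (\<lambda>x. (f x)^2)"
 using assms unfolding L2_def L2_sqnorm_def
 by (intro integrableI_bounded) auto

lemma L2_sqnorm_eq: assumes "f \<in> L2 M" shows "L2_sqnorm M f = ennreal (LINT x|M. (f x)^2)"
 unfolding L2_sqnorm_def by (intro nn_integral_eq_integral L2_integrable assms) simp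

lemma L2_mult_integrable:
 assumes f: "f \<in> L2 M" and g: "g \<in> L2 M"
 shows "integrable M (\<lambda>x. f x * g x)"
proof (rule Bochner_Integration.integrable_bound)
 show "integrable M (\<lambda>x. (f x)^2 + (g x)^2)" by (intro Bochner_Integration.integrable_add L2_integrable assms)
 show "(\<lambda>x. f x * g x) \<in> borel_measurable M" using assms by (auto simp: L2_def)
 show "AE x in M. norm (f x * g x) \<le> norm ((f x)^2 + (g x)^2)"
 proof (intro AE_I2)
  fix x
  have "2 * (\<bar>f x\<bar> * \<bar>g x\<bar>) \<le> (f x)^2 + (g x)^2"
   using zero_le_power2[of "\<bar>f x\<bar> - \<bar>g x\<bar>"] by (simp add: power2_diff)
  moreover have "0 \<le> \<bar>f x\<bar> * \<bar>g x\<bar>" by simp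
  ultimately have "\<bar>f x * g x\<bar> \<le> (f x)^2 + (g x)^2" unfolding abs_mult by linarith
  then show "norm (f x * g x) \<le> norm ((f x)^2 + (g x)^2)" by simp
 qed
qed

lemma L2_cmult: assumes "f \<in> L2 M" shows "(\<lambda>x. c * f x) \<in> L2 M"
proof -
 have [measurable]: "f \<in> borel_measurable M" using assms by (simp add: L2_def)
 have "L2_sqnorm M (\<lambda>x. c * f x) = ennreal (c^2) * L2_sqnorm M f"
  unfolding L2_sqnorm_def by (subst nn_integral_cmult[symmetric]) (auto simp: power_mult_distrib ennreal_mult)
 then show ?thesis using assms by (auto simp: L2_def ennreal_mult_less_top)
qed

lemma L2_add: assumes f: "f \<in> L2 M" and g: "g \<in> L2 M" shows "(\<lambda>x. f x + g x) \<in> L2 M"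
proof -
 have "integrable M (\<lambda>x. (f x)^2 + (g x)^2 + 2 * (f x * g x))"
  by (intro Bochner_Integration.integrable_add integrable_mult_right L2_integrable L2_mult_integrable assms)
 then have "integrable M (\<lambda>x. (f x + g x)^2)" by (simp add: power2_sum mult.assoc)
 moreover have "(\<lambda>x. f x + g x) \<in> borel_measurable M" using assms by (auto simp: L2_def)
 ultimately show ?thesis by (simp add: L2_def L2_sqnorm_def nn_integral_eq_integral)
qed

lemma L2_diff: assumes f: "f \<in> L2 M" and g: "g \<in> L2 M" shows "(\<lambda>x. f x - g x) \<in> L2 M"
 using L2_add[OF f L2_cmult[OF g, of "-1"]] by simp

definition L2_norm :: "'a measure \<Rightarrow> ('a \<Rightarrow> real) \<Rightarrow> real" where
 "L2_norm M f = sqrt (enn2real (L2_sqnorm M f))"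

abbreviation "N2 \<equiv> L2_norm lborel"

lemma L2_norm_nonneg: "0 \<le> L2_norm M f" by (simp add: L2_norm_def)

lemma L2_norm_sq: "f \<in> L2 M \<Longrightarrow> (L2_norm M f)^2 = (LINT x|M. (f x)^2)"
 by (simp add: L2_norm_def L2_sqnorm_eq)

lemma ennreal_L2_norm_sq: "f \<in> L2 M \<Longrightarrow> ennreal ((L2_norm M f)^2) = L2_sqnorm M f"
 by (simp add: L2_norm_sq L2_sqnorm_eq)

lemma L2_Cauchy_Schwarz:
 assumes f: "f \<in> L2 M" and g: "g \<in> L2 M"
 shows "(LINT x|M. \<bar>f x * g x\<bar>) \<le> L2_norm M f * L2_norm M g"
proof -
 have [measurable]: "f \<in> borel_measurable M" "g \<in> borel_measurable M" using f g by (auto simp: L2_def)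
 have i: "integrable M (\<lambda>x. \<bar>f x * g x\<bar>)" using L2_mult_integrable[OF f g] by simp
 have "ennreal ((LINT x|M. \<bar>f x * g x\<bar>)^2) = (\<integral>\<^sup>+x. ennreal \<bar>f x\<bar> * ennreal \<bar>g x\<bar> \<partial>M)^2"
  using i by (simp add: nn_integral_eq_integral abs_mult ennreal_mult[symmetric] ennreal_power)
 also have "\<dots> \<le> (\<integral>\<^sup>+x. (ennreal \<bar>f x\<bar>)^2 \<partial>M) * (\<integral>\<^sup>+x. (ennreal \<bar>g x\<bar>)^2 \<partial>M)"
  by (rule Cauchy_Schwarz_nn_integral) measurable
 also have "\<dots> = ennreal ((L2_norm M f * L2_norm M g)^2)"
  by (simp add: power_mult_distrib ennreal_mult ennreal_L2_norm_sq[OF f] ennreal_L2_norm_sq[OF g] L2_sqnorm_def ennreal_power)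
 finally have "(LINT x|M. \<bar>f x * g x\<bar>)^2 \<le> (L2_norm M f * L2_norm M g)^2" by simp
 then show ?thesis by (rule power2_le_imp_le) (simp add: L2_norm_nonneg)
qed

lemma L2_norm_triangle:
 assumes f: "f \<in> L2 M" and g: "g \<in> L2 M"
 shows "L2_norm M (\<lambda>x. f x + g x) \<le> L2_norm M f + L2_norm M g"
proof (rule power2_le_imp_le)
 have "(L2_norm M (\<lambda>x. f x + g x))^2 = (LINT x|M. (f x)^2 + (g x)^2 + 2 * (f x * g x))"
  by (simp add: L2_norm_sq L2_add f g power2_sum mult.assoc)
 also have "\<dots> = (L2_norm M f)^2 + (L2_norm M g)^2 + 2 * (LINT x|M. f x * g x)"
  by (simp add: L2_norm_sq f g L2_integrable L2_mult_integrable)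
 also have "(LINT x|M. f x * g x) \<le> (LINT x|M. \<bar>f x * g x\<bar>)"
  by (intro integral_mono integrable_abs L2_mult_integrable f g) simp
 also have "\<dots> \<le> L2_norm M f * L2_norm M g" by (rule L2_Cauchy_Schwarz[OF f g])
 finally show "(L2_norm M (\<lambda>x. f x + g x))^2 \<le> (L2_norm M f + L2_norm M g)^2"
  by (simp add: power2_sum)
qed (simp add: L2_norm_nonneg)

lemma L2_norm_cmult: "f \<in> L2 M \<Longrightarrow> L2_norm M (\<lambda>x. c * f x) = \<bar>c\<bar> * L2_norm M f"
proof -
 assume f: "f \<in> L2 M"
 have "(L2_norm M (\<lambda>x. c * f x))^2 = (\<bar>c\<bar> * L2_norm M f)^2"
  by (simp add: L2_norm_sq L2_cmult f power_mult_distrib)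
 then show ?thesis by (simp add: L2_norm_nonneg)
qed

lemma L2_norm_triangle_diff:
 assumes f: "f \<in> L2 M" and g: "g \<in> L2 M"
 shows "\<bar>L2_norm M f - L2_norm M g\<bar> \<le> L2_norm M (\<lambda>x. f x - g x)"
proof -
 have "L2_norm M f \<le> L2_norm M (\<lambda>x. f x - g x) + L2_norm M g"
  using L2_norm_triangle[OF L2_diff[OF f g] g] by simp
 moreover have "L2_norm M g \<le> L2_norm M (\<lambda>x. g x - f x) + L2_norm M f"
  using L2_norm_triangle[OF L2_diff[OF g f] f] by simp
 moreover have "L2_norm M (\<lambda>x. g x - f x) = L2_norm M (\<lambda>x. f x - g x)"
  using L2_norm_cmult[OF L2_diff[OF f g], of "-1"] by simp
 ultimately show ?thesis by simp
qed

text \<open>Approximation is defined by squared norms in \<open>ennreal\<close>, while all estimates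
  are made with real norms.\<close>

lemma tendsto_L2_sqnorm_iff:
 assumes "\<And>n. f n \<in> L2 M"
 shows "(\<lambda>n. L2_sqnorm M (f n)) ----> 0 \<longleftrightarrow> (\<lambda>n. L2_norm M (f n)) ----> 0"
proof -
 have "(\<lambda>n. L2_sqnorm M (f n)) ----> 0 \<longleftrightarrow> (\<lambda>n. ennreal ((L2_norm M (f n))^2)) ----> ennreal 0"
  by (simp add: ennreal_L2_norm_sq assms)
 also have "\<dots> \<longleftrightarrow> (\<lambda>n. (L2_norm M (f n))^2) ----> 0"
  by (rule tendsto_ennreal_iff) auto
 also have "\<dots> \<longleftrightarrow> (\<lambda>n. L2_norm M (f n)) ----> 0"
 proof
  assume "(\<lambda>n. (L2_norm M (f n))^2) ----> 0"
  then have "(\<lambda>n. sqrt ((L2_norm M (f n))^2)) ----> sqrt 0" by (rule tendsto_real_sqrt)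
  then show "(\<lambda>n. L2_norm M (f n)) ----> 0" by (simp add: L2_norm_nonneg)
 next
  assume "(\<lambda>n. L2_norm M (f n)) ----> 0"
  from tendsto_power[OF this, of 2] show "(\<lambda>n. (L2_norm M (f n))^2) ----> 0" by simp
 qed
 finally show ?thesis .
qed

text \<open>The theorem of Riesz and Fischer. Completeness of the Sobolev space starts from an L2
  limit.\<close>

lemma L2_complete:
 assumes f: "\<And>n. f n \<in> L2 M"
  and cauchy: "\<And>e. e > 0 \<Longrightarrow> \<exists>K. \<forall>i\<ge>K. \<forall>j\<ge>K. L2_norm M (\<lambda>x. f i x - f j x) < e"
 shows "\<exists>g\<in>L2 M. (\<lambda>n. L2_norm M (\<lambda>x. f n x - g x)) ----> 0"
proof -
 have [measurable]: "f n \<in> borel_measurable M" for n using f by (simp add: L2_def)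
 have "\<forall>n. \<exists>K. \<forall>i\<ge>K. \<forall>j\<ge>K. L2_norm M (\<lambda>x. f i x - f j x) < (1/2)^n"
  using cauchy by simp
 then obtain K where K: "\<And>n i j. i \<ge> K n \<Longrightarrow> j \<ge> K n \<Longrightarrow> L2_norm M (\<lambda>x. f i x - f j x) < (1/2)^n"
  by metis
 \<comment> \<open>Taking maxima makes the indices nondecreasing, and consecutive members along
   \<open>r\<close> still differ by less than (1/2)^n in norm.\<close>
 define r where "r = (\<lambda>n. Max (K ` {..n}))"
 have rK: "K n \<le> r n" for n unfolding r_def by simp
 have r_mono: "r n \<le> r (Suc n)" for n unfolding r_def by simp
 define u where "u = (\<lambda>n x. f (r (Suc n)) x - f (r n) x)"
 have uL: "u n \<in> L2 M" for n unfolding u_def by (intro L2_diff f)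
 have [measurable]: "u n \<in> borel_measurable M" for n using uL by (simp add: L2_def)
 have un: "L2_norm M (u n) < (1/2)^n" for n
  unfolding u_def using K[of n "r (Suc n)" "r n"] rK[of n] r_mono[of n] by auto
 text \<open>The weights \<open>2^n\<close> make the telescoping series converge almost everywhere without
  Minkowski's inequality for infinite sums.\<close>
 have fin: "(\<integral>\<^sup>+x. (\<Sum>n. ennreal (2^n * (u n x)^2)) \<partial>M) < \<infinity>"
 proof -
  have "(\<integral>\<^sup>+x. (\<Sum>n. ennreal (2^n * (u n x)^2)) \<partial>M) = (\<Sum>n. \<integral>\<^sup>+x. ennreal (2^n * (u n x)^2) \<partial>M)"
   by (rule nn_integral_suminf) measurable
  also have "\<dots> \<le> (\<Sum>n. ennreal ((1/2)^n))"
  proof (intro suminf_le summableI)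
   fix n
   have "(\<integral>\<^sup>+x. ennreal (2^n * (u n x)^2) \<partial>M) = ennreal (2^n) * L2_sqnorm M (u n)"
    unfolding L2_sqnorm_def by (subst nn_integral_cmult[symmetric]) (auto simp: ennreal_mult)
   also have "\<dots> = ennreal (2^n * (L2_norm M (u n))^2)"
    by (simp add: ennreal_L2_norm_sq[OF uL, symmetric] ennreal_mult)
   also have "\<dots> \<le> ennreal (2^n * ((1/2)^n)^2)"
    using un[of n] by (intro ennreal_leI mult_left_mono power_mono) (auto simp: L2_norm_nonneg)
   also have "2^n * ((1/2)^n)^2 = (1/2::real)^n"
    by (simp add: power2_eq_square power_divide)
   finally show "(\<integral>\<^sup>+x. ennreal (2^n * (u n x)^2) \<partial>M) \<le> ennreal ((1/2)^n)" .
  qed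
  also have "\<dots> < \<infinity>" by (subst suminf_ennreal2) (auto intro: summable_geometric)
  finally show ?thesis .
 qed
 have "AE x in M. (\<Sum>n. ennreal (2^n * (u n x)^2)) \<noteq> \<infinity>"
  by (rule nn_integral_PInf_AE) (use fin in auto)
 then have conv: "AE x in M. convergent (\<lambda>n. f (r n) x)"
 proof eventually_elim
  case (elim x)
  have s: "summable (\<lambda>n. 2^n * (u n x)^2)"
   by (rule summable_suminf_not_top) (use elim in auto)
  have "summable (\<lambda>n. (1/2)^n + 2^n * (u n x)^2)"
   by (intro summable_add s summable_geometric) simp
  moreover have "norm (u n x) \<le> (1/2)^n + 2^n * (u n x)^2" for n
  proof -
   have "0 \<le> (1/2)^n * (1 - 2^n * \<bar>u n x\<bar>)^2" by simp
   also have "\<dots> = (1/2)^n - 2 * \<bar>u n x\<bar> + 2^n * (u n x)^2"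
    by (simp add: power_mult_distrib algebra_simps power_divide power2_eq_square)
   finally have *: "2 * \<bar>u n x\<bar> \<le> (1/2)^n + 2^n * (u n x)^2" by simp
   show ?thesis using * abs_ge_zero[of "u n x"] by simp
  qed
  ultimately have "summable (\<lambda>n. u n x)" by (rule summable_comparison_test'[where N=0])
  then have "convergent (\<lambda>n. \<Sum>i<n. u i x)" by (simp add: summable_iff_convergent)
  then have "convergent (\<lambda>n. f (r 0) x + (\<Sum>i<n. u i x))" by (intro convergent_add convergent_const)
  moreover have "f (r 0) x + (\<Sum>i<n. u i x) = f (r n) x" for n
   unfolding u_def by (subst sum_lessThan_telescope) simp
  ultimately show ?case by simp
 qed
 define g where "g = (\<lambda>x. lim (\<lambda>n. f (r n) x))"
 have gm[measurable]: "g \<in> borel_measurable M" unfolding g_def by simp measurable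
 \<comment> \<open>Fatou's lemma along the subsequence bounds the distance to \<open>g\<close> of
   every late member of the full sequence.\<close>
 have key: "L2_sqnorm M (\<lambda>x. f i x - g x) \<le> ennreal (((1/2)^n)^2)" if "i \<ge> K n" for i n
 proof -
  have "L2_sqnorm M (\<lambda>x. f i x - g x) \<le> (\<integral>\<^sup>+x. liminf (\<lambda>k. ennreal ((f i x - f (r k) x)^2)) \<partial>M)"
   unfolding L2_sqnorm_def
  proof (rule nn_integral_mono_AE)
   show "AE x in M. ennreal ((f i x - g x)^2) \<le> liminf (\<lambda>k. ennreal ((f i x - f (r k) x)^2))"
    using conv
   proof eventually_elim
    case (elim x)
    then have "(\<lambda>k. f (r k) x) ----> g x" by (simp add: g_def convergent_LIMSEQ_iff)
    then have "(\<lambda>k. ennreal ((f i x - f (r k) x)^2)) ----> ennreal ((f i x - g x)^2)"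
     by (intro tendsto_intros)
    then show ?case by (subst lim_imp_Liminf) auto
   qed
  qed
  also have "\<dots> \<le> liminf (\<lambda>k. L2_sqnorm M (\<lambda>x. f i x - f (r k) x))"
   unfolding L2_sqnorm_def by (rule nn_integral_liminf) measurable
  also have "\<dots> \<le> liminf (\<lambda>k. ennreal (((1/2)^n)^2))"
  proof (rule Liminf_mono, rule eventually_sequentiallyI)
   fix k assume "n \<le> k"
   then have "K n \<le> r k" using rK[of n] lift_Suc_mono_le[of r, OF r_mono, of n k] by simp
   then have "L2_norm M (\<lambda>x. f i x - f (r k) x) < (1/2)^n" using K that by simp
   then show "L2_sqnorm M (\<lambda>x. f i x - f (r k) x) \<le> ennreal (((1/2)^n)^2)"
    by (subst ennreal_L2_norm_sq[symmetric]) (auto intro!: L2_diff f ennreal_leI power_mono simp: L2_norm_nonneg)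
  qed
  finally show ?thesis by (simp add: Liminf_const)
 qed
 have d: "(\<lambda>x. f i x - g x) \<in> L2 M" if "i \<ge> K n" for i n
  using key[OF that] le_less_trans[of _ "ennreal (((1/2)^n)^2)" \<infinity>] by (auto simp: L2_def)
 have gL: "g \<in> L2 M"
  using L2_diff[OF f d[of 0 "K 0"], of "K 0"] by simp
 have "(\<lambda>n. L2_norm M (\<lambda>x. f n x - g x)) ----> 0"
 proof (rule LIMSEQ_I)
  fix e :: real assume "e > 0"
  then obtain n where n: "(1/2::real)^n < e" using real_arch_pow_inv[of e "1/2"] by auto
  have "norm (L2_norm M (\<lambda>x. f i x - g x) - 0) < e" if "i \<ge> K n" for i
  proof -
   have "ennreal ((L2_norm M (\<lambda>x. f i x - g x))^2) \<le> ennreal (((1/2)^n)^2)"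
    using key[OF that] by (simp add: ennreal_L2_norm_sq L2_diff f gL)
   then have "(L2_norm M (\<lambda>x. f i x - g x))^2 \<le> ((1/2)^n)^2"
    by simp
   then have "L2_norm M (\<lambda>x. f i x - g x) \<le> (1/2)^n"
    by (rule power2_le_imp_le) simp
   then show ?thesis using n by (simp add: L2_norm_nonneg)
  qed
  then show "\<exists>no. \<forall>i\<ge>no. norm (L2_norm M (\<lambda>x. f i x - g x) - 0) < e" by auto
 qed
 then show ?thesis using gL by auto
qed

section \<open>Planar metric measure spaces comparable to the Euclidean plane\<close>

text \<open>The analysis is done on \<open>complex\<close>. The carrier of the space consists of the
  extensional functions on \<open>{..<2}\<close>, as in \<open>eucl 2\<close>, so that the identity
  can serve as a chart; \<open>iota\<close> and \<open>kappa\<close> move between the two.\<close>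

definition iota :: "complex \<Rightarrow> nat \<Rightarrow> real" where
 "iota z = (\<lambda>i. if i = 0 then Re z else if i = 1 then Im z else undefined)"

definition kappa :: "(nat \<Rightarrow> real) \<Rightarrow> complex" where
 "kappa f = Complex (f 0) (f 1)"

definition plane :: "(nat \<Rightarrow> real) set" where
 "plane = PiE {..<2} (\<lambda>_. UNIV)"

lemma iota_simps [simp]: "iota z 0 = Re z" "iota z 1 = Im z" "iota z (Suc 0) = Im z"
 by (auto simp: iota_def)

lemma iota_plane [simp]: "iota z \<in> plane"
 by (auto simp: iota_def plane_def PiE_iff extensional_def)

lemma kappa_iota [simp]: "kappa (iota z) = z"
 by (simp add: kappa_def)

lemma iota_kappa [simp]: "f \<in> plane \<Longrightarrow> iota (kappa f) = f"
 by (rule ext) (auto simp: iota_def kappa_def plane_def PiE_iff extensional_def)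

lemma inj_iota: "inj iota"
 by (rule inj_on_inverseI[of _ kappa]) simp

lemma iota_eq_iff [simp]: "iota z = iota w \<longleftrightarrow> z = w"
 using inj_iota by (auto dest: injD)

lemma range_iota: "range iota = plane"
 by (auto simp: image_iff) (metis iota_kappa)

lemma kappa_vimage: "kappa -` B \<inter> plane = iota ` B"
 by force

lemma plane_cases: assumes "f \<in> plane" obtains z where "f = iota z"
 using iota_kappa[OF assms] by metis

lemma L2_set_lessThan_2: "L2_set g {..<2::nat} = sqrt ((g 0)^2 + (g 1)^2)"
 by (simp add: L2_set_def numeral_2_eq_2)

lemma dist_iota: "L2_set (\<lambda>i. iota z i - iota w i) {..<2} = norm (z - w)"
 by (simp add: L2_set_lessThan_2 cmod_def)

definition plane_metric :: "(complex \<Rightarrow> complex \<Rightarrow> real) \<Rightarrow> (nat \<Rightarrow> real) metric" where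
 "plane_metric d = metric (plane, \<lambda>f g. d (kappa f) (kappa g))"

definition plane_measure :: "(complex \<Rightarrow> real) \<Rightarrow> (nat \<Rightarrow> real) measure" where
 "plane_measure \<rho> = embed_measure (density lborel (\<lambda>z. ennreal (\<rho> z))) iota"

text \<open>Every point of the plane is an accumulation point, so the second case of
  \<open>slope\<close> does not arise.\<close>

definition lipc :: "(complex \<Rightarrow> complex \<Rightarrow> real) \<Rightarrow> (complex \<Rightarrow> real) \<Rightarrow> complex \<Rightarrow> ennreal" where
 "lipc d F z = Limsup (at z) (\<lambda>y. ennreal (\<bar>F y - F z\<bar> / d y z))"

lemma eucl_2: "eucl 2 = plane_metric (\<lambda>z w. norm (z - w))"
 unfolding plane_metric_def eucl_def plane_def
 by (simp add: L2_set_lessThan_2 cmod_def kappa_def)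

lemma separable_space_euclidean: "separable_space (euclidean :: complex topology)"
proof -
 obtain D :: "complex set" where "countable D" and D: "\<And>X. open X \<Longrightarrow> X \<noteq> {} \<Longrightarrow> \<exists>d\<in>D. d \<in> X"
  using countable_dense_setE by auto
 have "closure D = UNIV"
  using D[of "- closure D"] closure_subset[of D] by auto
 then show ?thesis
  using \<open>countable D\<close> unfolding separable_space_def by auto
qed

text \<open>One locale serves four kinds of spaces: the example, its rescalings, their limit and the
  Euclidean plane. What survives bounded changes of metric and density is proved from the constants
  alone, and these are uniform along the blow-up.\<close>

locale planar =
 fixes d :: "complex \<Rightarrow> complex \<Rightarrow> real" and \<rho> :: "complex \<Rightarrow> real" and s W c1 c2 :: real
 assumes d_sym: "d x y = d y x"
  and d_triangle: "d x z \<le> d x y + d y z"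
  and d_lower: "s * norm (x - y) \<le> d x y"
  and d_upper: "d x y \<le> W * norm (x - y)"
  and s_pos: "0 < s"
  and \<rho>_measurable [measurable]: "\<rho> \<in> borel_measurable borel"
  and c1_pos: "0 < c1" and \<rho>_lower: "c1 \<le> \<rho> z" and \<rho>_upper: "\<rho> z \<le> c2"
begin

abbreviation "X \<equiv> plane_metric d"
abbreviation "m \<equiv> plane_measure \<rho>"
abbreviation "M \<equiv> density lborel (\<lambda>z. ennreal (\<rho> z))"

lemma W_pos: "0 < W" and s_le_W: "s \<le> W"
 using order_trans[OF d_lower[of 1 0] d_upper[of 1 0]] s_pos by auto

lemma c2_pos: "0 < c2"
 using order_trans[OF \<rho>_lower[of 0] \<rho>_upper[of 0]] c1_pos by auto

lemma d_nonneg: "0 \<le> d x y"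
 using order_trans[OF _ d_lower[of x y], of 0] s_pos by simp

lemma d_pos: "x \<noteq> y \<Longrightarrow> 0 < d x y"
 using less_le_trans[OF _ d_lower[of x y], of 0] s_pos by simp

lemma d_self [simp]: "d x x = 0"
 using d_upper[of x x] d_nonneg[of x x] by simp

lemma Metric: "Metric_space plane (\<lambda>f g. d (kappa f) (kappa g))"
proof
 show "d (kappa x) (kappa y) = 0 \<longleftrightarrow> x = y" if "x \<in> plane" "y \<in> plane" for x y
  using that d_pos by (metis d_self iota_kappa less_irrefl)
qed (auto simp: d_nonneg d_sym d_triangle)

lemma mspace_X [simp]: "mspace X = plane"
 by (simp add: plane_metric_def Metric_space.mspace_metric[OF Metric])

lemma mdist_X [simp]: "mdist X f g = d (kappa f) (kappa g)"
 by (simp add: plane_metric_def Metric_space.mdist_metric[OF Metric])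

lemma mball_X: "mball_of X (iota z) r = iota ` {y. d z y < r}"
 by force

text \<open>Comparability with the norm makes the open sets the Euclidean ones, whatever
  \<open>d\<close> is.\<close>

lemma openin_X: "openin (mtopology_of X) U \<longleftrightarrow> (\<exists>V. open V \<and> U = iota ` V)"
proof -
 have *: "openin (mtopology_of X) (iota ` V) \<longleftrightarrow> open V" for V
 proof -
  have "openin (mtopology_of X) (iota ` V) \<longleftrightarrow>
    (\<forall>x\<in>V. \<exists>r>0. {y. d x y < r} \<subseteq> V)"
  proof -
   have "Metric_space.mball plane (\<lambda>f g. d (kappa f) (kappa g)) (iota x) r = iota ` {y. d x y < r}" for x r
    by (auto simp: Metric_space.in_mball[OF Metric] image_iff) (metis iota_kappa)
   moreover have "iota ` V \<subseteq> plane" by auto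
   moreover have "(\<forall>x. x \<in> iota ` V \<longrightarrow> P x) \<longleftrightarrow> (\<forall>x\<in>V. P (iota x))" for P by auto
   ultimately show ?thesis
    by (simp add: plane_metric_def Metric_space.mtopology_of[OF Metric] Metric_space.openin_mtopology[OF Metric]
      inj_image_subset_iff[OF inj_iota])
  qed
  also have "\<dots> \<longleftrightarrow> open V"
   unfolding open_dist
  proof (intro ball_cong refl iffI)
   fix x assume "\<exists>r>0. {y. d x y < r} \<subseteq> V"
   then obtain r where r: "r > 0" "{y. d x y < r} \<subseteq> V" by auto
   have "y \<in> V" if "dist y x < r / W" for y
   proof -
    have "d x y \<le> W * norm (x - y)" by (rule d_upper)
    also have "\<dots> < r" using that W_pos by (simp add: dist_norm norm_minus_commute field_simps)
    finally show ?thesis using r by auto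
   qed
   then show "\<exists>e>0. \<forall>y. dist y x < e \<longrightarrow> y \<in> V" using r W_pos by (intro exI[of _ "r/W"]) auto
  next
   fix x assume "\<exists>e>0. \<forall>y. dist y x < e \<longrightarrow> y \<in> V"
   then obtain e where e: "e > 0" "\<And>y. dist y x < e \<Longrightarrow> y \<in> V" by auto
   have "y \<in> V" if "d x y < s * e" for y
    using le_less_trans[OF d_lower[of x y] that] s_pos e(2)[of y] by (simp add: dist_norm norm_minus_commute)
   then show "\<exists>r>0. {y. d x y < r} \<subseteq> V" using e s_pos by (intro exI[of _ "s*e"]) auto
  qed
  finally show ?thesis .
 qed
 show ?thesis
 proof
  assume U: "openin (mtopology_of X) U"
  then have "U \<subseteq> plane" using openin_subset by force
  then have "U = iota ` (kappa ` U)" by force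
  then show "\<exists>V. open V \<and> U = iota ` V" using U * by metis
 qed (use * in auto)
qed

lemma mtopology_X: "mtopology_of X = mtopology_of (eucl 2)"
proof -
 interpret E: planar "\<lambda>z w. norm (z - w)" "\<lambda>_. 1" 1 1 1 1
  by unfold_locales (auto simp: norm_minus_commute norm_triangle_ineq4 intro: norm_diff_triangle_le)
 show ?thesis unfolding topology_eq openin_X eucl_2 E.openin_X by simp
qed

lemma homeomorphic_kappa: "homeomorphic_map (mtopology_of X) euclidean kappa"
proof (rule homeomorphic_maps_imp_map[where g = iota], unfold homeomorphic_maps_def, intro conjI)
 have v: "{x \<in> plane. kappa x \<in> V} = iota ` V" for V
  by force
 show "continuous_map (mtopology_of X) euclidean kappa"
  unfolding continuous_map_def by (auto simp: openin_X v)
 show "continuous_map euclidean (mtopology_of X) iota"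
  unfolding continuous_map_def openin_X using inj_iota by (auto simp: inj_image_mem_iff)
qed auto

lemma sets_m: "sets m = {iota ` A | A. A \<in> sets borel}"
 by (simp add: plane_measure_def sets_embed_measure inj_iota)

lemma space_m [simp]: "space m = plane"
 by (simp add: plane_measure_def space_embed_measure range_iota)

lemma sets_m_borel: "sets m = borel_sets_of X"
proof -
 have "sets m = sets (vimage_algebra plane kappa borel)"
 proof -
  have "A \<in> sets (vimage_algebra plane kappa borel) \<longleftrightarrow> (\<exists>B\<in>sets borel. A = kappa -` B \<inter> plane)" for A
   by (subst sets_vimage_algebra2) auto
  then show ?thesis by (force simp: sets_m kappa_vimage)
 qed
 also have "\<dots> = sets (sigma plane {kappa -` V \<inter> plane | V. open V})"
  unfolding borel_def by (subst vimage_algebra_sigma) auto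
 also have "\<dots> = sigma_sets plane {kappa -` V \<inter> plane | V. open V}"
  by (rule sets_measure_of) auto
 also have "{kappa -` V \<inter> plane | V. open V} = {U. openin (mtopology_of X) U}"
  by (auto simp: openin_X kappa_vimage)
 finally show ?thesis by (simp add: borel_sets_of_def)
qed

lemma iota_measurable [measurable]: "iota \<in> borel \<rightarrow>\<^sub>M m"
 using measurable_embed_measure2[OF inj_iota, of M] by (simp add: plane_measure_def)

lemma kappa_measurable [measurable]: "kappa \<in> m \<rightarrow>\<^sub>M borel"
 unfolding plane_measure_def
 by (auto intro: measurable_embed_measure1)

lemma measurable_m_iff: "f \<in> measurable m N \<longleftrightarrow> f \<circ> iota \<in> measurable borel N"
proof
 assume "f \<circ> iota \<in> borel \<rightarrow>\<^sub>M N"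
 then show "f \<in> m \<rightarrow>\<^sub>M N"
  unfolding plane_measure_def by (intro measurable_embed_measure1) (simp add: comp_def)
qed (auto intro: measurable_comp)

lemma nn_integral_m:
 assumes "f \<in> borel_measurable m"
 shows "(\<integral>\<^sup>+x. f x \<partial>m) = (NN z. f (iota z) * ennreal (\<rho> z))"
proof -
 have [measurable]: "(\<lambda>z. f (iota z)) \<in> borel_measurable borel"
  using assms by simp
 show ?thesis using assms unfolding plane_measure_def
  by (subst nn_integral_embed_measure[OF inj_iota]) (auto simp: nn_integral_density mult.commute)
qed

lemma emeasure_m: "A \<in> sets borel \<Longrightarrow> emeasure m (iota ` A) = (\<integral>\<^sup>+z\<in>A. ennreal (\<rho> z) \<partial>lborel)"
 unfolding plane_measure_def
 by (subst emeasure_embed_measure_image[OF inj_iota]) (auto simp: emeasure_density)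

lemma emeasure_M_bounds:
 assumes [measurable]: "A \<in> sets borel"
 shows "ennreal c1 * emeasure lborel A \<le> (\<integral>\<^sup>+z\<in>A. ennreal (\<rho> z) \<partial>lborel)"
  and "(\<integral>\<^sup>+z\<in>A. ennreal (\<rho> z) \<partial>lborel) \<le> ennreal c2 * emeasure lborel A"
proof -
 show "ennreal c1 * emeasure lborel A \<le> (\<integral>\<^sup>+z\<in>A. ennreal (\<rho> z) \<partial>lborel)"
  by (subst nn_integral_cmult_indicator[symmetric])
   (auto intro!: nn_integral_mono ennreal_leI \<rho>_lower split: split_indicator)
 show "(\<integral>\<^sup>+z\<in>A. ennreal (\<rho> z) \<partial>lborel) \<le> ennreal c2 * emeasure lborel A"
  by (subst nn_integral_cmult_indicator[symmetric])
   (auto intro!: nn_integral_mono ennreal_leI \<rho>_upper split: split_indicator)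
qed

lemma d_continuous: "continuous_on UNIV (\<lambda>y. d z y)"
proof -
 have "\<bar>d z x - d z y\<bar> \<le> W * dist x y" for x y
  using d_triangle[of z x y] d_triangle[of z y x] d_upper[of x y] d_sym[of x y] by (simp add: dist_norm)
 then have "W-lipschitz_on UNIV (\<lambda>y. d z y)"
  using W_pos by (intro lipschitz_onI) (auto simp: dist_real_def)
 then show ?thesis by (rule lipschitz_on_continuous_on)
qed

lemma d_borel [measurable]: "(\<lambda>y. d z y) \<in> borel_measurable borel" "(\<lambda>y. d y z) \<in> borel_measurable borel"
 using borel_measurable_continuous_onI[OF d_continuous] by (auto simp: d_sym[of _ z])

lemma ball_borel [measurable]: "{y. d z y < r} \<in> sets borel"
 by simp

lemma ball_subset: "{y. d z y < r} \<subseteq> ball z (r / s)" "ball z (r / W) \<subseteq> {y. d z y < r}"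
proof -
 show "{y. d z y < r} \<subseteq> ball z (r / s)"
  using le_less_trans[OF d_lower[of z]] s_pos by (auto simp: dist_norm field_simps)
 show "ball z (r / W) \<subseteq> {y. d z y < r}"
  using le_less_trans[OF d_upper[of z]] W_pos by (auto simp: dist_norm field_simps)
qed

lemma emeasure_lborel_ball_complex:
 "r \<ge> 0 \<Longrightarrow> emeasure lborel (ball (z::complex) r) = ennreal (pi * r^2)"
 by (simp add: emeasure_ball unit_ball_vol_2)

lemma emeasure_mball_bounds:
 assumes "r \<ge> 0"
 shows "ennreal (c1 * pi * (r / W)^2) \<le> emeasure m (mball_of X (iota z) r)"
  and "emeasure m (mball_of X (iota z) r) \<le> ennreal (c2 * pi * (r / s)^2)"
proof -
 have "ennreal (c1 * pi * (r / W)^2) = ennreal c1 * emeasure lborel (ball z (r / W))"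
  using assms W_pos c1_pos by (simp add: emeasure_lborel_ball_complex ennreal_mult[symmetric] mult.assoc)
 also have "\<dots> \<le> ennreal c1 * emeasure lborel {y. d z y < r}"
  by (intro mult_left_mono emeasure_mono ball_subset) auto
 also have "\<dots> \<le> emeasure m (mball_of X (iota z) r)"
  unfolding mball_X by (subst emeasure_m) (auto intro: emeasure_M_bounds)
 finally show "ennreal (c1 * pi * (r / W)^2) \<le> emeasure m (mball_of X (iota z) r)" .
 have "emeasure m (mball_of X (iota z) r) \<le> ennreal c2 * emeasure lborel {y. d z y < r}"
  unfolding mball_X by (subst emeasure_m) (auto intro: emeasure_M_bounds)
 also have "\<dots> \<le> ennreal c2 * emeasure lborel (ball z (r / s))"
  by (intro mult_left_mono emeasure_mono ball_subset) auto
 also have "\<dots> = ennreal (c2 * pi * (r / s)^2)"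
  using assms s_pos c2_pos by (simp add: emeasure_lborel_ball_complex ennreal_mult[symmetric] mult.assoc)
 finally show "emeasure m (mball_of X (iota z) r) \<le> ennreal (c2 * pi * (r / s)^2)" .
qed

lemma metric_measure_space_X: "metric_measure_space X m"
proof -
 interpret MS: Metric_space plane "\<lambda>f g. d (kappa f) (kappa g)" by (rule Metric)
 have "mcomplete_of X"
  unfolding mcomplete_of_def mspace_X
 proof -
  show "Metric_space.mcomplete plane (mdist X)" unfolding mdist_X[abs_def]
   unfolding MS.mcomplete_def
  proof (intro allI impI)
   fix \<sigma> assume \<sigma>: "MS.MCauchy \<sigma>"
   then have r: "\<sigma> n \<in> plane" for n by (auto simp: MS.MCauchy_def)
   have "Cauchy (\<lambda>n. kappa (\<sigma> n))"
   proof (rule metric_CauchyI)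
    fix e :: real assume "e > 0"
    then obtain N where N: "\<And>n n'. N \<le> n \<Longrightarrow> N \<le> n' \<Longrightarrow> d (kappa (\<sigma> n)) (kappa (\<sigma> n')) < s * e"
     using \<sigma> s_pos unfolding MS.MCauchy_def by force
    then show "\<exists>N. \<forall>n\<ge>N. \<forall>n'\<ge>N. dist (kappa (\<sigma> n)) (kappa (\<sigma> n')) < e"
     using le_less_trans[OF d_lower N] s_pos by (intro exI[of _ N]) (auto simp: dist_norm)
   qed
   then obtain l where l: "(\<lambda>n. kappa (\<sigma> n)) ----> l" using Cauchy_convergent convergent_def by auto
   have "(\<lambda>n. d (kappa (\<sigma> n)) l) ----> 0"
   proof (rule tendsto_sandwich[OF always_eventually always_eventually tendsto_const])
    show "(\<lambda>n. W * norm (kappa (\<sigma> n) - l)) ----> 0"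
     using l by (intro tendsto_mult_right_zero tendsto_norm_zero) (simp add: LIM_zero_iff)
   qed (auto simp: d_nonneg d_upper)
   then show "\<exists>x. limitin MS.mtopology \<sigma> x sequentially"
    by (intro exI[of _ "iota l"]) (auto simp: MS.limitin_metric_dist_null r)
  qed
 qed
 moreover have "separable_space (mtopology_of X)"
  using homeomorphic_separable_space[OF homeomorphic_map_imp_homeomorphic_space[OF homeomorphic_kappa]]
   separable_space_euclidean by auto
 moreover have "emeasure m (mball_of X x r) < \<infinity>" if "x \<in> plane" for x r
 proof (cases "r \<ge> 0")
  case True
  then show ?thesis using that emeasure_mball_bounds(2)[of r "kappa x"] by (auto intro: le_less_trans)
 next
  case False
  have "\<not> d (kappa x) y < r" for y using False d_nonneg[of "kappa x" y] by simp
  then have "mball_of X x r = {}" by auto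
  then show ?thesis by simp
 qed
 ultimately show ?thesis by (simp add: metric_measure_space_def sets_m_borel)
qed

lemma spt_X: "z \<in> plane \<Longrightarrow> z \<in> spt X m"
proof -
 assume z: "z \<in> plane"
 have "emeasure m (mball_of X z r) > 0" if "r > 0" for r
  using emeasure_mball_bounds(1)[of r "kappa z"] that z c1_pos W_pos
  by (auto intro: less_le_trans[rotated] simp: ennreal_less_zero_iff)
 then show ?thesis using z by (simp add: spt_def)
qed

section \<open>Ahlfors regularity, doubling and rectifiability\<close>

lemma Ahlfors_X: "Ahlfors_regular X m"
 unfolding Ahlfors_regular_def
proof (intro exI conjI ballI allI impI)
 define \<alpha> where "\<alpha> = Max {1, W^2 / (c1 * pi), c2 * pi / s^2}"
 have \<alpha>: "1 \<le> \<alpha>" "W^2 / (c1 * pi) \<le> \<alpha>" "c2 * pi / s^2 \<le> \<alpha>" unfolding \<alpha>_def by auto+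
 show "(1::real) \<le> 2" "1 \<le> \<alpha>" using \<alpha> by auto
 fix x and r :: real assume x: "x \<in> mspace X" and r: "0 < r"
 obtain z where z: "x = iota z" using x plane_cases by auto
 have "r powr 2 / \<alpha> \<le> c1 * pi * (r / W)^2"
 proof -
  have "r powr 2 / \<alpha> \<le> r^2 / (W^2 / (c1 * pi))"
   unfolding powr_numeral[OF less_imp_le[OF r]]
   using \<alpha>(1) W_pos c1_pos by (intro divide_left_mono \<alpha>(2) mult_pos_pos divide_pos_pos zero_le_power2) auto
  also have "\<dots> = c1 * pi * (r / W)^2" by (simp add: power_divide)
  finally show ?thesis .
 qed
 then show "ennreal (r powr 2 / \<alpha>) \<le> emeasure m (mball_of X x r)"
  using emeasure_mball_bounds(1)[of r z] r z by (auto intro: order_trans[OF ennreal_leI])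
 have "c2 * pi * (r / s)^2 = (c2 * pi / s^2) * r powr 2" using r by (simp add: power_divide)
 also have "\<dots> \<le> \<alpha> * r powr 2" using \<alpha> by (intro mult_right_mono) auto
 finally show "emeasure m (mball_of X x r) \<le> ennreal (\<alpha> * r powr 2)"
  using emeasure_mball_bounds(2)[of r z] r z by (auto intro: order_trans[OF _ ennreal_leI])
qed

lemma doubling_X: "doubling X m"
 unfolding doubling_def
proof (intro exI conjI ballI allI impI)
 define C where "C = max 1 ((c2 * pi * (2 / s)^2) / (c1 * pi * (1 / W)^2))"
 show "1 \<le> C" by (simp add: C_def)
 fix x and r :: real assume x: "x \<in> mspace X" and r: "0 < r"
 obtain z where z: "x = iota z" using x plane_cases by auto
 have "c2 * pi * (2 * r / s)^2 = (c2 * pi * (2 / s)^2) / (c1 * pi * (1 / W)^2) * (c1 * pi * (r / W)^2)"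
  using c1_pos W_pos s_pos by (simp add: field_simps)
 also have "\<dots> \<le> C * (c1 * pi * (r / W)^2)"
  using c1_pos unfolding C_def by (intro mult_right_mono) auto
 finally have "emeasure m (mball_of X x (2 * r)) \<le> ennreal (C * (c1 * pi * (r / W)^2))"
  using emeasure_mball_bounds(2)[of "2*r" z] r z by (auto intro: order_trans[OF _ ennreal_leI])
 also have "\<dots> = ennreal C * ennreal (c1 * pi * (r / W)^2)"
  using c1_pos by (intro ennreal_mult) (auto simp: C_def)
 also have "\<dots> \<le> ennreal C * emeasure m (mball_of X x r)"
  using emeasure_mball_bounds(1)[of r z] r z by (intro mult_left_mono) auto
 finally show "emeasure m (mball_of X x (2 * r)) \<le> ennreal C * emeasure m (mball_of X x r)" .
qed

lemma set_diam_bound: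
 assumes "C \<subseteq> plane" "f \<in> C" "set_diam X C \<le> ennreal D" "D \<ge> 0"
 shows "kappa ` C \<subseteq> cball (kappa f) (D / s)"
proof
 fix z assume "z \<in> kappa ` C"
 then obtain g where g: "g \<in> C" "z = kappa g" by auto
 have "ennreal (mdist X f g) \<le> (SUP y\<in>C. ennreal (mdist X f y))"
  by (rule SUP_upper) (rule g)
 also have "\<dots> \<le> set_diam X C"
  unfolding set_diam_def by (rule SUP_upper[where f = "\<lambda>x. SUP y\<in>C. ennreal (mdist X x y)"]) (rule assms)
 finally have "ennreal (mdist X f g) \<le> ennreal D" using assms(3) by simp
 then have "d (kappa f) z \<le> D" using assms(4) g by simp
 with d_lower[of "kappa f" z] have "s * norm (kappa f - z) \<le> D" by simp
 then show "z \<in> cball (kappa f) (D / s)" using s_pos by (simp add: dist_norm field_simps)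
qed

lemma emeasure_lborel_cball_complex:
 "r \<ge> 0 \<Longrightarrow> emeasure lborel (cball (z::complex) r) = ennreal (pi * r^2)"
 by (simp add: emeasure_cball unit_ball_vol_2)

text \<open>A set of diameter \<open>D\<close> lies in a Euclidean disc of radius D / s, whose area
  is 4 / s^2 times the weight pi * (D / 2)^2 that the set has in a covering sum. Hence Lebesgue
  measure is at most 4 / s^2 times every such sum.\<close>

lemma absolutely_continuous_hausdorff:
 assumes A: "A \<in> sets borel" and H: "hausdorff_measure X 2 (iota ` A) = 0"
 shows "emeasure lborel A = 0"
proof -
 define wt where "wt = (\<lambda>C. if C = {} then 0 else ennreal (unit_ball_vol (real 2)) * (set_diam X C / 2)^2)"
 have "(INF C\<in>{C :: nat \<Rightarrow> (nat \<Rightarrow> real) set. iota ` A \<subseteq> (\<Union>i. C i) \<and>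
   (\<forall>i. C i \<subseteq> mspace X \<and> set_diam X (C i) \<le> ennreal 1)}. (\<Sum>i. wt (C i))) \<le> hausdorff_measure X 2 (iota ` A)"
  unfolding hausdorff_measure_def wt_def
  by (rule SUP_upper[of 1 _ "\<lambda>\<delta>. INF C\<in>{C. iota ` A \<subseteq> (\<Union>i. C i) \<and>
   (\<forall>i. C i \<subseteq> mspace X \<and> set_diam X (C i) \<le> ennreal \<delta>)}. (\<Sum>i. if C i = {} then 0
       else ennreal (unit_ball_vol (real 2)) * (set_diam X (C i) / 2) ^ 2)"]) simp
 then have inf0: "(INF C\<in>{C :: nat \<Rightarrow> (nat \<Rightarrow> real) set. iota ` A \<subseteq> (\<Union>i. C i) \<and>
   (\<forall>i. C i \<subseteq> mspace X \<and> set_diam X (C i) \<le> ennreal 1)}. (\<Sum>i. wt (C i))) = 0"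
  using H by simp
 have small: "emeasure lborel A \<le> ennreal e" if "e > 0" for e
 proof -
  \<comment> \<open>The factor compensates 4 / s^2 in the comparison of areas with covering
    sums.\<close>
  define e' where "e' = e * s^2 / 4"
  have "e' > 0" using that s_pos by (simp add: e'_def)
  then have "(INF C\<in>{C :: nat \<Rightarrow> (nat \<Rightarrow> real) set. iota ` A \<subseteq> (\<Union>i. C i) \<and>
   (\<forall>i. C i \<subseteq> mspace X \<and> set_diam X (C i) \<le> ennreal 1)}. (\<Sum>i. wt (C i))) < ennreal e'"
   unfolding inf0 by simp
  then obtain C where C: "iota ` A \<subseteq> (\<Union>i. C i)" "\<And>i. C i \<subseteq> plane" "\<And>i. set_diam X (C i) \<le> ennreal 1"
   "(\<Sum>i. wt (C i)) < ennreal e'"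
   unfolding INF_less_iff mspace_X by auto
  have "\<exists>B\<in>sets borel. kappa ` C i \<subseteq> B \<and> emeasure lborel B \<le> ennreal (4 / s^2) * wt (C i)" for i
  proof (cases "C i = {}")
   case False
   then obtain f where f: "f \<in> C i" by auto
   have fin: "set_diam X (C i) \<le> ennreal 1" by (rule C)
   then obtain D where D: "D \<ge> 0" "set_diam X (C i) = ennreal D"
    by (cases "set_diam X (C i)") (auto simp: top_unique)
   have "emeasure lborel (cball (kappa f) (D / s)) = ennreal (4 / s^2) * wt (C i)"
   proof -
    have "ennreal D / 2 = ennreal (D / 2)" using divide_ennreal[of D 2] D by simp
    then have "wt (C i) = ennreal (pi * (D / 2)^2)"
     using False D by (simp add: wt_def unit_ball_vol_2 ennreal_power ennreal_mult)
    moreover have "ennreal (pi * (D / s)^2) = ennreal (4 / s^2) * ennreal (pi * (D / 2)^2)"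
     by (subst ennreal_mult[symmetric]) (auto simp: power_divide)
    moreover have "emeasure lborel (cball (kappa f) (D / s)) = ennreal (pi * (D / s)^2)"
     using D(1) s_pos by (intro emeasure_lborel_cball_complex) simp
    ultimately show ?thesis by simp
   qed
   moreover have "kappa ` C i \<subseteq> cball (kappa f) (D / s)"
    using D(2) by (intro set_diam_bound[OF C(2) f _ D(1)]) (simp only: order_refl)
   moreover have "cball (kappa f) (D / s) \<in> sets borel" by simp
   ultimately show ?thesis by (metis order_refl)
  qed (auto simp: wt_def intro!: bexI[of _ "{}"])
  then obtain B where B: "\<And>i. B i \<in> sets borel" "\<And>i. kappa ` C i \<subseteq> B i"
   "\<And>i. emeasure lborel (B i) \<le> ennreal (4 / s^2) * wt (C i)" by metis
  have "A \<subseteq> (\<Union>i. B i)"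
  proof
   fix a assume "a \<in> A"
   then obtain i where "iota a \<in> C i" using C(1) by auto
   then have "kappa (iota a) \<in> B i" using B(2) by blast
   then show "a \<in> (\<Union>i. B i)" by auto
  qed
  then have "emeasure lborel A \<le> emeasure lborel (\<Union>i. B i)" using B by (intro emeasure_mono) auto
  also have "\<dots> \<le> (\<Sum>i. emeasure lborel (B i))" using B by (intro emeasure_subadditive_countably) auto
  also have "\<dots> \<le> (\<Sum>i. ennreal (4 / s^2) * wt (C i))" using B by (intro suminf_le summableI) auto
  also have "\<dots> = ennreal (4 / s^2) * (\<Sum>i. wt (C i))" by simp
  also have "\<dots> \<le> ennreal (4 / s^2) * ennreal e'" using C(4) by (intro mult_left_mono) auto
  also have "\<dots> = ennreal e" using s_pos that by (simp add: ennreal_mult[symmetric] e'_def)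
  finally show ?thesis .
 qed
 have "emeasure lborel A \<le> 0"
 proof (rule ennreal_le_epsilon)
  fix e :: real assume "e > 0"
  then show "emeasure lborel A \<le> 0 + ennreal e" unfolding add_0 by (rule small)
 qed
 then show ?thesis unfolding le_zero_eq .
qed

lemma rectifiable_X: "rectifiable X m"
proof -
 \<comment> \<open>One chart suffices, the whole plane mapped by the identity; all other pieces are
   empty.\<close>
 define U where "U = (\<lambda>i::nat. if i = 0 then plane else {})"
 have null: "emeasure m A = 0" if "A \<in> sets m" "hausdorff_measure X 2 A = 0" for A
 proof -
  from that(1) obtain B where B: "B \<in> sets borel" "A = iota ` B" unfolding sets_m by auto
  have "emeasure m A \<le> ennreal c2 * emeasure lborel B"
   using emeasure_m[OF B(1)] emeasure_M_bounds(2)[OF B(1)] B by simp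
  also have "emeasure lborel B = 0" using absolutely_continuous_hausdorff[OF B(1)] that(2) unfolding B(2) .
  finally show ?thesis by simp
 qed
 have bilip: "biLipschitz_on X (eucl 2) plane id"
  unfolding biLipschitz_on_def
 proof (intro conjI exI ballI)
  define L where "L = Max {1, 1 / s, W}"
  have L: "1 \<le> L" "1 / s \<le> L" "W \<le> L" unfolding L_def by auto+
  show "1 \<le> L" by fact
  fix x y assume "x \<in> plane" "y \<in> plane"
  then obtain z w where zw: "x = iota z" "y = iota w" by (metis iota_kappa)
  have "d z w \<le> L * norm (z - w)" using d_upper[of z w] mult_right_mono[OF L(3), of "norm (z - w)"] by simp
  then show "mdist X x y / L \<le> mdist (eucl 2) (id x) (id y)"
   using L(1) zw by (simp add: dist_iota field_simps del: L2_set_lessThan_2)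
  have "norm (z - w) = 1 / s * (s * norm (z - w))" using s_pos by simp
  also have "\<dots> \<le> 1 / s * d z w" using s_pos d_lower by (intro mult_left_mono) auto
  also have "\<dots> \<le> L * d z w" using L d_nonneg by (intro mult_right_mono) auto
  finally show "mdist (eucl 2) (id x) (id y) \<le> L * mdist X x y" using zw by (simp add: dist_iota)
 qed (auto simp: plane_def)
 have "plane \<in> sets m" using sets.top[of m] by simp
 show ?thesis
  unfolding rectifiable_def
 proof (intro exI conjI allI impI ballI)
  show "U i \<in> sets m" for i using \<open>plane \<in> sets m\<close> by (simp add: U_def)
  show "emeasure m (U i \<inter> U j) = 0" if "i \<noteq> j" for i j using that by (auto simp: U_def)
  have "(\<Union>i. U i) = plane" by (auto simp: U_def)
  then show "emeasure m (mspace X - (\<Union>i. U i)) = 0" by simp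
  show "biLipschitz_on X (eucl 2) (U i) id" for i
   using bilip by (auto simp: U_def biLipschitz_on_def)
  show "emeasure m A = 0" if "A \<in> sets m" "A \<subseteq> U i \<and> hausdorff_measure X 2 A = 0" for i A
   using null that by auto
 qed
qed

end

section \<open>Slopes and Sobolev functions\<close>

text \<open>Stated with the Euclidean norm, so that the class of competitors is the same for all
  metrics \<open>d\<close>; \<open>Lip_bs_X\<close> identifies it with the intrinsic one.\<close>

definition Lipbs :: "(complex \<Rightarrow> real) set" where
 "Lipbs = {F. (\<exists>L. \<forall>x y. \<bar>F x - F y\<bar> \<le> L * norm (x - y)) \<and> (\<exists>R. \<forall>x. F x \<noteq> 0 \<longrightarrow> norm x \<le> R)}"

lemma Lipschitz_continuous:
 fixes F :: "complex \<Rightarrow> real"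
 assumes "\<And>x y. \<bar>F x - F y\<bar> \<le> L * norm (x - y)"
 shows "continuous_on UNIV F"
proof -
 have "0 \<le> L" using order_trans[OF abs_ge_zero assms[of 1 0]] by simp
 then have "L-lipschitz_on UNIV F" using assms by (intro lipschitz_onI) (auto simp: dist_real_def dist_norm)
 then show ?thesis by (rule lipschitz_on_continuous_on)
qed

lemma Lipbs_borel: "F \<in> Lipbs \<Longrightarrow> F \<in> borel_measurable borel"
 unfolding Lipbs_def using Lipschitz_continuous borel_measurable_continuous_onI by auto

lemma Lipbs_obtain:
 assumes "F \<in> Lipbs"
 obtains L R where "0 < L" "\<And>x y. \<bar>F x - F y\<bar> \<le> L * norm (x - y)" "0 < R" "\<And>x. norm x > R \<Longrightarrow> F x = 0"
proof -
 from assms obtain L R where L: "\<And>x y. \<bar>F x - F y\<bar> \<le> L * norm (x - y)" and R: "\<And>x. F x \<noteq> 0 \<Longrightarrow> norm x \<le> R"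
  unfolding Lipbs_def by auto
 have "\<bar>F x - F y\<bar> \<le> (\<bar>L\<bar> + 1) * norm (x - y)" for x y
  by (rule order_trans[OF L mult_right_mono]) auto
 moreover have "F x = 0" if "norm x > \<bar>R\<bar> + 1" for x
 proof (rule ccontr)
  assume "F x \<noteq> 0"
  from R[OF this] that show False by simp
 qed
 ultimately show ?thesis using that[of "\<bar>L\<bar> + 1" "\<bar>R\<bar> + 1"] by auto
qed

lemma Lipbs_add: assumes "F \<in> Lipbs" "G \<in> Lipbs" shows "(\<lambda>x. F x + G x) \<in> Lipbs"
proof -
 obtain L R where F: "\<And>x y. \<bar>F x - F y\<bar> \<le> L * norm (x - y)" "\<And>x. norm x > R \<Longrightarrow> F x = 0"
  using Lipbs_obtain[OF assms(1)] by metis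
 obtain L' R' where G: "\<And>x y. \<bar>G x - G y\<bar> \<le> L' * norm (x - y)" "\<And>x. norm x > R' \<Longrightarrow> G x = 0"
  using Lipbs_obtain[OF assms(2)] by metis
 have "\<bar>(F x + G x) - (F y + G y)\<bar> \<le> (L + L') * norm (x - y)" for x y
  using F(1)[of x y] G(1)[of x y] by (simp add: distrib_right)
 moreover have "norm x \<le> max R R'" if "F x + G x \<noteq> 0" for x
 proof (rule ccontr)
  assume "\<not> norm x \<le> max R R'"
  then have "F x = 0" "G x = 0" using F(2)[of x] G(2)[of x] by auto
  then show False using that by simp
 qed
 ultimately show ?thesis unfolding Lipbs_def by auto
qed

lemma Lipbs_cmult: assumes "F \<in> Lipbs" shows "(\<lambda>x. c * F x) \<in> Lipbs"
proof -
 obtain L R where F: "\<And>x y. \<bar>F x - F y\<bar> \<le> L * norm (x - y)" "\<And>x. norm x > R \<Longrightarrow> F x = 0"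
  using Lipbs_obtain[OF assms(1)] by metis
 have "\<bar>c * F x - c * F y\<bar> \<le> (\<bar>c\<bar> * L) * norm (x - y)" for x y
  using mult_left_mono[OF F(1)[of x y], of "\<bar>c\<bar>"] by (simp add: abs_mult[symmetric] right_diff_distrib mult.assoc)
 moreover have "norm x \<le> R" if "c * F x \<noteq> 0" for x
  using F(2)[of x] that by force
 ultimately show ?thesis unfolding Lipbs_def by auto
qed

lemma Lipbs_diff: "F \<in> Lipbs \<Longrightarrow> G \<in> Lipbs \<Longrightarrow> (\<lambda>x. F x - G x) \<in> Lipbs"
 using Lipbs_add[of F "\<lambda>x. - 1 * G x"] Lipbs_cmult[of G "- 1"] by simp

context planar
begin

lemma atin_X: "atin (mtopology_of X) (iota z) = filtermap iota (at z)"
proof (rule filter_eq_iff[THEN iffD2], intro allI)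
 fix P
 have "eventually P (atin (mtopology_of X) (iota z)) \<longleftrightarrow>
  (\<exists>V. open V \<and> z \<in> V \<and> (\<forall>y\<in>V. y \<noteq> z \<longrightarrow> P (iota y)))"
  by (auto simp: eventually_atin openin_X inj_image_mem_iff[OF inj_iota])
 also have "\<dots> \<longleftrightarrow> eventually P (filtermap iota (at z))"
  by (auto simp: eventually_filtermap eventually_at_topological)
 finally show "eventually P (atin (mtopology_of X) (iota z)) = eventually P (filtermap iota (at z))" .
qed

lemma slope_X: "slope X f (iota z) = lipc d (\<lambda>y. f (iota y)) z"
proof -
 have "iota z \<in> mtopology_of X derived_set_of mspace X"
 proof -
  have "atin (mtopology_of X) (iota z) \<noteq> bot" unfolding atin_X by (simp add: filtermap_bot_iff)
  then show ?thesis by (simp add: nontrivial_limit_atin)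
 qed
 moreover have "Limsup (filtermap iota (at z)) f = Limsup (at z) (\<lambda>y. f (iota y))" for f :: "_ \<Rightarrow> ennreal"
  by (intro antisym Limsup_filtermap_le Limsup_filtermap_ge inj_iota)
 ultimately show ?thesis by (simp add: slope_def atin_X lipc_def)
qed

lemma d_continuous2:
 fixes f g :: "'c::topological_space \<Rightarrow> complex"
 assumes f: "continuous_on S f" and g: "continuous_on S g"
 shows "continuous_on S (\<lambda>x. d (f x) (g x))"
 unfolding continuous_on_def
proof
 fix x assume x: "x \<in> S"
 have "((\<lambda>y. d (f y) (g y) - d (f x) (g x)) \<longlongrightarrow> 0) (at x within S)"
 proof (rule Lim_null_comparison)
  have "\<bar>d a b - d a' b'\<bar> \<le> W * norm (a - a') + W * norm (b - b')" for a b a' b'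
   using d_triangle[of a b a'] d_triangle[of a' b b'] d_triangle[of a' b' a] d_triangle[of a b' b]
    d_upper[of a a'] d_upper[of b b'] d_sym[of a a'] d_sym[of b b'] by simp
  then show "\<forall>\<^sub>F y in at x within S. norm (d (f y) (g y) - d (f x) (g x)) \<le> W * norm (f y - f x) + W * norm (g y - g x)"
   by simp
  have "((\<lambda>y. W * norm (f y - f x) + W * norm (g y - g x)) \<longlongrightarrow> W * norm (f x - f x) + W * norm (g x - g x)) (at x within S)"
   using f g x unfolding continuous_on_def by (intro tendsto_intros) auto
  then show "((\<lambda>y. W * norm (f y - f x) + W * norm (g y - g x)) \<longlongrightarrow> 0) (at x within S)" by simp
 qed
 then show "((\<lambda>x. d (f x) (g x)) \<longlongrightarrow> d (f x) (g x)) (at x within S)" by (simp add: LIM_zero_iff)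
qed

lemma d_measurable2 [measurable (raw)]:
 assumes [measurable]: "f \<in> borel_measurable N" "g \<in> borel_measurable N"
 shows "(\<lambda>x. d (f x) (g x)) \<in> borel_measurable N"
proof -
 have "(\<lambda>p. d (fst p) (snd p)) \<in> borel_measurable (borel \<Otimes>\<^sub>M borel)"
  unfolding borel_prod by (intro borel_measurable_continuous_onI d_continuous2 continuous_intros)
 then have "(\<lambda>x. (\<lambda>p. d (fst p) (snd p)) (f x, g x)) \<in> borel_measurable N"
  by (rule measurable_compose_rev) measurable
 then show ?thesis by simp
qed

text \<open>The slope is an infimum over radii of suprema of difference quotients. The quotients are
  continuous in the increment \<open>v\<close>, so the supremum may be restricted to a countable
  dense set of increments that does not depend on the base point.\<close>

lemma lipc_measurable:
 fixes F :: "complex \<Rightarrow> real"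
 assumes F: "continuous_on UNIV F"
 shows "lipc d F \<in> borel_measurable borel"
proof -
 obtain D :: "complex set" where D: "countable D" "\<And>X. open X \<Longrightarrow> X \<noteq> {} \<Longrightarrow> \<exists>d\<in>D. d \<in> X"
  using countable_dense_setE by auto
 have [measurable]: "F \<in> borel_measurable borel" by (rule borel_measurable_continuous_onI[OF F])
 define q where "q = (\<lambda>z v. ennreal (\<bar>F (z + v) - F z\<bar> / d (z + v) z))"
 have "lipc d F z = (INF n. SUP v\<in>D \<inter> (ball 0 (1 / Suc n) - {0}). q z v)" for z
 proof -
  have "lipc d F z = (INF e\<in>{0<..}. SUP y\<in>ball z e - {z}. ennreal (\<bar>F y - F z\<bar> / d y z))"
   unfolding lipc_def Limsup_at ..
  also have "\<dots> = (INF e\<in>{0<..}. SUP v\<in>ball 0 e - {0}. q z v)"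
  proof -
   have "ball z e - {z} = (\<lambda>v. z + v) ` (ball 0 e - {0})" for e
   proof (intro antisym subsetI)
    fix y assume "y \<in> ball z e - {z}"
    then have "y - z \<in> ball 0 e - {0}" "y = z + (y - z)" by (auto simp: dist_norm)
    then show "y \<in> (\<lambda>v. z + v) ` (ball 0 e - {0})" by blast
   qed (auto simp: dist_norm)
   then show ?thesis by (simp add: q_def image_image)
  qed
  also have "\<dots> = (INF n. SUP v\<in>ball 0 (1 / Suc n) - {0}. q z v)"
  proof (rule antisym)
   show "(INF e\<in>{0<..}. SUP v\<in>ball 0 e - {0}. q z v) \<le> (INF n. SUP v\<in>ball 0 (1 / Suc n) - {0}. q z v)"
    by (rule INF_greatest) (rule INF_lower, simp)
   show "(INF n. SUP v\<in>ball 0 (1 / Suc n) - {0}. q z v) \<le> (INF e\<in>{0<..}. SUP v\<in>ball 0 e - {0}. q z v)"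
   proof (rule INF_greatest)
    fix e :: real assume "e \<in> {0<..}"
    then obtain n where n: "1 / Suc n < e" using nat_approx_posE by auto
    have "(SUP v\<in>ball 0 (1 / Suc n) - {0}. q z v) \<le> (SUP v\<in>ball 0 e - {0}. q z v)"
     using n by (intro SUP_subset_mono) auto
    then show "(INF n. SUP v\<in>ball 0 (1 / Suc n) - {0}. q z v) \<le> (SUP v\<in>ball 0 e - {0}. q z v)"
     by (rule INF_lower2[OF UNIV_I])
   qed
  qed
  also have "\<dots> = (INF n. SUP v\<in>D \<inter> (ball 0 (1 / Suc n) - {0}). q z v)"
  proof (rule INF_cong[OF refl])
   fix n
   let ?B = "ball 0 (1 / Suc n) - {0 :: complex}" and ?S = "SUP v\<in>D \<inter> (ball 0 (1 / Suc n) - {0}). q z v"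
   have op: "open ?B" by auto
   have "q z v \<le> ?S" if v: "v \<in> ?B" for v
   proof (rule ccontr)
    assume "\<not> q z v \<le> ?S"
    then have gt: "?S < q z v" by simp
    have "continuous_on ?B (\<lambda>v. \<bar>F (z + v) - F z\<bar> / d (z + v) z)"
     using d_pos[of "z + v" z for v]
     by (intro continuous_intros continuous_on_compose2[OF F] d_continuous2) (auto simp: less_imp_neq[THEN not_sym])
    then have "continuous_on ?B (q z)"
     unfolding q_def by (intro continuous_on_ennreal)
    then have "open (q z -` {?S<..} \<inter> ?B)"
     using continuous_on_open_vimage[OF op, of "q z"] open_greaterThan[of ?S] by simp
    moreover have "v \<in> q z -` {?S<..} \<inter> ?B" using v gt by simp
    ultimately obtain v' where v': "v' \<in> D" "v' \<in> ?B" "?S < q z v'" using D(2) by blast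
    then have "q z v' \<le> ?S" by (intro SUP_upper) auto
    then show False using v'(3) by simp
   qed
   then have "(SUP v\<in>?B. q z v) \<le> ?S" by (intro SUP_least)
   moreover have "?S \<le> (SUP v\<in>?B. q z v)" by (rule SUP_subset_mono) auto
   ultimately show "(SUP v\<in>?B. q z v) = ?S" by simp
  qed
  finally show ?thesis .
 qed
 then have "lipc d F = (\<lambda>z. INF n. SUP v\<in>D \<inter> (ball 0 (1 / Suc n) - {0}). q z v)" by auto
 moreover have "(\<lambda>z. q z v) \<in> borel_measurable borel" for v unfolding q_def by simp
 ultimately show ?thesis
  using D(1) by simp
qed

lemma lipc_le:
 fixes F :: "complex \<Rightarrow> real"
 assumes "\<And>x y. \<bar>F x - F y\<bar> \<le> L * d x y" "L \<ge> 0"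
 shows "lipc d F z \<le> ennreal L"
 unfolding lipc_def
proof (rule Limsup_bounded, rule eventually_at_filter[THEN iffD2], rule always_eventually, intro allI impI)
 fix y assume "y \<noteq> z"
 then show "ennreal (\<bar>F y - F z\<bar> / d y z) \<le> ennreal L"
  using assms(1)[of y z] d_pos[of y z] by (intro ennreal_leI) (simp add: field_simps)
qed

text \<open>Along a curve of speed at most \<open>c\<close>, a difference quotient in time is at
  most \<open>c\<close> times a difference quotient with respect to \<open>d\<close>. The time steps
  1 / (n + 1) are those of \<open>Lipschitz_difference_le_nn_integral\<close>.\<close>

lemma lipc_along_curve:
 fixes F :: "complex \<Rightarrow> real"
 assumes \<gamma>: "\<And>s t. d (\<gamma> s) (\<gamma> t) \<le> c * \<bar>s - t\<bar>" and c: "c \<ge> 0"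
 shows "limsup (\<lambda>n. ennreal (\<bar>F (\<gamma> (t + 1 / Suc n)) - F (\<gamma> t)\<bar> * Suc n)) \<le> ennreal c * lipc d F (\<gamma> t)"
proof (cases "lipc d F (\<gamma> t) = \<infinity>")
 case True
 show ?thesis
 proof (cases "c = 0")
  case True
  then have "\<gamma> s = \<gamma> t" for s using \<gamma>[of s t] d_pos[of "\<gamma> s" "\<gamma> t"] by auto
  then have "F (\<gamma> (t + 1 / Suc n)) = F (\<gamma> t)" for n by metis
  then show ?thesis by (simp add: Limsup_const)
 next
  case False
  then show ?thesis using True c by simp
 qed
next
 case False
 show ?thesis
 proof (rule ennreal_le_epsilon)
  fix e :: real assume e: "e > 0"
  define C where "C = lipc d F (\<gamma> t) + ennreal (e / (c + 1))"
  have "0 < e / (c + 1)" using e c by simp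
  then have "lipc d F (\<gamma> t) < C" using False
   unfolding C_def by simp
  then have "\<forall>\<^sub>F y in at (\<gamma> t). ennreal (\<bar>F y - F (\<gamma> t)\<bar> / d y (\<gamma> t)) < C"
   unfolding lipc_def by (rule Limsup_lessD)
  then obtain \<eta> where \<eta>: "\<eta> > 0" "\<And>y. y \<noteq> \<gamma> t \<Longrightarrow> dist y (\<gamma> t) < \<eta> \<Longrightarrow> ennreal (\<bar>F y - F (\<gamma> t)\<bar> / d y (\<gamma> t)) < C"
   unfolding eventually_at by auto
  have "\<forall>\<^sub>F n in sequentially. c * (invS n) < s * \<eta>"
  proof -
   have "(\<lambda>n. c * (invS n)) ----> c * 0"
    by (intro tendsto_intros inverse_Suc_tendsto)
   then show ?thesis using s_pos \<eta>(1) by (intro order_tendstoD) auto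
  qed
  then have "\<forall>\<^sub>F n in sequentially. ennreal (\<bar>F (\<gamma> (t + 1 / Suc n)) - F (\<gamma> t)\<bar> * Suc n) \<le> ennreal c * C"
  proof eventually_elim
   case (elim n)
   define y where "y = \<gamma> (t + 1 / Suc n)"
   have dy: "d y (\<gamma> t) \<le> c * (1 / Suc n)" using \<gamma>[of "t + 1 / Suc n" t] by (simp add: y_def)
   show ?case
   proof (cases "y = \<gamma> t")
    case True then show ?thesis by (simp add: y_def)
   next
    case False
    have "s * dist y (\<gamma> t) < s * \<eta>" using d_lower[of y "\<gamma> t"] dy elim by (simp add: dist_norm)
    then have lt: "ennreal (\<bar>F y - F (\<gamma> t)\<bar> / d y (\<gamma> t)) < C" using \<eta>(2)[OF False] s_pos by simp
    have dp: "d y (\<gamma> t) > 0" using False by (rule d_pos)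
    have "\<bar>F y - F (\<gamma> t)\<bar> * Suc n = (d y (\<gamma> t) * Suc n) * (\<bar>F y - F (\<gamma> t)\<bar> / d y (\<gamma> t))"
     using dp by simp
    also have "\<dots> \<le> c * (\<bar>F y - F (\<gamma> t)\<bar> / d y (\<gamma> t))"
     using dy dp by (intro mult_right_mono) (auto simp: field_simps)
    finally have "ennreal (\<bar>F y - F (\<gamma> t)\<bar> * Suc n) \<le> ennreal c * ennreal (\<bar>F y - F (\<gamma> t)\<bar> / d y (\<gamma> t))"
     using c by (subst ennreal_mult[symmetric]) (auto simp: d_nonneg intro: ennreal_leI)
    also have "\<dots> \<le> ennreal c * C" using lt by (intro mult_left_mono) auto
    finally show ?thesis by (simp add: y_def)
   qed
  qed
  then have "limsup (\<lambda>n. ennreal (\<bar>F (\<gamma> (t + 1 / Suc n)) - F (\<gamma> t)\<bar> * Suc n)) \<le> ennreal c * C"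
   by (rule Limsup_bounded)
  also have "\<dots> = ennreal c * lipc d F (\<gamma> t) + ennreal (c * (e / (c + 1)))"
   using c e ennreal_mult[of c "e / (c + 1)"] by (simp add: C_def distrib_left)
  also have "c * (e / (c + 1)) \<le> e" using c e by (simp add: field_simps)
  then have "ennreal c * lipc d F (\<gamma> t) + ennreal (c * (e / (c + 1))) \<le> ennreal c * lipc d F (\<gamma> t) + ennreal e"
   by (intro add_left_mono ennreal_leI)
  finally show "limsup (\<lambda>n. ennreal (\<bar>F (\<gamma> (t + 1 / Suc n)) - F (\<gamma> t)\<bar> * Suc n)) \<le> ennreal c * lipc d F (\<gamma> t) + ennreal e" .
 qed
qed

text \<open>In other words, the slope is an upper gradient along Lipschitz curves.\<close>

lemma difference_le_lipc:
 fixes F :: "complex \<Rightarrow> real"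
 assumes F: "\<And>x y. \<bar>F x - F y\<bar> \<le> L * norm (x - y)"
  and \<gamma>: "\<And>s t. d (\<gamma> s) (\<gamma> t) \<le> c * \<bar>s - t\<bar>" and c: "c \<ge> 0" and ab: "a \<le> b"
 shows "ennreal \<bar>F (\<gamma> b) - F (\<gamma> a)\<bar> \<le> (\<integral>\<^sup>+t\<in>{a..b}. ennreal c * lipc d F (\<gamma> t) \<partial>lborel)"
proof (rule Lipschitz_difference_le_nn_integral[where h = "\<lambda>t. F (\<gamma> t)" and L = "L / s * c"])
 have L0: "0 \<le> L" using order_trans[OF abs_ge_zero F[of 1 0]] by simp
 show "\<bar>F (\<gamma> u) - F (\<gamma> t)\<bar> \<le> L / s * c * \<bar>u - t\<bar>" for u t
 proof -
  have "\<bar>F (\<gamma> u) - F (\<gamma> t)\<bar> \<le> L * norm (\<gamma> u - \<gamma> t)" by (rule F)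
  also have "\<dots> = L / s * (s * norm (\<gamma> u - \<gamma> t))" using s_pos by simp
  also have "\<dots> \<le> L / s * (c * \<bar>u - t\<bar>)"
   using L0 s_pos by (intro mult_left_mono order_trans[OF d_lower \<gamma>]) auto
  finally show ?thesis by simp
 qed
qed (use ab lipc_along_curve[OF \<gamma> c] in auto)

text \<open>A one-parameter group of measure preserving maps of constant speed turns a bound on the
 slope into a bound on difference quotients in L2, stable under passage to the limit.\<close>

lemma flow_difference_le:
 fixes F :: "complex \<Rightarrow> real" and \<phi> :: "real \<Rightarrow> complex \<Rightarrow> complex" and \<kappa> :: "complex \<Rightarrow> real" and t L :: real
 assumes F: "\<And>x y. \<bar>F x - F y\<bar> \<le> L * norm (x - y)"
  and \<phi>_meas [measurable]: "(\<lambda>p. \<phi> (fst p) (snd p)) \<in> borel_measurable (borel \<Otimes>\<^sub>M borel)"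
  and \<phi>_pres: "\<And>(f :: complex \<Rightarrow> ennreal) u. f \<in> borel_measurable borel \<Longrightarrow> (NN z. f (\<phi> u z)) = (NN z. f z)"
  and \<phi>_0: "\<And>z. \<phi> 0 z = z"
  and \<kappa> [measurable]: "\<kappa> \<in> borel_measurable borel" and \<kappa>_nonneg: "\<And>z. \<kappa> z \<ge> 0"
  and speed: "\<And>z u v. \<kappa> z * d (\<phi> u z) (\<phi> v z) \<le> \<bar>u - v\<bar>"
  and inv: "\<And>z u. \<kappa> (\<phi> u z) = \<kappa> z" and t: "t > 0"
 shows "(NN z. ennreal ((\<kappa> z * (F (\<phi> t z) - F z))^2))
  \<le> ennreal (t^2) * (NN (z::complex). (if \<kappa> z = 0 then 0 else (lipc d F z)^2))"
proof -
 have cF: "continuous_on UNIV F" by (rule Lipschitz_continuous[OF F])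
 have [measurable]: "lipc d F \<in> borel_measurable borel" by (rule lipc_measurable[OF cF])
 have [measurable]: "F \<in> borel_measurable borel" by (rule borel_measurable_continuous_onI[OF cF])
 have [measurable]: "(\<lambda>(z, s). \<phi> s z) \<in> borel \<Otimes>\<^sub>M borel \<rightarrow>\<^sub>M borel"
 proof -
  show ?thesis
   using measurable_compose[OF _ \<phi>_meas, of "\<lambda>p. (snd p, fst p)" "borel \<Otimes>\<^sub>M borel"] by simp
 qed
 have [measurable]: "(\<lambda>s. \<phi> s z) \<in> borel_measurable borel" for z
  using measurable_compose[OF _ \<phi>_meas, of "\<lambda>s. (s, z)" borel] by simp
 have [measurable]: "\<phi> s \<in> borel_measurable borel" for s
  using measurable_compose[OF _ \<phi>_meas, of "\<lambda>z. (s, z)" borel] by simp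
 \<comment> \<open>\<kappa> is the reciprocal of a bound on the speed of a flow line and is constant
   along it. Where it vanishes the speed is not controlled, and both sides of the pointwise estimate
   are 0.\<close>
 define l where "l = (\<lambda>z. if \<kappa> z = 0 then 0 else lipc d F z)"
 have lm[measurable]: "l \<in> borel_measurable borel" unfolding l_def by simp
 have pt: "ennreal ((\<kappa> z * (F (\<phi> t z) - F z))^2) \<le> ennreal t * (\<integral>\<^sup>+s\<in>{0..t}. (l (\<phi> s z))^2 \<partial>lborel)" for z
 proof (cases "\<kappa> z = 0")
  case False
  then have \<kappa>: "\<kappa> z > 0" using \<kappa>_nonneg[of z] by simp
  have "ennreal \<bar>F (\<phi> t z) - F (\<phi> 0 z)\<bar> \<le> (\<integral>\<^sup>+s\<in>{0..t}. ennreal (1 / \<kappa> z) * lipc d F (\<phi> s z) \<partial>lborel)"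
  proof (rule difference_le_lipc[OF F, where \<gamma> = "\<lambda>s. \<phi> s z"])
   show "d (\<phi> u z) (\<phi> v z) \<le> 1 / \<kappa> z * \<bar>u - v\<bar>" for u v
    using speed[of z u v] \<kappa> by (simp add: field_simps)
  qed (use t \<kappa> in auto)
  also have "\<dots> = ennreal (1 / \<kappa> z) * (NN s. l (\<phi> s z) * indicator {0..t} s)"
   using False by (subst nn_integral_cmult[symmetric]) (auto simp: l_def inv mult.assoc)
  finally have "ennreal (\<kappa> z) * ennreal \<bar>F (\<phi> t z) - F z\<bar>
    \<le> ennreal (\<kappa> z) * (ennreal (1 / \<kappa> z) * (NN s. l (\<phi> s z) * indicator {0..t} s))"
   by (intro mult_left_mono) (auto simp: \<phi>_0)
  also have "\<dots> = (NN s. l (\<phi> s z) * indicator {0..t} s)"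
   using \<kappa> by (simp add: mult.assoc[symmetric] ennreal_mult[symmetric])
  finally have le: "ennreal \<bar>\<kappa> z * (F (\<phi> t z) - F z)\<bar> \<le> (NN s. l (\<phi> s z) * indicator {0..t} s)"
   using \<kappa> by (simp add: abs_mult ennreal_mult[symmetric])
  have "ennreal ((\<kappa> z * (F (\<phi> t z) - F z))^2) = (ennreal \<bar>\<kappa> z * (F (\<phi> t z) - F z)\<bar>)^2"
   by (simp add: ennreal_power)
  also have "\<dots> \<le> (NN s. (l (\<phi> s z) * indicator {0..t} s) * indicator {0..t} s)^2"
   using le by (intro power_mono) (auto simp: mult.assoc indicator_inter_arith[symmetric])
  also have "\<dots> \<le> (NN s. (l (\<phi> s z) * indicator {0..t} s)^2) * (NN s. (indicator {0..t} s)^2)"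
   by (rule Cauchy_Schwarz_nn_integral) measurable
  also have "(NN s. (indicator {0..t} s)^2) = ennreal t"
   using t by (simp add: power2_eq_square indicator_inter_arith[symmetric])
  also have "(NN s. (l (\<phi> s z) * indicator {0..t} s)^2) = (\<integral>\<^sup>+s\<in>{0..t}. (l (\<phi> s z))^2 \<partial>lborel)"
   by (intro nn_integral_cong) (auto split: split_indicator)
  finally show ?thesis by (simp add: mult.commute)
 qed simp
 have "(NN z. ennreal ((\<kappa> z * (F (\<phi> t z) - F z))^2))
   \<le> (NN z. ennreal t * (\<integral>\<^sup>+s\<in>{0..t}. (l (\<phi> s z))^2 \<partial>lborel))"
  by (intro nn_integral_mono pt)
 also have "\<dots> = ennreal t * (NN z. (\<integral>\<^sup>+s\<in>{0..t}. (l (\<phi> s z))^2 \<partial>lborel))"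
  by (rule nn_integral_cmult) measurable
 \<comment> \<open>After Fubini's theorem the inner integral does not depend on time, because each
   map of the flow preserves Lebesgue measure.\<close>
 also have "(NN z. (\<integral>\<^sup>+s\<in>{0..t}. (l (\<phi> s z))^2 \<partial>lborel))
   = (NN s. NN z. (l (\<phi> s z))^2 * indicator {0..t} s)"
  by (rule lborel_pair.Fubini') measurable
 also have "\<dots> = (\<integral>\<^sup>+s\<in>{0..t}. (NN z. (l z)^2) \<partial>lborel)"
 proof (rule nn_integral_cong)
  fix s
  have "(NN z. (l (\<phi> s z))^2 * indicator {0..t} s) = (NN z. (l (\<phi> s z))^2) * indicator {0..t} s"
   by (rule nn_integral_multc) measurable
  also have "(NN z. (l (\<phi> s z))^2) = (NN z. (l z)^2)"
   by (rule \<phi>_pres[of "\<lambda>z. (l z)^2"]) measurable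
  finally show "(NN z. (l (\<phi> s z))^2 * indicator {0..t} s) = (NN z. (l z)^2) * indicator {0..t} s" .
 qed
 also have "\<dots> = (NN z. (l z)^2) * ennreal t"
  using t by (simp add: nn_integral_cmult)
 finally show ?thesis using t
  by (simp add: power2_eq_square ennreal_mult l_def if_distrib[of "\<lambda>x. x * x"] if_distribR ac_simps cong: if_cong)
qed

end

text \<open>This and the next definitions are the notions behind \<open>H12\<close> and
  \<open>H12_norm\<close>, moved to the complex plane; \<open>slope_energy_X\<close>,
  \<open>H12_X\<close> and \<open>H12_norm_X\<close> justify the move.\<close>

definition energy :: "(complex \<Rightarrow> complex \<Rightarrow> real) \<Rightarrow> (complex \<Rightarrow> real) \<Rightarrow> (complex \<Rightarrow> real) \<Rightarrow> ennreal" where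
 "energy d \<rho> F = (NN z. (lipc d F z)^2 * ennreal (\<rho> z))"

definition Lipbs_approx :: "(complex \<Rightarrow> real) \<Rightarrow> (complex \<Rightarrow> real) \<Rightarrow> (nat \<Rightarrow> complex \<Rightarrow> real) \<Rightarrow> bool" where
 "Lipbs_approx \<rho> f F \<longleftrightarrow> (\<forall>n. F n \<in> Lipbs) \<and>
  (\<lambda>n. L2_sqnorm (density lborel (\<lambda>z. ennreal (\<rho> z))) (\<lambda>z. F n z - f z)) ----> 0"

definition Cheeger :: "(complex \<Rightarrow> complex \<Rightarrow> real) \<Rightarrow> (complex \<Rightarrow> real) \<Rightarrow> (complex \<Rightarrow> real) \<Rightarrow> ennreal" where
 "Cheeger d \<rho> f = (INF F\<in>{F. Lipbs_approx \<rho> f F}. liminf (\<lambda>n. energy d \<rho> (F n)))"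

definition Sob :: "(complex \<Rightarrow> complex \<Rightarrow> real) \<Rightarrow> (complex \<Rightarrow> real) \<Rightarrow> (complex \<Rightarrow> real) set" where
 "Sob d \<rho> = {f \<in> L2 (density lborel (\<lambda>z. ennreal (\<rho> z))).
  \<exists>F. Lipbs_approx \<rho> f F \<and> (SUP n. energy d \<rho> (F n)) < \<infinity>}"

definition Sob_norm :: "(complex \<Rightarrow> complex \<Rightarrow> real) \<Rightarrow> (complex \<Rightarrow> real) \<Rightarrow> (complex \<Rightarrow> real) \<Rightarrow> real" where
 "Sob_norm d \<rho> f = sqrt (enn2real (L2_sqnorm (density lborel (\<lambda>z. ennreal (\<rho> z))) f + Cheeger d \<rho> f))"

context planar
begin

section \<open>Transport of the Sobolev space to the complex plane\<close>

lemma Lip_bs_X: "f \<in> Lip_bs X \<longleftrightarrow> (\<lambda>z. f (iota z)) \<in> Lipbs"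
proof -
 have all: "(\<forall>x\<in>plane. P x) \<longleftrightarrow> (\<forall>z. P (iota z))" for P
  by (metis iota_kappa iota_plane)
 have "Lipschitz_continuous_map X euclidean_metric f \<longleftrightarrow> (\<exists>L. \<forall>x y. \<bar>f (iota x) - f (iota y)\<bar> \<le> L * d x y)"
  by (simp add: Lipschitz_continuous_map_def all dist_real_def)
 also have "\<dots> \<longleftrightarrow> (\<exists>L. \<forall>x y. \<bar>f (iota x) - f (iota y)\<bar> \<le> L * norm (x - y))"
 proof
  assume "\<exists>L. \<forall>x y. \<bar>f (iota x) - f (iota y)\<bar> \<le> L * d x y"
  then obtain L where L: "\<And>x y. \<bar>f (iota x) - f (iota y)\<bar> \<le> L * d x y" by auto
  have "0 \<le> L * d 1 0" by (rule order_trans[OF abs_ge_zero L])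
  then have "0 \<le> L" using d_pos[of 1 0] by (simp add: zero_le_mult_iff)
  then have "\<bar>f (iota x) - f (iota y)\<bar> \<le> L * W * norm (x - y)" for x y
   using L[of x y] mult_left_mono[OF d_upper[of x y], of L] by simp
  then show "\<exists>L. \<forall>x y. \<bar>f (iota x) - f (iota y)\<bar> \<le> L * norm (x - y)" by auto
 next
  assume "\<exists>L. \<forall>x y. \<bar>f (iota x) - f (iota y)\<bar> \<le> L * norm (x - y)"
  then obtain L where L: "\<And>x y. \<bar>f (iota x) - f (iota y)\<bar> \<le> L * norm (x - y)" by auto
  have L0: "0 \<le> L" using order_trans[OF abs_ge_zero L[of 1 0]] by simp
  have "\<bar>f (iota x) - f (iota y)\<bar> \<le> L / s * d x y" for x y
  proof -
   have "\<bar>f (iota x) - f (iota y)\<bar> \<le> L / s * (s * norm (x - y))" using L[of x y] s_pos by simp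
   also have "\<dots> \<le> L / s * d x y" using L0 s_pos by (intro mult_left_mono d_lower) auto
   finally show ?thesis .
  qed
  then show "\<exists>L. \<forall>x y. \<bar>f (iota x) - f (iota y)\<bar> \<le> L * d x y" by blast
 qed
 finally have 1: "Lipschitz_continuous_map X euclidean_metric f \<longleftrightarrow> (\<exists>L. \<forall>x y. \<bar>f (iota x) - f (iota y)\<bar> \<le> L * norm (x - y))" .
 have Msp: "Metric_space plane (mdist X)" using Metric_space_mspace_mdist[of X] by simp
 have "bounded_support X f \<longleftrightarrow> (\<exists>c B. \<forall>z. f (iota z) \<noteq> 0 \<longrightarrow> d c z \<le> B)"
 proof -
  have "bounded_support X f \<longleftrightarrow> (\<exists>c B. {x \<in> plane. f x \<noteq> 0} \<subseteq> Metric_space.mcball plane (mdist X) (iota c) B)"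
   unfolding bounded_support_def mspace_X Metric_space.mbounded_def[OF Msp]
  proof (intro iffI; elim exE)
   fix x B assume *: "{x \<in> plane. f x \<noteq> 0} \<subseteq> Metric_space.mcball plane (mdist X) x B"
   show "\<exists>c B. {x \<in> plane. f x \<noteq> 0} \<subseteq> Metric_space.mcball plane (mdist X) (iota c) B"
   proof (cases "x \<in> plane")
    case True
    then show ?thesis using * by (metis iota_kappa)
   next
    \<comment> \<open>A centre outside the carrier has an empty closed ball.\<close>
    case False
    then have "{x \<in> plane. f x \<noteq> 0} = {}" using * Metric_space.in_mcball[OF Msp] by auto
    then show ?thesis by auto
   qed
  qed blast
  also have "\<dots> \<longleftrightarrow> (\<exists>c B. \<forall>z. f (iota z) \<noteq> 0 \<longrightarrow> d c z \<le> B)"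
  proof -
   have "({x \<in> plane. f x \<noteq> 0} \<subseteq> Metric_space.mcball plane (mdist X) (iota c) B) \<longleftrightarrow>
     (\<forall>x\<in>plane. f x \<noteq> 0 \<longrightarrow> d c (kappa x) \<le> B)" for c B
    unfolding subset_iff Metric_space.in_mcball[OF Msp] by auto
   then show ?thesis by (simp only: all kappa_iota)
  qed
  finally show ?thesis .
 qed
 also have "\<dots> \<longleftrightarrow> (\<exists>R. \<forall>z. f (iota z) \<noteq> 0 \<longrightarrow> norm z \<le> R)"
 proof (intro iffI; elim exE)
  fix c B assume *: "\<forall>z. f (iota z) \<noteq> 0 \<longrightarrow> d c z \<le> B"
  have "norm z \<le> norm c + B / s" if "f (iota z) \<noteq> 0" for z
  proof -
   have "s * norm (c - z) \<le> B" using order_trans[OF d_lower] * that by simp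
   then have "norm (c - z) \<le> B / s" using s_pos by (simp add: field_simps)
   then show ?thesis using norm_triangle_ineq2[of z c] by (simp add: norm_minus_commute)
  qed
  then show "\<exists>R. \<forall>z. f (iota z) \<noteq> 0 \<longrightarrow> norm z \<le> R" by auto
 next
  fix R assume *: "\<forall>z. f (iota z) \<noteq> 0 \<longrightarrow> norm z \<le> R"
  have "d 0 z \<le> W * R" if "f (iota z) \<noteq> 0" for z
  proof -
   have "W * norm z \<le> W * R" using * that W_pos by simp
   then show ?thesis using d_upper[of 0 z] by simp
  qed
  then show "\<exists>c B. \<forall>z. f (iota z) \<noteq> 0 \<longrightarrow> d c z \<le> B" by auto
 qed
 finally show ?thesis using 1 by (simp add: Lip_bs_def Lipbs_def)
qed

lemma Lipbs_lipc_measurable: "F \<in> Lipbs \<Longrightarrow> lipc d F \<in> borel_measurable borel"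
 unfolding Lipbs_def using Lipschitz_continuous lipc_measurable by auto

lemma slope_energy_X: "(\<lambda>z. f (iota z)) \<in> Lipbs \<Longrightarrow> slope_energy X m f = energy d \<rho> (\<lambda>z. f (iota z))"
proof -
 assume f: "(\<lambda>z. f (iota z)) \<in> Lipbs"
 have "(\<lambda>x. (slope X f x)^2) \<in> borel_measurable m"
  unfolding measurable_m_iff comp_def slope_X using Lipbs_lipc_measurable[OF f] by simp
 then show ?thesis
  by (simp add: slope_energy_def energy_def nn_integral_m slope_X)
qed

lemma L2_sqnorm_X:
 assumes "f \<in> borel_measurable m"
 shows "L2_sqnorm m f = L2_sqnorm M (\<lambda>z. f (iota z))"
proof -
 have [measurable]: "(\<lambda>z. f (iota z)) \<in> borel_measurable borel" using assms by simp
 have "(\<lambda>x. ennreal ((f x)^2)) \<in> borel_measurable m" using assms by simp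
 then show ?thesis
  by (simp add: L2_sqnorm_def nn_integral_m nn_integral_density mult.commute)
qed

lemma L2_X: "f \<in> L2 m \<longleftrightarrow> (\<lambda>z. f (iota z)) \<in> L2 M"
 using L2_sqnorm_X by (auto simp: L2_def measurable_m_iff comp_def)

lemma approximating_X:
 assumes f: "f \<in> borel_measurable m"
 shows "approximating X m f F \<longleftrightarrow> Lipbs_approx \<rho> (\<lambda>z. f (iota z)) (\<lambda>n z. F n (iota z))"
proof -
 have "L2_sqnorm m (\<lambda>x. F n x - f x) = L2_sqnorm M (\<lambda>z. F n (iota z) - f (iota z))"
  if "(\<lambda>z. F n (iota z)) \<in> Lipbs" for n
 proof -
  have "F n \<in> borel_measurable m" using Lipbs_borel[OF that] by (simp add: measurable_m_iff comp_def)
  then have "(\<lambda>x. F n x - f x) \<in> borel_measurable m" using f by simp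
  then show ?thesis by (rule L2_sqnorm_X)
 qed
 then show ?thesis
  unfolding approximating_def Lipbs_approx_def Lip_bs_X by auto
qed

lemma H12_X: "f \<in> H12 X m \<longleftrightarrow> (\<lambda>z. f (iota z)) \<in> Sob d \<rho>"
proof (cases "f \<in> borel_measurable m")
 case True
 have 1: "(SUP n. slope_energy X m (F n)) = (SUP n. energy d \<rho> (\<lambda>z. F n (iota z)))" if "approximating X m f F" for F
  using that by (intro SUP_cong refl slope_energy_X) (auto simp: approximating_def Lip_bs_X)
 show ?thesis
 proof
  assume "f \<in> H12 X m"
  then show "(\<lambda>z. f (iota z)) \<in> Sob d \<rho>"
   using 1 approximating_X[OF True] unfolding H12_def Sob_def L2_X by auto
 next
  assume "(\<lambda>z. f (iota z)) \<in> Sob d \<rho>"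
  then obtain G where G: "f \<in> L2 m" "Lipbs_approx \<rho> (\<lambda>z. f (iota z)) G" "(SUP n. energy d \<rho> (G n)) < \<infinity>"
   unfolding Sob_def L2_X by auto
  define F where "F = (\<lambda>n x. G n (kappa x))"
  have "approximating X m f F" using G(2) by (simp add: approximating_X[OF True] F_def)
  moreover have "(SUP n. slope_energy X m (F n)) < \<infinity>" using 1[OF calculation] G(3) by (simp add: F_def)
  ultimately show "f \<in> H12 X m" using G(1) unfolding H12_def by auto
 qed
next
 case False
 then have "(\<lambda>z. f (iota z)) \<notin> borel_measurable M" by (simp add: measurable_m_iff comp_def)
 with False show ?thesis by (simp add: H12_def Sob_def L2_def)
qed

lemma H12_norm_X:
 assumes f: "f \<in> borel_measurable m"
 shows "H12_norm X m f = Sob_norm d \<rho> (\<lambda>z. f (iota z))"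
proof -
 have "(INF F\<in>{F. approximating X m f F}. liminf (\<lambda>n. slope_energy X m (F n))) = Cheeger d \<rho> (\<lambda>z. f (iota z))"
  unfolding Cheeger_def
 proof (rule INF_eq)
  fix F assume "F \<in> {F. approximating X m f F}"
  then have F: "approximating X m f F" by simp
  then have "slope_energy X m (F n) = energy d \<rho> (\<lambda>z. F n (iota z))" for n
   by (intro slope_energy_X) (auto simp: approximating_def Lip_bs_X)
  then show "\<exists>G\<in>{G. Lipbs_approx \<rho> (\<lambda>z. f (iota z)) G}. liminf (\<lambda>n. energy d \<rho> (G n)) \<le> liminf (\<lambda>n. slope_energy X m (F n))"
   using F by (intro bexI[of _ "\<lambda>n z. F n (iota z)"]) (auto simp: approximating_X[OF f])
 next
  fix G assume G: "G \<in> {G. Lipbs_approx \<rho> (\<lambda>z. f (iota z)) G}"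
  define F where "F = (\<lambda>n x. G n (kappa x))"
  have F: "approximating X m f F" using G by (simp add: approximating_X[OF f] F_def)
  then have "slope_energy X m (F n) = energy d \<rho> (\<lambda>z. F n (iota z))" for n
   by (intro slope_energy_X) (auto simp: approximating_def Lip_bs_X)
  then show "\<exists>F\<in>{F. approximating X m f F}. liminf (\<lambda>n. slope_energy X m (F n)) \<le> liminf (\<lambda>n. energy d \<rho> (G n))"
   using F by (intro bexI[of _ F]) (auto simp: F_def)
 qed
 then show ?thesis by (simp add: H12_norm_def Sob_norm_def L2_sqnorm_X[OF f])
qed

lemma H12_borel: "f \<in> H12 X m \<Longrightarrow> f \<in> borel_measurable m"
 by (simp add: H12_def L2_def)

text \<open>The bilinear form is pulled back along \<open>iota\<close>, and a limit found in the
  plane is pulled back along \<open>kappa\<close>.\<close>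

lemma infinitesimally_Hilbertian_if:
 assumes "Hilbert_space_on (Sob d \<rho>) (Sob_norm d \<rho>)"
  and diff: "\<And>f g. f \<in> Sob d \<rho> \<Longrightarrow> g \<in> Sob d \<rho> \<Longrightarrow> (\<lambda>z. f z - g z) \<in> Sob d \<rho>"
 shows "infinitesimally_Hilbertian X m"
proof -
 let ?H = "Sob d \<rho>" and ?N = "Sob_norm d \<rho>"
 obtain B where B:
  "\<forall>f\<in>?H. \<forall>g\<in>?H. B f g = B g f"
  "\<forall>f\<in>?H. \<forall>g\<in>?H. \<forall>h\<in>?H. B (\<lambda>x. f x + g x) h = B f h + B g h"
  "\<forall>c. \<forall>f\<in>?H. \<forall>g\<in>?H. B (\<lambda>x. c * f x) g = c * B f g"
  "\<forall>f\<in>?H. B f f = (?N f)^2"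
  using assms(1) unfolding Hilbert_space_on_def by auto
 have comp: "\<exists>f\<in>?H. (\<lambda>n. ?N (\<lambda>x. F n x - f x)) ----> 0"
  if "\<And>n::nat. F n \<in> ?H" "\<forall>e>0. \<exists>K. \<forall>i\<ge>K. \<forall>j\<ge>K. ?N (\<lambda>x. F i x - F j x) < e" for F :: "nat \<Rightarrow> complex \<Rightarrow> real"
  using assms(1) that unfolding Hilbert_space_on_def by simp
 show ?thesis
  unfolding infinitesimally_Hilbertian_def Hilbert_space_on_def
 proof (intro conjI exI[of _ "\<lambda>f g. B (\<lambda>z. f (iota z)) (\<lambda>z. g (iota z))"] allI impI)
  show "\<forall>f\<in>H12 X m. B (\<lambda>z. f (iota z)) (\<lambda>z. f (iota z)) = (H12_norm X m f)^2"
   using B(4) H12_norm_X[OF H12_borel] by (auto simp: H12_X)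
  fix F :: "nat \<Rightarrow> (nat \<Rightarrow> real) \<Rightarrow> real"
  assume F: "(\<forall>n. F n \<in> H12 X m) \<and> (\<forall>e>0. \<exists>K. \<forall>i\<ge>K. \<forall>j\<ge>K. H12_norm X m (\<lambda>x. F i x - F j x) < e)"
  have bm: "(\<lambda>x. F i x - g x) \<in> borel_measurable m" if "g \<in> borel_measurable m" for i g
   using F H12_borel that by simp
  have "\<exists>f\<in>?H. (\<lambda>n. ?N (\<lambda>x. F n (iota x) - f x)) ----> 0"
   by (rule comp) (use F H12_norm_X[OF bm[OF H12_borel]] in \<open>auto simp: H12_X\<close>)
  then obtain f where f: "f \<in> ?H" "(\<lambda>n. ?N (\<lambda>x. F n (iota x) - f x)) ----> 0" by auto
  have "f \<in> borel_measurable borel" using f by (simp add: Sob_def L2_def)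
  then have fm: "(\<lambda>x. f (kappa x)) \<in> borel_measurable m" by simp
  show "\<exists>f\<in>H12 X m. (\<lambda>n. H12_norm X m (\<lambda>x. F n x - f x)) ----> 0"
   using f H12_norm_X[OF bm[OF fm]] by (intro bexI[of _ "\<lambda>x. f (kappa x)"]) (auto simp: H12_X)
 qed (use B in \<open>auto simp: H12_X\<close>)
qed

lemma infinitesimally_Hilbertian_parallelogram:
 assumes "infinitesimally_Hilbertian X m"
  and f: "f \<in> Sob d \<rho>" and g: "g \<in> Sob d \<rho>"
  and p: "(\<lambda>z. f z + g z) \<in> Sob d \<rho>" and q: "(\<lambda>z. f z - g z) \<in> Sob d \<rho>" and g': "(\<lambda>z. - g z) \<in> Sob d \<rho>"
 shows "(Sob_norm d \<rho> (\<lambda>z. f z + g z))^2 + (Sob_norm d \<rho> (\<lambda>z. f z - g z))^2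
  = 2 * (Sob_norm d \<rho> f)^2 + 2 * (Sob_norm d \<rho> g)^2"
proof -
 let ?H = "H12 X m"
 let ?f = "\<lambda>x. f (kappa x)" and ?g = "\<lambda>x. g (kappa x)"
 from assms(1) obtain B where B:
  "\<forall>f\<in>?H. \<forall>g\<in>?H. B f g = B g f"
  "\<forall>f\<in>?H. \<forall>g\<in>?H. \<forall>h\<in>?H. B (\<lambda>x. f x + g x) h = B f h + B g h"
  "\<forall>c. \<forall>f\<in>?H. \<forall>g\<in>?H. B (\<lambda>x. c * f x) g = c * B f g"
  "\<forall>f\<in>?H. B f f = (H12_norm X m f)^2"
  unfolding infinitesimally_Hilbertian_def Hilbert_space_on_def by auto
 note B = B(1)[rule_format] B(2)[rule_format] B(3)[rule_format] B(4)[rule_format]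
 have N: "(Sob_norm d \<rho> u)^2 = B (\<lambda>x. u (kappa x)) (\<lambda>x. u (kappa x))" if "u \<in> Sob d \<rho>" for u
 proof -
  have "(\<lambda>x. u (kappa x)) \<in> ?H" using that by (simp add: H12_X)
  then show ?thesis using B(4) H12_norm_X[OF H12_borel] by simp
 qed
 \<comment> \<open>The negative of \<open>?g\<close> is written as a multiple, the form in which
   homogeneity of \<open>B\<close> is available.\<close>
 have in_H: "?f \<in> ?H" "?g \<in> ?H" "(\<lambda>x. ?f x + ?g x) \<in> ?H" "(\<lambda>x. ?f x + - 1 * ?g x) \<in> ?H" "(\<lambda>x. - 1 * ?g x) \<in> ?H"
  using f g p q g' by (auto simp: H12_X)
 have add: "B (\<lambda>x. u x + v x) (\<lambda>x. u x + v x) = B u u + 2 * B u v + B v v"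
  if "u \<in> ?H" "v \<in> ?H" "(\<lambda>x. u x + v x) \<in> ?H" for u v
  using B(2)[OF that(1,2,3)] B(1)[OF that(1,3)] B(1)[OF that(2,3)] B(2)[OF that(1,2,1)] B(2)[OF that(1,2,2)]
   B(1)[OF that(1,2)] by simp
 have neg: "B ?f (\<lambda>x. - 1 * ?g x) = - B ?f ?g"
  using B(1)[OF in_H(1,5)] B(3)[OF in_H(2,1), of "-1"] B(1)[OF in_H(1,2)] by simp
 have neg2: "B (\<lambda>x. - 1 * ?g x) (\<lambda>x. - 1 * ?g x) = B ?g ?g"
  using B(3)[OF in_H(2,5), of "-1"] B(1)[OF in_H(2,5)] B(3)[OF in_H(2,2), of "-1"] by simp
 show ?thesis
  using N[OF p] N[OF q] N[OF f] N[OF g] add[OF in_H(1,2,3)] add[OF in_H(1,5,4)] neg neg2 by simp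
qed

section \<open>The Poincare inequality\<close>

text \<open>Joining two points of a square by a horizontal and a vertical segment gives the Poincare
 inequality by Fubini's theorem, without any change of variables.\<close>

lemma square_double_integral:
 fixes F :: "complex \<Rightarrow> real" and a b l L :: real
 defines "Q \<equiv> {z. Re z \<in> {a..a+l} \<and> Im z \<in> {b..b+l}}"
 assumes F: "\<And>x y. \<bar>F x - F y\<bar> \<le> L * norm (x - y)" and l: "0 \<le> l"
 shows "(\<integral>\<^sup>+x\<in>Q. (\<integral>\<^sup>+y\<in>Q. ennreal \<bar>F x - F y\<bar> \<partial>lborel) \<partial>lborel)
  \<le> ennreal (2 * l^3 * W) * (\<integral>\<^sup>+z\<in>Q. lipc d F z \<partial>lborel)"
  and "emeasure lborel Q = ennreal (l^2)"
proof -
 have cF: "continuous_on UNIV F" by (rule Lipschitz_continuous[OF F])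
 have lm[measurable]: "lipc d F \<in> borel_measurable borel" by (rule lipc_measurable[OF cF])
 have [measurable]: "F \<in> borel_measurable borel" by (rule borel_measurable_continuous_onI[OF cF])
 have Qm[measurable]: "Q \<in> sets borel" unfolding Q_def by simp
 have [measurable]: "(\<lambda>p. Complex (fst p) (snd p)) \<in> borel \<Otimes>\<^sub>M borel \<rightarrow>\<^sub>M borel"
  "(\<lambda>p. Complex (snd p) (fst p)) \<in> borel \<Otimes>\<^sub>M borel \<rightarrow>\<^sub>M borel"
  unfolding Complex_eq by auto
 let ?I = "{a..a+l}" and ?J = "{b..b+l}"
 have indQ: "indicator Q (Complex x y) = (indicator ?I x * indicator ?J y :: ennreal)" for x y
  by (auto simp: Q_def split: split_indicator)
 define G where "G = (\<lambda>y. NN t. lipc d F (Complex t y) * indicator ?I t)"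
 define K where "K = (\<lambda>x. NN t. lipc d F (Complex x t) * indicator ?J t)"
 have Gm[measurable]: "G \<in> borel_measurable borel" unfolding G_def by simp
 have Km[measurable]: "K \<in> borel_measurable borel" unfolding K_def by simp
 have sp: "(\<integral>\<^sup>+z\<in>Q. h z \<partial>lborel) = (\<integral>\<^sup>+x\<in>?I. (\<integral>\<^sup>+y\<in>?J. h (Complex x y) \<partial>lborel) \<partial>lborel)"
  "(\<integral>\<^sup>+z\<in>Q. h z \<partial>lborel) = (\<integral>\<^sup>+y\<in>?J. (\<integral>\<^sup>+x\<in>?I. h (Complex x y) \<partial>lborel) \<partial>lborel)"
  if [measurable]: "h \<in> borel_measurable borel" for h
 proof -
  have [measurable]: "(\<lambda>(x, y). h (Complex x y)) \<in> borel_measurable (borel \<Otimes>\<^sub>M borel)"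
   by (simp add: split_beta')
  have [measurable]: "(\<lambda>y. h (Complex x y)) \<in> borel_measurable borel" "(\<lambda>y. h (Complex y x)) \<in> borel_measurable borel" for x
   unfolding Complex_eq by auto
  have *: "(\<integral>\<^sup>+z\<in>Q. h z \<partial>lborel) = (NN x. NN y. h (Complex x y) * (indicator ?I x * indicator ?J y))"
   by (subst nn_integral_lborel_complex) (auto simp: indQ)
  show "(\<integral>\<^sup>+z\<in>Q. h z \<partial>lborel) = (\<integral>\<^sup>+x\<in>?I. (\<integral>\<^sup>+y\<in>?J. h (Complex x y) \<partial>lborel) \<partial>lborel)"
   unfolding * by (auto intro!: nn_integral_cong simp: nn_integral_cmult[symmetric] mult_ac)
  show "(\<integral>\<^sup>+z\<in>Q. h z \<partial>lborel) = (\<integral>\<^sup>+y\<in>?J. (\<integral>\<^sup>+x\<in>?I. h (Complex x y) \<partial>lborel) \<partial>lborel)"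
   unfolding * by (subst lborel_pair.Fubini', measurable)
    (auto intro!: nn_integral_cong simp: nn_integral_cmult[symmetric] mult_ac)
 qed
 show QE: "emeasure lborel Q = ennreal (l^2)"
  using sp(1)[of "\<lambda>_. 1"] l by (simp add: nn_integral_cmult ennreal_mult power2_eq_square)
 define J where "J = (\<integral>\<^sup>+z\<in>Q. lipc d F z \<partial>lborel)"
 have J: "J = (\<integral>\<^sup>+y\<in>?J. G y \<partial>lborel)" "J = (\<integral>\<^sup>+x\<in>?I. K x \<partial>lborel)"
  unfolding G_def K_def J_def by (rule sp[OF lm])+
 \<comment> \<open>\<open>G (Im x)\<close> does not depend on \<open>Re x\<close>, so integration
   over the other side of the square costs a factor \<open>l\<close>.\<close>
 have J1: "(NN x. G (Im x) * indicator Q x) = ennreal l * J"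
  using sp(1)[of "\<lambda>z. G (Im z)"] l by (simp add: J(1) nn_integral_cmult_indicator mult.commute[of "ennreal l"])
 have J2: "(NN y. K (Re y) * indicator Q y) = ennreal l * J"
  using sp(2)[of "\<lambda>z. K (Re z)"] l by (simp add: J(2) nn_integral_cmult_indicator mult.commute[of "ennreal l"])
 have seg: "ennreal \<bar>F (\<gamma> v) - F (\<gamma> u)\<bar> \<le> ennreal W * (NN t. lipc d F (\<gamma> t) * indicator {p..q} t)"
  if \<gamma>: "\<And>s t. norm (\<gamma> s - \<gamma> t) = \<bar>s - t\<bar>" and uv: "u \<in> {p..q}" "v \<in> {p..q}" and \<gamma>m: "\<gamma> \<in> borel_measurable borel"
  for \<gamma> :: "real \<Rightarrow> complex" and u v p q
 proof -
  have sp: "d (\<gamma> s) (\<gamma> t) \<le> W * \<bar>s - t\<bar>" for s t using d_upper[of "\<gamma> s" "\<gamma> t"] by (simp add: \<gamma>)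
  have "ennreal \<bar>F (\<gamma> (max u v)) - F (\<gamma> (min u v))\<bar> \<le> (\<integral>\<^sup>+t\<in>{min u v..max u v}. ennreal W * lipc d F (\<gamma> t) \<partial>lborel)"
   by (rule difference_le_lipc[OF F sp]) (use W_pos in auto)
  also have "\<dots> \<le> (NN t. ennreal W * (lipc d F (\<gamma> t) * indicator {p..q} t))"
   using uv by (intro nn_integral_mono) (auto split: split_indicator)
  also have "\<dots> = ennreal W * (NN t. lipc d F (\<gamma> t) * indicator {p..q} t)"
  proof (rule nn_integral_cmult)
   note [measurable] = \<gamma>m
   show "(\<lambda>t. lipc d F (\<gamma> t) * indicator {p..q} t) \<in> borel_measurable lborel" by simp
  qed
  finally show ?thesis by (auto simp: max_def min_def abs_minus_commute split: if_splits)
 qed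
 \<comment> \<open>The corner of the connecting path has the imaginary part of \<open>x\<close> and
   the real part of \<open>y\<close>; its two segments are controlled by the line integrals
   \<open>G\<close> and \<open>K\<close>.\<close>
 have pt: "ennreal \<bar>F x - F y\<bar> \<le> ennreal W * G (Im x) + ennreal W * K (Re y)" if "x \<in> Q" "y \<in> Q" for x y
 proof -
  have "ennreal \<bar>F (Complex (Re x) (Im x)) - F (Complex (Re y) (Im x))\<bar> \<le> ennreal W * G (Im x)"
   using that unfolding G_def
   by (intro seg[where \<gamma> = "\<lambda>t. Complex t (Im x)"]) (auto simp: Q_def cmod_def Complex_eq)
  moreover have "ennreal \<bar>F (Complex (Re y) (Im x)) - F (Complex (Re y) (Im y))\<bar> \<le> ennreal W * K (Re y)"
   using that unfolding K_def
   by (intro seg[where \<gamma> = "\<lambda>t. Complex (Re y) t"]) (auto simp: Q_def cmod_def Complex_eq)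
  moreover have "ennreal \<bar>F x - F y\<bar> \<le> ennreal \<bar>F x - F (Complex (Re y) (Im x))\<bar> + ennreal \<bar>F (Complex (Re y) (Im x)) - F y\<bar>"
   by (subst ennreal_plus[symmetric], simp, simp, rule ennreal_leI, linarith)
  ultimately show ?thesis by (auto intro: order_trans[OF _ add_mono])
 qed
 have aff: "(NN z. A * (h z * indicator Q z) + B * indicator Q z)
   = A * (NN z. h z * indicator Q z) + B * ennreal (l^2)"
  if [measurable]: "h \<in> borel_measurable borel" for A B h
  by (simp add: nn_integral_add nn_integral_cmult QE)
 have [measurable]: "(\<lambda>x. G (Im x)) \<in> borel_measurable borel" "(\<lambda>x. K (Re x)) \<in> borel_measurable borel" by auto
 let ?W = "ennreal W" and ?l = "ennreal (l^2)"
 have inner: "(\<integral>\<^sup>+y\<in>Q. ennreal \<bar>F x - F y\<bar> \<partial>lborel) \<le> ?W * (ennreal l * J) + ?W * G (Im x) * ?l" if "x \<in> Q" for x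
  unfolding J2[symmetric] by (subst aff[symmetric])
   (use pt[OF that] in \<open>auto intro!: nn_integral_mono split: split_indicator simp: add.commute\<close>)
 have "(\<integral>\<^sup>+x\<in>Q. (\<integral>\<^sup>+y\<in>Q. ennreal \<bar>F x - F y\<bar> \<partial>lborel) \<partial>lborel)
   \<le> (NN x. ?W * ?l * (G (Im x) * indicator Q x) + ?W * (ennreal l * J) * indicator Q x)"
  using inner by (auto intro!: nn_integral_mono split: split_indicator simp: ac_simps)
 also have "\<dots> = ?W * ?l * ennreal l * J + ?W * ?l * ennreal l * J"
  by (subst aff) (simp_all add: J1 ac_simps)
 also have "\<dots> = 2 * (?W * ?l * ennreal l * J)" by (simp only: mult_2)
 also have "\<dots> = ennreal (2 * l^3 * W) * J"
  using l W_pos by (simp add: ennreal_mult power2_eq_square power3_eq_cube mult_ac)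
 finally show "(\<integral>\<^sup>+x\<in>Q. (\<integral>\<^sup>+y\<in>Q. ennreal \<bar>F x - F y\<bar> \<partial>lborel) \<partial>lborel)
  \<le> ennreal (2 * l^3 * W) * (\<integral>\<^sup>+z\<in>Q. lipc d F z \<partial>lborel)" unfolding J_def .
qed

end

text \<open>Taking the average outside the absolute value replaces the deviation from an average by
  a mean over pairs of points, to which \<open>square_double_integral\<close> applies.\<close>

lemma oscillation_le_double_integral:
 assumes A [measurable]: "A \<in> sets N" and fin: "emeasure N A < \<infinity>"
  and f [measurable]: "f \<in> borel_measurable N" and K: "\<And>x. \<bar>f x\<bar> \<le> K"
 shows "(\<integral>\<^sup>+x\<in>A. ennreal \<bar>f x - average N A f\<bar> \<partial>N) * emeasure N A
  \<le> (\<integral>\<^sup>+x\<in>A. (\<integral>\<^sup>+y\<in>A. ennreal \<bar>f x - f y\<bar> \<partial>N) \<partial>N)"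
proof -
 have em: "emeasure N A = ennreal (measure N A)" using fin by (simp add: emeasure_eq_ennreal_measure)
 have iA: "integrable N (\<lambda>y. indicator A y *\<^sub>R g y)" if "g \<in> borel_measurable N" "\<And>x. \<bar>g x\<bar> \<le> C" for g :: "_ \<Rightarrow> real" and C
 proof (rule Bochner_Integration.integrable_bound)
  show "integrable N (\<lambda>y. C * indicator A y)" using fin by simp
  show "AE x in N. norm (indicator A x *\<^sub>R g x) \<le> norm (C * indicator A x)"
   using order_trans[OF that(2) abs_ge_self] by (intro AE_I2) (auto split: split_indicator)
 qed (use that in measurable)
 have pt: "ennreal \<bar>f x - average N A f\<bar> * emeasure N A \<le> (\<integral>\<^sup>+y\<in>A. ennreal \<bar>f x - f y\<bar> \<partial>N)" for x
 proof (cases "measure N A = 0")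
  case False
  have "(LINT y|N. indicator A y *\<^sub>R (f x - f y)) = f x * measure N A - (LINT y:A|N. f y)"
  proof -
   have "(LINT y|N. indicator A y *\<^sub>R (f x - f y)) = (LINT y|N. f x * indicator A y - indicator A y *\<^sub>R f y)"
    by (simp add: algebra_simps)
   also have "\<dots> = (LINT y|N. f x * indicator A y) - (LINT y|N. indicator A y *\<^sub>R f y)"
    using fin K by (intro Bochner_Integration.integral_diff iA[of f K]) (auto simp: integrable_indicator_iff)
   finally show ?thesis using fin by (simp add: set_lebesgue_integral_def)
  qed
  also have "\<dots> = (f x - average N A f) * measure N A" using False by (simp add: average_def field_simps)
  finally have "ennreal \<bar>f x - average N A f\<bar> * emeasure N A = ennreal (norm (LINT y|N. indicator A y *\<^sub>R (f x - f y)))"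
   by (simp add: em abs_mult ennreal_mult)
  also have "\<dots> \<le> (\<integral>\<^sup>+y. ennreal (norm (indicator A y *\<^sub>R (f x - f y))) \<partial>N)"
  proof (rule integral_norm_bound_ennreal, rule iA[of _ "2 * K"])
   show "\<bar>f x - f y\<bar> \<le> 2 * K" for y using K[of x] K[of y] by simp
  qed measurable
  also have "\<dots> = (\<integral>\<^sup>+y\<in>A. ennreal \<bar>f x - f y\<bar> \<partial>N)"
   by (intro nn_integral_cong) (auto split: split_indicator)
  finally show ?thesis .
 qed (simp add: em)
 have "(\<integral>\<^sup>+x\<in>A. ennreal \<bar>f x - average N A f\<bar> \<partial>N) * emeasure N A
   = (\<integral>\<^sup>+x. (ennreal \<bar>f x - average N A f\<bar> * indicator A x) * emeasure N A \<partial>N)"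
  by (rule nn_integral_multc[symmetric]) measurable
 also have "\<dots> \<le> (\<integral>\<^sup>+x\<in>A. (\<integral>\<^sup>+y\<in>A. ennreal \<bar>f x - f y\<bar> \<partial>N) \<partial>N)"
  using pt by (intro nn_integral_mono) (auto split: split_indicator)
 finally show ?thesis .
qed

lemma ennreal_le_sqrtI:
 assumes "x^2 \<le> ennreal a" "a \<ge> 0" shows "x \<le> ennreal (sqrt a)"
proof (cases x)
 case (real r)
 then have "r^2 \<le> a" using assms by (simp add: ennreal_power)
 then have "r \<le> sqrt a" by (rule real_le_rsqrt)
 then show ?thesis using real by (simp add: ennreal_leI)
qed (use assms in \<open>auto simp: top_unique power2_eq_square ennreal_mult_top\<close>)

context planar
begin

lemma lipc_le_Lipschitz:
 assumes L: "\<And>x y. \<bar>F x - F y\<bar> \<le> L * norm (x - y)" "0 \<le> L"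
 shows "lipc d F z \<le> ennreal (L / s)"
proof (rule lipc_le)
 fix x y
 have "\<bar>F x - F y\<bar> \<le> L / s * (s * norm (x - y))" using L(1) s_pos by simp
 also have "\<dots> \<le> L / s * d x y" using L(2) s_pos by (intro mult_left_mono d_lower) auto
 finally show "\<bar>F x - F y\<bar> \<le> L / s * d x y" .
qed (use L s_pos in simp)

text \<open>A ball lies in a square and the square in a larger concentric ball, so the estimate for
  pairs of points of the square transfers to balls.\<close>

lemma Poincare_X: "weak_Poincare_1_2 X m"
proof -
 \<comment> \<open>The square \<open>Q\<close> below has half side r / s. Its points have Euclidean
   distance at most 2 * r / s from the centre, hence \<open>d\<close>-distance less than 3 * W * r /
   s; the 3 gives the strict inequality.\<close>
 define \<Lambda> where "\<Lambda> = 3 * W / s"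
 \<comment> \<open>Collected from the double integral over \<open>Q\<close>, the Cauchy--Schwarz
   inequality on \<open>Q\<close> and the bounds for the masses of the two balls.\<close>
 define C where "C = 2 * c2^2 * W * (2/s)^4 / sqrt c1 * (sqrt (c2 * pi) * \<Lambda> / s) / (c1 * pi / W^2)^2"
 have C: "C > 0" unfolding C_def \<Lambda>_def using s_pos W_pos c1_pos c2_pos by simp
 have \<Lambda>: "\<Lambda> \<ge> 1" using s_le_W s_pos by (simp add: \<Lambda>_def field_simps)
 have main: "nn_average m (mball_of X x r) (\<lambda>y. ennreal \<bar>f y - average m (mball_of X x r) f\<bar>)
    \<le> ennreal (C * r * sqrt (enn2real (nn_average m (mball_of X x (\<Lambda> * r)) (\<lambda>y. (slope X f y)^2))))"
  if f: "f \<in> Lip_bs X" and x: "x \<in> mspace X" and r: "r > 0" for f x r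
 proof -
  obtain z where z: "x = iota z" using x plane_cases by auto
  define F where "F = (\<lambda>z. f (iota z))"
  have FL: "F \<in> Lipbs" using f by (simp add: Lip_bs_X F_def)
  obtain L R where L: "L > 0" "\<And>x y. \<bar>F x - F y\<bar> \<le> L * norm (x - y)" and R: "\<And>x. norm x > R \<Longrightarrow> F x = 0" "R > 0"
   using Lipbs_obtain[OF FL] by metis
  have Fm[measurable]: "F \<in> borel_measurable borel" by (rule Lipbs_borel[OF FL])
  have fm[measurable]: "f \<in> borel_measurable m" using Fm by (simp add: measurable_m_iff comp_def F_def)
  have lm[measurable]: "lipc d F \<in> borel_measurable borel" by (rule Lipbs_lipc_measurable[OF FL])
  have slope_eq: "slope X f (iota z) = lipc d F z" for z by (simp add: slope_X F_def)
  have "compact (F ` cball 0 R)"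
   by (rule compact_continuous_image[OF continuous_on_subset[OF Lipschitz_continuous[OF L(2)]]]) auto
  then obtain b where b: "\<And>y. y \<in> F ` cball 0 R \<Longrightarrow> norm y \<le> b" using compact_imp_bounded bounded_iff by metis
  have F_bd: "\<bar>F x\<bar> \<le> max b 0" for x
   by (cases "norm x > R") (use R(1)[of x] b[of "F x"] in auto)
  \<comment> \<open>\<open>f\<close> is arbitrary off the carrier. \<open>g\<close> agrees with it
    on the carrier and is bounded everywhere, as \<open>oscillation_le_double_integral\<close>
    requires.\<close>
  define g where "g = (\<lambda>x. F (kappa x))"
  have f_g: "f x = g x" if "x \<in> plane" for x using that by (simp add: g_def F_def)
  define B where "B = {y. d z y < r}"
  define B' where "B' = {y. d z y < \<Lambda> * r}"
  let ?B = "iota ` B" and ?B' = "iota ` B'"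
  have Bm[measurable]: "B \<in> sets borel" "B' \<in> sets borel" unfolding B_def B'_def by auto
  have mB: "mball_of X x r = ?B" "mball_of X x (\<Lambda> * r) = ?B'"
   unfolding z B_def B'_def by (rule mball_X)+
  have iBm: "?B \<in> sets m" "?B' \<in> sets m" using Bm unfolding sets_m by auto+
  define \<mu> where "\<mu> = measure m (?B)"
  define \<mu>' where "\<mu>' = measure m (?B')"
  have fin: "emeasure m (?B) < \<infinity>" "emeasure m (?B') < \<infinity>"
   using metric_measure_space_X x unfolding metric_measure_space_def mB[symmetric] by auto+
  have em: "emeasure m (?B) = ennreal \<mu>" "emeasure m (?B') = ennreal \<mu>'"
   using fin by (simp_all add: \<mu>_def \<mu>'_def emeasure_eq_ennreal_measure)
  have \<mu>_lower: "c1 * pi / W^2 * r^2 \<le> \<mu>"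
  proof -
   have "ennreal (c1 * pi * (r / W)^2) \<le> ennreal \<mu>"
    using emeasure_mball_bounds(1)[of r z] r unfolding z[symmetric] mB em by simp
   then show ?thesis by (subst (asm) ennreal_le_iff) (auto simp: \<mu>_def power_divide)
  qed
  have \<mu>: "\<mu> > 0" using less_le_trans[OF _ \<mu>_lower] c1_pos W_pos r by simp
  have \<mu>'_upper: "\<mu>' \<le> c2 * pi * (\<Lambda> * r / s)^2"
  proof -
   have "ennreal \<mu>' \<le> ennreal (c2 * pi * (\<Lambda> * r / s)^2)"
    using emeasure_mball_bounds(2)[of "\<Lambda> * r" z] r \<Lambda> unfolding z[symmetric] mB em by simp
   then show ?thesis using c2_pos by simp
  qed
  have \<mu>': "\<mu>' > 0"
  proof -
   have "r \<le> \<Lambda> * r" using mult_right_mono[OF \<Lambda>, of r] r by simp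
   then have "B \<subseteq> B'" unfolding B_def B'_def by auto
   then have "\<mu> \<le> \<mu>'" unfolding \<mu>_def \<mu>'_def using fin iBm by (intro measure_mono_fmeasurable) (auto simp: fmeasurable_def)
   then show ?thesis using \<mu> by simp
  qed
  define l where "l = 2 * r / s"
  have l: "l \<ge> 0" using r s_pos by (simp add: l_def)
  define Q where "Q = {w. Re w \<in> {Re z - r / s..Re z - r / s + l} \<and> Im w \<in> {Im z - r / s..Im z - r / s + l}}"
  have Qm[measurable]: "Q \<in> sets borel" unfolding Q_def by simp
  let ?q = "\<lambda>x. \<integral>\<^sup>+y\<in>Q. ennreal \<bar>F x - F y\<bar> \<partial>lborel" and ?c = "ennreal c2 * ennreal c2"
   and ?ff = "\<integral>\<^sup>+x\<in>?B. (\<integral>\<^sup>+y\<in>?B. ennreal \<bar>f x - f y\<bar> \<partial>m) \<partial>m"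
  have BQ: "B \<subseteq> Q"
  proof
   fix w assume "w \<in> B"
   then have "norm (z - w) < r / s" using ball_subset(1)[of z r] by (auto simp: B_def dist_norm)
   then have "\<bar>Re (z - w)\<bar> < r / s" "\<bar>Im (z - w)\<bar> < r / s" using abs_Re_le_cmod[of "z - w"] abs_Im_le_cmod[of "z - w"] by auto+
   then show "w \<in> Q" unfolding Q_def l_def by auto
  qed
  have QB': "Q \<subseteq> B'"
  proof
   fix w assume w: "w \<in> Q"
   have "\<bar>Re (z - w)\<bar> \<le> r / s" "\<bar>Im (z - w)\<bar> \<le> r / s"
    using w unfolding Q_def l_def by auto
   then have "norm (z - w) < 3 * (r / s)" using cmod_le[of "z - w"] divide_pos_pos[OF r s_pos] by linarith
   then have "W * norm (z - w) < \<Lambda> * r" using W_pos s_pos by (simp add: \<Lambda>_def field_simps)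
   then show "w \<in> B'" using d_upper[of z w] by (simp add: B'_def)
  qed
  define I where "I = (\<integral>\<^sup>+y\<in>?B. ennreal \<bar>f y - average m (?B) f\<bar> \<partial>m)"
  define S where "S = (\<integral>\<^sup>+y\<in>?B'. (slope X f y)^2 \<partial>m)"
  have slm: "(\<lambda>y. (slope X f y)^2) \<in> borel_measurable m"
   unfolding measurable_m_iff comp_def slope_eq by simp
  have S_eq: "S = (NN w. (lipc d F w)^2 * indicator B' w * ennreal (\<rho> w))"
   unfolding S_def using slm iBm by (subst nn_integral_m) (auto simp: slope_eq inj_image_mem_iff[OF inj_iota] indicator_def intro!: nn_integral_cong)
  have S_fin: "S < \<infinity>"
  proof -
   have "lipc d F w \<le> ennreal (L / s)" for w by (rule lipc_le_Lipschitz) (use L in auto)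
   then have "S \<le> (\<integral>\<^sup>+y. (ennreal (L / s))^2 * indicator (?B') y \<partial>m)"
    unfolding S_def
    by (intro nn_integral_mono) (auto split: split_indicator simp: slope_eq intro!: power_mono)
   also have "\<dots> = (ennreal (L / s))^2 * emeasure m (?B')" by (rule nn_integral_cmult_indicator[OF iBm(2)])
   also have "\<dots> < \<infinity>" using fin L s_pos ennreal_power[of "L / s" 2] by (simp add: ennreal_mult_less_top)
   finally show ?thesis .
  qed
  then obtain a where a: "a \<ge> 0" "S = ennreal a" by (cases S) auto
  \<comment> \<open>From the integral of the slope to the integral of its square; the density is
    inserted by 1 \<le> \<rho> w / c1.\<close>
  have CS: "(\<integral>\<^sup>+w\<in>Q. lipc d F w \<partial>lborel) \<le> ennreal (sqrt (a / c1 * l^2))"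
  proof (rule ennreal_le_sqrtI)
   have "(\<integral>\<^sup>+w\<in>Q. lipc d F w \<partial>lborel)^2 = (NN w. (lipc d F w * indicator Q w) * indicator Q w)^2"
    by (simp add: mult.assoc indicator_inter_arith[symmetric])
   also have "\<dots> \<le> (NN w. (lipc d F w * indicator Q w)^2) * (NN w. (indicator Q w)^2)"
    by (rule Cauchy_Schwarz_nn_integral) measurable
   also have "(NN w. (indicator Q w)^2) = ennreal (l^2)"
    using square_double_integral(2)[OF L(2) l, of "Re z - r/s" "Im z - r/s"]
    by (simp add: power2_eq_square indicator_inter_arith[symmetric] Q_def)
   also have "(NN w. (lipc d F w * indicator Q w)^2) \<le> (NN w. ennreal (1 / c1) * ((lipc d F w)^2 * indicator B' w * ennreal (\<rho> w)))"
   proof (rule nn_integral_mono)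
    fix w
    have "1 \<le> ennreal (1 / c1) * ennreal (\<rho> w)"
     using c1_pos \<rho>_lower[of w] by (subst ennreal_mult[symmetric]) (auto simp: field_simps intro: order_trans)
    then have "(lipc d F w)^2 * 1 \<le> (lipc d F w)^2 * (ennreal (1 / c1) * ennreal (\<rho> w))" by (intro mult_left_mono) auto
    then show "(lipc d F w * indicator Q w)^2 \<le> ennreal (1 / c1) * ((lipc d F w)^2 * indicator B' w * ennreal (\<rho> w))"
     using QB' by (auto split: split_indicator simp: mult_ac)
   qed
   also have "\<dots> = ennreal (1 / c1) * S" unfolding S_eq by (rule nn_integral_cmult) measurable
   finally show "(\<integral>\<^sup>+w\<in>Q. lipc d F w \<partial>lborel)^2 \<le> ennreal (a / c1 * l^2)"
    using a c1_pos by (simp add: ennreal_mult[symmetric] mult_right_mono)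
  qed (use a c1_pos in simp)
  have "I * ennreal \<mu> \<le> ?ff"
  proof -
   have gm: "g \<in> borel_measurable m" by (simp add: g_def)
   have avg: "average m (?B) f = average m (?B) g"
    unfolding average_def set_lebesgue_integral_def by (intro arg_cong2[where f = "(/)"] Bochner_Integration.integral_cong refl) (simp add: f_g)
   have "I = (\<integral>\<^sup>+y\<in>?B. ennreal \<bar>g y - average m (?B) g\<bar> \<partial>m)"
    unfolding I_def avg by (intro nn_integral_cong) (simp add: f_g)
   moreover have "?ff
     = (\<integral>\<^sup>+x\<in>?B. (\<integral>\<^sup>+y\<in>?B. ennreal \<bar>g x - g y\<bar> \<partial>m) \<partial>m)"
    by (intro nn_integral_cong) (auto simp: f_g split: split_indicator intro!: nn_integral_cong)
   moreover have "\<bar>g x\<bar> \<le> max b 0" for x unfolding g_def by (rule F_bd)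
   ultimately show ?thesis
    unfolding em(1)[symmetric] using oscillation_le_double_integral[OF iBm(1) fin(1) gm, of "max b 0"] by simp
  qed
  also have "\<dots> \<le> ?c * (\<integral>\<^sup>+x\<in>Q. ?q x \<partial>lborel)"
  proof -
   have inner: "(\<integral>\<^sup>+y\<in>?B. ennreal \<bar>f (iota x) - f y\<bar> \<partial>m) \<le> ennreal c2 * ?q x" for x
   proof -
    have "(\<integral>\<^sup>+y\<in>?B. ennreal \<bar>f (iota x) - f y\<bar> \<partial>m)
      = (NN y. ennreal \<bar>F x - F y\<bar> * indicator (?B) (iota y) * ennreal (\<rho> y))"
     unfolding F_def by (rule nn_integral_m) (use iBm in measurable)
    also have "\<dots> \<le> (NN y. ennreal c2 * (ennreal \<bar>F x - F y\<bar> * indicator Q y))"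
     using BQ by (intro nn_integral_mono)
      (auto simp: inj_image_mem_iff[OF inj_iota] mult.commute[of _ "ennreal (\<rho> _)"] split: split_indicator intro!: mult_right_mono ennreal_leI \<rho>_upper)
    also have "\<dots> = ennreal c2 * ?q x" by (rule nn_integral_cmult) measurable
    finally show ?thesis .
   qed
   have mm: "(\<lambda>x. \<integral>\<^sup>+y\<in>?B. ennreal \<bar>f x - f y\<bar> \<partial>m) \<in> borel_measurable m"
   proof -
    interpret sigma_finite_measure m
     unfolding plane_measure_def
     by (rule sigma_finite_embed_measure) (simp_all add: sigma_finite_measure.sigma_finite_iff_density_finite[OF sigma_finite_lborel] inj_iota)
    show ?thesis using iBm by simp
   qed
   have "?ff
     = (NN x. (\<integral>\<^sup>+y\<in>?B. ennreal \<bar>f (iota x) - f y\<bar> \<partial>m) * indicator (?B) (iota x) * ennreal (\<rho> x))"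
    by (rule nn_integral_m) (use mm iBm in measurable)
   also have "\<dots> \<le> (NN x. ?c * (?q x * indicator Q x))"
   proof (rule nn_integral_mono)
    fix x
    show "(\<integral>\<^sup>+y\<in>?B. ennreal \<bar>f (iota x) - f y\<bar> \<partial>m) * indicator (?B) (iota x) * ennreal (\<rho> x)
      \<le> ?c * (?q x * indicator Q x)"
    proof (cases "x \<in> B")
     case True
     then have "x \<in> Q" using BQ by auto
     then show ?thesis using True mult_mono[OF inner[of x] ennreal_leI[OF \<rho>_upper[of x]]]
      by (simp add: inj_image_mem_iff[OF inj_iota] mult_ac)
    qed (simp add: inj_image_mem_iff[OF inj_iota])
   qed
   also have "\<dots> = ?c * (\<integral>\<^sup>+x\<in>Q. ?q x \<partial>lborel)"
    by (rule nn_integral_cmult) measurable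
   finally show ?thesis .
  qed
  also have "\<dots> \<le> ?c * (ennreal (2 * l^3 * W) * (\<integral>\<^sup>+w\<in>Q. lipc d F w \<partial>lborel))"
   unfolding Q_def by (intro mult_left_mono square_double_integral(1)[OF L(2) l]) simp
  also have "\<dots> \<le> ?c * (ennreal (2 * l^3 * W) * ennreal (sqrt (a / c1 * l^2)))"
   by (intro mult_left_mono CS) auto
  also have "\<dots> = ennreal (2 * c2^2 * W * l^4 / sqrt c1 * sqrt a)"
  proof -
   have "c2 * c2 * ((2 * l^3 * W) * sqrt (a / c1 * l^2)) = 2 * c2^2 * W * l^4 / sqrt c1 * sqrt a"
    using l by (simp add: real_sqrt_mult real_sqrt_divide power2_eq_square power4_eq_xxxx power3_eq_cube)
   moreover have "?c * (ennreal (2 * l^3 * W) * ennreal (sqrt (a / c1 * l^2)))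
    = ennreal (c2 * c2 * ((2 * l^3 * W) * sqrt (a / c1 * l^2)))"
    using c2_pos l W_pos a c1_pos by (simp add: ennreal_mult)
   ultimately show ?thesis by simp
  qed
  finally have I: "I * ennreal \<mu> \<le> ennreal (2 * c2^2 * W * l^4 / sqrt c1 * sqrt a)" .
  then have "I \<noteq> \<infinity>" using \<mu> by (auto simp: top_unique)
  then obtain i where i: "i \<ge> 0" "I = ennreal i" by (cases I) auto
  have i_le: "i * \<mu> \<le> 2 * c2^2 * W * l^4 / sqrt c1 * sqrt a"
   using I i \<mu> a c1_pos W_pos by (subst (asm) i, subst (asm) ennreal_mult[symmetric], simp, simp, subst (asm) ennreal_le_iff) auto
  have sa: "sqrt a \<le> sqrt (a / \<mu>') * (sqrt (c2 * pi) * \<Lambda> / s * r)"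
  proof -
   have "sqrt a = sqrt (a / \<mu>') * sqrt \<mu>'" using \<mu>' by (simp add: real_sqrt_mult[symmetric])
   also have "sqrt \<mu>' \<le> sqrt (c2 * pi * (\<Lambda> * r / s)^2)" using \<mu>'_upper by simp
   also have "\<dots> = sqrt (c2 * pi) * \<Lambda> / s * r" using \<Lambda> r s_pos by (simp add: real_sqrt_mult)
   finally show ?thesis using a \<mu>' by (simp add: mult_left_mono)
  qed
  \<comment> \<open>Powers of \<open>r\<close>: the double integral gives r^4, the root of the mass
    of the larger ball one more, and division by the square of \<mu> removes four.\<close>
  have "i / \<mu> \<le> C * r * sqrt (a / \<mu>')"
  proof -
   define P where "P = 2 * c2^2 * W * (2/s)^4 / sqrt c1"
   have P: "P > 0" unfolding P_def using c1_pos c2_pos W_pos s_pos by simp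
   have l4: "l^4 = (2/s)^4 * r^4" by (simp add: l_def power_divide)
   have "i / \<mu> = i * \<mu> / \<mu>^2" using \<mu> by (simp add: power2_eq_square)
   also have "\<dots> \<le> P * r^4 * sqrt a / \<mu>^2"
    using i_le unfolding P_def l4 by (intro divide_right_mono) (auto simp: mult_ac)
   also have "\<dots> \<le> P * r^4 * (sqrt (a / \<mu>') * (sqrt (c2 * pi) * \<Lambda> / s * r)) / \<mu>^2"
    using sa P r by (intro divide_right_mono mult_left_mono) auto
   also have "\<dots> \<le> P * r^4 * (sqrt (a / \<mu>') * (sqrt (c2 * pi) * \<Lambda> / s * r)) / (c1 * pi / W^2 * r^2)^2"
    using \<mu>_lower \<mu> \<mu>' P r a c1_pos c2_pos W_pos s_pos \<Lambda>
    by (intro divide_left_mono power_mono mult_nonneg_nonneg mult_pos_pos zero_less_power) auto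
   also have "\<dots> = C * r * sqrt (a / \<mu>')"
    using r c1_pos W_pos s_pos unfolding C_def P_def[symmetric]
    by (simp add: field_simps power2_eq_square power4_eq_xxxx)
   finally show ?thesis .
  qed
  moreover have "nn_average m (mball_of X x r) (\<lambda>y. ennreal \<bar>f y - average m (mball_of X x r) f\<bar>) = ennreal (i / \<mu>)"
   unfolding nn_average_def mB I_def[symmetric] em i(2) using i \<mu> by (simp add: divide_ennreal)
  moreover have "nn_average m (mball_of X x (\<Lambda> * r)) (\<lambda>y. (slope X f y)^2) = ennreal (a / \<mu>')"
   unfolding nn_average_def mB S_def[symmetric] em a(2) using a \<mu>' by (simp add: divide_ennreal)
  ultimately show ?thesis using a \<mu>' by (auto intro!: ennreal_leI)
 qed
 then show ?thesis unfolding weak_Poincare_1_2_def using C \<Lambda> by blast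
qed

lemma PI_space_X: "PI_space X m"
 by (simp add: PI_space_def doubling_X Poincare_X)

end

section \<open>Mollification\<close>

text \<open>The Euclidean plane as an instance, so that \<open>lipe\<close> inherits all facts about
  slopes.\<close>

interpretation euclid: planar "\<lambda>z w. norm (z - w)" "\<lambda>_. 1" 1 1 1 1
 by unfold_locales (auto simp: norm_minus_commute intro: norm_diff_triangle_le)

abbreviation "lipe \<equiv> lipc (\<lambda>z w. norm (z - w))"

lemma lborel_integral_reflect:
 fixes f :: "complex \<Rightarrow> real"
 assumes [measurable]: "f \<in> borel_measurable borel"
 shows "(LB y. f (x - y)) = (LB y. f y)"
  and "integrable lborel (\<lambda>y. f (x - y)) \<longleftrightarrow> integrable lborel f"
proof -
 have d: "lborel = distr lborel borel (\<lambda>y::complex. x - y)"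
  using lborel_affine[of "-1" x] by (simp add: density_1)
 have "(LB y. f y) = (LINT y|distr lborel borel (\<lambda>y. x - y). f y)"
  using d by simp
 also have "\<dots> = (LB y. f (x - y))" by (subst integral_distr) auto
 finally show "(LB y. f (x - y)) = (LB y. f y)" ..
 have "integrable lborel f \<longleftrightarrow> integrable (distr lborel borel (\<lambda>y. x - y)) f" using d by simp
 also have "\<dots> \<longleftrightarrow> integrable lborel (\<lambda>y. f (x - y))" by (subst integrable_distr_eq) auto
 finally show "integrable lborel (\<lambda>y. f (x - y)) \<longleftrightarrow> integrable lborel f" ..
qed

lemma nn_integral_lborel_reflect:
 fixes f :: "complex \<Rightarrow> ennreal"
 assumes [measurable]: "f \<in> borel_measurable borel"
 shows "(NN y. f (x - y)) = (NN y. f y)"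
proof -
 have d: "lborel = distr lborel borel (\<lambda>y::complex. x - y)"
  using lborel_affine[of "-1" x] by (simp add: density_1)
 have "(NN y. f y) = (\<integral>\<^sup>+y. f y \<partial>distr lborel borel (\<lambda>y. x - y))" using d by simp
 also have "\<dots> = (NN y. f (x - y))" by (subst nn_integral_distr) auto
 finally show ?thesis ..
qed

text \<open>The Cauchy--Schwarz inequality for the weight \<kappa>, followed by Fubini's theorem and
  translation invariance.\<close>

lemma nn_Young:
 fixes l :: "complex \<Rightarrow> ennreal" and \<kappa> :: "complex \<Rightarrow> real"
 assumes [measurable]: "l \<in> borel_measurable borel" "\<kappa> \<in> borel_measurable borel" and nonneg: "\<And>z. 0 \<le> \<kappa> z"
 shows "(NN x. (NN y. l (x - y) * ennreal (\<kappa> y))^2)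
  \<le> (NN y. ennreal (\<kappa> y))^2 * (NN x. (l x)^2)"
proof -
 define T where "T = (NN y. ennreal (\<kappa> y))"
 have sq: "(ennreal (sqrt (\<kappa> y)))^2 = ennreal (\<kappa> y)" for y using nonneg[of y] by (simp add: ennreal_power)
 have "(NN y. l (x - y) * ennreal (\<kappa> y))^2 \<le> (NN y. (l (x - y))^2 * ennreal (\<kappa> y)) * T" for x
 proof -
  have "(NN y. l (x - y) * ennreal (\<kappa> y))
    = (NN y. (l (x - y) * ennreal (sqrt (\<kappa> y))) * ennreal (sqrt (\<kappa> y)))"
   by (simp add: mult.assoc power2_eq_square[symmetric] sq)
  also have "\<dots>^2 \<le> (NN y. (l (x - y) * ennreal (sqrt (\<kappa> y)))^2) * (NN y. (ennreal (sqrt (\<kappa> y)))^2)"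
   by (rule Cauchy_Schwarz_nn_integral) measurable
  finally show ?thesis by (simp add: power_mult_distrib sq T_def)
 qed
 then have "(NN x. (NN y. l (x - y) * ennreal (\<kappa> y))^2)
   \<le> (NN x. (NN y. (l (x - y))^2 * ennreal (\<kappa> y)) * T)" by (intro nn_integral_mono)
 also have "\<dots> = (NN x. NN y. (l (x - y))^2 * ennreal (\<kappa> y)) * T"
  by (rule nn_integral_multc) measurable
 also have "(NN x. NN y. (l (x - y))^2 * ennreal (\<kappa> y))
   = (NN y. NN x. (l (x - y))^2 * ennreal (\<kappa> y))"
  by (rule lborel_pair.Fubini') measurable
 also have "\<dots> = (NN y. (NN x. (l x)^2) * ennreal (\<kappa> y))"
 proof (rule nn_integral_cong)
  fix y
  have "(NN x. (l (x - y))^2 * ennreal (\<kappa> y)) = (NN x. (l (x - y))^2) * ennreal (\<kappa> y)"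
   by (rule nn_integral_multc) measurable
  also have "(NN x. (l (x - y))^2) = (NN x. (l x)^2)"
   using nn_integral_lborel_add[of "\<lambda>x. (l x)^2" "- y"] by simp
  finally show "(NN x. (l (x - y))^2 * ennreal (\<kappa> y)) = (NN x. (l x)^2) * ennreal (\<kappa> y)" .
 qed
 also have "\<dots> = (NN x. (l x)^2) * T" unfolding T_def by (rule nn_integral_cmult) measurable
 finally show ?thesis unfolding T_def[symmetric] by (simp add: power2_eq_square mult_ac)
qed

lemma limsup_cmult_le: "limsup (\<lambda>n. ennreal c * f n) \<le> ennreal c * limsup f"
proof -
 have "continuous_on UNIV (\<lambda>x. ennreal c * x)"
  unfolding continuous_on_def by (auto intro!: ennreal_tendsto_cmult tendsto_ident_at)
 then have "limsup (\<lambda>n. ennreal c * f n) = ennreal c * limsup f"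
  by (intro Limsup_compose_continuous_mono) (auto intro!: monoI mult_left_mono)
 then show ?thesis by simp
qed

section \<open>Convolution with bounded kernels and mollifiers\<close>

definition conv :: "(complex \<Rightarrow> real) \<Rightarrow> (complex \<Rightarrow> real) \<Rightarrow> complex \<Rightarrow> real" where
 "conv f \<kappa> x = (LB y. f (x - y) * \<kappa> y)"

text \<open>The sign is left free, because the components of the gradient of a mollifier are to be
  kernels as well.\<close>

locale kernel =
 fixes \<kappa> :: "complex \<Rightarrow> real" and r B :: real
 assumes \<kappa>_meas [measurable]: "\<kappa> \<in> borel_measurable borel"
  and \<kappa>_supp: "\<And>z. norm z > r \<Longrightarrow> \<kappa> z = 0" and \<kappa>_bound: "\<And>z. \<bar>\<kappa> z\<bar> \<le> B" and r_pos: "0 < r"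
begin

lemma B_nonneg: "0 \<le> B" using order_trans[OF abs_ge_zero \<kappa>_bound] .

lemma integrable_power: "integrable lborel (\<lambda>y. \<bar>\<kappa> y\<bar> ^ Suc n)"
proof (rule Bochner_Integration.integrable_bound)
 show "integrable lborel (\<lambda>y. B ^ Suc n * indicator (cball (0::complex) r) y)"
  using emeasure_bounded_finite[of "cball (0::complex) r"] by simp
 have "\<bar>\<kappa> x\<bar> ^ Suc n \<le> B ^ Suc n" for x by (intro power_mono \<kappa>_bound) simp
 then show "AE x in lborel. norm (\<bar>\<kappa> x\<bar> ^ Suc n) \<le> norm (B ^ Suc n * indicator (cball 0 r) x)"
  using \<kappa>_supp B_nonneg by (intro AE_I2) (auto simp del: power_Suc simp: power_0_left split: split_indicator)
qed measurable

lemma integrable_abs_kernel: "integrable lborel (\<lambda>y. \<bar>\<kappa> y\<bar>)" using integrable_power[of 0] by simp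

lemma kernel_L2: "(\<lambda>y. \<kappa> (x - y)) \<in> L2 lborel"
proof -
 have "(NN y. ennreal ((\<kappa> (x - y))^2)) = (NN y. ennreal ((\<kappa> y)^2))"
  by (rule nn_integral_lborel_reflect) measurable
 also have "\<dots> < \<infinity>" using integrable_power[of 1] by (simp add: nn_integral_eq_integral power2_eq_square abs_mult[symmetric])
 finally show ?thesis by (simp add: L2_def L2_sqnorm_def)
qed

lemma conv_alt:
 assumes f: "f \<in> L2 lborel"
 shows "conv f \<kappa> x = (LB y. f y * \<kappa> (x - y))" "integrable lborel (\<lambda>y. f y * \<kappa> (x - y))"
  "integrable lborel (\<lambda>y. f (x - y) * \<kappa> y)"
proof -
 have [measurable]: "f \<in> borel_measurable borel" using f by (simp add: L2_def)
 show "integrable lborel (\<lambda>y. f y * \<kappa> (x - y))" by (rule L2_mult_integrable[OF f kernel_L2])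
 then show "integrable lborel (\<lambda>y. f (x - y) * \<kappa> y)"
  using lborel_integral_reflect(2)[of "\<lambda>y. f y * \<kappa> (x - y)" x] by simp
 show "conv f \<kappa> x = (LB y. f y * \<kappa> (x - y))"
  unfolding conv_def using lborel_integral_reflect(1)[of "\<lambda>y. f y * \<kappa> (x - y)" x] by simp
qed

lemma conv_add: "f \<in> L2 lborel \<Longrightarrow> g \<in> L2 lborel \<Longrightarrow> conv (\<lambda>x. f x + g x) \<kappa> x = conv f \<kappa> x + conv g \<kappa> x"
 unfolding conv_def by (simp add: distrib_right conv_alt)

lemma conv_diff: "f \<in> L2 lborel \<Longrightarrow> g \<in> L2 lborel \<Longrightarrow> conv (\<lambda>x. f x - g x) \<kappa> x = conv f \<kappa> x - conv g \<kappa> x"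
 unfolding conv_def by (simp add: left_diff_distrib conv_alt)

lemma conv_cmult: "conv (\<lambda>x. c * f x) \<kappa> x = c * conv f \<kappa> x"
 unfolding conv_def by (simp add: mult.assoc)

lemma conv_L2:
 assumes f: "f \<in> L2 lborel"
 shows "conv f \<kappa> \<in> L2 lborel" "N2 (conv f \<kappa>) \<le> (LB y. \<bar>\<kappa> y\<bar>) * N2 f"
proof -
 have [measurable]: "f \<in> borel_measurable borel" using f by (simp add: L2_def)
 have [measurable]: "conv f \<kappa> \<in> borel_measurable borel" unfolding conv_def[abs_def] by simp
 let ?T = "LB y. \<bar>\<kappa> y\<bar>"
 have T: "(NN y. ennreal \<bar>\<kappa> y\<bar>) = ennreal ?T" by (rule nn_integral_eq_integral[OF integrable_abs_kernel]) simp
 have "L2_sqnorm lborel (conv f \<kappa>) \<le> (NN x. (NN y. ennreal \<bar>f (x - y)\<bar> * ennreal \<bar>\<kappa> y\<bar>)^2)"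
  unfolding L2_sqnorm_def
 proof (rule nn_integral_mono)
  fix x
  have "ennreal \<bar>conv f \<kappa> x\<bar> \<le> (NN y. ennreal (norm (f (x - y) * \<kappa> y)))"
   unfolding conv_def using integral_norm_bound_ennreal[OF conv_alt(3)[OF f]] by simp
  then have "(ennreal \<bar>conv f \<kappa> x\<bar>)^2 \<le> (NN y. ennreal \<bar>f (x - y)\<bar> * ennreal \<bar>\<kappa> y\<bar>)^2"
   by (intro power_mono) (simp_all add: abs_mult ennreal_mult)
  then show "ennreal ((conv f \<kappa> x)^2) \<le> (NN y. ennreal \<bar>f (x - y)\<bar> * ennreal \<bar>\<kappa> y\<bar>)^2"
   by (simp add: ennreal_power)
 qed
 also have "\<dots> \<le> (NN y. ennreal \<bar>\<kappa> y\<bar>)^2 * (NN x. (ennreal \<bar>f x\<bar>)^2)"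
  by (rule nn_Young[where l = "\<lambda>x. ennreal \<bar>f x\<bar>"]) auto
 also have "\<dots> = ennreal ((?T * N2 f)^2)"
  unfolding T power_mult_distrib by (simp add: ennreal_mult ennreal_L2_norm_sq[OF f] L2_sqnorm_def ennreal_power)
 finally have le: "L2_sqnorm lborel (conv f \<kappa>) \<le> ennreal ((?T * N2 f)^2)" .
 show L: "conv f \<kappa> \<in> L2 lborel" using le by (auto simp: L2_def intro: le_less_trans)
 have "(N2 (conv f \<kappa>))^2 \<le> (?T * N2 f)^2"
  using le unfolding ennreal_L2_norm_sq[OF L, symmetric] by simp
 then show "N2 (conv f \<kappa>) \<le> ?T * N2 f"
  by (rule power2_le_imp_le) (simp add: L2_norm_nonneg)
qed

end

text \<open>\<open>g\<close> is the gradient of \<kappa>. Differentiability enters as a Taylor bound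
  of second order, uniform in the base point, since such a bound passes through the convolution
  integral directly.\<close>

locale mollifier = kernel \<kappa> r B for \<kappa> r B +
 fixes g :: "complex \<Rightarrow> complex" and K :: real
 assumes \<kappa>_nonneg: "\<And>z. 0 \<le> \<kappa> z" and \<kappa>_total: "(LB z. \<kappa> z) = 1"
  and g_meas [measurable]: "g \<in> borel_measurable borel"
  and g_supp: "\<And>z. norm z > r \<Longrightarrow> g z = 0" and g_bound: "\<And>z. norm (g z) \<le> K"
  and taylor: "\<And>z h. norm h \<le> r \<Longrightarrow> \<bar>\<kappa> (z + h) - \<kappa> z - g z \<bullet> h\<bar> \<le> K * (norm h)^2"
begin

sublocale g1: kernel "\<lambda>z. Re (g z)" r K
 by unfold_locales (auto simp: g_supp r_pos intro: order_trans[OF abs_Re_le_cmod g_bound])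

sublocale g2: kernel "\<lambda>z. Im (g z)" r K
 by unfold_locales (auto simp: g_supp r_pos intro: order_trans[OF abs_Im_le_cmod g_bound])

definition grad :: "(complex \<Rightarrow> real) \<Rightarrow> complex \<Rightarrow> complex" where
 "grad f x = Complex (conv f (\<lambda>z. Re (g z)) x) (conv f (\<lambda>z. Im (g z)) x)"

lemma nn_\<kappa>: "(NN y. ennreal (\<kappa> y)) = 1"
 using nn_integral_eq_integral[of lborel \<kappa>] integrable_abs_kernel \<kappa>_nonneg \<kappa>_total by simp

text \<open>The Taylor bound for \<kappa> is integrated against \<open>f\<close>. For increments of
  norm at most \<open>r\<close> only the disc of radius 2 * r around \<open>x\<close> contributes,
  and on it \<open>f\<close> is integrable.\<close>

lemma conv_taylor:
 assumes f: "f \<in> L2 lborel"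
 obtains C where "\<And>h. norm h \<le> r \<Longrightarrow> \<bar>conv f \<kappa> (x + h) - conv f \<kappa> x - grad f x \<bullet> h\<bar> \<le> C * (norm h)^2"
proof
 have [measurable]: "f \<in> borel_measurable borel" using f by (simp add: L2_def)
 have [measurable]: "indicat_real (cball x (2 * r)) \<in> borel_measurable borel"
  by (intro borel_measurable_indicator) simp
 have "indicat_real (cball x (2 * r)) \<in> L2 lborel"
  using emeasure_bounded_finite[of "cball x (2 * r)"] by (simp add: L2_def L2_sqnorm_def power2_eq_square indicator_inter_arith[symmetric] ennreal_indicator)
 from L2_mult_integrable[OF f this] have int: "integrable lborel (\<lambda>y. \<bar>f y * indicator (cball x (2 * r)) y\<bar>)" by simp
 fix h :: complex assume h: "norm h \<le> r"
 have i2: "integrable lborel (\<lambda>y. f y * (g (x - y) \<bullet> h))"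
  unfolding inner_complex_def distrib_left mult.assoc[symmetric]
  by (intro Bochner_Integration.integrable_add integrable_mult_left g1.conv_alt g2.conv_alt f)
 have "grad f x \<bullet> h = (LB y. f y * (g (x - y) \<bullet> h))"
  unfolding grad_def inner_complex_def g1.conv_alt(1)[OF f] g2.conv_alt(1)[OF f] distrib_left mult.assoc[symmetric]
  by (simp add: g1.conv_alt(2)[OF f] g2.conv_alt(2)[OF f])
 then have "conv f \<kappa> (x + h) - conv f \<kappa> x - grad f x \<bullet> h
   = (LB y. f y * (\<kappa> ((x - y) + h) - \<kappa> (x - y) - g (x - y) \<bullet> h))"
  using conv_alt(2)[OF f, of "x + h"] conv_alt(2)[OF f, of x] i2
  by (simp add: conv_alt(1)[OF f] right_diff_distrib algebra_simps)
 also have "\<bar>\<dots>\<bar> \<le> (LB y. (K * (norm h)^2) * \<bar>f y * indicator (cball x (2 * r)) y\<bar>)"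
 proof (rule integral_abs_bound[THEN order_trans], rule integral_mono)
  have "integrable lborel (\<lambda>y. f y * \<kappa> ((x + h) - y) - f y * \<kappa> (x - y) - f y * (g (x - y) \<bullet> h))"
   by (intro Bochner_Integration.integrable_diff conv_alt f i2)
  then show "integrable lborel (\<lambda>y. \<bar>f y * (\<kappa> ((x - y) + h) - \<kappa> (x - y) - g (x - y) \<bullet> h)\<bar>)"
   by (intro integrable_abs) (simp add: right_diff_distrib algebra_simps)
  show "integrable lborel (\<lambda>y. (K * (norm h)^2) * \<bar>f y * indicator (cball x (2 * r)) y\<bar>)"
   by (intro integrable_mult_right int)
  fix y
  show "\<bar>f y * (\<kappa> ((x - y) + h) - \<kappa> (x - y) - g (x - y) \<bullet> h)\<bar> \<le> (K * (norm h)^2) * \<bar>f y * indicator (cball x (2 * r)) y\<bar>"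
  proof (cases "y \<in> cball x (2 * r)")
   case True
   then show ?thesis using mult_right_mono[OF taylor[OF h, of "x - y"], of "\<bar>f y\<bar>"] by (simp add: abs_mult mult_ac)
  next
   case False
   then have far: "norm (x - y) > 2 * r" by (simp add: dist_norm)
   have "norm (x - y) \<le> norm ((x - y) + h) + norm h" using norm_triangle_ineq4[of "(x - y) + h" h] by simp
   then have "norm ((x - y) + h) > r" using far h by simp
   then show ?thesis using far r_pos \<kappa>_supp[of "x - y"] \<kappa>_supp[of "(x - y) + h"] g_supp[of "x - y"]
    by (simp add: indicator_simps(2)[OF False])
  qed
 qed
 finally show "\<bar>conv f \<kappa> (x + h) - conv f \<kappa> x - grad f x \<bullet> h\<bar>
   \<le> (K * (LB y. \<bar>f y * indicator (cball x (2 * r)) y\<bar>)) * (norm h)^2"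
  by (simp add: mult_ac)
qed

lemma lipe_conv_le:
 assumes f: "f \<in> L2 lborel"
 shows "lipe (conv f \<kappa>) x \<le> ennreal (norm (grad f x))"
proof (rule ennreal_le_epsilon)
 fix e :: real assume e: "e > 0"
 obtain C where C: "\<And>h. norm h \<le> r \<Longrightarrow> \<bar>conv f \<kappa> (x + h) - conv f \<kappa> x - grad f x \<bullet> h\<bar> \<le> C * (norm h)^2"
  using conv_taylor[OF f] by auto
 define \<eta> where "\<eta> = min r (e / (\<bar>C\<bar> + 1))"
 have \<eta>: "\<eta> > 0" using r_pos e by (simp add: \<eta>_def)
 have "\<bar>conv f \<kappa> y - conv f \<kappa> x\<bar> / norm (y - x) \<le> norm (grad f x) + e" if y: "y \<noteq> x" "dist y x < \<eta>" for y
 proof -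
  define h where "h = y - x"
  have h: "norm h \<le> r" "norm h \<le> e / (\<bar>C\<bar> + 1)" "norm h > 0" using y by (auto simp: h_def \<eta>_def dist_norm)
  have "\<bar>conv f \<kappa> y - conv f \<kappa> x\<bar> \<le> \<bar>grad f x \<bullet> h\<bar> + C * (norm h)^2" using C[OF h(1)] by (simp add: h_def)
  also have "\<dots> \<le> norm (grad f x) * norm h + \<bar>C\<bar> * (norm h)^2"
   by (intro add_mono Cauchy_Schwarz_ineq2 mult_right_mono) auto
  also have "\<bar>C\<bar> * (norm h)^2 \<le> e * norm h"
  proof -
   have "\<bar>C\<bar> * norm h \<le> \<bar>C\<bar> * (e / (\<bar>C\<bar> + 1))" using h by (intro mult_left_mono) auto
   also have "\<dots> \<le> e" using e by (simp add: field_simps)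
   finally show ?thesis using h(3) by (simp add: power2_eq_square mult.assoc[symmetric] mult_right_mono)
  qed
  finally show ?thesis using h(3) unfolding h_def by (simp add: field_simps)
 qed
 then have "\<forall>\<^sub>F y in at x. ennreal (\<bar>conv f \<kappa> y - conv f \<kappa> x\<bar> / norm (y - x)) \<le> ennreal (norm (grad f x) + e)"
  unfolding eventually_at using \<eta> by (intro exI[of _ \<eta>]) (auto intro: ennreal_leI)
 then have "lipe (conv f \<kappa>) x \<le> ennreal (norm (grad f x) + e)" unfolding lipc_def by (rule Limsup_bounded)
 then show "lipe (conv f \<kappa>) x \<le> ennreal (norm (grad f x)) + ennreal e" using e by simp
qed

text \<open>Difference quotients of the convolution in the direction \<open>u\<close> of its
  gradient are averages of difference quotients of \<open>F\<close>. Reverse Fatou, with the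
  Lipschitz constant as majorant, moves the limit inside, where the slope of \<open>F\<close> bounds
  it.\<close>

lemma norm_grad_le:
 assumes FL: "F \<in> Lipbs" and F2: "F \<in> L2 lborel"
 shows "ennreal (norm (grad F x)) \<le> (NN y. lipe F (x - y) * ennreal (\<kappa> y))"
proof (cases "grad F x = 0")
 case False
 obtain L R where L: "L > 0" "\<And>x y. \<bar>F x - F y\<bar> \<le> L * norm (x - y)" using Lipbs_obtain[OF FL] by metis
 have [measurable]: "F \<in> borel_measurable borel" by (rule Lipbs_borel[OF FL])
 define u where "u = sgn (grad F x)"
 have u: "norm u = 1" "grad F x \<bullet> u = norm (grad F x)"
  using False by (simp_all add: u_def norm_sgn sgn_div_norm power2_norm_eq_inner[symmetric] power2_eq_square)
 obtain C where C: "\<And>h. norm h \<le> r \<Longrightarrow> \<bar>conv F \<kappa> (x + h) - conv F \<kappa> x - grad F x \<bullet> h\<bar> \<le> C * (norm h)^2"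
  using conv_taylor[OF F2] by auto
 define e where "e = (\<lambda>n::nat. invS n)"
 have e: "e n > 0" "e n * Suc n = 1" for n by (auto simp: e_def)
 have e0: "e ----> 0" unfolding e_def by (rule inverse_Suc_tendsto)
 define q where "q = (\<lambda>n. (conv F \<kappa> (x + e n *\<^sub>R u) - conv F \<kappa> x) * Suc n)"
 have "q ----> norm (grad F x)"
 proof (rule LIM_zero_cancel, rule Lim_null_comparison)
  have "\<forall>\<^sub>F n in sequentially. e n < r" using e0 r_pos by (intro order_tendstoD) auto
  then show "\<forall>\<^sub>F n in sequentially. norm (q n - norm (grad F x)) \<le> C * e n"
  proof eventually_elim
   case (elim n)
   have "norm (e n *\<^sub>R u) = e n" using e(1)[of n] by (simp add: u)
   then have "\<bar>conv F \<kappa> (x + e n *\<^sub>R u) - conv F \<kappa> x - e n * norm (grad F x)\<bar> \<le> C * (e n)^2"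
    using C[of "e n *\<^sub>R u"] elim by (simp add: u)
   then have "\<bar>conv F \<kappa> (x + e n *\<^sub>R u) - conv F \<kappa> x - e n * norm (grad F x)\<bar> * Suc n \<le> C * (e n)^2 * Suc n"
    by simp
   also have "C * (e n)^2 * Suc n = C * e n" using e(2)[of n] by (simp add: power2_eq_square)
   also have "\<bar>conv F \<kappa> (x + e n *\<^sub>R u) - conv F \<kappa> x - e n * norm (grad F x)\<bar> * Suc n = \<bar>q n - (e n * Suc n) * norm (grad F x)\<bar>"
   proof -
    have "\<bar>a\<bar> * real (Suc n) = \<bar>a * real (Suc n)\<bar>" for a by (simp add: abs_mult)
    moreover have "(conv F \<kappa> (x + e n *\<^sub>R u) - conv F \<kappa> x - e n * norm (grad F x)) * real (Suc n)
      = q n - (e n * Suc n) * norm (grad F x)" by (simp add: q_def algebra_simps)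
    ultimately show ?thesis by simp
   qed
   finally show ?case using e(2)[of n] by simp
  qed
  show "(\<lambda>n. C * e n) ----> 0" using e0 by (intro tendsto_mult_right_zero)
 qed
 then have "(\<lambda>n. ennreal \<bar>q n\<bar>) ----> ennreal \<bar>norm (grad F x)\<bar>" by (intro tendsto_intros)
 then have "ennreal (norm (grad F x)) = limsup (\<lambda>n. ennreal \<bar>q n\<bar>)"
  using lim_imp_Limsup[OF trivial_limit_sequentially] by force
 define Q where "Q = (\<lambda>n y. ennreal (\<bar>F (x - y + e n *\<^sub>R u) - F (x - y)\<bar> * Suc n) * ennreal (\<kappa> y))"
 have Qm[measurable]: "Q n \<in> borel_measurable borel" for n unfolding Q_def by simp
 note \<open>ennreal (norm (grad F x)) = limsup (\<lambda>n. ennreal \<bar>q n\<bar>)\<close>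
 also have "limsup (\<lambda>n. ennreal \<bar>q n\<bar>) \<le> limsup (\<lambda>n. NN y. Q n y)"
 proof (intro Limsup_mono always_eventually allI)
  fix n
  have eq: "x + e n *\<^sub>R u - y = x - y + e n *\<^sub>R u" for y by simp
  have eq2: "(a * c - b * c) * N = (a - b) * N * c" for a b c N :: real by (simp add: algebra_simps)
  have i: "integrable lborel (\<lambda>y. F (x - y + e n *\<^sub>R u) * \<kappa> y)"
   using conv_alt(3)[OF F2, of "x + e n *\<^sub>R u"] unfolding eq .
  have "q n = (LB y. (F (x - y + e n *\<^sub>R u) - F (x - y)) * Suc n * \<kappa> y)"
  proof -
   have "q n = ((LB y. F (x - y + e n *\<^sub>R u) * \<kappa> y) - (LB y. F (x - y) * \<kappa> y)) * Suc n"
    unfolding q_def conv_def eq ..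
   also have "\<dots> = (LB y. (F (x - y + e n *\<^sub>R u) * \<kappa> y - F (x - y) * \<kappa> y) * Suc n)"
    using i conv_alt(3)[OF F2, of x] by simp
   finally show ?thesis unfolding eq2 .
  qed
  moreover have "integrable lborel (\<lambda>y. (F (x - y + e n *\<^sub>R u) - F (x - y)) * Suc n * \<kappa> y)"
  proof -
   have "integrable lborel (\<lambda>y. (F (x - y + e n *\<^sub>R u) * \<kappa> y - F (x - y) * \<kappa> y) * Suc n)"
    using i conv_alt(3)[OF F2, of x] by simp
   then show ?thesis unfolding eq2 .
  qed
  ultimately have "ennreal (norm (q n)) \<le> (NN y. ennreal (norm ((F (x - y + e n *\<^sub>R u) - F (x - y)) * Suc n * \<kappa> y)))"
   using integral_norm_bound_ennreal by metis
  then show "ennreal \<bar>q n\<bar> \<le> (NN y. Q n y)"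
   by (simp add: Q_def abs_mult \<kappa>_nonneg ennreal_mult del: of_nat_Suc)
 qed
 also have "\<dots> \<le> (NN y. limsup (\<lambda>n. Q n y))"
 proof (rule nn_integral_limsup[where w = "\<lambda>y. ennreal L * ennreal (\<kappa> y)"])
  fix n
  have "\<bar>F (x - y + e n *\<^sub>R u) - F (x - y)\<bar> * Suc n \<le> L" for y
  proof -
   have "\<bar>F (x - y + e n *\<^sub>R u) - F (x - y)\<bar> \<le> L * e n"
    using L(2)[of "x - y + e n *\<^sub>R u" "x - y"] e(1)[of n] by (simp add: u)
   then have "\<bar>F (x - y + e n *\<^sub>R u) - F (x - y)\<bar> * Suc n \<le> L * e n * Suc n" by simp
   also have "L * e n * Suc n = L" using e(2)[of n] by simp
   finally show ?thesis .
  qed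
  then show "AE y in lborel. Q n y \<le> ennreal L * ennreal (\<kappa> y)"
   unfolding Q_def by (intro AE_I2 mult_right_mono ennreal_leI) auto
  show "(NN y. ennreal L * ennreal (\<kappa> y)) < \<infinity>"
   by (subst nn_integral_cmult) (auto simp: nn_\<kappa>)
 qed measurable
 also have "\<dots> \<le> (NN y. lipe F (x - y) * ennreal (\<kappa> y))"
 proof (rule nn_integral_mono)
  fix y
  have "limsup (\<lambda>n. Q n y) = limsup (\<lambda>n. ennreal (\<kappa> y) * ennreal (\<bar>F (x - y + e n *\<^sub>R u) - F (x - y)\<bar> * Suc n))"
   by (simp add: Q_def mult.commute)
  also have "\<dots> \<le> ennreal (\<kappa> y) * limsup (\<lambda>n. ennreal (\<bar>F (x - y + e n *\<^sub>R u) - F (x - y)\<bar> * Suc n))"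
   by (rule limsup_cmult_le)
  also have "\<dots> \<le> ennreal (\<kappa> y) * (ennreal 1 * lipe F (x - y + 0 *\<^sub>R u))"
   using euclid.lipc_along_curve[of "\<lambda>t. x - y + t *\<^sub>R u" 1 F 0]
   by (intro mult_left_mono) (simp_all add: u e_def scaleR_diff_left[symmetric])
  finally show "limsup (\<lambda>n. Q n y) \<le> lipe F (x - y) * ennreal (\<kappa> y)" by (simp add: mult.commute)
 qed
 finally show ?thesis .
qed simp

text \<open>The Dirichlet energy of the mollified function. It is defined on all of L2, where for a
  fixed kernel it is a continuous quadratic form.\<close>

definition grad_energy :: "(complex \<Rightarrow> real) \<Rightarrow> real" where
 "grad_energy f = (N2 (conv f (\<lambda>z. Re (g z))))^2 + (N2 (conv f (\<lambda>z. Im (g z))))^2"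

lemma grad_energy_nonneg: "0 \<le> grad_energy f" by (simp add: grad_energy_def)

lemma grad_energy_eq:
 assumes f: "f \<in> L2 lborel"
 shows "(NN x. (ennreal (norm (grad f x)))^2) = ennreal (grad_energy f)"
proof -
 note L = g1.conv_L2(1)[OF f] g2.conv_L2(1)[OF f]
 have [measurable]: "conv f (\<lambda>z. Re (g z)) \<in> borel_measurable borel" "conv f (\<lambda>z. Im (g z)) \<in> borel_measurable borel"
  using L by (auto simp: L2_def)
 have "(NN x. (ennreal (norm (grad f x)))^2)
   = (NN x. ennreal ((conv f (\<lambda>z. Re (g z)) x)^2) + ennreal ((conv f (\<lambda>z. Im (g z)) x)^2))"
  by (intro nn_integral_cong) (simp add: ennreal_power grad_def cmod_def)
 also have "\<dots> = L2_sqnorm lborel (conv f (\<lambda>z. Re (g z))) + L2_sqnorm lborel (conv f (\<lambda>z. Im (g z)))"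
  unfolding L2_sqnorm_def by (rule nn_integral_add) measurable
 finally show ?thesis by (simp add: ennreal_L2_norm_sq[OF L(1), symmetric] ennreal_L2_norm_sq[OF L(2), symmetric] grad_energy_def)
qed

text \<open>Mollification does not increase the energy, by Young's inequality for a kernel of mass
  1.\<close>

lemma grad_energy_le_lipe:
 assumes FL: "F \<in> Lipbs" and F2: "F \<in> L2 lborel"
 shows "ennreal (grad_energy F) \<le> (NN x. (lipe F x)^2)"
proof -
 have [measurable]: "lipe F \<in> borel_measurable borel" by (rule euclid.Lipbs_lipc_measurable[OF FL])
 have "ennreal (grad_energy F) = (NN x. (ennreal (norm (grad F x)))^2)"
  by (rule grad_energy_eq[OF F2, symmetric])
 also have "\<dots> \<le> (NN x. (NN y. lipe F (x - y) * ennreal (\<kappa> y))^2)"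
  by (intro nn_integral_mono power_mono norm_grad_le FL F2) simp
 also have "\<dots> \<le> (NN y. ennreal (\<kappa> y))^2 * (NN x. (lipe F x)^2)"
  by (rule nn_Young) (auto simp: \<kappa>_nonneg)
 finally show ?thesis by (simp add: nn_\<kappa>)
qed

lemma lipe_conv_energy:
 assumes f: "f \<in> L2 lborel"
 shows "(NN x. (lipe (conv f \<kappa>) x)^2) \<le> ennreal (grad_energy f)"
 unfolding grad_energy_eq[OF f, symmetric]
 by (intro nn_integral_mono power_mono lipe_conv_le f) simp

lemma conv_contraction: "f \<in> L2 lborel \<Longrightarrow> N2 (conv f \<kappa>) \<le> N2 f"
 using conv_L2(2)[of f] \<kappa>_total \<kappa>_nonneg by simp

lemma conv_close:
 assumes F2: "F \<in> L2 lborel" and L: "\<And>x y. \<bar>F x - F y\<bar> \<le> L * norm (x - y)" and R: "\<And>x. norm x > R \<Longrightarrow> F x = 0"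
 shows "\<bar>conv F \<kappa> x - F x\<bar> \<le> L * r" and "norm x > R + r \<Longrightarrow> conv F \<kappa> x = 0"
  and "\<bar>conv F \<kappa> x - conv F \<kappa> y\<bar> \<le> L * norm (x - y)"
proof -
 have L0: "0 \<le> L" using order_trans[OF abs_ge_zero L[of 1 0]] by simp
 have k: "integrable lborel \<kappa>" using integrable_abs_kernel \<kappa>_nonneg by simp
 have "\<bar>conv F \<kappa> x - F x\<bar> = \<bar>LB y. F (x - y) * \<kappa> y - F x * \<kappa> y\<bar>"
  using conv_alt(3)[OF F2, of x] k \<kappa>_total by (simp add: conv_def)
 also have "\<dots> \<le> (LB y. L * r * \<kappa> y)"
 proof (rule integral_abs_bound[THEN order_trans], rule integral_mono)
  show "integrable lborel (\<lambda>y. \<bar>F (x - y) * \<kappa> y - F x * \<kappa> y\<bar>)"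
   using conv_alt(3)[OF F2, of x] k by simp
  show "integrable lborel (\<lambda>y. L * r * \<kappa> y)" using k by simp
  fix y
  show "\<bar>F (x - y) * \<kappa> y - F x * \<kappa> y\<bar> \<le> L * r * \<kappa> y"
  proof (cases "norm y > r")
   case False
   have "\<bar>F (x - y) - F x\<bar> \<le> L * r"
    using L[of "x - y" x] mult_left_mono[of "norm y" r L] False L0 by simp
   then have "\<bar>F (x - y) - F x\<bar> * \<kappa> y \<le> L * r * \<kappa> y" by (rule mult_right_mono) (rule \<kappa>_nonneg)
   then show ?thesis by (simp add: left_diff_distrib[symmetric] abs_mult \<kappa>_nonneg)
  qed (simp add: \<kappa>_supp)
 qed
 finally show "\<bar>conv F \<kappa> x - F x\<bar> \<le> L * r" using \<kappa>_total by simp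
 show "conv F \<kappa> x = 0" if "norm x > R + r"
 proof -
  have "F (x - y) * \<kappa> y = 0" for y
  proof (cases "norm y > r")
   case False
   then have "norm (x - y) > R" using that norm_triangle_ineq2[of x y] by simp
   then show ?thesis by (simp add: R)
  qed (simp add: \<kappa>_supp)
  then have "(\<lambda>y. F (x - y) * \<kappa> y) = (\<lambda>y. 0)" by auto
  then show ?thesis by (simp only: conv_def) simp
 qed
 have "\<bar>conv F \<kappa> x - conv F \<kappa> y\<bar> = \<bar>LB z. F (x - z) * \<kappa> z - F (y - z) * \<kappa> z\<bar>"
  using conv_alt(3)[OF F2] by (simp add: conv_def)
 also have "\<dots> \<le> (LB z. L * norm (x - y) * \<kappa> z)"
 proof (rule integral_abs_bound[THEN order_trans], rule integral_mono)
  show "integrable lborel (\<lambda>z. \<bar>F (x - z) * \<kappa> z - F (y - z) * \<kappa> z\<bar>)"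
   by (intro integrable_abs Bochner_Integration.integrable_diff conv_alt(3) F2)
  show "integrable lborel (\<lambda>z. L * norm (x - y) * \<kappa> z)" using k by simp
  fix z
  have "\<bar>F (x - z) - F (y - z)\<bar> * \<kappa> z \<le> L * norm (x - y) * \<kappa> z"
   using L[of "x - z" "y - z"] by (intro mult_right_mono) (auto simp: \<kappa>_nonneg)
  then show "\<bar>F (x - z) * \<kappa> z - F (y - z) * \<kappa> z\<bar> \<le> L * norm (x - y) * \<kappa> z"
   by (simp add: left_diff_distrib[symmetric] abs_mult \<kappa>_nonneg)
 qed
 finally show "\<bar>conv F \<kappa> x - conv F \<kappa> y\<bar> \<le> L * norm (x - y)" using \<kappa>_total by simp
qed

lemma conv_Lipbs: "F \<in> Lipbs \<Longrightarrow> F \<in> L2 lborel \<Longrightarrow> conv F \<kappa> \<in> Lipbs"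
proof -
 assume F: "F \<in> Lipbs" and F2: "F \<in> L2 lborel"
 obtain L R where L: "\<And>x y. \<bar>F x - F y\<bar> \<le> L * norm (x - y)" and R: "\<And>x. norm x > R \<Longrightarrow> F x = 0"
  using Lipbs_obtain[OF F] by metis
 have "norm x \<le> R + r" if "conv F \<kappa> x \<noteq> 0" for x
 proof (rule ccontr)
  assume "\<not> norm x \<le> R + r"
  then have "conv F \<kappa> x = 0" by (intro conv_close(2)[OF F2 L R]) auto
  then show False using that by simp
 qed
 then show ?thesis using conv_close(3)[OF F2 L R] unfolding Lipbs_def by blast
qed

lemma conv_close_L2:
 assumes F2: "F \<in> L2 lborel" and L: "\<And>x y. \<bar>F x - F y\<bar> \<le> L * norm (x - y)" and R: "\<And>x. norm x > R \<Longrightarrow> F x = 0"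
  and R0: "R \<ge> 0" and r1: "r \<le> 1"
 shows "N2 (\<lambda>x. conv F \<kappa> x - F x) \<le> L * r * (sqrt pi * (R + 1))"
proof (rule power2_le_imp_le)
 have L0: "0 \<le> L" using order_trans[OF abs_ge_zero L[of 1 0]] by simp
 have "L2_sqnorm lborel (\<lambda>x. conv F \<kappa> x - F x) \<le> (NN x. ennreal ((L * r)^2) * indicator (cball (0::complex) (R + 1)) x)"
  unfolding L2_sqnorm_def
 proof (rule nn_integral_mono)
  fix x
  show "ennreal ((conv F \<kappa> x - F x)^2) \<le> ennreal ((L * r)^2) * indicator (cball 0 (R + 1)) x"
  proof (cases "norm x \<le> R + 1")
   case True
   have "(conv F \<kappa> x - F x)^2 \<le> (L * r)^2"
    using conv_close(1)[OF F2 L R] L0 r_pos by (intro abs_le_square_iff[THEN iffD1]) simp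
   then show ?thesis using True by simp
  next
   case False
   then have "conv F \<kappa> x = 0" using r1 by (intro conv_close(2)[OF F2 L R]) auto
   then show ?thesis using False R[of x] by simp
  qed
 qed
 also have "\<dots> = ennreal ((L * r)^2) * emeasure lborel (cball (0::complex) (R + 1))"
  by (rule nn_integral_cmult_indicator) simp
 also have "\<dots> = ennreal ((L * r * (sqrt pi * (R + 1)))^2)"
  using R0 by (simp add: euclid.emeasure_lborel_cball_complex ennreal_mult[symmetric] power_mult_distrib)
 finally show "(N2 (\<lambda>x. conv F \<kappa> x - F x))^2 \<le> (L * r * (sqrt pi * (R + 1)))^2"
  using ennreal_L2_norm_sq[OF L2_diff[OF conv_L2(1)[OF F2] F2]] by (metis ennreal_le_iff zero_le_power2)
qed (use r_pos R0 order_trans[OF abs_ge_zero L[of 1 0]] in simp)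

lemma grad_energy_L2_continuous:
 assumes "\<And>n. F n \<in> L2 lborel" "f \<in> L2 lborel" "(\<lambda>n. N2 (\<lambda>x. F n x - f x)) ----> 0"
 shows "(\<lambda>n. grad_energy (F n)) ----> grad_energy f"
proof -
 have "(\<lambda>n. N2 (conv (F n) k)) ----> N2 (conv f k)" if "kernel k r K" for k
 proof (rule LIM_zero_cancel, rule Lim_null_comparison[OF always_eventually])
  interpret k: kernel k r K by fact
  show "\<forall>n. norm (N2 (conv (F n) k) - N2 (conv f k)) \<le> (LB y. \<bar>k y\<bar>) * N2 (\<lambda>x. F n x - f x)"
  proof
   fix n
   have "norm (N2 (conv (F n) k) - N2 (conv f k)) \<le> N2 (\<lambda>x. conv (F n) k x - conv f k x)"
    using L2_norm_triangle_diff[OF k.conv_L2(1) k.conv_L2(1)] assms by simp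
   also have "(\<lambda>x. conv (F n) k x - conv f k x) = conv (\<lambda>x. F n x - f x) k" using k.conv_diff assms by auto
   also have "N2 \<dots> \<le> (LB y. \<bar>k y\<bar>) * N2 (\<lambda>x. F n x - f x)"
    by (intro k.conv_L2(2) L2_diff assms)
   finally show "norm (N2 (conv (F n) k) - N2 (conv f k)) \<le> (LB y. \<bar>k y\<bar>) * N2 (\<lambda>x. F n x - f x)" .
  qed
  show "(\<lambda>n. (LB y. \<bar>k y\<bar>) * N2 (\<lambda>x. F n x - f x)) ----> 0"
   using assms(3) by (rule tendsto_mult_right_zero)
 qed
 from this[OF g1.kernel_axioms] this[OF g2.kernel_axioms] show ?thesis
  unfolding grad_energy_def by (intro tendsto_intros)
qed

definition grad_form :: "(complex \<Rightarrow> real) \<Rightarrow> (complex \<Rightarrow> real) \<Rightarrow> real" where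
 "grad_form f h = (LB x. conv f (\<lambda>z. Re (g z)) x * conv h (\<lambda>z. Re (g z)) x)
  + (LB x. conv f (\<lambda>z. Im (g z)) x * conv h (\<lambda>z. Im (g z)) x)"

lemma grad_form_sym: "grad_form f h = grad_form h f"
 by (simp add: grad_form_def mult.commute)

lemma grad_form_self: "f \<in> L2 lborel \<Longrightarrow> grad_form f f = grad_energy f"
 by (simp add: grad_form_def grad_energy_def L2_norm_sq g1.conv_L2 g2.conv_L2 power2_eq_square[symmetric])

lemma grad_form_add:
 "f \<in> L2 lborel \<Longrightarrow> f' \<in> L2 lborel \<Longrightarrow> h \<in> L2 lborel \<Longrightarrow> grad_form (\<lambda>x. f x + f' x) h = grad_form f h + grad_form f' h"
 by (simp add: grad_form_def g1.conv_add g2.conv_add distrib_right L2_mult_integrable g1.conv_L2 g2.conv_L2)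

lemma grad_form_cmult: "grad_form (\<lambda>x. c * f x) h = c * grad_form f h"
 by (simp add: grad_form_def g1.conv_cmult g2.conv_cmult mult.assoc distrib_left)

end

text \<open>The squared positive part has the Lipschitz derivative 2 * max 0 x, so its Taylor
  remainder is quadratic.\<close>

lemma truncated_square_taylor:
 fixes a b :: real
 shows "\<bar>(max 0 b)^2 - (max 0 a)^2 + 2 * max 0 a * (a - b)\<bar> \<le> (a - b)^2"
proof -
 consider "a \<ge> 0" "b \<ge> 0" | "a \<ge> 0" "b < 0" | "a < 0" "b \<ge> 0" | "a < 0" "b < 0" by force
 then show ?thesis
 proof cases
  case 1
  have "b^2 - a^2 + 2 * a * (a - b) = (a - b)^2" by (simp add: power2_eq_square algebra_simps)
  then show ?thesis using 1 by simp
 next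
  case 2
  have "0 \<le> a * (a - 2 * b)" using 2 by simp
  moreover have "a * (a - 2 * b) = - (a^2) + 2 * a * (a - b)" by (simp add: power2_eq_square algebra_simps)
  moreover have "(a - b)^2 = a * (a - 2 * b) + b^2" by (simp add: power2_eq_square algebra_simps)
  ultimately show ?thesis using 2 zero_le_power2[of b] by simp
 next
  case 3
  then have "b^2 \<le> (b - a)^2" by simp
  then show ?thesis using 3 by (simp add: power2_commute)
 qed simp
qed

text \<open>Squaring the truncated paraboloid makes the gradient Lipschitz across the boundary of
  the disc, which is the smoothness that \<open>mollifier\<close> asks for.\<close>

definition bump :: "real \<Rightarrow> complex \<Rightarrow> real" where
 "bump r z = (max 0 (1 - (norm z / r)^2))^2"

definition bump_mass :: "real \<Rightarrow> real" where
 "bump_mass r = (LB z. bump r z)"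

definition moll :: "real \<Rightarrow> complex \<Rightarrow> real" where
 "moll r z = bump r z / bump_mass r"

definition moll_grad :: "real \<Rightarrow> complex \<Rightarrow> complex" where
 "moll_grad r z = (- 4 * max 0 (1 - (norm z / r)^2) / (r^2 * bump_mass r)) *\<^sub>R z"

lemma bump_borel [measurable]: "bump r \<in> borel_measurable borel"
 unfolding bump_def[abs_def] by simp

lemma bump_bounds: "0 \<le> bump r z" "bump r z \<le> 1"
proof -
 show "0 \<le> bump r z" by (simp add: bump_def)
 show "bump r z \<le> 1" unfolding bump_def by (rule power_le_one) auto
qed

lemma bump_supp: "r > 0 \<Longrightarrow> norm z > r \<Longrightarrow> max 0 (1 - (norm z / r)^2) = 0"
proof -
 assume "r > 0" "norm z > r"
 then have "1 \<le> (norm z / r)^2" by simp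
 then show ?thesis by simp
qed

lemma bump_kernel: "r > 0 \<Longrightarrow> kernel (bump r) r 1"
 by unfold_locales (use bump_bounds bump_supp in \<open>auto simp: bump_def\<close>)

lemma bump_mass_pos: assumes "r > 0" shows "bump_mass r > 0"
proof -
 interpret kernel "bump r" r 1 by (rule bump_kernel[OF assms])
 have "0 < 1/2 * measure lborel (ball (0::complex) (r/2))"
  using assms by simp
 also have "\<dots> = (LB z. 1/2 * indicator (ball (0::complex) (r/2)) z)"
  by simp
 also have "\<dots> \<le> bump_mass r"
  unfolding bump_mass_def
 proof (rule integral_mono)
  show "integrable lborel (\<lambda>z. 1/2 * indicat_real (ball (0::complex) (r/2)) z)"
   using emeasure_bounded_finite[of "ball (0::complex) (r/2)"] by simp
  show "integrable lborel (bump r)" using integrable_abs_kernel bump_bounds by simp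
  fix z :: complex
  show "1/2 * indicator (ball 0 (r/2)) z \<le> bump r z"
  proof (cases "z \<in> ball 0 (r/2)")
   case True
   then have "(norm z / r)^2 \<le> (1/2)^2" using assms by simp
   moreover have "(1/2::real)^2 = 1/4" by (simp add: power2_eq_square)
   ultimately have "3/4 \<le> max 0 (1 - (norm z / r)^2)" unfolding le_max_iff_disj by simp
   then have "(3/4)^2 \<le> bump r z" unfolding bump_def by (rule power_mono) simp
   then show ?thesis using True by (simp add: power2_eq_square)
  qed (simp add: bump_bounds)
 qed
 finally show ?thesis .
qed

text \<open>The first summand of the constant bounds the Taylor remainder, the second the gradient.
  For norm z \<le> 2 * r the increment of 1 - (norm z / r)^2 is at most 5 * norm h / r, which
  contributes 25 to the remainder; the quadratic part of that increment contributes 2.\<close>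

lemma moll_mollifier:
 assumes r: "r > 0"
 shows "mollifier (moll r) r (1 / bump_mass r) (moll_grad r) (27 / (r^2 * bump_mass r) + 4 / (r * bump_mass r))"
proof -
 note c = bump_mass_pos[OF r]
 let ?K = "27 / (r^2 * bump_mass r) + 4 / (r * bump_mass r)"
 let ?p = "\<lambda>z::complex. max 0 (1 - (norm z / r)^2)"
 have p1: "?p z \<le> 1" for z by simp
 have g_supp: "moll_grad r z = 0" if "norm z > r" for z using bump_supp[OF r that] by (simp add: moll_grad_def)
 show ?thesis
 proof unfold_locales
  show "moll r \<in> borel_measurable borel" unfolding moll_def[abs_def] by simp
  show "moll_grad r \<in> borel_measurable borel" unfolding moll_grad_def[abs_def] by simp
  show "moll r z = 0" if "norm z > r" for z using bump_supp[OF r that] by (simp add: moll_def bump_def)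
  show "\<bar>moll r z\<bar> \<le> 1 / bump_mass r" for z
   using bump_bounds[of r z] c by (simp add: moll_def divide_right_mono)
  show "0 \<le> moll r z" for z using bump_bounds c by (simp add: moll_def)
  show "(LB z. moll r z) = 1" using c by (simp add: moll_def bump_mass_def)
  show "moll_grad r z = 0" if "norm z > r" for z by (rule g_supp[OF that])
  show "norm (moll_grad r z) \<le> ?K" for z
  proof (cases "norm z > r")
   case True
   then show ?thesis using g_supp[OF True] r c by simp
  next
   case False
   have "norm (moll_grad r z) = 4 * ?p z / (r^2 * bump_mass r) * norm z"
    using c by (simp add: moll_grad_def)
   also have "\<dots> \<le> 4 * 1 / (r^2 * bump_mass r) * r"
    using False p1 c by (intro mult_mono divide_right_mono mult_left_mono) auto
   also have "\<dots> = 4 / (r * bump_mass r)" using r by (simp add: power2_eq_square)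
   finally show ?thesis using r c by (simp add: add_increasing)
  qed
  show "\<bar>moll r (z + h) - moll r z - moll_grad r z \<bullet> h\<bar> \<le> ?K * (norm h)^2" if h: "norm h \<le> r" for z h
  proof (cases "norm z > 2 * r")
   case True
   have "norm z \<le> norm (z + h) + norm h" using norm_triangle_ineq4[of "z + h" h] by simp
   then have "norm (z + h) > r" "norm z > r" using True h r by auto
   then show ?thesis using bump_supp[OF r, of z] bump_supp[OF r, of "z + h"] g_supp[of z] r c
    by (simp add: moll_def bump_def)
  next
   case False
   define a where "a = 1 - (norm z / r)^2"
   define b where "b = 1 - (norm (z + h) / r)^2"
   have "(norm (z + h))^2 = (norm z)^2 + 2 * (z \<bullet> h) + (norm h)^2"
    by (simp add: power2_norm_eq_inner inner_add_right inner_commute)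
   then have ab: "a - b = (2 * (z \<bullet> h) + (norm h)^2) / r^2"
    by (simp add: a_def b_def power_divide diff_divide_distrib[symmetric])
   have "\<bar>2 * (z \<bullet> h) + (norm h)^2\<bar> \<le> 2 * (norm z * norm h) + norm h * norm h"
    using Cauchy_Schwarz_ineq2[of z h] abs_triangle_ineq[of "2 * (z \<bullet> h)" "norm h * norm h"]
    by (simp add: power2_eq_square)
   also have "\<dots> \<le> 2 * (2 * r * norm h) + r * norm h"
    using False h by (intro add_mono mult_left_mono mult_right_mono) auto
   finally have "\<bar>a - b\<bar> \<le> 5 * r * norm h / r^2"
    unfolding ab abs_divide by (simp add: divide_right_mono)
   also have "\<dots> = 5 * norm h / r" using r by (simp add: power2_eq_square)
   finally have "(a - b)^2 \<le> (5 * norm h / r)^2"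
    using r by (intro abs_le_square_iff[THEN iffD1]) simp
   then have sq: "(a - b)^2 \<le> 25 * (norm h)^2 / r^2" by (simp add: power_divide)
   have m: "0 \<le> max 0 a" "max 0 a \<le> 1" by (auto simp: a_def)
   have eq: "(moll r (z + h) - moll r z - moll_grad r z \<bullet> h) * bump_mass r
     = ((max 0 b)^2 - (max 0 a)^2 + 2 * max 0 a * (a - b)) - 2 * max 0 a * (norm h)^2 / r^2"
    using c r unfolding moll_def bump_def moll_grad_def a_def[symmetric] b_def[symmetric] ab
    by (simp add: field_simps)
   have "\<bar>moll r (z + h) - moll r z - moll_grad r z \<bullet> h\<bar> * bump_mass r
     = \<bar>(moll r (z + h) - moll r z - moll_grad r z \<bullet> h) * bump_mass r\<bar>" using c by (simp add: abs_mult)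
   also have "\<dots> \<le> \<bar>(max 0 b)^2 - (max 0 a)^2 + 2 * max 0 a * (a - b)\<bar> + \<bar>2 * max 0 a * (norm h)^2 / r^2\<bar>"
    unfolding eq by (rule abs_triangle_ineq4)
   also have "\<dots> \<le> 25 * (norm h)^2 / r^2 + 2 * (norm h)^2 / r^2"
   proof (rule add_mono)
    show "\<bar>(max 0 b)^2 - (max 0 a)^2 + 2 * max 0 a * (a - b)\<bar> \<le> 25 * (norm h)^2 / r^2"
     using truncated_square_taylor[of b a] sq by simp
    have "2 * max 0 a * (norm h)^2 \<le> 2 * 1 * (norm h)^2" using m by (intro mult_right_mono mult_left_mono) auto
    then show "\<bar>2 * max 0 a * (norm h)^2 / r^2\<bar> \<le> 2 * (norm h)^2 / r^2"
     using m by (simp add: divide_right_mono)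
   qed
   also have "\<dots> = 27 / (r^2 * bump_mass r) * (norm h)^2 * bump_mass r" using c by simp
   finally have "\<bar>moll r (z + h) - moll r z - moll_grad r z \<bullet> h\<bar> \<le> 27 / (r^2 * bump_mass r) * (norm h)^2"
    using c by (simp only: mult_le_cancel_right_pos)
   also have "\<dots> \<le> ?K * (norm h)^2" using r c by (intro mult_right_mono) auto
   finally show ?thesis .
  qed
 qed (use r in auto)
qed

section \<open>The Sobolev space of a planar conformal metric is Hilbertian\<close>

context planar
begin

lemma lipc_compare:
 fixes F :: "complex \<Rightarrow> real"
 assumes "planar d' \<rho>' s' W' c1' c2'" and c: "c > 0"
  and ev: "\<forall>\<^sub>F y in at z. d' y z \<le> c * d y z"
 shows "lipc d F z \<le> ennreal c * lipc d' F z"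
proof (cases "lipc d' F z = \<infinity>")
 case True
 then show ?thesis using c by simp
next
 case False
 interpret p': planar d' \<rho>' s' W' c1' c2' by fact
 show ?thesis
 proof (rule ennreal_le_epsilon)
  fix e :: real assume e: "e > 0"
  define C where "C = lipc d' F z + ennreal (e / c)"
  have "lipc d' F z < C" using False e c
   unfolding C_def by simp
  then have "\<forall>\<^sub>F y in at z. ennreal (\<bar>F y - F z\<bar> / d' y z) < C" unfolding lipc_def by (rule Limsup_lessD)
  moreover have "\<forall>\<^sub>F y in at z. y \<noteq> z" by (simp add: eventually_at_filter)
  ultimately have "\<forall>\<^sub>F y in at z. ennreal (\<bar>F y - F z\<bar> / d y z) \<le> ennreal c * C"
   using ev
  proof eventually_elim
   case (elim y)
   have pos: "d y z > 0" "d' y z > 0" using elim d_pos p'.d_pos by auto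
   then have "\<bar>F y - F z\<bar> / d y z \<le> c * (\<bar>F y - F z\<bar> / d' y z)"
    using elim c mult_left_mono[of "d' y z" "c * d y z" "\<bar>F y - F z\<bar>"] by (simp add: field_simps)
   then have "ennreal (\<bar>F y - F z\<bar> / d y z) \<le> ennreal c * ennreal (\<bar>F y - F z\<bar> / d' y z)"
    using c pos by (subst ennreal_mult[symmetric]) (auto intro: ennreal_leI)
   also have "\<dots> \<le> ennreal c * C" using elim by (intro mult_left_mono) auto
   finally show ?case .
  qed
  then have "lipc d F z \<le> ennreal c * C" unfolding lipc_def by (rule Limsup_bounded)
  also have "\<dots> = ennreal c * lipc d' F z + ennreal e"
   unfolding C_def distrib_left using c e by (simp add: ennreal_mult[symmetric])
  finally show "lipc d F z \<le> ennreal c * lipc d' F z + ennreal e" .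
 qed
qed

lemma L2_M: "f \<in> L2 M \<longleftrightarrow> f \<in> L2 lborel"
 and L2_M_le: "f \<in> borel_measurable borel \<Longrightarrow> L2_sqnorm M f \<le> ennreal c2 * L2_sqnorm lborel f"
 and L2_M_ge: "f \<in> borel_measurable borel \<Longrightarrow> ennreal c1 * L2_sqnorm lborel f \<le> L2_sqnorm M f"
proof -
 have eq: "L2_sqnorm M f = (NN z. ennreal (\<rho> z) * ennreal ((f z)^2))" if [measurable]: "f \<in> borel_measurable borel" for f
  unfolding L2_sqnorm_def by (rule nn_integral_density) auto
 show le: "L2_sqnorm M f \<le> ennreal c2 * L2_sqnorm lborel f" if [measurable]: "f \<in> borel_measurable borel" for f
  unfolding eq[OF that] unfolding L2_sqnorm_def
  by (subst nn_integral_cmult[symmetric]) (auto intro!: nn_integral_mono mult_right_mono ennreal_leI \<rho>_upper)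
 show ge: "ennreal c1 * L2_sqnorm lborel f \<le> L2_sqnorm M f" if [measurable]: "f \<in> borel_measurable borel" for f
  unfolding eq[OF that] unfolding L2_sqnorm_def
  by (subst nn_integral_cmult[symmetric]) (auto intro!: nn_integral_mono mult_right_mono ennreal_leI \<rho>_lower)
 show "f \<in> L2 M \<longleftrightarrow> f \<in> L2 lborel"
 proof (cases "f \<in> borel_measurable borel")
  case True
  have "L2_sqnorm lborel f < \<infinity>" if "L2_sqnorm M f < \<infinity>"
  proof (rule ccontr)
   assume "\<not> L2_sqnorm lborel f < \<infinity>"
   then have "L2_sqnorm lborel f = \<infinity>" by (simp add: less_top[symmetric])
   then show False using ge[OF True] that c1_pos by simp
  qed
  moreover have "L2_sqnorm M f < \<infinity>" if "L2_sqnorm lborel f < \<infinity>"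
  proof -
   have "L2_sqnorm M f \<le> ennreal c2 * L2_sqnorm lborel f" by (rule le[OF True])
   also have "\<dots> < \<infinity>" using that by (simp add: ennreal_mult_less_top)
   finally show ?thesis .
  qed
  ultimately have "L2_sqnorm M f < \<infinity> \<longleftrightarrow> L2_sqnorm lborel f < \<infinity>" by auto
  moreover have "f \<in> borel_measurable M" "f \<in> borel_measurable lborel" using True by auto
  ultimately show ?thesis unfolding L2_def by simp
 next
  case False
  then show ?thesis unfolding L2_def by simp
 qed
qed

lemma L2_norm_M_le: "f \<in> L2 lborel \<Longrightarrow> L2_norm M f \<le> sqrt c2 * N2 f"
 and L2_norm_M_ge: "f \<in> L2 lborel \<Longrightarrow> sqrt c1 * N2 f \<le> L2_norm M f"
proof -
 assume f: "f \<in> L2 lborel"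
 then have b: "f \<in> borel_measurable borel" by (simp add: L2_def)
 from f have fM: "f \<in> L2 M" by (simp only: L2_M)
 have "ennreal ((L2_norm M f)^2) \<le> ennreal (c2 * (N2 f)^2)"
  using L2_M_le[OF b] c2_pos by (simp add: ennreal_L2_norm_sq[OF f] ennreal_L2_norm_sq[OF fM] ennreal_mult)
 then have "(L2_norm M f)^2 \<le> (sqrt c2 * N2 f)^2" using c2_pos by (simp add: power_mult_distrib)
 then show "L2_norm M f \<le> sqrt c2 * N2 f"
  by (rule power2_le_imp_le) (use c2_pos in \<open>simp add: L2_norm_nonneg\<close>)
 have "ennreal (c1 * (N2 f)^2) \<le> ennreal ((L2_norm M f)^2)"
  using L2_M_ge[OF b] c1_pos by (simp add: ennreal_L2_norm_sq[OF f] ennreal_L2_norm_sq[OF fM] ennreal_mult)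
 then have "(sqrt c1 * N2 f)^2 \<le> (L2_norm M f)^2" using c1_pos by (simp add: power_mult_distrib)
 then show "sqrt c1 * N2 f \<le> L2_norm M f"
  by (rule power2_le_imp_le) (rule L2_norm_nonneg)
qed

end

lemma Lipbs_L2: "F \<in> Lipbs \<Longrightarrow> F \<in> L2 lborel"
proof -
 assume F: "F \<in> Lipbs"
 have [measurable]: "F \<in> borel_measurable borel" by (rule Lipbs_borel[OF F])
 obtain L R where L: "L > 0" "\<And>x y. \<bar>F x - F y\<bar> \<le> L * norm (x - y)" and R: "R > 0" "\<And>x. norm x > R \<Longrightarrow> F x = 0"
  using Lipbs_obtain[OF F] by auto
 have "compact (cball (0::complex) R)" by simp
 moreover have "continuous_on (cball 0 R) F" using Lipschitz_continuous[OF L(2)] continuous_on_subset by auto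
 ultimately have "bounded (F ` cball 0 R)" using compact_continuous_image compact_imp_bounded by blast
 then obtain B where "\<forall>y\<in>F ` cball 0 R. norm y \<le> B" unfolding bounded_iff by auto
 then have B: "\<bar>F x\<bar> \<le> B" if "norm x \<le> R" for x using that by auto
 have "L2_sqnorm lborel F \<le> (NN x. ennreal (B^2) * indicator (cball (0::complex) R) x)"
  unfolding L2_sqnorm_def
 proof (rule nn_integral_mono)
  fix x
  show "ennreal ((F x)^2) \<le> ennreal (B^2) * indicator (cball 0 R) x"
  proof (cases "norm x \<le> R")
   case True
   then have "\<bar>F x\<bar> \<le> \<bar>B\<bar>" using B[of x] by simp
   then have "(F x)^2 \<le> B^2" by (rule abs_le_square_iff[THEN iffD1])
   then show ?thesis using True by simp
  qed (use R in simp)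
 qed
 also have "\<dots> = ennreal (B^2) * emeasure lborel (cball (0::complex) R)" by (rule nn_integral_cmult_indicator) simp
 also have "\<dots> < \<infinity>" using emeasure_bounded_finite[of "cball (0::complex) R"] by (simp add: ennreal_mult_less_top)
 finally show ?thesis by (simp add: L2_def)
qed

text \<open>\<rho> is the square of the conformal factor of \<open>d\<close>, as the area density in
  dimension two has to be. The exempted origin is a null set.\<close>

locale conformal = planar d \<rho> s W c1 c2 for d \<rho> s W c1 c2 +
 assumes conformal: "z \<noteq> 0 \<Longrightarrow> ((\<lambda>y. d y z / norm (y - z)) \<longlongrightarrow> sqrt (\<rho> z)) (at z)"
begin

text \<open>The slope scales with the inverse conformal factor, so its square scales with the
  inverse of \<rho>, which the area density cancels. The ratio of the distances only converges to
  sqrt (\<rho> z); hence comparison with constants on either side, followed by a limit.\<close>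

lemma lipc_conformal:
 fixes F :: "complex \<Rightarrow> real"
 assumes F: "F \<in> Lipbs" and z: "z \<noteq> 0"
 shows "(lipc d F z)^2 * ennreal (\<rho> z) = (lipe F z)^2"
proof -
 define w where "w = sqrt (\<rho> z)"
 have \<rho>: "\<rho> z > 0" using c1_pos \<rho>_lower[of z] by simp
 then have w: "w > 0" "\<rho> z = w^2" by (auto simp: w_def)
 have lim: "((\<lambda>y. d y z / norm (y - z)) \<longlongrightarrow> w) (at z)" using conformal[OF z] by (simp add: w_def)
 have ne: "\<forall>\<^sub>F y in at z. y \<noteq> z" by (simp add: eventually_at_filter)
 have up: "lipe F z \<le> ennreal c * lipc d F z" if "c > w" for c
 proof (rule euclid.lipc_compare[OF planar_axioms])
  show "c > 0" using that w by simp
  show "\<forall>\<^sub>F y in at z. d y z \<le> c * norm (y - z)"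
   using order_tendstoD(2)[OF lim that] ne by eventually_elim (simp add: field_simps)
 qed
 have low: "lipc d F z \<le> ennreal (1 / c) * lipe F z" if "c < w" "c > 0" for c
 proof (rule lipc_compare[OF euclid.planar_axioms])
  show "1 / c > 0" using that by simp
  show "\<forall>\<^sub>F y in at z. norm (y - z) \<le> 1 / c * d y z"
   using order_tendstoD(1)[OF lim that(1)] ne by eventually_elim (use that in \<open>simp add: field_simps\<close>)
 qed
 obtain L R where L: "L > 0" "\<And>x y. \<bar>F x - F y\<bar> \<le> L * norm (x - y)" using Lipbs_obtain[OF F] by metis
 have "lipe F z \<le> ennreal L" by (rule euclid.lipc_le) (use L in auto)
 then obtain b where b: "b \<ge> 0" "lipe F z = ennreal b" by (cases "lipe F z") (auto simp: top_unique)
 have "lipc d F z \<le> ennreal (1 / (w / 2)) * ennreal b" using low[of "w/2"] w b by simp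
 then obtain a where a: "a \<ge> 0" "lipc d F z = ennreal a"
  using w b by (cases "lipc d F z") (auto simp: top_unique ennreal_mult[symmetric])
 have "b \<le> c * a" if "c > w" for c
  using up[OF that] that w a b by (simp add: ennreal_mult[symmetric])
 then have "\<forall>\<^sub>F c in at_right w. b \<le> c * a"
  unfolding eventually_at_right_field by (intro exI[of _ "w + 1"]) simp
 moreover have "((\<lambda>c. c * a) \<longlongrightarrow> w * a) (at_right w)" by (intro tendsto_intros)
 ultimately have "b \<le> w * a" by (intro tendsto_lowerbound[where F = "at_right w"]) auto
 moreover have "c * a \<le> b" if "c < w" "c > 0" for c
 proof -
  have "a \<le> 1 / c * b" using low[OF that] that a b by (simp add: ennreal_mult[symmetric])
  then show ?thesis using that by (simp add: field_simps)
 qed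
 then have "\<forall>\<^sub>F c in at_left w. c * a \<le> b"
  unfolding eventually_at_left_field using w by auto
 moreover have "((\<lambda>c. c * a) \<longlongrightarrow> w * a) (at_left w)" by (intro tendsto_intros)
 ultimately have "w * a \<le> b" by (intro tendsto_upperbound[where F = "at_left w"]) auto
 with \<open>b \<le> w * a\<close> have "b = w * a" by simp
 then show ?thesis using a b w by (simp add: ennreal_power ennreal_mult[symmetric] power_mult_distrib mult.commute)
qed

lemma energy_conformal: "F \<in> Lipbs \<Longrightarrow> energy d \<rho> F = (NN z. (lipe F z)^2)"
 unfolding energy_def
proof (rule nn_integral_cong_AE)
 assume F: "F \<in> Lipbs"
 have "AE z in lborel. z \<notin> {0::complex}" by (rule AE_not_in) (simp add: null_sets_def)
 then show "AE z in lborel. (lipc d F z)^2 * ennreal (\<rho> z) = (lipe F z)^2"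
  by eventually_elim (simp add: lipc_conformal[OF F])
qed

end

interpretation mol: mollifier "moll (invS n)" "invS n" "1 / bump_mass (invS n)"
 "moll_grad (invS n)"
 "27 / ((invS n)^2 * bump_mass (invS n)) + 4 / ((invS n) * bump_mass (invS n))" for n
 by (rule moll_mollifier) simp

lemma null_comparison:
 fixes f g :: "nat \<Rightarrow> real"
 shows "g ----> 0 \<Longrightarrow> (\<And>n. norm (f n) \<le> g n) \<Longrightarrow> f ----> 0"
 by (rule Lim_null_comparison[OF always_eventually[OF allI]])

context planar
begin

section \<open>The Sobolev functions form a vector space\<close>

lemma energy_finite: "F \<in> Lipbs \<Longrightarrow> energy d \<rho> F < \<infinity>"
proof -
 assume F: "F \<in> Lipbs"
 obtain L R where L: "L > 0" "\<And>x y. \<bar>F x - F y\<bar> \<le> L * norm (x - y)" and R: "R > 0" "\<And>x. norm x > R \<Longrightarrow> F x = 0"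
  using Lipbs_obtain[OF F] by auto
 have "lipc d F z \<le> ennreal (L / s)" for z by (rule lipc_le_Lipschitz) (use L in auto)
 moreover have "lipc d F z = 0" if "norm z > R" for z
 proof -
  have "\<forall>\<^sub>F y in at z. y \<in> {y. norm y > R}"
   using that by (intro topological_tendstoD tendsto_ident_at) (auto intro: open_Collect_less continuous_intros)
  then have "\<forall>\<^sub>F y in at z. ennreal (\<bar>F y - F z\<bar> / d y z) \<le> 0"
   by eventually_elim (simp add: R that)
  then have "lipc d F z \<le> 0" unfolding lipc_def by (rule Limsup_bounded)
  then show ?thesis by simp
 qed
 ultimately have le: "(lipc d F z)^2 * ennreal (\<rho> z) \<le> ((ennreal (L / s))^2 * ennreal c2) * indicator (cball 0 R) z" for z
  by (cases "norm z > R") (auto intro!: mult_mono power_mono ennreal_leI \<rho>_upper)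
 have "energy d \<rho> F \<le> (NN z. ((ennreal (L / s))^2 * ennreal c2) * indicator (cball (0::complex) R) z)"
  unfolding energy_def by (rule nn_integral_mono) (rule le)
 also have "\<dots> = ((ennreal (L / s))^2 * ennreal c2) * emeasure lborel (cball (0::complex) R)"
  by (rule nn_integral_cmult_indicator) simp
 also have "\<dots> < \<infinity>" using emeasure_bounded_finite[of "cball (0::complex) R"] L s_pos ennreal_power[of "L / s" 2]
  by (simp add: ennreal_mult_less_top)
 finally show ?thesis .
qed

lemma Lipbs_approx_const: "F \<in> Lipbs \<Longrightarrow> Lipbs_approx \<rho> F (\<lambda>n. F)"
 by (simp add: Lipbs_approx_def L2_sqnorm_def)

lemma Lipbs_L2_M: "F \<in> Lipbs \<Longrightarrow> F \<in> L2 M"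
 by (simp only: L2_M Lipbs_L2)

lemma Lipbs_Sob: "F \<in> Lipbs \<Longrightarrow> F \<in> Sob d \<rho>"
 unfolding Sob_def using Lipbs_approx_const[of F] energy_finite[of F] Lipbs_L2_M[of F] by auto

lemma Cheeger_le_energy: "F \<in> Lipbs \<Longrightarrow> Cheeger d \<rho> F \<le> energy d \<rho> F"
 unfolding Cheeger_def
 by (rule INF_lower2[of "\<lambda>n. F"]) (auto simp: Lipbs_approx_const Liminf_const)

lemma Cheeger_finite: "f \<in> Sob d \<rho> \<Longrightarrow> Cheeger d \<rho> f < \<infinity>"
proof -
 assume "f \<in> Sob d \<rho>"
 then obtain F where F: "Lipbs_approx \<rho> f F" "(SUP n. energy d \<rho> (F n)) < \<infinity>" unfolding Sob_def by auto
 have "Cheeger d \<rho> f \<le> liminf (\<lambda>n. energy d \<rho> (F n))"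
  unfolding Cheeger_def by (rule INF_lower) (simp add: F)
 also have "\<dots> \<le> limsup (\<lambda>n. energy d \<rho> (F n))" by (rule Liminf_le_Limsup) simp
 also have "\<dots> \<le> (SUP n. energy d \<rho> (F n))"
  by (intro Limsup_bounded always_eventually allI SUP_upper UNIV_I)
 finally show ?thesis using F(2) by simp
qed

lemma Sob_L2: "f \<in> Sob d \<rho> \<Longrightarrow> f \<in> L2 M" "f \<in> Sob d \<rho> \<Longrightarrow> f \<in> L2 lborel"
 by (auto simp: Sob_def L2_M)

lemma Sob_norm_sq:
 assumes "f \<in> Sob d \<rho>"
 shows "(Sob_norm d \<rho> f)^2 = (L2_norm M f)^2 + enn2real (Cheeger d \<rho> f)"
proof -
 have eq: "L2_sqnorm M f + Cheeger d \<rho> f = ennreal ((L2_norm M f)^2 + enn2real (Cheeger d \<rho> f))"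
  using ennreal_L2_norm_sq[OF Sob_L2(1)[OF assms]] Cheeger_finite[OF assms] by simp
 have "enn2real (L2_sqnorm M f + Cheeger d \<rho> f) = (L2_norm M f)^2 + enn2real (Cheeger d \<rho> f)"
  unfolding eq by (rule enn2real_ennreal) simp
 then show ?thesis by (simp add: Sob_norm_def)
qed

lemma lipc_add_le: "lipc d (\<lambda>z. F z + G z) z \<le> lipc d F z + lipc d G z"
proof (cases "lipc d F z = \<infinity> \<or> lipc d G z = \<infinity>")
 case False
 then have fin: "lipc d F z \<noteq> \<infinity>" "lipc d G z \<noteq> \<infinity>" by auto
 show ?thesis
 proof (rule ennreal_le_epsilon)
  fix e :: real assume e: "e > 0"
  have lt: "x < x + ennreal (e / 2)" if "x \<noteq> \<infinity>" for x :: ennreal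
   using that e by simp
  have "\<forall>\<^sub>F y in at z. ennreal (\<bar>F y - F z\<bar> / d y z) < lipc d F z + ennreal (e / 2)"
   using lt[OF fin(1)] unfolding lipc_def by (rule Limsup_lessD)
  moreover have "\<forall>\<^sub>F y in at z. ennreal (\<bar>G y - G z\<bar> / d y z) < lipc d G z + ennreal (e / 2)"
   using lt[OF fin(2)] unfolding lipc_def by (rule Limsup_lessD)
  ultimately have "\<forall>\<^sub>F y in at z. ennreal (\<bar>F y + G y - (F z + G z)\<bar> / d y z)
    \<le> (lipc d F z + ennreal (e / 2)) + (lipc d G z + ennreal (e / 2))"
  proof eventually_elim
   case (elim y)
   have "\<bar>F y + G y - (F z + G z)\<bar> / d y z \<le> \<bar>F y - F z\<bar> / d y z + \<bar>G y - G z\<bar> / d y z"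
    unfolding add_divide_distrib[symmetric] by (intro divide_right_mono) (auto simp: d_nonneg)
   then have "ennreal (\<bar>F y + G y - (F z + G z)\<bar> / d y z) \<le> ennreal (\<bar>F y - F z\<bar> / d y z) + ennreal (\<bar>G y - G z\<bar> / d y z)"
    by (simp add: d_nonneg flip: ennreal_plus)
   also have "\<dots> \<le> (lipc d F z + ennreal (e / 2)) + (lipc d G z + ennreal (e / 2))"
    using elim by (intro add_mono) auto
   finally show ?case .
  qed
  then have "lipc d (\<lambda>z. F z + G z) z \<le> (lipc d F z + ennreal (e / 2)) + (lipc d G z + ennreal (e / 2))"
   unfolding lipc_def by (rule Limsup_bounded)
  also have "\<dots> = lipc d F z + lipc d G z + (ennreal (e / 2) + ennreal (e / 2))" by simp
  also have "ennreal (e / 2) + ennreal (e / 2) = ennreal e" using e by (simp flip: ennreal_plus)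
  finally show "lipc d (\<lambda>z. F z + G z) z \<le> lipc d F z + lipc d G z + ennreal e" .
 qed
qed auto

lemma lipc_cmult_le: "lipc d (\<lambda>z. c * F z) z \<le> ennreal \<bar>c\<bar> * lipc d F z"
proof -
 have "lipc d (\<lambda>z. c * F z) z = Limsup (at z) (\<lambda>y. ennreal \<bar>c\<bar> * ennreal (\<bar>F y - F z\<bar> / d y z))"
  unfolding lipc_def
  by (rule arg_cong2[where f = Limsup], rule refl, rule ext)
   (simp add: ennreal_mult[symmetric] d_nonneg abs_mult[symmetric] right_diff_distrib)
 also have "continuous_on UNIV (\<lambda>x. ennreal \<bar>c\<bar> * x)"
  unfolding continuous_on_def by (auto intro!: ennreal_tendsto_cmult tendsto_ident_at)
 then have "Limsup (at z) (\<lambda>y. ennreal \<bar>c\<bar> * ennreal (\<bar>F y - F z\<bar> / d y z)) = ennreal \<bar>c\<bar> * lipc d F z"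
  unfolding lipc_def by (intro Limsup_compose_continuous_mono) (auto intro!: monoI mult_left_mono)
 finally show ?thesis by simp
qed

lemma energy_cmult_le:
 assumes F: "F \<in> Lipbs" shows "energy d \<rho> (\<lambda>z. c * F z) \<le> ennreal (c^2) * energy d \<rho> F"
proof -
 have [measurable]: "lipc d F \<in> borel_measurable borel" by (rule Lipbs_lipc_measurable[OF F])
 have "energy d \<rho> (\<lambda>z. c * F z) \<le> (NN z. ennreal (c^2) * ((lipc d F z)^2 * ennreal (\<rho> z)))"
  unfolding energy_def
 proof (rule nn_integral_mono)
  fix z
  have "(lipc d (\<lambda>z. c * F z) z)^2 \<le> (ennreal \<bar>c\<bar> * lipc d F z)^2"
   by (intro power_mono lipc_cmult_le) simp
  then show "(lipc d (\<lambda>z. c * F z) z)^2 * ennreal (\<rho> z) \<le> ennreal (c^2) * ((lipc d F z)^2 * ennreal (\<rho> z))"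
   by (simp add: power_mult_distrib ennreal_power mult.assoc[symmetric] mult_right_mono)
 qed
 also have "\<dots> = ennreal (c^2) * energy d \<rho> F" unfolding energy_def by (rule nn_integral_cmult) measurable
 finally show ?thesis .
qed

lemma ennreal_power2_add_le: "(a + b)^2 \<le> 2 * a^2 + 2 * (b :: ennreal)^2"
proof (cases a; cases b)
 fix x y assume xy: "0 \<le> x" "a = ennreal x" "0 \<le> y" "b = ennreal y"
 have "(x + y)^2 \<le> 2 * x^2 + 2 * y^2" using zero_le_power2[of "x - y"] by (simp add: power2_sum power2_diff)
 then have "ennreal ((x + y)^2) \<le> ennreal (2 * x^2 + 2 * y^2)" by (rule ennreal_leI)
 also have "\<dots> = 2 * a^2 + 2 * b^2" using xy by (simp add: ennreal_mult ennreal_power)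
 also have "ennreal ((x + y)^2) = (a + b)^2" using xy by (simp add: ennreal_power[symmetric])
 finally show ?thesis .
qed (auto simp: power2_eq_square ennreal_mult_top)

lemma energy_add_le:
 assumes F: "F \<in> Lipbs" and G: "G \<in> Lipbs"
 shows "energy d \<rho> (\<lambda>z. F z + G z) \<le> 2 * energy d \<rho> F + 2 * energy d \<rho> G"
proof -
 have [measurable]: "lipc d F \<in> borel_measurable borel" "lipc d G \<in> borel_measurable borel"
  by (rule Lipbs_lipc_measurable[OF F], rule Lipbs_lipc_measurable[OF G])
 have "energy d \<rho> (\<lambda>z. F z + G z) \<le> (NN z. 2 * ((lipc d F z)^2 * ennreal (\<rho> z)) + 2 * ((lipc d G z)^2 * ennreal (\<rho> z)))"
  unfolding energy_def
 proof (rule nn_integral_mono)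
  fix z
  have "(lipc d (\<lambda>z. F z + G z) z)^2 \<le> (lipc d F z + lipc d G z)^2" by (intro power_mono lipc_add_le) simp
  also have "\<dots> \<le> 2 * (lipc d F z)^2 + 2 * (lipc d G z)^2" by (rule ennreal_power2_add_le)
  finally have "(lipc d (\<lambda>z. F z + G z) z)^2 * ennreal (\<rho> z) \<le> (2 * (lipc d F z)^2 + 2 * (lipc d G z)^2) * ennreal (\<rho> z)"
   by (rule mult_right_mono) simp
  then show "(lipc d (\<lambda>z. F z + G z) z)^2 * ennreal (\<rho> z) \<le> 2 * ((lipc d F z)^2 * ennreal (\<rho> z)) + 2 * ((lipc d G z)^2 * ennreal (\<rho> z))"
   by (simp only: distrib_right mult.assoc)
 qed
 also have "\<dots> = 2 * energy d \<rho> F + 2 * energy d \<rho> G"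
  unfolding energy_def by (subst nn_integral_add, measurable, subst (1 2) nn_integral_cmult, measurable)
 finally show ?thesis .
qed

lemma Lipbs_approx_M:
 assumes f: "f \<in> L2 M"
 shows "Lipbs_approx \<rho> f F \<longleftrightarrow> (\<forall>n. F n \<in> Lipbs) \<and> (\<lambda>n. L2_norm M (\<lambda>z. F n z - f z)) ----> 0"
proof (cases "\<forall>n. F n \<in> Lipbs")
 case True
 then have "(\<lambda>z. F n z - f z) \<in> L2 M" for n by (intro L2_diff Lipbs_L2_M f) simp
 then show ?thesis unfolding Lipbs_approx_def by (subst tendsto_L2_sqnorm_iff) (simp_all add: True)
qed (auto simp: Lipbs_approx_def)

lemma Sob_cmult: assumes "f \<in> Sob d \<rho>" shows "(\<lambda>z. c * f z) \<in> Sob d \<rho>"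
proof -
 obtain F where F: "Lipbs_approx \<rho> f F" "(SUP n. energy d \<rho> (F n)) < \<infinity>" and f: "f \<in> L2 M"
  using assms unfolding Sob_def by auto
 have FL: "F n \<in> Lipbs" for n using F(1) by (simp add: Lipbs_approx_def)
 have dL: "(\<lambda>z. F n z - f z) \<in> L2 M" for n by (intro L2_diff Lipbs_L2_M FL f)
 have "(\<lambda>n. \<bar>c\<bar> * L2_norm M (\<lambda>z. F n z - f z)) ----> 0"
  using F(1) unfolding Lipbs_approx_M[OF f] by (intro tendsto_mult_right_zero) simp
 then have A: "Lipbs_approx \<rho> (\<lambda>z. c * f z) (\<lambda>n z. c * F n z)"
  by (simp add: Lipbs_approx_M[OF L2_cmult[OF f]] L2_norm_cmult[OF dL, symmetric] right_diff_distrib Lipbs_cmult[OF FL])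
 have "(SUP n. energy d \<rho> (\<lambda>z. c * F n z)) \<le> ennreal (c^2) * (SUP n. energy d \<rho> (F n))"
  by (intro SUP_least order_trans[OF energy_cmult_le[OF FL]] mult_left_mono SUP_upper) auto
 also have "\<dots> < \<infinity>" using F(2) by (simp add: ennreal_mult_less_top)
 finally show ?thesis using A L2_cmult[OF f] unfolding Sob_def by auto
qed

lemma Sob_add: assumes "f \<in> Sob d \<rho>" "g \<in> Sob d \<rho>" shows "(\<lambda>z. f z + g z) \<in> Sob d \<rho>"
proof -
 obtain F where F: "Lipbs_approx \<rho> f F" "(SUP n. energy d \<rho> (F n)) < \<infinity>" and f: "f \<in> L2 M"
  using assms(1) unfolding Sob_def by auto
 obtain G where G: "Lipbs_approx \<rho> g G" "(SUP n. energy d \<rho> (G n)) < \<infinity>" and g: "g \<in> L2 M"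
  using assms(2) unfolding Sob_def by auto
 have FL: "F n \<in> Lipbs" "G n \<in> Lipbs" for n using F(1) G(1) by (auto simp: Lipbs_approx_def)
 have dL: "(\<lambda>z. F n z - f z) \<in> L2 M" "(\<lambda>z. G n z - g z) \<in> L2 M" for n by (intro L2_diff Lipbs_L2_M FL f g)+
 have "(\<lambda>n. L2_norm M (\<lambda>z. F n z - f z) + L2_norm M (\<lambda>z. G n z - g z)) ----> 0"
  using F(1) G(1) unfolding Lipbs_approx_M[OF f] Lipbs_approx_M[OF g] by (intro tendsto_add_zero) simp_all
 moreover have "norm (L2_norm M (\<lambda>z. (F n z + G n z) - (f z + g z))) \<le> L2_norm M (\<lambda>z. F n z - f z) + L2_norm M (\<lambda>z. G n z - g z)" for n
  using L2_norm_triangle[OF dL(1)[of n] dL(2)[of n]] by (simp add: L2_norm_nonneg algebra_simps)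
 ultimately have "(\<lambda>n. L2_norm M (\<lambda>z. (F n z + G n z) - (f z + g z))) ----> 0"
  by (rule null_comparison)
 then have A: "Lipbs_approx \<rho> (\<lambda>z. f z + g z) (\<lambda>n z. F n z + G n z)"
  by (simp add: Lipbs_approx_M[OF L2_add[OF f g]] Lipbs_add[OF FL])
 have "(SUP n. energy d \<rho> (\<lambda>z. F n z + G n z)) \<le> 2 * (SUP n. energy d \<rho> (F n)) + 2 * (SUP n. energy d \<rho> (G n))"
  by (intro SUP_least order_trans[OF energy_add_le[OF FL]] add_mono mult_left_mono SUP_upper) auto
 also have "\<dots> < \<infinity>" using F(2) G(2) by (simp add: ennreal_mult_less_top)
 finally show ?thesis using A L2_add[OF f g] unfolding Sob_def by auto
qed

lemma Sob_diff: "f \<in> Sob d \<rho> \<Longrightarrow> g \<in> Sob d \<rho> \<Longrightarrow> (\<lambda>z. f z - g z) \<in> Sob d \<rho>"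
 using Sob_add[of f "\<lambda>z. - 1 * g z"] Sob_cmult[of g "- 1"] by simp

text \<open>The density lies between two positive constants, so convergence may be tested with
  Lebesgue measure, on whose L2 space convolution acts.\<close>

lemma Lipbs_approx_iff:
 assumes F: "\<And>n. F n \<in> Lipbs" and f: "f \<in> L2 lborel"
 shows "Lipbs_approx \<rho> f F \<longleftrightarrow> (\<lambda>n. N2 (\<lambda>z. F n z - f z)) ----> 0"
proof -
 have dL: "(\<lambda>z. F n z - f z) \<in> L2 lborel" for n by (intro L2_diff Lipbs_L2 F f)
 have "Lipbs_approx \<rho> f F \<longleftrightarrow> (\<lambda>n. L2_norm M (\<lambda>z. F n z - f z)) ----> 0"
  using f by (subst Lipbs_approx_M) (simp_all add: F L2_M)
 also have "\<dots> \<longleftrightarrow> (\<lambda>n. N2 (\<lambda>z. F n z - f z)) ----> 0"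
 proof
  assume *: "(\<lambda>n. L2_norm M (\<lambda>z. F n z - f z)) ----> 0"
  have "(\<lambda>n. 1 / sqrt c1 * L2_norm M (\<lambda>z. F n z - f z)) ----> 0" using * by (rule tendsto_mult_right_zero)
  moreover have "norm (N2 (\<lambda>z. F n z - f z)) \<le> 1 / sqrt c1 * L2_norm M (\<lambda>z. F n z - f z)" for n
   using L2_norm_M_ge[OF dL[of n]] c1_pos by (simp add: L2_norm_nonneg field_simps)
  ultimately show "(\<lambda>n. N2 (\<lambda>z. F n z - f z)) ----> 0"
   by (rule null_comparison)
 next
  assume *: "(\<lambda>n. N2 (\<lambda>z. F n z - f z)) ----> 0"
  have "(\<lambda>n. sqrt c2 * N2 (\<lambda>z. F n z - f z)) ----> 0" using * by (rule tendsto_mult_right_zero)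
  moreover have "norm (L2_norm M (\<lambda>z. F n z - f z)) \<le> sqrt c2 * N2 (\<lambda>z. F n z - f z)" for n
   using L2_norm_M_le[OF dL[of n]] by (simp add: L2_norm_nonneg)
  ultimately show "(\<lambda>n. L2_norm M (\<lambda>z. F n z - f z)) ----> 0"
   by (rule null_comparison)
 qed
 finally show ?thesis .
qed

end

context conformal
begin

section \<open>The Cheeger energy as a limit of quadratic forms\<close>

lemma grad_energy_le_energy: "F \<in> Lipbs \<Longrightarrow> ennreal (mol.grad_energy n F) \<le> energy d \<rho> F"
 using mol.grad_energy_le_lipe[of F n] energy_conformal[of F] Lipbs_L2[of F] by simp

text \<open>An L2-continuous functional below the energy on Lipschitz functions also stays below the
  relaxation of the energy.\<close>

lemma grad_energy_le_Cheeger: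
 assumes f: "f \<in> L2 lborel"
 shows "ennreal (mol.grad_energy n f) \<le> Cheeger d \<rho> f"
 unfolding Cheeger_def
proof (rule INF_greatest)
 fix F assume "F \<in> {F. Lipbs_approx \<rho> f F}"
 then have F: "Lipbs_approx \<rho> f F" by simp
 then have FL: "F k \<in> Lipbs" for k by (simp add: Lipbs_approx_def)
 have "(\<lambda>k. mol.grad_energy n (F k)) ----> mol.grad_energy n f"
  using F Lipbs_approx_iff[OF FL f] by (intro mol.grad_energy_L2_continuous Lipbs_L2 FL f) simp
 then have "(\<lambda>k. ennreal (mol.grad_energy n (F k))) ----> ennreal (mol.grad_energy n f)" by simp
 then have "ennreal (mol.grad_energy n f) = liminf (\<lambda>k. ennreal (mol.grad_energy n (F k)))"
  using lim_imp_Liminf[OF trivial_limit_sequentially] by force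
 also have "\<dots> \<le> liminf (\<lambda>k. energy d \<rho> (F k))"
  by (intro Liminf_mono always_eventually allI grad_energy_le_energy FL)
 finally show "ennreal (mol.grad_energy n f) \<le> liminf (\<lambda>k. energy d \<rho> (F k))" .
qed

lemma Sob_approximable:
 assumes f: "f \<in> Sob d \<rho>"
 obtains F where "\<And>k. F k \<in> Lipbs" "(\<lambda>k. N2 (\<lambda>z. F k z - f z)) ----> 0"
proof -
 obtain F where F: "Lipbs_approx \<rho> f F" using f unfolding Sob_def by auto
 then have FL: "F k \<in> Lipbs" for k by (simp add: Lipbs_approx_def)
 show ?thesis using that[OF FL] F unfolding Lipbs_approx_iff[OF FL Sob_L2(2)[OF f]] .
qed

text \<open>For Lipschitz functions of bounded support the convergence is explicit; mollification
  contracts the L2 norm, so the convergence extends by density.\<close>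

lemma moll_tendsto:
 assumes f: "f \<in> Sob d \<rho>"
 shows "(\<lambda>n. N2 (\<lambda>z. conv f (moll (invS n)) z - f z)) ----> 0"
proof (rule LIMSEQ_I)
 fix e :: real assume e: "e > 0"
 note f2 = Sob_L2(2)[OF f]
 obtain F where F: "\<And>k. F k \<in> Lipbs" "(\<lambda>k. N2 (\<lambda>z. F k z - f z)) ----> 0"
  using Sob_approximable[OF f] by auto
 have "\<forall>\<^sub>F k in sequentially. N2 (\<lambda>z. F k z - f z) < e / 3"
  using order_tendstoD(2)[OF F(2), of "e / 3"] e by simp
 then obtain k where k: "N2 (\<lambda>z. F k z - f z) < e / 3" by force
 define G where "G = F k"
 have G: "G \<in> Lipbs" "G \<in> L2 lborel" unfolding G_def by (intro F Lipbs_L2)+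
 obtain L R where L: "L > 0" "\<And>x y. \<bar>G x - G y\<bar> \<le> L * norm (x - y)" and R: "R > 0" "\<And>x. norm x > R \<Longrightarrow> G x = 0"
  using Lipbs_obtain[OF G(1)] by auto
 have "(\<lambda>n. L * (invS n) * (sqrt pi * (R + 1))) ----> L * 0 * (sqrt pi * (R + 1))"
  by (intro tendsto_intros inverse_Suc_tendsto)
 then have "\<forall>\<^sub>F n in sequentially. L * (invS n) * (sqrt pi * (R + 1)) < e / 3"
  using e by (intro order_tendstoD(2)[where y = "L * 0 * (sqrt pi * (R + 1))"]) auto
 then obtain N where N: "\<And>n. n \<ge> N \<Longrightarrow> L * (invS n) * (sqrt pi * (R + 1)) < e / 3"
  unfolding eventually_sequentially by auto
 have "norm (N2 (\<lambda>z. conv f (moll (invS n)) z - f z) - 0) < e" if n: "n \<ge> N" for n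
 proof -
  let ?C = "\<lambda>h. conv h (moll (invS n))"
  have d1: "(\<lambda>z. f z - G z) \<in> L2 lborel" "(\<lambda>z. G z - f z) \<in> L2 lborel" by (intro L2_diff f2 G)+
  have d2: "(\<lambda>z. ?C G z - G z) \<in> L2 lborel" by (intro L2_diff mol.conv_L2 G)
  have "(\<lambda>z. ?C f z - f z) = (\<lambda>z. ?C (\<lambda>z. f z - G z) z + ((?C G z - G z) + (G z - f z)))"
   unfolding mol.conv_diff[OF f2 G(2)] by simp
  then have "N2 (\<lambda>z. ?C f z - f z)
    \<le> N2 (?C (\<lambda>z. f z - G z)) + N2 (\<lambda>z. (?C G z - G z) + (G z - f z))"
   using L2_norm_triangle[OF mol.conv_L2(1)[OF d1(1)] L2_add[OF d2 d1(2)]] by simp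
  also have "\<dots> \<le> N2 (\<lambda>z. f z - G z) + (N2 (\<lambda>z. ?C G z - G z) + N2 (\<lambda>z. G z - f z))"
   by (intro add_mono mol.conv_contraction d1 L2_norm_triangle d2)
  also have "N2 (\<lambda>z. f z - G z) = N2 (\<lambda>z. G z - f z)"
   using L2_norm_cmult[OF d1(2), of "-1"] by simp
  also have "N2 (\<lambda>z. ?C G z - G z) \<le> L * (invS n) * (sqrt pi * (R + 1))"
   by (rule mol.conv_close_L2[OF G(2) L(2) R(2)]) (use R in auto)
  finally have "N2 (\<lambda>z. ?C f z - f z) < e" using k N[OF n] unfolding G_def by linarith
  then show ?thesis unfolding diff_0_right real_norm_def abs_of_nonneg[OF L2_norm_nonneg] .
 qed
 then show "\<exists>no. \<forall>n\<ge>no. norm (N2 (\<lambda>z. conv f (moll (invS n)) z - f z) - 0) < e" by auto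
qed

text \<open>One inequality is \<open>grad_energy_le_Cheeger\<close>; the other needs a recovery
  sequence of Lipschitz functions of bounded support. Mollifying \<open>f\<close> itself need not
  give bounded support, so approximants F (j n) are mollified, with j n so late that the quadratic
  form at scale n grows by less than 1 / (n + 1).\<close>

theorem Cheeger_limit:
 assumes f: "f \<in> Sob d \<rho>"
 shows "(\<lambda>n. mol.grad_energy n f) ----> enn2real (Cheeger d \<rho> f)"
proof -
 note f2 = Sob_L2(2)[OF f]
 obtain c where c: "c \<ge> 0" "Cheeger d \<rho> f = ennreal c" using Cheeger_finite[OF f] by (cases "Cheeger d \<rho> f") auto
 obtain F where F: "\<And>k. F k \<in> Lipbs" "(\<lambda>k. N2 (\<lambda>z. F k z - f z)) ----> 0"
  using Sob_approximable[OF f] by auto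
 have "\<exists>j. N2 (\<lambda>z. F j z - f z) < invS n \<and> mol.grad_energy n (F j) < mol.grad_energy n f + invS n" for n
 proof -
  have "(\<lambda>k. mol.grad_energy n (F k)) ----> mol.grad_energy n f"
   by (intro mol.grad_energy_L2_continuous Lipbs_L2 F f2)
  then have "\<forall>\<^sub>F k in sequentially. mol.grad_energy n (F k) < mol.grad_energy n f + invS n"
   by (rule order_tendstoD) simp
  moreover have "\<forall>\<^sub>F k in sequentially. N2 (\<lambda>z. F k z - f z) < invS n"
   by (rule order_tendstoD(2)[OF F(2)]) simp
  ultimately have "\<forall>\<^sub>F k in sequentially. N2 (\<lambda>z. F k z - f z) < invS n \<and> mol.grad_energy n (F k) < mol.grad_energy n f + invS n"
   by eventually_elim simp
  then show ?thesis using eventually_happens'[OF trivial_limit_sequentially] by simp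
 qed
 then obtain j where j: "\<And>n. N2 (\<lambda>z. F (j n) z - f z) < invS n"
  "\<And>n. mol.grad_energy n (F (j n)) < mol.grad_energy n f + invS n" by metis
 define G where "G = (\<lambda>n. conv (F (j n)) (moll (invS n)))"
 have F2: "F k \<in> L2 lborel" for k by (intro Lipbs_L2 F)
 have GL: "G n \<in> Lipbs" for n unfolding G_def by (intro mol.conv_Lipbs F F2)
 have G_energy: "energy d \<rho> (G n) \<le> ennreal (mol.grad_energy n f + invS n)" for n
 proof -
  have "energy d \<rho> (G n) = (NN z. (lipe (G n) z)^2)" by (rule energy_conformal[OF GL])
  also have "\<dots> \<le> ennreal (mol.grad_energy n (F (j n)))" unfolding G_def by (rule mol.lipe_conv_energy[OF F2])
  also have "\<dots> \<le> ennreal (mol.grad_energy n f + invS n)" using j(2)[of n] by (intro ennreal_leI) simp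
  finally show ?thesis .
 qed
 have "(\<lambda>n. N2 (\<lambda>z. G n z - f z)) ----> 0"
 proof (rule null_comparison)
  have "(\<lambda>n. invS n + N2 (\<lambda>z. conv f (moll (invS n)) z - f z)) ----> 0 + 0"
   by (intro tendsto_add moll_tendsto[OF f] inverse_Suc_tendsto)
  then show "(\<lambda>n. invS n + N2 (\<lambda>z. conv f (moll (invS n)) z - f z)) ----> 0" by simp
  fix n
  let ?C = "\<lambda>h. conv h (moll (invS n))"
  have d1: "(\<lambda>z. F (j n) z - f z) \<in> L2 lborel" by (intro L2_diff f2 F2)
  have d2: "(\<lambda>z. ?C f z - f z) \<in> L2 lborel" by (intro L2_diff mol.conv_L2 f2)
  have "(\<lambda>z. G n z - f z) = (\<lambda>z. ?C (\<lambda>z. F (j n) z - f z) z + (?C f z - f z))"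
   unfolding mol.conv_diff[OF F2 f2] G_def by simp
  then have "N2 (\<lambda>z. G n z - f z) \<le> N2 (?C (\<lambda>z. F (j n) z - f z)) + N2 (\<lambda>z. ?C f z - f z)"
   using L2_norm_triangle[OF mol.conv_L2(1)[OF d1] d2] by simp
  also have "\<dots> \<le> invS n + N2 (\<lambda>z. ?C f z - f z)"
   using order_trans[OF mol.conv_contraction[OF d1] less_imp_le[OF j(1)]] by simp
  finally show "norm (N2 (\<lambda>z. G n z - f z)) \<le> invS n + N2 (\<lambda>z. ?C f z - f z)"
   by (simp add: L2_norm_nonneg)
 qed
 then have "Lipbs_approx \<rho> f G" by (simp add: Lipbs_approx_iff[OF GL f2])
 then have Ch: "ennreal c \<le> liminf (\<lambda>n. energy d \<rho> (G n))"
  unfolding c(2)[symmetric] Cheeger_def by (intro INF_lower) simp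
 have upper: "mol.grad_energy n f \<le> c" for n
  using grad_energy_le_Cheeger[OF f2, of n] c by simp
 show ?thesis unfolding c(2) enn2real_ennreal[OF c(1)]
 proof (rule LIMSEQ_I)
  fix e :: real assume e: "e > 0"
  have "\<forall>\<^sub>F n in sequentially. c - e < mol.grad_energy n f"
  \<comment> \<open>The claim is trivial for c < e; treating this case apart keeps c - e / 2
    nonnegative, as \<open>ennreal\<close> cuts off below 0.\<close>
  proof (cases "c < e")
   case True
   then have "c - e < mol.grad_energy n f" for n using mol.grad_energy_nonneg[of n f] by simp
   then show ?thesis by simp
  next
   case False
   have "ennreal (c - e / 2) < ennreal c" using False e by (simp add: ennreal_less_iff)
   then have "ennreal (c - e / 2) < liminf (\<lambda>n. energy d \<rho> (G n))" using Ch by simp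
   then have "\<forall>\<^sub>F n in sequentially. ennreal (c - e / 2) < energy d \<rho> (G n)" by (rule less_LiminfD)
   moreover have "\<forall>\<^sub>F n in sequentially. invS n < e / 2"
    using e by (intro order_tendstoD(2)[OF inverse_Suc_tendsto]) simp
   ultimately show ?thesis
   proof eventually_elim
    case (elim n)
    have "ennreal (c - e / 2) < ennreal (mol.grad_energy n f + invS n)"
     using elim(1) G_energy[of n] by simp
    then have "c - e / 2 < mol.grad_energy n f + invS n"
     using False e by (simp add: ennreal_less_iff)
    then show ?case using elim(2) by simp
   qed
  qed
  then obtain N where N: "\<And>n. n \<ge> N \<Longrightarrow> c - e < mol.grad_energy n f" unfolding eventually_sequentially by auto
  have "norm (mol.grad_energy n f - c) < e" if "n \<ge> N" for n using N[OF that] upper[of n] by simp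
  then show "\<exists>no. \<forall>n\<ge>no. norm (mol.grad_energy n f - c) < e" by auto
 qed
qed

text \<open>A diagonal sequence of nearly optimal competitors. A bound on a liminf makes the
  energies small only frequently, which is enough to pick one member for each
  \<open>n\<close>.\<close>

lemma Sob_if_bounded_approximation:
 assumes f: "f \<in> L2 M" and F: "\<And>n. F n \<in> Sob d \<rho>"
  and lim: "(\<lambda>n. L2_norm M (\<lambda>z. F n z - f z)) ----> 0" and bd: "\<And>n. Cheeger d \<rho> (F n) \<le> ennreal C"
 shows "f \<in> Sob d \<rho>"
proof -
 have "\<exists>G\<in>Lipbs. L2_norm M (\<lambda>z. G z - F n z) < invS n \<and> energy d \<rho> G < ennreal C + 1" for n
 proof -
  have "Cheeger d \<rho> (F n) < ennreal C + 1"
   using bd[of n] by (rule le_less_trans) simp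
  then obtain G where G: "Lipbs_approx \<rho> (F n) G" "liminf (\<lambda>k. energy d \<rho> (G k)) < ennreal C + 1"
   unfolding Cheeger_def INF_less_iff by auto
  have GL: "G k \<in> Lipbs" for k using G(1) by (simp add: Lipbs_approx_def)
  have "(\<lambda>k. L2_norm M (\<lambda>z. G k z - F n z)) ----> 0"
   using G(1) unfolding Lipbs_approx_M[OF Sob_L2(1)[OF F]] by simp
  then have "\<forall>\<^sub>F k in sequentially. L2_norm M (\<lambda>z. G k z - F n z) < invS n"
   by (rule order_tendstoD) simp
  moreover have "\<exists>\<^sub>F k in sequentially. energy d \<rho> (G k) < ennreal C + 1"
   using G(2) unfolding frequently_def not_less by (metis Liminf_bounded not_less)
  ultimately have "\<exists>\<^sub>F k in sequentially. energy d \<rho> (G k) < ennreal C + 1 \<and> L2_norm M (\<lambda>z. G k z - F n z) < invS n"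
   by (intro frequently_eventually_frequently)
  then show ?thesis using GL by (blast dest: frequently_ex)
 qed
 then obtain G where G: "\<And>n. G n \<in> Lipbs" "\<And>n. L2_norm M (\<lambda>z. G n z - F n z) < invS n"
  "\<And>n. energy d \<rho> (G n) < ennreal C + 1" by metis
 have "(\<lambda>n. L2_norm M (\<lambda>z. G n z - f z)) ----> 0"
 proof (rule null_comparison)
  have "(\<lambda>n. invS n + L2_norm M (\<lambda>z. F n z - f z)) ----> 0 + 0"
   by (intro tendsto_add lim inverse_Suc_tendsto)
  then show "(\<lambda>n. invS n + L2_norm M (\<lambda>z. F n z - f z)) ----> 0" by simp
  fix n
  have "L2_norm M (\<lambda>z. G n z - f z) \<le> L2_norm M (\<lambda>z. G n z - F n z) + L2_norm M (\<lambda>z. F n z - f z)"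
   using L2_norm_triangle[OF L2_diff[OF Lipbs_L2_M[OF G(1)[of n]] Sob_L2(1)[OF F[of n]]] L2_diff[OF Sob_L2(1)[OF F[of n]] f]]
   by simp
  then show "norm (L2_norm M (\<lambda>z. G n z - f z)) \<le> invS n + L2_norm M (\<lambda>z. F n z - f z)"
   using G(2)[of n] unfolding real_norm_def abs_of_nonneg[OF L2_norm_nonneg] by simp
 qed
 then have "Lipbs_approx \<rho> f G" by (simp add: Lipbs_approx_M[OF f] G(1))
 moreover have "(SUP n. energy d \<rho> (G n)) \<le> ennreal C + 1" using G(3) by (intro SUP_least less_imp_le)
 then have "(SUP n. energy d \<rho> (G n)) < \<infinity>" by (rule le_less_trans) simp
 ultimately show ?thesis using f unfolding Sob_def by auto
qed

lemma Sob_norm_nonneg: "0 \<le> Sob_norm d \<rho> f"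
 by (simp add: Sob_norm_def)

lemma L2_norm_le_Sob_norm: "f \<in> Sob d \<rho> \<Longrightarrow> L2_norm M f \<le> Sob_norm d \<rho> f"
 by (rule power2_le_imp_le) (simp_all add: Sob_norm_sq, simp add: Sob_norm_def)

lemma Cheeger_le_Sob_norm: "f \<in> Sob d \<rho> \<Longrightarrow> Cheeger d \<rho> f \<le> ennreal ((Sob_norm d \<rho> f)^2)"
proof -
 assume f: "f \<in> Sob d \<rho>"
 have "Cheeger d \<rho> f = ennreal (enn2real (Cheeger d \<rho> f))" using Cheeger_finite[OF f] by simp
 also have "\<dots> \<le> ennreal ((Sob_norm d \<rho> f)^2)" by (intro ennreal_leI) (simp add: Sob_norm_sq[OF f])
 finally show ?thesis .
qed

lemma grad_energy_add:
 assumes L: "f \<in> L2 lborel" "g \<in> L2 lborel"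
 shows "mol.grad_energy n (\<lambda>x. f x + g x) = mol.grad_energy n f + 2 * mol.grad_form n f g + mol.grad_energy n g"
 using mol.grad_form_add[OF L L2_add[OF L], of n]
  mol.grad_form_add[OF L L(1), of n] mol.grad_form_add[OF L L(2), of n]
  mol.grad_form_sym[of n f "\<lambda>x. f x + g x"] mol.grad_form_sym[of n g "\<lambda>x. f x + g x"] mol.grad_form_sym[of n g f]
  mol.grad_form_self[OF L2_add[OF L], of n] mol.grad_form_self[OF L(1), of n] mol.grad_form_self[OF L(2), of n]
 by linarith

text \<open>This is nonnegativity of the quadratic form at f - g.\<close>

lemma grad_energy_add_le:
 assumes L: "f \<in> L2 lborel" "g \<in> L2 lborel"
 shows "mol.grad_energy n (\<lambda>x. f x + g x) \<le> 2 * mol.grad_energy n f + 2 * mol.grad_energy n g"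
proof -
 note L' = L2_cmult[OF L(2), of "-1"]
 have "mol.grad_form n f (\<lambda>x. -1 * g x) = - mol.grad_form n f g"
  using mol.grad_form_cmult[of n "-1" g f] mol.grad_form_sym[of n f g] mol.grad_form_sym[of n f "\<lambda>x. -1 * g x"] by linarith
 moreover have "mol.grad_energy n (\<lambda>x. -1 * g x) = mol.grad_energy n g"
  using mol.grad_form_cmult[of n "-1" g "\<lambda>x. -1 * g x"] mol.grad_form_cmult[of n "-1" g g] mol.grad_form_sym[of n g "\<lambda>x. -1 * g x"]
   mol.grad_form_self[OF L', of n] mol.grad_form_self[OF L(2), of n] by linarith
 ultimately show ?thesis
  using mol.grad_energy_nonneg[of n "\<lambda>x. f x + -1 * g x"] grad_energy_add[OF L, of n] grad_energy_add[OF L(1) L', of n] by linarith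
qed

text \<open>The inner product is the L2 product plus the limit of the forms
  \<open>grad_form\<close>, which exists by polarisation of \<open>Cheeger_limit\<close>. For
  completeness an L2 limit is taken first; bounds on \<open>grad_energy\<close> pass to it at every
  fixed scale, and then to the limit of the scales.\<close>

theorem Hilbert_Sob: "Hilbert_space_on (Sob d \<rho>) (Sob_norm d \<rho>)"
proof -
 let ?H = "Sob d \<rho>" and ?N = "Sob_norm d \<rho>"
 define B where "B = (\<lambda>f g. (LINT z|M. f z * g z) + lim (\<lambda>n. mol.grad_form n f g))"
 have conv: "convergent (\<lambda>n. mol.grad_form n f g)" if f: "f \<in> ?H" and g: "g \<in> ?H" for f g
 proof -
  note L = Sob_L2(2)[OF f] Sob_L2(2)[OF g]
  have "mol.grad_form n f g = (mol.grad_energy n (\<lambda>x. f x + g x) - mol.grad_energy n f - mol.grad_energy n g) / 2" for n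
   using grad_energy_add[OF L, of n] by simp
  then have "(\<lambda>n. mol.grad_form n f g) = (\<lambda>n. (mol.grad_energy n (\<lambda>x. f x + g x) - mol.grad_energy n f - mol.grad_energy n g) / 2)"
   by auto
  moreover have "(\<lambda>n. (mol.grad_energy n (\<lambda>x. f x + g x) - mol.grad_energy n f - mol.grad_energy n g) / 2)
    ----> (enn2real (Cheeger d \<rho> (\<lambda>x. f x + g x)) - enn2real (Cheeger d \<rho> f) - enn2real (Cheeger d \<rho> g)) / 2"
   by (rule tendsto_divide[OF tendsto_diff[OF tendsto_diff[OF Cheeger_limit[OF Sob_add[OF f g]]
      Cheeger_limit[OF f]] Cheeger_limit[OF g]] tendsto_const]) simp
  ultimately show ?thesis by (simp only: convergentI)
 qed
 have lim: "(\<lambda>n. mol.grad_form n f g) ----> lim (\<lambda>n. mol.grad_form n f g)" if "f \<in> ?H" "g \<in> ?H" for f g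
  using conv[OF that] by (simp add: convergent_LIMSEQ_iff)
 show ?thesis
  unfolding Hilbert_space_on_def
 proof (intro conjI exI[of _ B] ballI allI impI)
  show "B f g = B g f" for f g
  proof -
   have "(\<lambda>n. mol.grad_form n f g) = (\<lambda>n. mol.grad_form n g f)" by (rule ext) (rule mol.grad_form_sym)
   then show ?thesis unfolding B_def by (simp only: mult.commute)
  qed
  show "B (\<lambda>x. f x + g x) h = B f h + B g h" if "f \<in> ?H" "g \<in> ?H" "h \<in> ?H" for f g h
  proof -
   have "(\<lambda>n. mol.grad_form n f h + mol.grad_form n g h) ----> lim (\<lambda>n. mol.grad_form n f h) + lim (\<lambda>n. mol.grad_form n g h)"
    by (intro tendsto_add lim that)
   then have "lim (\<lambda>n. mol.grad_form n (\<lambda>x. f x + g x) h) = lim (\<lambda>n. mol.grad_form n f h) + lim (\<lambda>n. mol.grad_form n g h)"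
    unfolding mol.grad_form_add[OF Sob_L2(2)[OF that(1)] Sob_L2(2)[OF that(2)] Sob_L2(2)[OF that(3)]] by (rule limI)
   moreover have "(LINT z|M. (f z + g z) * h z) = (LINT z|M. f z * h z) + (LINT z|M. g z * h z)"
    using that by (simp add: distrib_right L2_mult_integrable Sob_L2)
   ultimately show ?thesis by (simp add: B_def)
  qed
  show "B (\<lambda>x. c * f x) g = c * B f g" if "f \<in> ?H" "g \<in> ?H" for c f g
  proof -
   have "(\<lambda>n. c * mol.grad_form n f g) ----> c * lim (\<lambda>n. mol.grad_form n f g)" by (intro tendsto_mult_left lim that)
   then have "lim (\<lambda>n. mol.grad_form n (\<lambda>x. c * f x) g) = c * lim (\<lambda>n. mol.grad_form n f g)"
    unfolding mol.grad_form_cmult by (rule limI)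
   then show ?thesis by (simp add: B_def distrib_left mult.assoc)
  qed
  show "B f f = (?N f)^2" if "f \<in> ?H" for f
  proof -
   have "lim (\<lambda>n. mol.grad_form n f f) = enn2real (Cheeger d \<rho> f)"
    unfolding mol.grad_form_self[OF Sob_L2(2)[OF that]] by (rule limI[OF Cheeger_limit[OF that]])
   then show ?thesis
    unfolding B_def Sob_norm_sq[OF that] L2_norm_sq[OF Sob_L2(1)[OF that]] by (simp only: power2_eq_square)
  qed
 next
  fix F :: "nat \<Rightarrow> complex \<Rightarrow> real"
  assume F': "(\<forall>n. F n \<in> ?H) \<and> (\<forall>e>0. \<exists>K. \<forall>i\<ge>K. \<forall>j\<ge>K. ?N (\<lambda>x. F i x - F j x) < e)"
  then have F: "F n \<in> ?H" for n by simp
  have cauchy: "\<exists>K. \<forall>i\<ge>K. \<forall>j\<ge>K. ?N (\<lambda>x. F i x - F j x) < e" if "e > 0" for e using F' that by simp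
  have FM: "F n \<in> L2 M" for n by (rule Sob_L2(1)[OF F])
  have dH: "(\<lambda>x. F i x - F j x) \<in> ?H" for i j by (intro Sob_diff F)
  have "\<exists>f\<in>L2 M. (\<lambda>n. L2_norm M (\<lambda>x. F n x - f x)) ----> 0"
  proof (rule L2_complete[OF FM])
   fix e :: real assume "e > 0"
   then obtain K where "\<forall>i\<ge>K. \<forall>j\<ge>K. ?N (\<lambda>x. F i x - F j x) < e" using cauchy by blast
   then show "\<exists>K. \<forall>i\<ge>K. \<forall>j\<ge>K. L2_norm M (\<lambda>x. F i x - F j x) < e"
    using le_less_trans[OF L2_norm_le_Sob_norm[OF dH]] by blast
  qed
  then obtain f where f: "f \<in> L2 M" "(\<lambda>n. L2_norm M (\<lambda>x. F n x - f x)) ----> 0" by auto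
  have f2: "f \<in> L2 lborel" using f(1) by (simp only: L2_M)
  have F2: "F n \<in> L2 lborel" for n by (rule Sob_L2(2)[OF F])
  have lim2: "(\<lambda>n. N2 (\<lambda>x. F n x - f x)) ----> 0"
  proof (rule null_comparison)
   show "(\<lambda>n. 1 / sqrt c1 * L2_norm M (\<lambda>z. F n z - f z)) ----> 0" using f(2) by (rule tendsto_mult_right_zero)
   show "norm (N2 (\<lambda>z. F n z - f z)) \<le> 1 / sqrt c1 * L2_norm M (\<lambda>z. F n z - f z)" for n
    using L2_norm_M_ge[OF L2_diff[OF F2[of n] f2]] c1_pos by (simp add: L2_norm_nonneg field_simps)
  qed
  text \<open>Lower semicontinuity: the Cheeger energy is a supremum of functionals that are
   continuous in \<open>L2\<close>.\<close>
  have lsc: "mol.grad_energy n (\<lambda>x. F i x - f x) \<le> e^2"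
   if K: "\<forall>i\<ge>K. \<forall>j\<ge>K. ?N (\<lambda>x. F i x - F j x) < e" and i: "i \<ge> K" for n i K e
  proof (rule tendsto_upperbound)
   show "(\<lambda>j. mol.grad_energy n (\<lambda>x. F i x - F j x)) ----> mol.grad_energy n (\<lambda>x. F i x - f x)"
   proof (intro mol.grad_energy_L2_continuous L2_diff F2 f2)
    have "N2 (\<lambda>x. (F i x - F j x) - (F i x - f x)) = N2 (\<lambda>x. F j x - f x)" for j
     using L2_norm_cmult[OF L2_diff[OF F2[of j] f2], of "-1"] by simp
    then show "(\<lambda>j. N2 (\<lambda>x. (F i x - F j x) - (F i x - f x))) ----> 0" using lim2 by simp
   qed
   have "mol.grad_energy n (\<lambda>x. F i x - F j x) \<le> e^2" if "j \<ge> K" for j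
   proof -
    have "ennreal (mol.grad_energy n (\<lambda>x. F i x - F j x)) \<le> ennreal ((?N (\<lambda>x. F i x - F j x))^2)"
     by (rule order_trans[OF grad_energy_le_Cheeger[OF L2_diff[OF F2 F2]] Cheeger_le_Sob_norm[OF dH]])
    then have "mol.grad_energy n (\<lambda>x. F i x - F j x) \<le> (?N (\<lambda>x. F i x - F j x))^2" by simp
    also have "\<dots> \<le> e^2" using K i that by (intro power_mono less_imp_le Sob_norm_nonneg) blast
    finally show ?thesis .
   qed
   then show "\<forall>\<^sub>F j in sequentially. mol.grad_energy n (\<lambda>x. F i x - F j x) \<le> e^2"
    by (rule eventually_sequentiallyI)
  qed simp
  have fH: "f \<in> ?H"
  proof -
   obtain K where K: "\<forall>i\<ge>K. \<forall>j\<ge>K. ?N (\<lambda>x. F i x - F j x) < 1" using cauchy[of 1] by auto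
   \<comment> \<open>By \<open>grad_energy_add_le\<close>, applied to F K and to the difference F (n
     + K) - F K, whose energy is at most 1.\<close>
   define C where "C = 2 * enn2real (Cheeger d \<rho> (F K)) + 2"
   have "Cheeger d \<rho> (F (n + K)) \<le> ennreal C" for n
   proof -
    have le: "mol.grad_energy k (F (n + K)) \<le> C" for k
    proof -
     have "ennreal (mol.grad_energy k (\<lambda>x. F (n + K) x - F K x)) \<le> ennreal ((?N (\<lambda>x. F (n + K) x - F K x))^2)"
      by (rule order_trans[OF grad_energy_le_Cheeger[OF L2_diff[OF F2 F2]] Cheeger_le_Sob_norm[OF dH]])
     then have "mol.grad_energy k (\<lambda>x. F (n + K) x - F K x) \<le> (?N (\<lambda>x. F (n + K) x - F K x))^2" by simp
     also have "\<dots> \<le> 1^2" using K by (intro power_mono less_imp_le Sob_norm_nonneg) simp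
     finally have "mol.grad_energy k (\<lambda>x. F (n + K) x - F K x) \<le> 1" by simp
     moreover have "mol.grad_energy k (F K) \<le> enn2real (Cheeger d \<rho> (F K))"
      using grad_energy_le_Cheeger[OF F2[of K], of k] Cheeger_finite[OF F[of K]]
      by (cases "Cheeger d \<rho> (F K)") (auto simp: ennreal_le_iff)
     ultimately show ?thesis
      using grad_energy_add_le[OF L2_diff[OF F2[of "n + K"] F2[of K]] F2[of K], of k] by (simp add: C_def)
    qed
    have "enn2real (Cheeger d \<rho> (F (n + K))) \<le> C"
     by (rule tendsto_upperbound[OF Cheeger_limit[OF F] always_eventually]) (rule allI, rule le, simp)
    then have "ennreal (enn2real (Cheeger d \<rho> (F (n + K)))) \<le> ennreal C" by (rule ennreal_leI)
    then show ?thesis using Cheeger_finite[OF F[of "n + K"]] by simp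
   qed
   moreover have "(\<lambda>n. L2_norm M (\<lambda>x. F (n + K) x - f x)) ----> 0"
    using LIMSEQ_ignore_initial_segment[OF f(2), of K] .
   ultimately show ?thesis by (intro Sob_if_bounded_approximation[OF f(1), where F = "\<lambda>n. F (n + K)"] F) auto
  qed
  show "\<exists>f\<in>?H. (\<lambda>n. ?N (\<lambda>x. F n x - f x)) ----> 0"
  proof (intro bexI[OF _ fH] LIMSEQ_I)
   fix e :: real assume e: "e > 0"
   then obtain K where K: "\<forall>i\<ge>K. \<forall>j\<ge>K. ?N (\<lambda>x. F i x - F j x) < e / 2" using cauchy[of "e / 2"] by auto
   have "\<forall>\<^sub>F n in sequentially. L2_norm M (\<lambda>x. F n x - f x) < e / 2"
    using e by (intro order_tendstoD(2)[OF f(2)]) simp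
   then obtain K' where K': "\<And>n. n \<ge> K' \<Longrightarrow> L2_norm M (\<lambda>x. F n x - f x) < e / 2" unfolding eventually_sequentially by auto
   have "norm (?N (\<lambda>x. F n x - f x) - 0) < e" if n: "n \<ge> max K K'" for n
   proof -
    have dn: "(\<lambda>x. F n x - f x) \<in> ?H" by (intro Sob_diff F fH)
    have "enn2real (Cheeger d \<rho> (\<lambda>x. F n x - f x)) \<le> (e / 2)^2"
     using n by (intro tendsto_upperbound[OF Cheeger_limit[OF dn] always_eventually] allI lsc[OF K]) auto
    moreover have "(L2_norm M (\<lambda>x. F n x - f x))^2 \<le> (e / 2)^2"
     using K'[of n] n by (intro power_mono L2_norm_nonneg) auto
    ultimately have "(?N (\<lambda>x. F n x - f x))^2 \<le> (e / 2)^2 + (e / 2)^2" by (simp add: Sob_norm_sq[OF dn])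
    also have "\<dots> < e^2" using e by (simp add: power_divide)
    finally have "?N (\<lambda>x. F n x - f x) < e" by (rule power2_less_imp_less) (use e in simp)
    then show ?thesis by (simp add: Sob_norm_def)
   qed
   then show "\<exists>no. \<forall>n\<ge>no. norm (?N (\<lambda>x. F n x - f x) - 0) < e" by blast
  qed
 qed
qed

theorem infinitesimally_Hilbertian_X: "infinitesimally_Hilbertian X m"
 by (rule infinitesimally_Hilbertian_if[OF Hilbert_Sob Sob_diff])

end

section \<open>The oscillating conformal metric\<close>

definition om :: "complex \<Rightarrow> real" where
 "om z = sqrt (1 + (1 + sin (1 / (norm z)^2))^2)"

text \<open>The origin, where \<open>om\<close> has no limit, is bridged by continuity: a segment
  through it is a limit of segments that avoid it.\<close>

definition om_fun :: "(complex \<Rightarrow> real) set" where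
 "om_fun = {u. continuous_on UNIV u \<and>
  (\<forall>z. z \<noteq> 0 \<longrightarrow> (\<forall>e>0. \<forall>\<^sub>F w in at z. \<bar>u w - u z\<bar> \<le> (om z + e) * norm (w - z)))}"

text \<open>In this form the triangle inequality is immediate, a single test function gives a lower
  bound, and upper bounds come from integrating test functions along curves.\<close>

definition om_dist :: "complex \<Rightarrow> complex \<Rightarrow> real" where
 "om_dist x y = (SUP u\<in>om_fun. \<bar>u x - u y\<bar>)"

lemma om_bounds: "1 \<le> om z" "om z \<le> 3"
proof -
 show "1 \<le> om z" unfolding om_def by simp
 have "0 \<le> 1 + sin (1 / (norm z)^2)" "1 + sin (1 / (norm z)^2) \<le> 2"
  using sin_ge_minus_one[of "1 / (norm z)^2"] sin_le_one[of "1 / (norm z)^2"] by linarith+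
 then have "(1 + sin (1 / (norm z)^2))^2 \<le> 2^2" by (intro power_mono)
 then show "om z \<le> 3" unfolding om_def by (intro real_le_lsqrt) auto
qed

lemma om_pos: "0 < om z" using om_bounds(1)[of z] by simp

lemma om_sq: "(om z)^2 = 1 + (1 + sin (1 / (norm z)^2))^2"
 by (simp add: om_def)

lemma om_continuous: "continuous_on (- {0}) om"
 unfolding om_def[abs_def] by (intro continuous_intros) auto

lemma om_isCont: "z \<noteq> 0 \<Longrightarrow> isCont om z"
 using om_continuous by (simp add: continuous_on_eq_continuous_at open_Compl)

lemma om_borel [measurable]: "om \<in> borel_measurable borel"
 unfolding om_def[abs_def] by simp

lemma om_funD:
 assumes "u \<in> om_fun"
 shows "continuous_on UNIV u" "z \<noteq> 0 \<Longrightarrow> e > 0 \<Longrightarrow> \<forall>\<^sub>F w in at z. \<bar>u w - u z\<bar> \<le> (om z + e) * norm (w - z)"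
 using assms by (auto simp: om_fun_def)

lemma om_fun_uminus: "u \<in> om_fun \<Longrightarrow> (\<lambda>z. - u z) \<in> om_fun"
proof -
 assume u: "u \<in> om_fun"
 have "\<bar>- u w - - u z\<bar> = \<bar>u w - u z\<bar>" for w z by simp
 then show ?thesis using u unfolding om_fun_def by (auto intro: continuous_on_minus)
qed

section \<open>Increments of test functions along curves\<close>

lemma has_vector_derivative_right_bound:
 assumes "(f has_vector_derivative f') (at_right t)" "\<eta> > 0"
 shows "\<forall>\<^sub>F s in at_right t. norm (f s - f t - (s - t) *\<^sub>R f') \<le> \<eta> * (s - t)"
  and "\<forall>\<^sub>F s in at_right t. norm (f s - f t) \<le> (norm f' + \<eta>) * (s - t)"
proof -
 obtain e where e: "e > 0" "\<And>s. s > t \<Longrightarrow> norm (s - t) < e \<Longrightarrow> norm (f s - f t - (s - t) *\<^sub>R f') \<le> \<eta> * norm (s - t)"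
  using assms unfolding has_vector_derivative_def has_derivative_within_alt by auto
 have "\<forall>\<^sub>F s in at_right t. s \<in> {t<..<t + e}" using e by (intro eventually_at_right_real) auto
 then show *: "\<forall>\<^sub>F s in at_right t. norm (f s - f t - (s - t) *\<^sub>R f') \<le> \<eta> * (s - t)"
  by eventually_elim (use e(2) in force)
 have "\<forall>\<^sub>F s in at_right t. s > t" by (simp add: eventually_at_filter)
 with * show "\<forall>\<^sub>F s in at_right t. norm (f s - f t) \<le> (norm f' + \<eta>) * (s - t)"
 proof eventually_elim
  case (elim s)
  have "norm (f s - f t) \<le> norm (f s - f t - (s - t) *\<^sub>R f') + norm ((s - t) *\<^sub>R f')"
   using norm_triangle_ineq[of "f s - f t - (s - t) *\<^sub>R f'" "(s - t) *\<^sub>R f'"] by simp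
  also have "norm ((s - t) *\<^sub>R f') = norm f' * (s - t)" using elim(2) by simp
  finally show ?case using elim(1) unfolding distrib_right by simp
 qed
qed

lemma om_speed_continuous:
 assumes \<gamma>: "continuous_on {a..b} \<gamma>" and nz: "0 \<notin> \<gamma> ` {a..b}" and v: "continuous_on ({a..b} - S) v"
 shows "continuous_on ({a..b} - S) (\<lambda>t. om (\<gamma> t) * norm (v t))"
 using nz by (intro continuous_intros continuous_on_compose2[OF om_continuous continuous_on_subset[OF \<gamma>]] v) auto

lemma om_speed_measurable:
 assumes \<gamma>: "continuous_on {a..b} \<gamma>" and nz: "0 \<notin> \<gamma> ` {a..b}" and S: "finite S" and v: "continuous_on ({a..b} - S) v"
 shows "(\<lambda>t. om (\<gamma> t) * norm (v t) * indicator {a..b::real} t) \<in> borel_measurable borel"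
proof (rule measurable_discrete_difference[where X = S])
 show "(\<lambda>t. indicator ({a..b} - S) t *\<^sub>R (om (\<gamma> t) * norm (v t))) \<in> borel_measurable borel"
  using S by (intro borel_measurable_continuous_on_indicator om_speed_continuous[OF \<gamma> nz v])
   (auto intro: borel_closed finite_imp_closed)
qed (auto simp: S countable_finite split: split_indicator)

text \<open>The increment of \<open>u\<close> along \<gamma> minus the accumulated length has upper
  right derivative at most 0 off \<open>S\<close>, so \<open>antimono_of_local_finite\<close>
  applies.\<close>

lemma om_fun_curve:
 assumes u: "u \<in> om_fun" and ab: "a \<le> b" and \<gamma>: "continuous_on {a..b} \<gamma>" and nz: "0 \<notin> \<gamma> ` {a..b}" and S: "finite S"
  and der: "\<And>t. t \<in> {a..b} - S \<Longrightarrow> (\<gamma> has_vector_derivative v t) (at t)" and v: "continuous_on ({a..b} - S) v"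
 shows "ennreal \<bar>u (\<gamma> b) - u (\<gamma> a)\<bar> \<le> (\<integral>\<^sup>+t\<in>{a..b}. ennreal (om (\<gamma> t) * norm (v t)) \<partial>lborel)"
proof -
 define k where "k = (\<lambda>t. om (\<gamma> t) * norm (v t))"
 have km: "(\<lambda>t. k t * indicator {a..b} t) \<in> borel_measurable borel"
  unfolding k_def by (rule om_speed_measurable[OF \<gamma> nz S v])
 show ?thesis
 \<comment> \<open>The speed may be unbounded near \<open>S\<close>. If its integral is infinite the
   claim is trivial; otherwise finiteness makes the speed integrable.\<close>
 proof (cases "\<integral>\<^sup>+t\<in>{a..b}. ennreal (k t) \<partial>lborel")
  case (real r)
  have "((\<lambda>t. k t * indicator {a..b} t) has_integral r) UNIV"
  proof (rule nn_integral_has_integral[OF km])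
   show "0 \<le> k t * indicator {a..b} t" for t using om_pos[of "\<gamma> t"] by (simp add: k_def)
   show "(NN t. ennreal (k t * indicator {a..b} t)) = ennreal r"
    unfolding real(2)[symmetric] by (intro nn_integral_cong) (auto split: split_indicator)
  qed (rule real(1))
  moreover have "(\<lambda>t. k t * indicator {a..b} t) = (\<lambda>t. if t \<in> {a..b} then k t else 0)" by (auto split: split_indicator)
  ultimately have kr: "(k has_integral r) {a..b}" by (simp only: has_integral_restrict_UNIV)
  then have ki: "k integrable_on {a..b}" by blast
  define G where "G = (\<lambda>t. integral {a..t} k)"
  have one: "u (\<gamma> b) - u (\<gamma> a) \<le> r" if u: "u \<in> om_fun" for u
  proof -
   define \<phi> where "\<phi> = (\<lambda>t. u (\<gamma> t) - G t)"
   have "\<phi> b \<le> \<phi> a"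
   proof (rule antimono_of_local_finite[OF S ab])
    show "continuous_on {a..b} \<phi>"
     unfolding \<phi>_def G_def
     by (intro continuous_intros indefinite_integral_continuous_1[OF ki] continuous_on_compose2[OF om_funD(1)[OF u] \<gamma>]) auto
    fix t e :: real assume t: "t \<in> {a<..<b} - S" and e: "e > 0"
    \<comment> \<open>Bounds the coefficient of \<eta> that arises when the local estimates
      \<open>d1\<close>, \<open>d2\<close>, \<open>d3\<close> are combined.\<close>
    define c where "c = om (\<gamma> t) + norm (v t) + 2"
    have c: "c > 0" using om_pos[of "\<gamma> t"] by (simp add: c_def add_pos_nonneg)
    define \<eta> where "\<eta> = min 1 (e / c)"
    have \<eta>: "\<eta> > 0" "\<eta> \<le> 1" "\<eta> * c \<le> e" using e c by (auto simp: \<eta>_def min_def field_simps)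
    have \<gamma>nz: "\<gamma> t \<noteq> 0" using nz t by auto
    have d1: "\<forall>\<^sub>F s in at_right t. norm (\<gamma> s - \<gamma> t) \<le> (norm (v t) + \<eta>) * (s - t)"
     using has_vector_derivative_right_bound[OF has_vector_derivative_at_within[OF der[of t]] \<eta>(1)] t
     by simp
    have d2: "\<forall>\<^sub>F s in at_right t. \<bar>u (\<gamma> s) - u (\<gamma> t)\<bar> \<le> (om (\<gamma> t) + \<eta>) * norm (\<gamma> s - \<gamma> t)"
    proof -
     obtain S where S: "open S" "\<gamma> t \<in> S" "\<And>w. w \<in> S \<Longrightarrow> w \<noteq> \<gamma> t \<Longrightarrow> \<bar>u w - u (\<gamma> t)\<bar> \<le> (om (\<gamma> t) + \<eta>) * norm (w - \<gamma> t)"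
      using om_funD(2)[OF u \<gamma>nz \<eta>(1)] unfolding eventually_at_topological by auto
     have "isCont \<gamma> t" using der[of t] t has_vector_derivative_continuous by auto
     then have "(\<gamma> \<longlongrightarrow> \<gamma> t) (at_right t)" by (simp add: isCont_def filterlim_at_split)
     then have "\<forall>\<^sub>F s in at_right t. \<gamma> s \<in> S" using S(1,2) by (rule topological_tendstoD)
     then show ?thesis
     proof eventually_elim
      case (elim s) then show ?case using S(3) by force
     qed
    qed
    have d3: "\<forall>\<^sub>F s in at_right t. (k t - \<eta>) * (s - t) \<le> G s - G t"
    proof -
     have "continuous (at t within {a..b} - S) k"
      using om_speed_continuous[OF \<gamma> nz v] t unfolding k_def continuous_on_eq_continuous_within by auto
     then have "(G has_vector_derivative k t) (at t within {a..b} - S)"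
      unfolding G_def using t by (intro integral_has_vector_derivative_continuous_at ki S) auto
     moreover have "at t within {t<..<b} - S = at_right t"
      using t S by (intro at_within_nhd[of t "{..<b} - S"]) (auto intro: finite_imp_closed)
     moreover have "{t<..<b} - S \<subseteq> {a..b} - S" using t by auto
     ultimately have "(G has_vector_derivative k t) (at_right t)"
      by (metis has_vector_derivative_within_subset)
     then have "\<forall>\<^sub>F s in at_right t. norm (G s - G t - (s - t) *\<^sub>R k t) \<le> \<eta> * (s - t)"
      using \<eta>(1) by (rule has_vector_derivative_right_bound(1))
     then show ?thesis by eventually_elim (simp add: abs_le_iff algebra_simps)
    qed
    have "\<forall>\<^sub>F s in at_right t. s > t" by (simp add: eventually_at_filter)
    with d1 d2 d3 show "\<forall>\<^sub>F s in at_right t. \<phi> s - \<phi> t \<le> e * (s - t)"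
    proof eventually_elim
     case (elim s)
     have "u (\<gamma> s) - u (\<gamma> t) \<le> (om (\<gamma> t) + \<eta>) * norm (\<gamma> s - \<gamma> t)" using elim(2) by simp
     also have "\<dots> \<le> (om (\<gamma> t) + \<eta>) * ((norm (v t) + \<eta>) * (s - t))"
      using elim(1) om_pos[of "\<gamma> t"] \<eta> by simp
     finally have "\<phi> s - \<phi> t \<le> (om (\<gamma> t) + \<eta>) * ((norm (v t) + \<eta>) * (s - t)) - (k t - \<eta>) * (s - t)"
      using elim(3) by (simp add: \<phi>_def)
     also have "\<dots> = \<eta> * (om (\<gamma> t) + norm (v t) + \<eta> + 1) * (s - t)" by (simp add: k_def algebra_simps)
     also have "\<dots> \<le> \<eta> * c * (s - t)"
      using elim(4) \<eta> by (intro mult_right_mono mult_left_mono) (auto simp: c_def)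
     also have "\<dots> \<le> e * (s - t)" using elim(4) \<eta>(3) by simp
     finally show ?case .
    qed
   qed
   then show ?thesis using integral_unique[OF kr] by (simp add: \<phi>_def G_def)
  qed
  from one[OF u] one[OF om_fun_uminus[OF u]] have "\<bar>u (\<gamma> b) - u (\<gamma> a)\<bar> \<le> r" by simp
  then show ?thesis using real by (simp add: k_def ennreal_leI)
 qed (simp add: k_def)
qed

lemma om_fun_segment:
 assumes u: "u \<in> om_fun" and nz: "0 \<notin> closed_segment x y" and C: "\<And>z. z \<in> closed_segment x y \<Longrightarrow> om z \<le> C"
 shows "\<bar>u y - u x\<bar> \<le> C * norm (y - x)"
proof -
 define \<gamma> where "\<gamma> = (\<lambda>t. x + t *\<^sub>R (y - x))"
 have seg: "\<gamma> t \<in> closed_segment x y" if "t \<in> {0..1}" for t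
  using that by (auto simp: in_segment \<gamma>_def scaleR_diff_left scaleR_diff_right)
 have C0: "0 \<le> C" using C[of x] om_pos[of x] by simp
 have "ennreal \<bar>u (\<gamma> 1) - u (\<gamma> 0)\<bar> \<le> (\<integral>\<^sup>+t\<in>{0..1}. ennreal (om (\<gamma> t) * norm (y - x)) \<partial>lborel)"
 proof (rule om_fun_curve[OF u, where S = "{}"])
  show "(\<gamma> has_vector_derivative (y - x)) (at t)" if "t \<in> {0..1} - {}" for t
   unfolding \<gamma>_def by (auto intro!: derivative_eq_intros)
  show "0 \<notin> \<gamma> ` {0..1}"
  proof
   assume "0 \<in> \<gamma> ` {0..1}"
   then obtain t where "t \<in> {0..1}" "0 = \<gamma> t" by auto
   with seg[of t] nz show False by simp
  qed
 qed (auto simp: \<gamma>_def intro!: continuous_intros)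
 also have "\<dots> \<le> (NN t. ennreal (C * norm (y - x)) * indicator {0..1::real} t)"
  using C seg by (intro nn_integral_mono) (auto split: split_indicator intro!: ennreal_leI mult_right_mono)
 also have "\<dots> = ennreal (C * norm (y - x))" by (subst nn_integral_cmult_indicator) auto
 finally show ?thesis using C0 by (simp add: \<gamma>_def)
qed

text \<open>The segment may pass through the origin. Its translates orthogonal to y - x do so for at
  most one shift, and continuity of \<open>u\<close> leads back to the segment itself.\<close>

lemma om_fun_Lipschitz:
 assumes u: "u \<in> om_fun" shows "\<bar>u y - u x\<bar> \<le> 3 * norm (y - x)"
proof (cases "x = y")
 case False
 define w where "w = \<i> * (y - x)"
 define e where "e = (\<lambda>n::nat. invS n)"
 have e0: "e ----> 0" unfolding e_def by (rule inverse_Suc_tendsto)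
 have bad: "t = Im (- x / (y - x))" if seg: "0 \<in> closed_segment (x + t *\<^sub>R w) (y + t *\<^sub>R w)" for t
 proof -
  obtain l where l: "0 = (1 - l) *\<^sub>R (x + t *\<^sub>R w) + l *\<^sub>R (y + t *\<^sub>R w)" using seg unfolding in_segment by auto
  have "(1 - l) *\<^sub>R (x + t *\<^sub>R w) + l *\<^sub>R (y + t *\<^sub>R w) = x + (of_real l + \<i> * of_real t) * (y - x)"
   by (simp add: w_def scaleR_conv_of_real algebra_simps)
  with l have "- x = (of_real l + \<i> * of_real t) * (y - x)" by (metis add_eq_0_iff2 add.commute)
  then have "- x / (y - x) = of_real l + \<i> * of_real t" using False by simp
  then show ?thesis by simp
 qed
 have "(\<lambda>n. u (x + e n *\<^sub>R w)) ----> u (x + 0 *\<^sub>R w)" "(\<lambda>n. u (y + e n *\<^sub>R w)) ----> u (y + 0 *\<^sub>R w)"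
  by (intro continuous_on_tendsto_compose[OF om_funD(1)[OF u]] tendsto_intros e0; simp)+
 then have "(\<lambda>n. \<bar>u (y + e n *\<^sub>R w) - u (x + e n *\<^sub>R w)\<bar>) ----> \<bar>u y - u x\<bar>"
  using tendsto_rabs[OF tendsto_diff] by force
 then show ?thesis
 proof (rule tendsto_upperbound)
  define t0 where "t0 = Im (- x / (y - x))"
  have "\<forall>\<^sub>F n in sequentially. e n \<noteq> t0"
  proof (cases "t0 > 0")
   case True
   then show ?thesis using order_tendstoD(2)[OF e0 True] by (auto elim: eventually_mono)
  next
   case False
   have "e n > 0" for n by (simp add: e_def)
   then show ?thesis using False by (intro always_eventually allI) (metis less_irrefl)
  qed
  then show "\<forall>\<^sub>F n in sequentially. \<bar>u (y + e n *\<^sub>R w) - u (x + e n *\<^sub>R w)\<bar> \<le> 3 * norm (y - x)"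
  proof eventually_elim
   case (elim n)
   then have "0 \<notin> closed_segment (x + e n *\<^sub>R w) (y + e n *\<^sub>R w)" using bad t0_def by auto
   from om_fun_segment[OF u this om_bounds(2)] show ?case by simp
  qed
 qed simp
qed simp

lemma om_dist_bdd: "bdd_above ((\<lambda>u. \<bar>u x - u y\<bar>) ` om_fun)"
 using om_fun_Lipschitz[of _ x y] by force

lemma om_dist_upper: "u \<in> om_fun \<Longrightarrow> \<bar>u x - u y\<bar> \<le> om_dist x y"
 unfolding om_dist_def by (rule cSUP_upper[OF _ om_dist_bdd])

lemma zero_om_fun: "(\<lambda>z. 0) \<in> om_fun"
 unfolding om_fun_def using om_pos by (auto intro!: always_eventually simp: less_imp_le add_nonneg_nonneg)

lemma om_dist_least: "(\<And>u. u \<in> om_fun \<Longrightarrow> \<bar>u x - u y\<bar> \<le> C) \<Longrightarrow> om_dist x y \<le> C"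
 unfolding om_dist_def using zero_om_fun by (intro cSUP_least) auto

lemma Lipschitz_om_fun:
 assumes "\<And>z w. \<bar>u w - u z\<bar> \<le> norm (w - z)" shows "u \<in> om_fun"
proof -
 have "\<bar>u w - u z\<bar> \<le> (om z + e) * norm (w - z)" if "e > 0" for w z e
 proof -
  have "1 * norm (w - z) \<le> (om z + e) * norm (w - z)"
   using om_bounds(1)[of z] that by (intro mult_right_mono) auto
  then show ?thesis using assms[of w z] by simp
 qed
 moreover have "continuous_on UNIV u" using Lipschitz_continuous[of u 1] assms by simp
 ultimately show ?thesis unfolding om_fun_def by simp
qed

lemma om_dist_planar: "planar om_dist (\<lambda>z. (om z)^2) 1 3 1 9"
proof
 fix x y z :: complex
 show "om_dist x y = om_dist y x" unfolding om_dist_def by (simp add: abs_minus_commute)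
 show "om_dist x z \<le> om_dist x y + om_dist y z"
 proof (rule om_dist_least)
  fix u assume u: "u \<in> om_fun"
  have "\<bar>u x - u z\<bar> \<le> \<bar>u x - u y\<bar> + \<bar>u y - u z\<bar>" by simp
  then show "\<bar>u x - u z\<bar> \<le> om_dist x y + om_dist y z"
   using om_dist_upper[OF u, of x y] om_dist_upper[OF u, of y z] by simp
 qed
 show "om_dist x y \<le> 3 * norm (x - y)" by (intro om_dist_least om_fun_Lipschitz)
 show "1 * norm (x - y) \<le> om_dist x y"
 proof -
  define e where "e = sgn (x - y)"
  have "(\<lambda>w. e \<bullet> w) \<in> om_fun"
  proof (rule Lipschitz_om_fun)
   fix z w
   have "\<bar>e \<bullet> (w - z)\<bar> \<le> norm e * norm (w - z)" by (rule Cauchy_Schwarz_ineq2)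
   also have "\<dots> \<le> 1 * norm (w - z)" by (intro mult_right_mono) (auto simp: e_def norm_sgn)
   finally show "\<bar>e \<bullet> w - e \<bullet> z\<bar> \<le> norm (w - z)" by (simp add: inner_diff_right)
  qed
  from om_dist_upper[OF this, of x y] have "\<bar>e \<bullet> (x - y)\<bar> \<le> om_dist x y" by (simp add: inner_diff_right)
  moreover have "e \<bullet> (x - y) = norm (x - y)"
   by (cases "x = y") (simp_all add: e_def sgn_div_norm power2_norm_eq_inner[symmetric] power2_eq_square)
  ultimately show ?thesis by simp
 qed
 show "(om z)^2 \<le> 9" using power_mono[OF om_bounds(2)[of z], of 2] om_pos[of z] by simp
 show "1 \<le> (om z)^2" using power_mono[OF om_bounds(1)[of z], of 2] by simp
qed auto

text \<open>The test function is a cone of slope \<open>c\<close> with vertex \<open>z\<close>,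
  truncated at distance r / 2 so that it is locally constant away from the disc on which
  \<open>om\<close> exceeds \<open>c\<close>.\<close>

lemma om_dist_local_lower:
 assumes z: "z \<noteq> 0" and c: "c < om z"
 shows "\<forall>\<^sub>F y in at z. c * norm (y - z) \<le> om_dist y z"
proof (cases "c > 0")
 case True
 have "\<forall>\<^sub>F w in nhds z. c < om w"
  using om_isCont[OF z] c by (intro order_tendstoD(1)[where y = "om z"]) (auto simp: isCont_def tendsto_at_iff_tendsto_nhds)
 then obtain r where r: "r > 0" "\<And>w. dist w z < r \<Longrightarrow> c < om w" unfolding eventually_nhds_metric by auto
 define u where "u = (\<lambda>w. c * min (norm (w - z)) (r / 2))"
 have lip: "\<bar>u w - u w'\<bar> \<le> c * norm (w - w')" for w w'
 proof -
  have "\<bar>min (norm (w - z)) (r / 2) - min (norm (w' - z)) (r / 2)\<bar> \<le> norm (w - w')"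
   using norm_triangle_ineq3[of "w - z" "w' - z"] by simp
  then show ?thesis using True by (simp add: u_def right_diff_distrib[symmetric] abs_mult)
 qed
 have "u \<in> om_fun" unfolding om_fun_def
 proof (intro CollectI conjI allI impI)
  show "continuous_on UNIV u" by (rule Lipschitz_continuous[OF lip])
  fix w :: complex and e :: real assume w: "w \<noteq> 0" and e: "e > 0"
  show "\<forall>\<^sub>F w' in at w. \<bar>u w' - u w\<bar> \<le> (om w + e) * norm (w' - w)"
  proof (cases "dist w z < r")
   case True
   have "\<bar>u w' - u w\<bar> \<le> (om w + e) * norm (w' - w)" for w'
    using lip[of w' w] mult_right_mono[of c "om w + e" "norm (w' - w)"] r(2)[OF True] e by auto
   then show ?thesis by simp
  next
   case False
   have "\<forall>\<^sub>F w' in at w. w' \<in> ball w (r / 2)" using r by (intro eventually_at_in_open') auto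
   then show ?thesis
   proof eventually_elim
    case (elim w')
    have "norm (w - z) \<ge> r" "norm (w' - z) \<ge> r / 2"
     using False elim norm_triangle_ineq[of "w - w'" "w' - z"] by (auto simp: dist_norm)
    then have "u w' = u w" using r by (simp add: u_def)
    then show ?case using om_pos[of w] e by simp
   qed
  qed
 qed
 have "\<forall>\<^sub>F y in at z. y \<in> ball z (r / 2)" using r by (intro eventually_at_in_open') auto
 then show ?thesis
 proof eventually_elim
  case (elim y)
  have "u y - u z = c * norm (y - z)" using elim r by (simp add: u_def dist_norm norm_minus_commute)
  then show ?case using om_dist_upper[OF \<open>u \<in> om_fun\<close>, of y z] by simp
 qed
next
 case False
 interpret planar om_dist "\<lambda>z. (om z)^2" 1 3 1 9 by (rule om_dist_planar)
 have "c * norm (y - z) \<le> om_dist y z" for y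
  using mult_right_mono[of c 0 "norm (y - z)"] False d_nonneg[of y z] by simp
 then show ?thesis by simp
qed

text \<open>A neighbourhood in which segments to \<open>z\<close> may be used both to integrate test
  functions and to prolong paths.\<close>

lemma om_dist_local_upper:
 assumes z: "z \<noteq> 0" and c: "om z < c"
 obtains r where "r > 0" "\<And>y. dist y z < r \<Longrightarrow> 0 \<notin> closed_segment y z" "\<And>y w. dist y z < r \<Longrightarrow> w \<in> closed_segment y z \<Longrightarrow> om w < c"
proof -
 have "\<forall>\<^sub>F w in nhds z. om w < c"
  using om_isCont[OF z] c by (intro order_tendstoD(2)[where y = "om z"]) (auto simp: isCont_def tendsto_at_iff_tendsto_nhds)
 then obtain r where r: "r > 0" "\<And>w. dist w z < r \<Longrightarrow> om w < c" unfolding eventually_nhds_metric by auto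
 define r' where "r' = min r (norm z)"
 have seg: "dist w z < r'" if "dist y z < r'" "w \<in> closed_segment y z" for w y
  using that dist_in_closed_segment[of w z y] by (auto simp: closed_segment_commute dist_commute)
 show ?thesis
 proof (rule that[of r'])
  show "0 \<notin> closed_segment y z" if "dist y z < r'" for y
   using seg[OF that, of 0] by (auto simp: r'_def)
  show "om w < c" if "dist y z < r'" "w \<in> closed_segment y z" for y w
   using seg[OF that] r(2) by (simp add: r'_def)
  show "r' > 0" using r z by (simp add: r'_def)
 qed
qed

interpretation X: conformal om_dist "\<lambda>z. (om z)^2" 1 3 1 9
proof (rule conformal.intro[OF om_dist_planar], unfold_locales)
 fix z :: complex assume z: "z \<noteq> 0"
 have ne: "\<forall>\<^sub>F y in at z. y \<noteq> z" by (simp add: eventually_at_filter)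
 have "((\<lambda>y. om_dist y z / norm (y - z)) \<longlongrightarrow> om z) (at z)"
 proof (rule order_tendstoI)
  fix c assume "c < om z"
  then obtain c' where c': "c < c'" "c' < om z" using dense by auto
  show "\<forall>\<^sub>F y in at z. c < om_dist y z / norm (y - z)"
   using om_dist_local_lower[OF z c'(2)] ne
   by eventually_elim (use c'(1) in \<open>auto simp: field_simps intro: less_le_trans[OF mult_strict_right_mono]\<close>)
 next
  fix c assume "om z < c"
  then obtain c' where c': "om z < c'" "c' < c" using dense by auto
  obtain r where r: "r > 0" "\<And>y. dist y z < r \<Longrightarrow> 0 \<notin> closed_segment y z"
   "\<And>y w. dist y z < r \<Longrightarrow> w \<in> closed_segment y z \<Longrightarrow> om w < c'" using om_dist_local_upper[OF z c'(1)] by auto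
  have "om_dist y z \<le> c' * norm (y - z)" if "dist y z < r" for y
  proof (rule om_dist_least)
   fix u assume "u \<in> om_fun"
   from om_fun_segment[OF this r(2)[OF that] less_imp_le[OF r(3)[OF that]]]
   show "\<bar>u y - u z\<bar> \<le> c' * norm (y - z)" by (simp add: norm_minus_commute)
  qed
  then have "\<forall>\<^sub>F y in at z. om_dist y z \<le> c' * norm (y - z)" unfolding eventually_at using r(1) by auto
  then show "\<forall>\<^sub>F y in at z. om_dist y z / norm (y - z) < c"
   using ne by eventually_elim (use c'(2) in \<open>auto simp: field_simps intro: le_less_trans[OF _ mult_strict_right_mono]\<close>)
 qed
 then show "((\<lambda>y. om_dist y z / norm (y - z)) \<longlongrightarrow> sqrt ((om z)^2)) (at z)" using om_pos[of z] by simp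
qed

text \<open>\<open>om\<close> depends only on the norm, hence is constant along the arc.\<close>

lemma om_dist_arc:
 assumes t: "t \<ge> 0" and x: "x \<noteq> 0"
 shows "om_dist x (cis t * x) \<le> om x * norm x * t"
proof (rule om_dist_least)
 fix u assume u: "u \<in> om_fun"
 have om: "om (cis s * x) = om x" for s by (simp add: om_def norm_mult)
 have "ennreal \<bar>u (cis t * x) - u (cis 0 * x)\<bar> \<le> (\<integral>\<^sup>+s\<in>{0..t}. ennreal (om (cis s * x) * norm (\<i> * cis s * x)) \<partial>lborel)"
 proof (rule om_fun_curve[OF u t, where S = "{}"])
  show "((\<lambda>s. cis s * x) has_vector_derivative \<i> * cis s * x) (at s)" if "s \<in> {0..t} - {}" for s
  proof -
   have "((\<lambda>s. cis s) has_vector_derivative \<i> * cis s) (at s)"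
    by (auto simp: complex_eq_iff has_vector_derivative_complex_iff has_real_derivative_iff_has_vector_derivative[symmetric] intro!: derivative_eq_intros)
   then show ?thesis by (rule has_vector_derivative_mult_left)
  qed
 qed (use x in \<open>auto intro!: continuous_intros\<close>)
 also have "\<dots> = (NN s. ennreal (om x * norm x) * indicator {0..t} s)"
  by (simp add: om norm_mult)
 also have "\<dots> = ennreal (om x * norm x * t)"
  using t om_pos[of x] by (subst nn_integral_cmult_indicator) (auto simp: ennreal_mult)
 finally show "\<bar>u x - u (cis t * x)\<bar> \<le> om x * norm x * t"
  using t om_pos[of x] by simp
qed

section \<open>The Riemannian structure away from the origin\<close>

definition om_length :: "(real \<Rightarrow> complex) \<Rightarrow> ennreal" where
 "om_length g = (\<integral>\<^sup>+t\<in>{0..1}. ennreal (om (g t) * norm (vector_derivative g (at t))) \<partial>lborel)"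

definition punctured_paths :: "complex \<Rightarrow> complex \<Rightarrow> (real \<Rightarrow> complex) set" where
 "punctured_paths x y = {g. valid_path g \<and> 0 \<notin> path_image g \<and> pathstart g = x \<and> pathfinish g = y}"

definition om_ldist :: "complex \<Rightarrow> complex \<Rightarrow> ennreal" where
 "om_ldist x y = (INF g\<in>punctured_paths x y. om_length g)"

lemma AE_lborel_not_in_finite: "finite S \<Longrightarrow> AE t::real in lborel. t \<notin> S"
 by (rule AE_not_in) (auto simp: null_sets_def finite_imp_closed intro!: emeasure_lborel_countable countable_finite)

lemma om_length_eq:
 assumes "finite S" "\<And>t. t \<in> {0..1} - S \<Longrightarrow> (g has_vector_derivative v t) (at t)"
 shows "om_length g = (\<integral>\<^sup>+t\<in>{0..1}. ennreal (om (g t) * norm (v t)) \<partial>lborel)"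
 unfolding om_length_def
proof (rule nn_integral_cong_AE)
 show "AE t in lborel. ennreal (om (g t) * norm (vector_derivative g (at t))) * indicator {0..1} t
   = ennreal (om (g t) * norm (v t)) * indicator {0..1} t"
  using AE_lborel_not_in_finite[OF assms(1)]
 proof eventually_elim
  case (elim t)
  then show ?case using vector_derivative_at[OF assms(2)[of t]] by (cases "t \<in> {0..1}") auto
 qed
qed

lemma valid_path_obtain:
 assumes "valid_path g"
 obtains S v where "finite S" "\<And>t. t \<in> {0..1} - S \<Longrightarrow> (g has_vector_derivative v t) (at t)" "continuous_on ({0..1} - S) v"
 using assms unfolding valid_path_def piecewise_C1_differentiable_on_def C1_differentiable_on_def by blast

lemma om_dist_le_length:
 assumes "g \<in> punctured_paths x y" shows "ennreal (om_dist x y) \<le> om_length g"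
proof (cases "om_length g")
 case (real L)
 obtain S v where S: "finite S" and v: "\<And>t. t \<in> {0..1} - S \<Longrightarrow> (g has_vector_derivative v t) (at t)" "continuous_on ({0..1} - S) v"
  using assms valid_path_obtain by (auto simp: punctured_paths_def)
 have g: "continuous_on {0..1} g" "0 \<notin> g ` {0..1}" "g 0 = x" "g 1 = y"
  using assms valid_path_imp_path by (auto simp: punctured_paths_def path_def path_image_def pathstart_def pathfinish_def)
 have "\<bar>u x - u y\<bar> \<le> L" if "u \<in> om_fun" for u
 proof -
  have "ennreal \<bar>u (g 1) - u (g 0)\<bar> \<le> (\<integral>\<^sup>+t\<in>{0..1}. ennreal (om (g t) * norm (v t)) \<partial>lborel)"
   by (rule om_fun_curve[OF that _ g(1,2) S v]) auto
  then have "ennreal \<bar>u y - u x\<bar> \<le> ennreal L" using om_length_eq[OF S, of g v] v(1) unfolding real(2)[symmetric] g by simp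
  then show ?thesis using real(1) by simp
 qed
 then show ?thesis using real by (auto intro!: ennreal_leI om_dist_least)
qed simp

lemma om_dist_le_ldist: "ennreal (om_dist x y) \<le> om_ldist x y"
 unfolding om_ldist_def by (intro INF_greatest om_dist_le_length)

text \<open>Each half of the joined path runs at double speed; an affine substitution in time
  restores the lengths.\<close>

lemma om_length_join:
 assumes g: "g \<in> punctured_paths x z" and h: "h \<in> punctured_paths z w"
 shows "om_length (g +++ h) \<le> om_length g + om_length h"
proof -
 obtain S v where S: "finite S" and v: "\<And>t. t \<in> {0..1} - S \<Longrightarrow> (g has_vector_derivative v t) (at t)" "continuous_on ({0..1} - S) v"
  using g valid_path_obtain by (auto simp: punctured_paths_def)
 obtain S' v' where S': "finite S'" and v': "\<And>t. t \<in> {0..1} - S' \<Longrightarrow> (h has_vector_derivative v' t) (at t)" "continuous_on ({0..1} - S') v'"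
  using h valid_path_obtain by (auto simp: punctured_paths_def)
 have g': "continuous_on {0..1} g" "0 \<notin> g ` {0..1}" and h': "continuous_on {0..1} h" "0 \<notin> h ` {0..1}"
  using g h valid_path_imp_path by (auto simp: punctured_paths_def path_def path_image_def)
 define k where "k = (\<lambda>t. om (g t) * norm (v t) * indicator {0..1} t)"
 define k' where "k' = (\<lambda>t. om (h t) * norm (v' t) * indicator {0..1} t)"
 have [measurable]: "k \<in> borel_measurable borel" "k' \<in> borel_measurable borel"
  unfolding k_def k'_def using om_speed_measurable[OF g' S v(2)] om_speed_measurable[OF h' S' v'(2)] by auto
 define B where "B = {1/2} \<union> (\<lambda>s. s / 2) ` S \<union> (\<lambda>s. (s + 1) / 2) ` S'"
 define V where "V = (\<lambda>t. if t < 1/2 then 2 *\<^sub>R v (2 * t) else 2 *\<^sub>R v' (2 * t - 1))"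
 have B: "finite B" using S S' by (simp add: B_def)
 have der: "((g +++ h) has_vector_derivative V t) (at t)" if t: "t \<in> {0..1} - B" for t
 proof (cases "t < 1/2")
  case True
  have "t \<noteq> s / 2" if "s \<in> S" for s using t that by (auto simp: B_def)
  then have "2 * t \<in> {0..1} - S" using t True by force
  then have "((g \<circ> (\<lambda>t. 2 * t)) has_vector_derivative 2 *\<^sub>R v (2 * t)) (at t)"
   by (intro vector_diff_chain_at v) (auto intro!: derivative_eq_intros simp: has_real_derivative_iff_has_vector_derivative[symmetric])
  then show ?thesis
   unfolding V_def if_P[OF True]
   by (rule has_vector_derivative_transform_within_open[where S = "{..<1/2}"]) (use True in \<open>auto simp: joinpaths_def\<close>)
 next
  case False
  have "t \<noteq> 1/2" using t by (auto simp: B_def)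
  have "t \<noteq> (s + 1) / 2" if "s \<in> S'" for s using t that by (auto simp: B_def)
  then have "2 * t - 1 \<in> {0..1} - S'" using t False by force
  then have "((h \<circ> (\<lambda>t. 2 * t - 1)) has_vector_derivative 2 *\<^sub>R v' (2 * t - 1)) (at t)"
   by (intro vector_diff_chain_at v') (auto intro!: derivative_eq_intros simp: has_real_derivative_iff_has_vector_derivative[symmetric])
  then show ?thesis
   unfolding V_def if_not_P[OF False]
   by (rule has_vector_derivative_transform_within_open[where S = "{1/2<..}"])
    (use False \<open>t \<noteq> 1/2\<close> in \<open>auto simp: joinpaths_def\<close>)
 qed
 have "om_length (g +++ h) = (\<integral>\<^sup>+t\<in>{0..1}. ennreal (om ((g +++ h) t) * norm (V t)) \<partial>lborel)"
  by (rule om_length_eq[OF B der])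
 also have "\<dots> = (NN t. 2 * ennreal (k (0 + 2 * t)) + 2 * ennreal (k' (- 1 + 2 * t)))"
 proof (rule nn_integral_cong_AE)
  have "AE t::real in lborel. t \<noteq> 1/2" using AE_lborel_not_in_finite[of "{1/2}"] by simp
  then show "AE t in lborel. ennreal (om ((g +++ h) t) * norm (V t)) * indicator {0..1} t
    = 2 * ennreal (k (0 + 2 * t)) + 2 * ennreal (k' (- 1 + 2 * t))"
  proof eventually_elim
   case (elim t)
   have 2: "ennreal (a * (2 * b)) = 2 * ennreal (a * b)" if "b \<ge> 0" "a \<ge> 0" for a b
    using that ennreal_mult[of 2 "a * b"] by (simp add: mult_ac)
   show ?case
    using elim om_pos[of "g (2 * t)"] om_pos[of "h (2 * t - 1)"]
    by (auto simp: V_def k_def k'_def joinpaths_def 2 split: split_indicator)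
  qed
 qed
 also have "\<dots> = 2 * (NN t. ennreal (k (0 + 2 * t))) + 2 * (NN t. ennreal (k' (- 1 + 2 * t)))"
  by (subst nn_integral_add) (auto simp: nn_integral_cmult)
 also have "\<dots> = (NN t. ennreal (k t)) + (NN t. ennreal (k' t))"
  using nn_integral_real_affine[of "\<lambda>t. ennreal (k t)" 2 0] nn_integral_real_affine[of "\<lambda>t. ennreal (k' t)" 2 "- 1"] by simp
 also have "(NN t. ennreal (k t)) = om_length g"
  using om_length_eq[OF S v(1)] by (auto simp: k_def intro!: nn_integral_cong split: split_indicator)
 also have "(NN t. ennreal (k' t)) = om_length h"
  using om_length_eq[OF S' v'(1)] by (auto simp: k'_def intro!: nn_integral_cong split: split_indicator)
 finally show ?thesis by simp
qed

text \<open>An almost minimal path to \<open>z\<close> is prolonged by a segment. For short segments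
  this becomes the local condition in \<open>om_fun\<close> for the length distance from
  \<open>x\<close>.\<close>

lemma om_ldist_step:
 assumes nz: "0 \<notin> closed_segment z w" and C: "\<And>p. p \<in> closed_segment z w \<Longrightarrow> om p \<le> C"
 shows "om_ldist x w \<le> om_ldist x z + ennreal (C * norm (w - z))"
proof (rule ennreal_le_epsilon)
 fix e :: real assume e: "0 < e" and fin: "om_ldist x z + ennreal (C * norm (w - z)) < top"
 have "om_ldist x z < om_ldist x z + ennreal e"
  using e fin by simp
 then obtain g where g: "g \<in> punctured_paths x z" "om_length g < om_ldist x z + ennreal e"
  unfolding om_ldist_def[of x z] INF_less_iff by auto
 have l: "linepath z w \<in> punctured_paths z w" using nz by (simp add: punctured_paths_def)
 have "g +++ linepath z w \<in> punctured_paths x w"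
  using g(1) l by (auto simp: punctured_paths_def path_image_join)
 then have "om_ldist x w \<le> om_length (g +++ linepath z w)" unfolding om_ldist_def by (rule INF_lower)
 also have "\<dots> \<le> om_length g + om_length (linepath z w)" by (rule om_length_join[OF g(1) l])
 also have "om_length (linepath z w) = (\<integral>\<^sup>+t\<in>{0..1}. ennreal (om (linepath z w t) * norm (w - z)) \<partial>lborel)"
  by (rule om_length_eq[of "{}"]) (auto intro: has_vector_derivative_linepath_within)
 also have "\<dots> \<le> (NN t. ennreal (C * norm (w - z)) * indicator {0..1::real} t)"
  using C linepath_in_path[of _ z w] by (intro nn_integral_mono) (auto split: split_indicator intro!: ennreal_leI mult_right_mono)
 also have "\<dots> = ennreal (C * norm (w - z))" by (subst nn_integral_cmult_indicator) auto
 finally have "om_ldist x w \<le> om_length g + ennreal (C * norm (w - z))" by simp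
 also have "\<dots> \<le> om_ldist x z + ennreal e + ennreal (C * norm (w - z))" using g(2) by simp
 finally show "om_ldist x w \<le> om_ldist x z + ennreal (C * norm (w - z)) + ennreal e" by (simp add: ac_simps)
qed

text \<open>If the segment passes through the origin, the detour goes via \<i> * z. Its two pieces
  have total length at most 3 * norm z + norm w, while norm (w - z) = norm z + norm w because the
  points lie on opposite sides; with om \<le> 3 the factor is 9.\<close>

lemma om_ldist_step9:
 assumes z: "z \<noteq> 0" and w: "w \<noteq> 0"
 shows "om_ldist x w \<le> om_ldist x z + ennreal (9 * norm (w - z))"
proof (cases "0 \<in> closed_segment z w")
 case False
 have "om_ldist x w \<le> om_ldist x z + ennreal (3 * norm (w - z))" by (rule om_ldist_step[OF False om_bounds(2)])
 also have "\<dots> \<le> om_ldist x z + ennreal (9 * norm (w - z))" by simp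
 finally show ?thesis .
next
 case True
 then obtain l where l: "(1 - of_real l) * z + of_real l * w = 0"
  unfolding in_segment by (auto simp: scaleR_conv_of_real)
 have n1: "0 \<notin> closed_segment z (\<i> * z)"
 proof
  assume "0 \<in> closed_segment z (\<i> * z)"
  then obtain t where "(1 - of_real t) * z + of_real t * (\<i> * z) = 0"
   unfolding in_segment by (auto simp: scaleR_conv_of_real)
  then have "Complex (1 - t) t * z = 0" by (simp add: Complex_eq algebra_simps)
  then show False using z by (auto simp: Complex_eq_0)
 qed
 have n2: "0 \<notin> closed_segment (\<i> * z) w"
 proof
  assume "0 \<in> closed_segment (\<i> * z) w"
  then obtain t where t: "(1 - of_real t) * (\<i> * z) + of_real t * w = 0"
   unfolding in_segment by (auto simp: scaleR_conv_of_real)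
  have "Complex (- t * (1 - l)) ((1 - t) * l) * z
    = of_real l * ((1 - of_real t) * (\<i> * z) + of_real t * w) - of_real t * ((1 - of_real l) * z + of_real l * w)"
   by (simp add: Complex_eq algebra_simps)
  then have "t * (1 - l) = 0" "(1 - t) * l = 0" unfolding t l using z by (auto simp: Complex_eq_0)
  then show False using t l z w by auto
 qed
 have "norm (\<i> * z - z) \<le> 2 * norm z" using norm_triangle_ineq4[of "\<i> * z" z] by (simp add: norm_mult)
 moreover have "norm (w - \<i> * z) \<le> norm w + norm z" using norm_triangle_ineq4[of w "\<i> * z"] by (simp add: norm_mult)
 moreover have "norm (w - z) = norm w + norm z"
  using True unfolding between_mem_segment[symmetric] between by (simp add: dist_norm norm_minus_commute)
 ultimately have le: "3 * norm (\<i> * z - z) + 3 * norm (w - \<i> * z) \<le> 9 * norm (w - z)" by (smt (verit) norm_ge_zero)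
 have "om_ldist x w \<le> om_ldist x (\<i> * z) + ennreal (3 * norm (w - \<i> * z))" by (rule om_ldist_step[OF n2 om_bounds(2)])
 also have "\<dots> \<le> om_ldist x z + ennreal (3 * norm (\<i> * z - z)) + ennreal (3 * norm (w - \<i> * z))"
  by (intro add_right_mono om_ldist_step[OF n1 om_bounds(2)])
 also have "\<dots> = om_ldist x z + ennreal (3 * norm (\<i> * z - z) + 3 * norm (w - \<i> * z))"
  by simp
 also have "\<dots> \<le> om_ldist x z + ennreal (9 * norm (w - z))" by (intro add_left_mono ennreal_leI le)
 finally show ?thesis .
qed

text \<open>By \<open>om_ldist_step9\<close> the length distance from \<open>x\<close> is Lipschitz
  off the origin, so it extends continuously to the origin, and the extension is itself a test
  function. Evaluating \<open>om_dist\<close> on it gives the nontrivial inequality.\<close>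

lemma om_ldist_eq:
 assumes x: "x \<noteq> 0" and y: "y \<noteq> 0" shows "om_ldist x y = ennreal (om_dist x y)"
proof (rule antisym[OF _ om_dist_le_ldist])
 define f where "f = (\<lambda>z. enn2real (om_ldist x z))"
 have xx: "om_ldist x x = 0"
 proof -
  have l: "linepath x x \<in> punctured_paths x x" using x by (simp add: punctured_paths_def)
  have "om_length (linepath x x) = 0" by (simp add: om_length_def)
  then show ?thesis using INF_lower[OF l, of om_length] by (simp add: om_ldist_def)
 qed
 have fin: "om_ldist x z = ennreal (f z)" if "z \<noteq> 0" for z
 proof -
  have "om_ldist x z < top" using om_ldist_step9[OF x that, of x] unfolding xx by (auto simp: less_top[symmetric] top_unique)
  then show ?thesis by (simp add: f_def)
 qed
 have f0: "f z \<ge> 0" for z by (simp add: f_def)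
 have step: "f w \<le> f z + C * norm (w - z)" if "om_ldist x w \<le> om_ldist x z + ennreal (C * norm (w - z))" "z \<noteq> 0" "w \<noteq> 0" "C \<ge> 0" for w z C
  using that f0 by (simp add: fin ennreal_plus[symmetric] del: ennreal_plus)
 have "9-lipschitz_on (- {0}) f"
 proof (rule lipschitz_onI)
  fix z w :: complex assume zw: "z \<in> - {0}" "w \<in> - {0}"
  show "dist (f z) (f w) \<le> 9 * dist z w"
   using step[OF om_ldist_step9, of w z] step[OF om_ldist_step9, of z w] zw by (simp add: dist_norm norm_minus_commute abs_le_iff)
 qed simp
 from lipschitz_extend_closure[OF this] obtain u where u: "9-lipschitz_on (closure (- {0})) u" "\<And>z. z \<noteq> 0 \<Longrightarrow> u z = f z" by auto
 have "closure (- {0::complex}) = UNIV" by (simp add: closure_complement)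
 then have uc: "continuous_on UNIV u" using lipschitz_on_continuous_on[OF u(1)] by simp
 have "u \<in> om_fun" unfolding om_fun_def
 proof (intro CollectI conjI uc allI impI)
  fix z :: complex and e :: real assume z: "z \<noteq> 0" and e: "e > 0"
  have "om z < om z + e" using e by simp
  from om_dist_local_upper[OF z this] obtain r where r: "r > 0" "\<And>y. dist y z < r \<Longrightarrow> 0 \<notin> closed_segment y z"
   "\<And>y w. dist y z < r \<Longrightarrow> w \<in> closed_segment y z \<Longrightarrow> om w < om z + e" by auto
  have "\<bar>u w - u z\<bar> \<le> (om z + e) * norm (w - z)" if w: "dist w z < r" for w
  proof -
   have w0: "w \<noteq> 0" using r(2)[OF w] by auto
   have p: "om z + e \<ge> 0" using om_pos[of z] e by simp
   have "om_ldist x z \<le> om_ldist x w + ennreal ((om z + e) * norm (z - w))"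
    using r(2,3)[OF w] by (intro om_ldist_step less_imp_le)
   moreover have "om_ldist x w \<le> om_ldist x z + ennreal ((om z + e) * norm (w - z))"
    using r(2,3)[OF w] by (intro om_ldist_step less_imp_le) (simp_all add: closed_segment_commute)
   ultimately show ?thesis
    using step[of w z "om z + e"] step[of z w "om z + e"] z w0 p u(2) by (simp add: norm_minus_commute)
  qed
  then show "\<forall>\<^sub>F w in at z. \<bar>u w - u z\<bar> \<le> (om z + e) * norm (w - z)" unfolding eventually_at using r(1) by auto
 qed
 from om_dist_upper[OF this, of x y] have "f y \<le> om_dist x y" using x y xx f0[of y] by (simp add: u(2)) (simp add: f_def)
 then show "om_ldist x y \<le> ennreal (om_dist x y)" using fin[OF y] by (simp add: ennreal_leI)
qed

section \<open>Chart, metric tensor and smoothness\<close>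

definition pplane :: "(nat \<Rightarrow> real) set" where
 "pplane = plane - {iota 0}"

definition idchart :: "(nat \<Rightarrow> real) chart" where
 "idchart = (pplane, \<lambda>x. x)"

definition om_coeffs :: "(nat \<Rightarrow> real) metric_coeffs" where
 "om_coeffs c z i j = (if i = j then (om (kappa z))^2 else 0)"

abbreviation "eplane \<equiv> subtopology (mtopology_of (eucl 2)) pplane"

lemma iota_pplane [simp]: "iota z \<in> pplane \<longleftrightarrow> z \<noteq> 0"
 by (simp add: pplane_def)

lemma pplane_cases: assumes "x \<in> pplane" obtains z where "x = iota z" "z \<noteq> 0"
 using assms plane_cases unfolding pplane_def by auto

lemma kappa_pplane: "x \<in> pplane \<Longrightarrow> kappa x \<noteq> 0" "x \<in> pplane \<Longrightarrow> x \<in> plane"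
 by (metis pplane_cases kappa_iota) (simp add: pplane_def)

lemma pplane_image: "pplane = iota ` (- {0})"
 using range_iota by (auto simp: pplane_def)

lemma homeomorphic_eplane: "homeomorphic_map eplane (top_of_set (- {0})) kappa"
 and continuous_iota_eplane: "continuous_map (top_of_set (- {0})) eplane iota"
proof -
 have h: "homeomorphic_map (mtopology_of (eucl 2)) euclidean kappa" using euclid.homeomorphic_kappa by (simp add: euclid.mtopology_X)
 have e: "plane \<inter> pplane = pplane" by (auto simp: pplane_def)
 have k: "kappa ` pplane = - {0}" by (force simp: pplane_image)
 have *: "homeomorphic_map eplane (top_of_set (- {0})) kappa"
  by (intro homeomorphic_map_subtopologies[OF h]) (simp add: e k euclid.mtopology_X[symmetric])
 then show "homeomorphic_map eplane (top_of_set (- {0})) kappa" .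
 have "continuous_map (top_of_set (- {0})) (mtopology_of (eucl 2)) iota"
  unfolding continuous_map_def euclid.mtopology_X[symmetric] euclid.openin_X
  by (auto simp: openin_open)
 then show "continuous_map (top_of_set (- {0})) eplane iota" by (simp add: continuous_map_in_subtopology)
qed

lemma continuous_map_eplane:
 assumes "continuous_on (- {0}) (\<lambda>z. f (iota z))"
 shows "continuous_map eplane euclideanreal f"
proof (rule continuous_map_eq)
 show "continuous_map eplane euclideanreal ((\<lambda>z. f (iota z)) \<circ> kappa)"
  using assms by (intro continuous_map_compose[OF homeomorphic_imp_continuous_map[OF homeomorphic_eplane]]) simp
qed (auto simp: pplane_def)

text \<open>An algebra closed under partial derivatives, so that all orders are reached by one
  induction. Besides the coordinates it contains 1 / |x|^2 and its sine and cosine, which is where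
  the derivatives of \<open>om\<close> squared lead.\<close>

inductive_set smooth_alg :: "((nat \<Rightarrow> real) \<Rightarrow> real) set" where
 const: "(\<lambda>x. c) \<in> smooth_alg"
| coord: "i < 2 \<Longrightarrow> (\<lambda>x. x i) \<in> smooth_alg"
| inv: "(\<lambda>x. 1 / ((x 0)^2 + (x 1)^2)) \<in> smooth_alg"
| sin: "(\<lambda>x. sin (1 / ((x 0)^2 + (x 1)^2))) \<in> smooth_alg"
| cos: "(\<lambda>x. cos (1 / ((x 0)^2 + (x 1)^2))) \<in> smooth_alg"
| add: "f \<in> smooth_alg \<Longrightarrow> g \<in> smooth_alg \<Longrightarrow> (\<lambda>x. f x + g x) \<in> smooth_alg"
| mult: "f \<in> smooth_alg \<Longrightarrow> g \<in> smooth_alg \<Longrightarrow> (\<lambda>x. f x * g x) \<in> smooth_alg"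

lemma pplane_nz: "x \<in> pplane \<Longrightarrow> (x 0)^2 + (x 1)^2 \<noteq> 0"
 by (erule pplane_cases) (simp add: cmod_power2[symmetric])

text \<open>A partial derivative varies one coordinate; identities known only on
  \<open>pplane\<close> can be differentiated because they persist for nearby values of that
  coordinate.\<close>

lemma pplane_upd:
 assumes "x \<in> pplane" "i < 2" shows "\<forall>\<^sub>F t in nhds (x i). x(i := t) \<in> pplane"
proof -
 obtain z where z: "x = iota z" "z \<noteq> 0" using assms pplane_cases by auto
 define h where "h = (\<lambda>t. if i = 0 then Complex t (Im z) else Complex (Re z) t)"
 have upd: "x(i := t) = iota (h t)" for t
  using assms(2) unfolding z h_def less_2_cases_iff by (auto simp: iota_def)
 have "h (x i) = z" using assms(2) unfolding z h_def less_2_cases_iff by auto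
 moreover have "isCont h (x i)"
  unfolding h_def Complex_eq by (cases "i = 0") (auto intro!: continuous_intros)
 ultimately have "\<forall>\<^sub>F t in nhds (x i). h t \<noteq> 0"
  using z(2) by (metis continuous_at_imp_continuous_within isCont_def t1_space_nhds tendsto_imp_eventually_ne tendsto_at_iff_tendsto_nhds)
 then show ?thesis by (simp add: upd)
qed

lemma smooth_alg_continuous: "f \<in> smooth_alg \<Longrightarrow> continuous_map eplane euclideanreal f"
proof (rule continuous_map_eplane, induction rule: smooth_alg.induct)
 case (coord i)
 then show ?case by (auto simp: less_2_cases_iff intro!: continuous_intros)
qed (auto intro!: continuous_intros simp: cmod_power2[symmetric])

lemma smooth_alg_deriv:
 assumes "f \<in> smooth_alg" "i < 2"
 shows "\<exists>f'\<in>smooth_alg. \<forall>x\<in>pplane. ((\<lambda>t. f (x(i := t))) has_real_derivative f' x) (at (x i))"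
 using assms(1)
proof (induction rule: smooth_alg.induct)
 case (const c)
 show ?case by (intro bexI[OF _ smooth_alg.const[of 0]]) auto
next
 case (coord j)
 show ?case by (intro bexI[OF _ smooth_alg.const[of "if i = j then 1 else 0"]]) auto
next
 define q :: "(nat \<Rightarrow> real) \<Rightarrow> real" where "q = (\<lambda>x. - (2 * x i) * ((1 / ((x 0)^2 + (x 1)^2)) * (1 / ((x 0)^2 + (x 1)^2))))"
 have "(\<lambda>x. (- 2) * x i * ((1 / ((x 0)^2 + (x 1)^2)) * (1 / ((x 0)^2 + (x 1)^2)))) \<in> smooth_alg"
  using assms(2) by (intro smooth_alg.intros)
 then have q: "q \<in> smooth_alg" by (simp add: q_def)
 have d: "((\<lambda>t. 1 / (((x(i := t)) 0)^2 + ((x(i := t)) 1)^2)) has_real_derivative q x) (at (x i))" if "x \<in> pplane" for x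
  using pplane_nz[OF that] assms(2) unfolding less_2_cases_iff
  by (auto simp: q_def divide_simps power2_eq_square intro!: derivative_eq_intros)
 { case inv
  show ?case using q d by auto
 next
  case sin
  show ?case
   by (rule bexI[OF _ smooth_alg.mult[OF smooth_alg.cos q]]) (use DERIV_fun_sin[OF d] in \<open>auto simp del: fun_upd_apply\<close>)
 next
  case cos
  show ?case
   by (rule bexI[OF _ smooth_alg.mult[OF smooth_alg.mult[OF smooth_alg.const[of "- 1"] smooth_alg.sin] q]])
    (use DERIV_fun_cos[OF d] in \<open>auto simp del: fun_upd_apply\<close>) }
next
 case (add f g)
 then obtain f' g' where "f' \<in> smooth_alg" "g' \<in> smooth_alg"
  "\<And>x. x \<in> pplane \<Longrightarrow> ((\<lambda>t. f (x(i := t))) has_real_derivative f' x) (at (x i))"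
  "\<And>x. x \<in> pplane \<Longrightarrow> ((\<lambda>t. g (x(i := t))) has_real_derivative g' x) (at (x i))" by blast
 then show ?case by (intro bexI[OF _ smooth_alg.add[of f' g']]) (auto intro!: DERIV_add simp del: fun_upd_apply)
next
 case (mult f g)
 then obtain f' g' where "f' \<in> smooth_alg" "g' \<in> smooth_alg"
  and d: "\<And>x. x \<in> pplane \<Longrightarrow> ((\<lambda>t. f (x(i := t))) has_real_derivative f' x) (at (x i))"
  "\<And>x. x \<in> pplane \<Longrightarrow> ((\<lambda>t. g (x(i := t))) has_real_derivative g' x) (at (x i))" by blast
 have "((\<lambda>t. f (x(i := t)) * g (x(i := t))) has_real_derivative f' x * g x + f x * g' x) (at (x i))" if "x \<in> pplane" for x
  using DERIV_mult[OF d(1)[OF that] d(2)[OF that]] by (simp add: mult.commute)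
 then show ?case using mult.hyps \<open>f' \<in> smooth_alg\<close> \<open>g' \<in> smooth_alg\<close>
  by (intro bexI[OF _ smooth_alg.add[OF smooth_alg.mult[of f' g] smooth_alg.mult[of f g']]]) (auto simp del: fun_upd_apply)
qed

lemma smooth_on_pplane:
 assumes "g \<in> smooth_alg" "\<And>x. x \<in> pplane \<Longrightarrow> f x = g x"
 shows "smooth_on 2 pplane f"
proof -
 have "Ck 2 pplane k f" if "g \<in> smooth_alg" "\<And>x. x \<in> pplane \<Longrightarrow> f x = g x" for k f g
  using that
 proof (induction k arbitrary: f g)
  case 0
  then show ?case using smooth_alg_continuous[OF 0(1)] by (auto intro: continuous_map_eq)
 next
  case (Suc k)
  have c: "continuous_map eplane euclideanreal f"
   using smooth_alg_continuous[OF Suc.prems(1)] Suc.prems(2) by (auto intro: continuous_map_eq)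
  have "(\<forall>x\<in>pplane. (\<lambda>t. f (x(i := t))) field_differentiable at (x i)) \<and> Ck 2 pplane k (partial_deriv i f)" if i: "i < 2" for i
  proof -
   obtain g' where g': "g' \<in> smooth_alg" and d: "\<And>x. x \<in> pplane \<Longrightarrow> ((\<lambda>t. g (x(i := t))) has_real_derivative g' x) (at (x i))"
    using smooth_alg_deriv[OF Suc.prems(1) i] by blast
   have d': "((\<lambda>t. f (x(i := t))) has_real_derivative g' x) (at (x i))" if x: "x \<in> pplane" for x
   proof -
    have "\<forall>\<^sub>F t in nhds (x i). f (x(i := t)) = g (x(i := t))"
     using pplane_upd[OF x i] by eventually_elim (rule Suc.prems(2))
    from DERIV_cong_ev[OF refl this refl] d[OF x] show ?thesis by simp
   qed
   have "Ck 2 pplane k (partial_deriv i f)"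
    using g' by (rule Suc.IH) (auto simp: partial_deriv_def intro: DERIV_imp_deriv d')
   then show ?thesis using d' by (auto simp: field_differentiable_def)
  qed
  with c show ?case by simp
 qed
 then show ?thesis using assms by (auto simp: smooth_on_def)
qed

abbreviation "idtrans \<equiv> transition (pplane, \<lambda>x. x) (pplane, \<lambda>x. x)"

abbreviation "om_speed \<equiv> curve_speed 2 {idchart} om_coeffs"

lemma transition_idchart: "x \<in> pplane \<Longrightarrow> idtrans x = x"
 unfolding transition_def by simp

lemma om_sq_smooth: "smooth_on 2 pplane (\<lambda>x. (om (kappa x))^2)"
proof (rule smooth_on_pplane)
 let ?s = "\<lambda>x. sin (1 / ((x 0)^2 + (x 1)^2))"
 show "(\<lambda>x. 1 + (1 + ?s x) * (1 + ?s x)) \<in> smooth_alg" by (intro smooth_alg.intros)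
 show "(om (kappa x))^2 = 1 + (1 + ?s x) * (1 + ?s x)" for x
  unfolding om_sq kappa_def complex_norm by (simp add: power2_eq_square)
qed

lemma smooth_manifold_eplane: "smooth_manifold eplane 2 {idchart}"
proof -
 have sc: "second_countable (euclidean :: complex topology)"
 proof -
  obtain B :: "complex set set" where "countable B" "\<And>C. C \<in> B \<Longrightarrow> open C" "\<And>S. open S \<Longrightarrow> \<exists>U. U \<subseteq> B \<and> S = \<Union>U"
   using univ_second_countable by metis
  then show ?thesis unfolding second_countable_def by (intro exI[of _ B]) (simp, metis Union_iff Union_upper subsetD)
 qed
 have "eplane homeomorphic_space (top_of_set (- {0::complex}))"
  using homeomorphic_eplane homeomorphic_map_imp_homeomorphic_space by auto
 then have "second_countable eplane" "Hausdorff_space eplane"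
  using second_countable_subtopology[OF sc] Hausdorff_space_subtopology[OF Hausdorff_space_euclidean]
  by (auto simp: homeomorphic_space_second_countability homeomorphic_Hausdorff_space)
 moreover have "openin (mtopology_of (eucl 2)) pplane"
  unfolding euclid.mtopology_X[symmetric] euclid.openin_X by (auto simp: pplane_image)
 moreover have "smooth_on 2 pplane (\<lambda>z. idtrans z j)" if "j < 2" for j
  using smooth_alg.coord[OF that] by (rule smooth_on_pplane) (simp add: transition_idchart)
 moreover have "pplane \<subseteq> topspace (mtopology_of (eucl 2))"
  by (auto simp: pplane_def plane_def)
 ultimately show ?thesis
  unfolding smooth_manifold_def idchart_def
  by (auto simp: openin_subtopology_refl homeomorphic_map_id[unfolded id_def] Int_absorb1 subtopology_subtopology)
qed

lemma Riemannian_metric_om: "Riemannian_metric 2 {idchart} om_coeffs"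
proof -
 have s: "smooth_on 2 pplane (\<lambda>z. om_coeffs (pplane, \<lambda>x. x) z i j)" for i j
  using om_sq_smooth smooth_on_pplane[OF smooth_alg.const[of 0]] by (cases "i = j") (auto simp: om_coeffs_def)
 have p: "(\<Sum>i<2. \<Sum>j<2. om_coeffs (pplane, \<lambda>x. x) z i j * v i * v j) > 0" if "\<exists>i<2::nat. v i \<noteq> 0" for z v
 proof -
  have "(\<Sum>i<2. \<Sum>j<2. om_coeffs (pplane, \<lambda>x. x) z i j * v i * v j) = (om (kappa z))^2 * ((v 0)^2 + (v 1)^2)"
   by (simp add: numeral_2_eq_2 om_coeffs_def algebra_simps)
  moreover have "(v 0)^2 + (v 1)^2 > 0"
   using that unfolding less_2_cases_iff by (auto simp: sum_power2_gt_zero_iff)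
  ultimately show ?thesis using om_pos[of "kappa z"] by simp
 qed
 have pd: "partial_deriv i (\<lambda>z. idtrans z k) x = (if i = k then 1 else 0)"
  if x: "x \<in> pplane" "i < 2" for i k x
 proof -
  have "\<forall>\<^sub>F t in nhds (x i). idtrans (x(i := t)) k = (x(i := t)) k"
   using pplane_upd[OF x] by eventually_elim (simp only: transition_idchart)
  then have "partial_deriv i (\<lambda>z. idtrans z k) x = deriv (\<lambda>t. (x(i := t)) k) (x i)"
   unfolding partial_deriv_def by (rule deriv_cong_ev) simp
  also have "\<dots> = (if i = k then 1 else 0)" by simp
  finally show ?thesis .
 qed
 have "om_coeffs c x i j = (\<Sum>k<2. \<Sum>l<2. om_coeffs c x k l * (if i = k then 1 else 0) * (if j = l then 1 else 0))"
  if "i < 2" "j < 2" for c x i j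
  using that unfolding less_2_cases_iff by (elim disjE; simp add: numeral_2_eq_2)
 then have t: "om_coeffs (pplane, \<lambda>x. x) x i j = (\<Sum>k<2. \<Sum>l<2. om_coeffs (pplane, \<lambda>x. x) x k l
   * partial_deriv i (\<lambda>z. idtrans z k) x
   * partial_deriv j (\<lambda>z. idtrans z l) x)"
  if "x \<in> pplane" "i < 2" "j < 2" for x i j
  using that by (simp add: pd)
 have sym: "om_coeffs c z i j = om_coeffs c z j i" for c z i j by (simp add: om_coeffs_def)
 show ?thesis
  unfolding Riemannian_metric_def idchart_def
  by (simp only: ball_simps prod.case simp_thms image_ident Int_absorb) (blast intro: s p t sym)
qed

section \<open>Curve lengths and volume in the chart\<close>

lemma curve_speed_om:
 assumes "\<gamma> t \<in> pplane"
 shows "om_speed \<gamma> t = om (kappa (\<gamma> t)) * norm (Complex (deriv (\<lambda>s. \<gamma> s 0) t) (deriv (\<lambda>s. \<gamma> s 1) t))"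
proof -
 \<comment> \<open>There is only one chart, so the choice is determined.\<close>
 have "(SOME c. c \<in> {idchart} \<and> \<gamma> t \<in> fst c) = idchart"
  using assms by (intro some_equality) (auto simp: idchart_def)
 then have "om_speed \<gamma> t
   = sqrt ((om (kappa (\<gamma> t)))^2 * ((deriv (\<lambda>s. \<gamma> s 0) t)^2 + (deriv (\<lambda>s. \<gamma> s 1) t)^2))"
  unfolding curve_speed_def by (simp add: idchart_def om_coeffs_def numeral_2_eq_2 algebra_simps)
 then show ?thesis using om_pos[of "kappa (\<gamma> t)"] by (simp add: real_sqrt_mult complex_norm)
qed

lemma piecewise_C1_curve_eplane:
 "piecewise_C1_curve eplane 2 {idchart} \<gamma> \<longleftrightarrow> \<gamma> ` {0..1} \<subseteq> pplane \<and> valid_path (kappa \<circ> \<gamma>)"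
 (is "?L \<longleftrightarrow> ?R")
proof -
 have C1: "((\<lambda>t. \<gamma> t 0) C1_differentiable_on A \<and> (\<lambda>t. \<gamma> t 1) C1_differentiable_on A) \<longleftrightarrow> (kappa \<circ> \<gamma>) C1_differentiable_on A" for A
 proof
  assume "(\<lambda>t. \<gamma> t 0) C1_differentiable_on A \<and> (\<lambda>t. \<gamma> t 1) C1_differentiable_on A"
  then obtain D0 D1 where "\<And>t. t \<in> A \<Longrightarrow> ((\<lambda>t. \<gamma> t 0) has_vector_derivative D0 t) (at t)" "continuous_on A D0"
   "\<And>t. t \<in> A \<Longrightarrow> ((\<lambda>t. \<gamma> t 1) has_vector_derivative D1 t) (at t)" "continuous_on A D1"
   unfolding C1_differentiable_on_def by auto
  then show "(kappa \<circ> \<gamma>) C1_differentiable_on A"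
   unfolding C1_differentiable_on_def
   by (intro exI[of _ "\<lambda>t. Complex (D0 t) (D1 t)"])
    (auto simp: kappa_def has_vector_derivative_complex_iff has_real_derivative_iff_has_vector_derivative Complex_eq intro!: continuous_intros)
 next
  assume "(kappa \<circ> \<gamma>) C1_differentiable_on A"
  then obtain D where "\<And>t. t \<in> A \<Longrightarrow> ((kappa \<circ> \<gamma>) has_vector_derivative D t) (at t)" "continuous_on A D"
   unfolding C1_differentiable_on_def by auto
  then show "(\<lambda>t. \<gamma> t 0) C1_differentiable_on A \<and> (\<lambda>t. \<gamma> t 1) C1_differentiable_on A"
   unfolding C1_differentiable_on_def
   by (intro conjI exI[of _ "\<lambda>t. Re (D t)"] exI[of _ "\<lambda>t. Im (D t)"])
    (auto simp: kappa_def has_vector_derivative_complex_iff has_real_derivative_iff_has_vector_derivative intro!: continuous_intros)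
 qed
 have cm: "continuous_map (top_of_set {0..1}) eplane \<gamma> \<longleftrightarrow> \<gamma> ` {0..1} \<subseteq> pplane \<and> continuous_on {0..1} (kappa \<circ> \<gamma>)"
 proof
  assume c: "continuous_map (top_of_set {0..1}) eplane \<gamma>"
  show "\<gamma> ` {0..1} \<subseteq> pplane \<and> continuous_on {0..1} (kappa \<circ> \<gamma>)"
  proof
   show "\<gamma> ` {0..1} \<subseteq> pplane" using c by (auto simp: continuous_map_in_subtopology)
   show "continuous_on {0..1} (kappa \<circ> \<gamma>)"
    using continuous_map_compose[OF c homeomorphic_imp_continuous_map[OF homeomorphic_eplane]]
    by simp
  qed
 next
  assume c: "\<gamma> ` {0..1} \<subseteq> pplane \<and> continuous_on {0..1} (kappa \<circ> \<gamma>)"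
  then have "kappa (\<gamma> t) \<noteq> 0" "\<gamma> t \<in> plane" if "t \<in> {0..1}" for t
   using that kappa_pplane[of "\<gamma> t"] by (auto simp: image_subset_iff)
  then have "continuous_map (top_of_set {0..1}) (top_of_set (- {0})) (kappa \<circ> \<gamma>)"
   using c by simp
  from continuous_map_compose[OF this continuous_iota_eplane]
  show "continuous_map (top_of_set {0..1}) eplane \<gamma>"
   by (rule continuous_map_eq) (use \<open>\<And>t. t \<in> {0..1} \<Longrightarrow> \<gamma> t \<in> plane\<close> in auto)
 qed
 have e: "{t \<in> {0..1}. \<gamma> t \<in> pplane} = {0..1}" if "\<gamma> ` {0..1} \<subseteq> pplane" using that by auto
 have "(\<forall>(U, \<phi>)\<in>{idchart}. \<forall>i<2. (\<lambda>t. \<phi> (\<gamma> t) i) C1_differentiable_on ({t \<in> {0..1}. \<gamma> t \<in> U} - S))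
   \<longleftrightarrow> (kappa \<circ> \<gamma>) C1_differentiable_on ({0..1} - S)" if "\<gamma> ` {0..1} \<subseteq> pplane" for S
 proof -
  have "(\<forall>(U, \<phi>)\<in>{idchart}. \<forall>i<2. (\<lambda>t. \<phi> (\<gamma> t) i) C1_differentiable_on ({t \<in> {0..1}. \<gamma> t \<in> U} - S))
    \<longleftrightarrow> (\<forall>i<2. (\<lambda>t. \<gamma> t i) C1_differentiable_on ({t \<in> {0..1}. \<gamma> t \<in> pplane} - S))"
   by (simp add: idchart_def)
  also have "\<dots> \<longleftrightarrow> (kappa \<circ> \<gamma>) C1_differentiable_on ({0..1} - S)"
   unfolding e[OF that] C1[symmetric] by (auto simp: less_2_cases_iff)
  finally show ?thesis .
 qed
 then show ?thesis
  unfolding piecewise_C1_curve_def cm valid_path_def piecewise_C1_differentiable_on_def by blast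
qed

lemma curve_length_om:
 assumes "piecewise_C1_curve eplane 2 {idchart} \<gamma>"
 shows "curve_length 2 {idchart} om_coeffs \<gamma> = om_length (kappa \<circ> \<gamma>)"
proof -
 have p: "\<gamma> ` {0..1} \<subseteq> pplane" and v: "valid_path (kappa \<circ> \<gamma>)" using assms by (auto simp: piecewise_C1_curve_eplane)
 obtain S w where S: "finite S" and w: "\<And>t. t \<in> {0..1} - S \<Longrightarrow> ((kappa \<circ> \<gamma>) has_vector_derivative w t) (at t)"
  using valid_path_obtain[OF v] by metis
 have "w t = Complex (deriv (\<lambda>s. \<gamma> s 0) t) (deriv (\<lambda>s. \<gamma> s 1) t)" if "t \<in> {0..1} - S" for t
  using w[OF that] by (auto simp: has_vector_derivative_complex_iff kappa_def DERIV_imp_deriv)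
 then have *: "om_speed \<gamma> t = om ((kappa \<circ> \<gamma>) t) * norm (w t)" if "t \<in> {0..1} - S" for t
  using that p by (simp add: curve_speed_om image_subset_iff)
 show ?thesis
  unfolding curve_length_def
 proof (subst om_length_eq[OF S w], assumption, rule nn_integral_cong_AE)
  show "AE t in lborel. ennreal (om_speed \<gamma> t) * indicator {0..1} t = ennreal (om ((kappa \<circ> \<gamma>) t) * norm (w t)) * indicator {0..1} t"
   using AE_lborel_not_in_finite[OF S] by eventually_elim (auto simp: * split: split_indicator)
 qed
qed

lemma length_distance_om:
 assumes "x \<noteq> 0" "y \<noteq> 0"
 shows "length_distance eplane 2 {idchart} om_coeffs (iota x) (iota y) = ennreal (om_dist x y)"
proof -
 let ?L = "length_distance eplane 2 {idchart} om_coeffs (iota x) (iota y)"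
 have "?L = om_ldist x y"
 proof (rule antisym)
  show "?L \<le> om_ldist x y"
   unfolding om_ldist_def
  proof (rule INF_greatest)
   fix g assume g: "g \<in> punctured_paths x y"
   have e: "kappa \<circ> (iota \<circ> g) = g" by auto
   have pc: "piecewise_C1_curve eplane 2 {idchart} (iota \<circ> g)"
    unfolding piecewise_C1_curve_eplane e using g by (auto simp: punctured_paths_def path_image_def)
   then have "?L \<le> curve_length 2 {idchart} om_coeffs (iota \<circ> g)"
    unfolding length_distance_def using g by (intro INF_lower) (auto simp: punctured_paths_def pathstart_def pathfinish_def)
   then show "?L \<le> om_length g"
    by (simp only: curve_length_om[OF pc] e)
  qed
  show "om_ldist x y \<le> ?L"
   unfolding length_distance_def
  proof (rule INF_greatest)
   fix \<gamma> assume g: "\<gamma> \<in> {\<gamma>. piecewise_C1_curve eplane 2 {idchart} \<gamma> \<and> \<gamma> 0 = iota x \<and> \<gamma> 1 = iota y}"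
   have "kappa (\<gamma> t) \<noteq> 0" if "t \<in> {0..1}" for t
    using that g kappa_pplane(1)[of "\<gamma> t"] by (simp add: piecewise_C1_curve_eplane image_subset_iff)
   then have "kappa \<circ> \<gamma> \<in> punctured_paths x y"
    using g by (auto simp: punctured_paths_def piecewise_C1_curve_eplane path_image_def pathstart_def pathfinish_def)
   then have "om_ldist x y \<le> om_length (kappa \<circ> \<gamma>)" unfolding om_ldist_def by (rule INF_lower)
   then show "om_ldist x y \<le> curve_length 2 {idchart} om_coeffs \<gamma>" using g by (simp add: curve_length_om)
  qed
 qed
 then show ?thesis using om_ldist_eq[OF assms] by simp
qed

lemma det_n_diag: "det_n n (\<lambda>i j. if i = j then a i else 0) = (\<Prod>i<n. a i)"
proof -
 have "(\<Prod>i<n. if i = p i then a i else 0) = 0" if p: "p permutes {..<n}" "p \<noteq> id" for p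
 proof -
  obtain i where "p i \<noteq> i" using p(2) by force
  then have "i < n" using p(1) by (metis lessThan_iff permutes_not_in)
  then show ?thesis using \<open>p i \<noteq> i\<close> by force
 qed
 then have "det_n n (\<lambda>i j. if i = j then a i else 0)
   = (\<Sum>p | p permutes {..<n}. if p = id then (\<Prod>i<n. a i) else 0)"
  unfolding det_n_def by (intro sum.cong) auto
 then show ?thesis by (simp add: finite_permutations)
qed

lemma is_volume_measure_om:
 "is_volume_measure 2 {idchart} om_coeffs (restrict_space X.m pplane)"
proof -
 have "emeasure (restrict_space X.m pplane) A = (\<integral>\<^sup>+z\<in>A. ennreal (sqrt (det_n 2 (om_coeffs idchart z))) \<partial>(PiM {..<2} (\<lambda>_. lborel)))"
  if A: "A \<in> sets (restrict_space X.m pplane)" "A \<subseteq> pplane" for A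
 proof -
  have pm: "pplane \<in> sets X.m" unfolding X.sets_m pplane_image by force
  have Am: "A \<in> sets X.m" using A pm by (auto simp: sets_restrict_space)
  then obtain B where B [measurable]: "B \<in> sets borel" and AB: "A = iota ` B" unfolding X.sets_m by auto
  let ?k = "\<lambda>f::nat \<Rightarrow> real. Complex (f 0) (f 1)"
  have [measurable]: "(\<lambda>f. f i) \<in> PiM {..<2::nat} (\<lambda>_. lborel :: real measure) \<rightarrow>\<^sub>M borel" if "i < 2" for i
   using that measurable_component_singleton[of i "{..<2}" "\<lambda>_. lborel :: real measure"] by simp
  have [measurable]: "?k \<in> PiM {..<2::nat} (\<lambda>_. lborel :: real measure) \<rightarrow>\<^sub>M borel" unfolding Complex_eq by simp
  have "emeasure (restrict_space X.m pplane) A = emeasure X.m A"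
   using A pm sets.sets_into_space[OF pm] by (intro emeasure_restrict_space) (auto simp: Int_absorb2)
  also have "\<dots> = (\<integral>\<^sup>+z\<in>B. ennreal ((om z)^2) \<partial>lborel)" unfolding AB by (rule X.emeasure_m[OF B])
  also have "\<dots> = (\<integral>\<^sup>+f. ennreal ((om (?k f))^2) * indicator B (?k f) \<partial>(PiM {..<2} (\<lambda>_. lborel)))"
   by (subst lborel_complex_PiM, subst nn_integral_distr) (simp_all del: One_nat_def)
  also have "\<dots> = (\<integral>\<^sup>+z\<in>A. ennreal (sqrt (det_n 2 (om_coeffs idchart z))) \<partial>(PiM {..<2} (\<lambda>_. lborel)))"
  proof (rule nn_integral_cong)
   fix f assume "f \<in> space (PiM {..<2::nat} (\<lambda>_. lborel :: real measure))"
   then have f: "f \<in> plane" by (simp add: space_PiM plane_def)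
   \<comment> \<open>The determinant of the diagonal matrix is the fourth power of
     \<open>om\<close>.\<close>
   have "sqrt (det_n 2 (om_coeffs idchart f)) = (om (kappa f))^2"
    using det_n_diag[of 2 "\<lambda>_. (om (kappa f))^2"] by (simp add: om_coeffs_def[abs_def] numeral_2_eq_2)
   moreover have "f \<in> A \<longleftrightarrow> kappa f \<in> B" using f unfolding AB by force
   ultimately show "ennreal ((om (?k f))^2) * indicator B (?k f) = ennreal (sqrt (det_n 2 (om_coeffs idchart f))) * indicator A f"
    by (simp add: kappa_def[symmetric] del: One_nat_def split: split_indicator)
  qed
  finally show ?thesis .
 qed
 then show ?thesis by (simp add: is_volume_measure_def idchart_def)
qed

lemma Riemannian_manifold_X:
 "Riemannian_manifold (submetric X.X (mspace X.X - {iota 0})) (restrict_space X.m (mspace X.X - {iota 0}))"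
proof -
 have T: "mtopology_of (submetric X.X pplane) = eplane"
  by (simp add: mtopology_of_submetric X.mtopology_X)
 have "length_distance eplane 2 {idchart} om_coeffs x y = ennreal (mdist X.X x y)"
  if "x \<in> pplane" "y \<in> pplane" for x y
  using that by (auto elim!: pplane_cases simp: length_distance_om)
 then show ?thesis
  unfolding Riemannian_manifold_def X.mspace_X pplane_def[symmetric] T
  using smooth_manifold_eplane Riemannian_metric_om is_volume_measure_om
  by force
qed

section \<open>A Riemann--Lebesgue lemma\<close>

definition vanishes :: "'a measure \<Rightarrow> (nat \<Rightarrow> 'a \<Rightarrow> complex) \<Rightarrow> ('a \<Rightarrow> real) \<Rightarrow> bool" where
 "vanishes M E f \<longleftrightarrow> (\<lambda>n. \<integral>x. f x *\<^sub>R E n x \<partial>M) ----> 0"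

lemma norm_integral_le:
 fixes f :: "'a \<Rightarrow> complex"
 assumes "integrable M f" "integrable M g" "\<And>x. norm (f x) \<le> g x"
 shows "norm (\<integral>x. f x \<partial>M) \<le> (\<integral>x. g x \<partial>M)"
 using assms by (intro order_trans[OF integral_norm_bound integral_mono]) auto

locale oscillation =
 fixes M :: "'a measure" and E :: "nat \<Rightarrow> 'a \<Rightarrow> complex"
 assumes E_measurable [measurable]: "\<And>n. E n \<in> borel_measurable M" and E_bound: "\<And>n x. norm (E n x) \<le> 1"
begin

lemma scale_E_le: "norm (c *\<^sub>R E n x) \<le> \<bar>c\<bar>"
 using mult_left_le[OF E_bound, of "\<bar>c\<bar>" n x] by simp

lemma integrable_E: "integrable M f \<Longrightarrow> integrable M (\<lambda>x. f x *\<^sub>R E n x)" for f :: "'a \<Rightarrow> real"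
 by (rule Bochner_Integration.integrable_bound[where f = f]) (use scale_E_le in \<open>auto simp: borel_measurable_integrable\<close>)

lemma vanishes_add: "integrable M f \<Longrightarrow> integrable M g \<Longrightarrow> vanishes M E f \<Longrightarrow> vanishes M E g \<Longrightarrow> vanishes M E (\<lambda>x. f x + g x)"
 unfolding vanishes_def scaleR_left.add
 by (subst Bochner_Integration.integral_add) (auto simp: integrable_E intro: tendsto_add_zero)

lemma vanishes_cmult: "vanishes M E f \<Longrightarrow> vanishes M E (\<lambda>x. c * f x)"
 unfolding vanishes_def using tendsto_scaleR[OF tendsto_const[of c], of _ 0] by (simp flip: scaleR_scaleR)

text \<open>Replacing \<open>f\<close> by \<open>s i\<close> causes an error bounded by their L1
  distance, uniformly in \<open>n\<close>, because the oscillating factors are bounded by 1.\<close>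

lemma vanishes_limit:
 assumes s: "\<And>i. vanishes M E (s i)" "\<And>i. s i \<in> borel_measurable M" and w: "integrable M w"
  and f: "f \<in> borel_measurable M"
  and lim: "\<And>x. x \<in> space M \<Longrightarrow> (\<lambda>i. s i x) ----> f x" and bd: "\<And>i x. x \<in> space M \<Longrightarrow> \<bar>s i x\<bar> \<le> w x"
 shows "vanishes M E f"
 unfolding vanishes_def
proof (rule LIMSEQ_I)
 fix e :: real assume e: "e > 0"
 note [measurable] = s(2) f borel_measurable_integrable[OF w]
 have fw: "\<bar>f x\<bar> \<le> w x" if "x \<in> space M" for x
  using tendsto_rabs[OF lim[OF that]] bd[OF that] by (intro tendsto_upperbound) auto
 have fi: "integrable M f" and si: "integrable M (s i)" for i
  by (auto intro!: Bochner_Integration.integrable_bound[OF w] AE_I2 order_trans[OF fw abs_ge_self] order_trans[OF bd abs_ge_self])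
 have "(\<lambda>i. \<integral>x. \<bar>s i x - f x\<bar> \<partial>M) ----> (\<integral>x. 0 \<partial>M)"
 proof (rule integral_dominated_convergence[where w = "\<lambda>x. 2 * w x"])
  show "AE x in M. (\<lambda>i. \<bar>s i x - f x\<bar>) ----> 0"
   by (rule AE_I2) (use lim in \<open>auto intro!: tendsto_rabs_zero simp: LIM_zero_iff\<close>)
  show "AE x in M. norm \<bar>s i x - f x\<bar> \<le> 2 * w x" for i
   by (rule AE_I2) (use fw bd[of _ i] in \<open>force\<close>)
 qed (use w in auto)
 then have "\<forall>\<^sub>F i in sequentially. (\<integral>x. \<bar>s i x - f x\<bar> \<partial>M) < e / 2"
  using e by (intro order_tendstoD(2)[of _ 0]) auto
 then obtain i where i: "(\<integral>x. \<bar>s i x - f x\<bar> \<partial>M) < e / 2" by force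
 obtain N where N: "\<And>n. n \<ge> N \<Longrightarrow> norm (\<integral>x. s i x *\<^sub>R E n x \<partial>M) < e / 2"
  using LIMSEQ_D[OF s(1)[of i, unfolded vanishes_def], of "e / 2"] e by auto
 have "norm (\<integral>x. f x *\<^sub>R E n x \<partial>M) < e" if "n \<ge> N" for n
 proof -
  have "(\<integral>x. f x *\<^sub>R E n x \<partial>M) = (\<integral>x. s i x *\<^sub>R E n x \<partial>M) - (\<integral>x. (s i x - f x) *\<^sub>R E n x \<partial>M)"
   unfolding scaleR_left.diff by (subst Bochner_Integration.integral_diff) (auto simp: integrable_E fi si)
  also have "norm \<dots> \<le> norm (\<integral>x. s i x *\<^sub>R E n x \<partial>M) + norm (\<integral>x. (s i x - f x) *\<^sub>R E n x \<partial>M)"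
   by (rule norm_triangle_ineq4)
  also have "norm (\<integral>x. (s i x - f x) *\<^sub>R E n x \<partial>M) \<le> (\<integral>x. \<bar>s i x - f x\<bar> \<partial>M)"
   by (rule norm_integral_le) (auto simp: integrable_E fi si intro: scale_E_le simp del: norm_scaleR)
  finally show ?thesis using i N[OF that] by simp
 qed
 then show "\<exists>N. \<forall>n\<ge>N. norm ((\<integral>x. f x *\<^sub>R E n x \<partial>M) - 0) < e" by auto
qed

end

text \<open>A Dynkin argument leads from intervals to Borel sets, approximation from these to
  integrable functions. The first step is made inside the compact intervals \<open>I n\<close>,
  because complements need finite measure and the base case needs positive endpoints.\<close>

lemma vanishes_positive:
 assumes "oscillation lborel E" and base: "\<And>a b. 0 < a \<Longrightarrow> a \<le> b \<Longrightarrow> vanishes lborel E (indicator {a..b})"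
  and f: "integrable lborel f"
 shows "vanishes lborel E (\<lambda>x::real. indicator {0<..} x * f x)"
proof -
 interpret oscillation lborel E by fact
 define I where "I = (\<lambda>n. {invS n..real (Suc n)})"
 have Ii: "integrable lborel (indicator (I n) :: real \<Rightarrow> real)" for n
  unfolding I_def by (intro integrable_real_indicator) (simp_all del: emeasure_lborel_Icc_eq add: emeasure_lborel_Icc_eq ennreal_less_top)
 have AI: "integrable lborel (\<lambda>x. indicator A x * indicator (I n) x :: real)" if "A \<in> sets borel" for A n
  using that by (intro Bochner_Integration.integrable_bound[OF Ii[of n]]) (auto simp: I_def split: split_indicator)
 have sets: "vanishes lborel E (\<lambda>x. indicator A x * indicator (I n) x)" if "A \<in> sets borel" for A n
  using that
 proof (induction rule: borel_set_induct)
  case empty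
  then show ?case by (simp add: vanishes_def)
 next
  case (interval a b)
  define a' b' where "a' = max a (invS n)" "b' = min b (real (Suc n))"
  have e: "(\<lambda>x. indicator {a..b} x * indicator (I n) x :: real) = indicator {a'..b'}"
   by (auto simp: fun_eq_iff I_def a'_b'_def split: split_indicator)
  show ?case
  proof (cases "a' \<le> b'")
   case True
   moreover have "0 < a'" by (simp add: a'_b'_def less_max_iff_disj)
   ultimately show ?thesis unfolding e using base by simp
  qed (simp add: e vanishes_def)
 next
  case (compl A)
  have "invS n \<le> 1 / 1" by simp
  also have "\<dots> \<le> real (Suc n)" by simp
  finally have "vanishes lborel E (indicator (I n))"
   unfolding I_def by (intro base) auto
  then have "vanishes lborel E (\<lambda>x. indicator (I n) x + (- 1) * (indicator A x * indicator (I n) x))"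
   using compl Ii AI by (intro vanishes_add vanishes_cmult) auto
  also have "(\<lambda>x. indicator (I n) x + (- 1) * (indicator A x * indicator (I n) x)) = (\<lambda>x. indicator (- A) x * indicator (I n) x :: real)"
   by (auto split: split_indicator)
  finally show ?case .
 next
  case (union F)
  note [measurable] = union(2)
  have s: "(\<Sum>i<m. indicator (F i) x) = (indicator (\<Union>i<m. F i) x :: real)" for m x
   using union(1) by (subst indicator_UN_disjoint) (auto simp: disjoint_family_on_def)
  show ?case
  proof (rule vanishes_limit[where s = "\<lambda>m x. \<Sum>i<m. indicator (F i) x * indicator (I n) x", OF _ _ Ii[of n]])
   show "vanishes lborel E (\<lambda>x. \<Sum>i<m. indicator (F i) x * indicator (I n) x)" for m
   proof (induction m)
    case 0
    show ?case by (simp add: vanishes_def)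
   next
    case (Suc m)
    note i = AI[OF union(2), of _ n]
    show ?case unfolding sum.lessThan_Suc
     using i by (intro vanishes_add Suc union(3) Bochner_Integration.integrable_sum) auto
   qed
   show "(\<lambda>m. \<Sum>i<m. indicator (F i) x * indicator (I n) x) ----> (indicator (\<Union>i. F i) x * indicator (I n) x :: real)" for x
    unfolding sum_distrib_right[symmetric] s by (intro tendsto_mult LIMSEQ_indicator_UN tendsto_const)
   show "\<bar>\<Sum>i<m. indicator (F i) x * indicator (I n) x\<bar> \<le> (indicator (I n) x :: real)" for m x
    unfolding sum_distrib_right[symmetric] s by (auto split: split_indicator)
  qed (auto simp: I_def)
 qed
 have lim: "(\<lambda>n. indicator (I n) x) ----> (indicator {0<..} x :: real)" for x
 proof -
  have "\<forall>\<^sub>F n in sequentially. indicator (I n) x = (indicator {0<..} x :: real)"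
  proof (cases "x > 0")
   case True
   have "\<forall>\<^sub>F n in sequentially. invS n < x"
    using True LIMSEQ_Suc[OF lim_const_over_n[of 1]] by (rule order_tendstoD(2)[rotated])
   moreover have "\<forall>\<^sub>F n in sequentially. x \<le> real (Suc n)"
    using eventually_ge_at_top[of "nat \<lceil>x\<rceil>"] by eventually_elim linarith
   ultimately show ?thesis by eventually_elim (use True in \<open>auto simp: I_def\<close>)
  next
   case False
   then have "x < invS n" for n by (intro le_less_trans[of x 0]) auto
   then have "x \<notin> I n" for n unfolding I_def by (metis atLeastAtMost_iff not_le)
   then show ?thesis using False by simp
  qed
  then show ?thesis by (rule tendsto_eventually)
 qed
 show ?thesis using f
 proof (induction rule: integrable_induct)
  case (base A c)
  have Ai: "integrable lborel (indicator A :: real \<Rightarrow> real)" using base by simp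
  have "vanishes lborel E (\<lambda>x. indicator {0<..} x * indicator A x)"
  proof (rule vanishes_limit[OF sets[of A] _ Ai])
   show "(\<lambda>n. indicator A x * indicator (I n) x) ----> (indicator {0<..} x * indicator A x :: real)" for x
    using tendsto_mult[OF tendsto_const lim, of "indicator A x" x] by (simp add: mult.commute)
  qed (use base in \<open>auto simp: I_def split: split_indicator\<close>)
  from vanishes_cmult[OF this, of c] show ?case by (simp add: mult_ac)
 next
  case (add f g)
  have "integrable lborel (\<lambda>x. indicator {0<..} x * f x)" "integrable lborel (\<lambda>x. indicator {0<..} x * g x)"
   using integrable_mult_indicator[of "{0<..}" lborel f] integrable_mult_indicator[of "{0<..}" lborel g] add by auto
  from vanishes_add[OF this] add show ?case by (simp add: distrib_left)
 next
  case (lim f s)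
  note [measurable] = borel_measurable_integrable[OF lim.hyps(1)] borel_measurable_integrable[OF lim.hyps(4)]
  show ?case
  proof (rule vanishes_limit[OF lim.IH, where w = "\<lambda>x. 2 * \<bar>f x\<bar>"])
   show "(\<lambda>i. indicator {0<..} x * s i x) ----> indicator {0<..} x * f x" for x
    using lim.hyps(2)[of x] by (intro tendsto_intros) auto
   show "\<bar>indicator {0<..} x * s i x\<bar> \<le> 2 * \<bar>f x\<bar>" for i x
    using lim.hyps(3)[of x i] by (auto split: split_indicator)
  qed (use lim.hyps(4) in auto)
 qed
qed

text \<open>Reflection carries the negative half line to the positive one.\<close>

lemma vanishes_even:
 assumes E: "oscillation lborel E" and base: "\<And>a b. 0 < a \<Longrightarrow> a \<le> b \<Longrightarrow> vanishes lborel E (indicator {a..b})"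
  and even: "\<And>n x. E n (- x) = E n x" and f: "integrable lborel f"
 shows "vanishes lborel E (f :: real \<Rightarrow> real)"
proof -
 interpret oscillation lborel E by fact
 note [measurable] = borel_measurable_integrable[OF f]
 have f': "integrable lborel (\<lambda>x. f (- x))" using lborel_integrable_real_affine[OF f, of "- 1" 0] by simp
 have pos: "vanishes lborel E (\<lambda>x::real. indicator {0<..} x * f x)" if "integrable lborel f" for f
  by (rule vanishes_positive[OF E _ that]) (rule base)
 have i1: "integrable lborel (\<lambda>x. indicator {0<..} x * f x)" and i2: "integrable lborel (\<lambda>x. indicator {..<0} x * f x)"
  using integrable_mult_indicator[of "{0<..}" lborel f] integrable_mult_indicator[of "{..<0}" lborel f] f by auto
 have "(LB x. (indicator {..<0} x * f x) *\<^sub>R E n x) = (LB x. (indicator {0<..} x * f (- x)) *\<^sub>R E n x)" for n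
 proof -
  have "indicator {..<0} (- x) = (indicator {0<..} x :: real)" for x :: real by (auto split: split_indicator)
  then show ?thesis
   using lborel_integral_real_affine[of "- 1" "\<lambda>x. (indicator {..<0} x * f x) *\<^sub>R E n x" 0] by (simp add: even)
 qed
 then have "vanishes lborel E (\<lambda>x. indicator {..<0} x * f x)"
  using pos[OF f'] by (simp add: vanishes_def)
 from vanishes_add[OF i1 i2 pos[OF f] this]
 have "vanishes lborel E (\<lambda>x. indicator {0<..} x * f x + indicator {..<0} x * f x)" .
 moreover have "(LB x. (indicator {0<..} x * f x + indicator {..<0} x * f x) *\<^sub>R E n x) = (LB x. f x *\<^sub>R E n x)" for n
 proof (rule integral_cong_AE)
  show "AE x in lborel. (indicator {0<..} x * f x + indicator {..<0} x * f x) *\<^sub>R E n x = f x *\<^sub>R E n x"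
   using AE_lborel_not_in_finite[of "{0}"] by simp (auto elim!: eventually_mono split: split_indicator)
 qed auto
 ultimately show ?thesis by (simp add: vanishes_def)
qed

lemma cis_vector_derivative:
 assumes "(f has_real_derivative f') (at x within A)"
 shows "((\<lambda>x. cis (f x)) has_vector_derivative \<i> * of_real f' * cis (f x)) (at x within A)"
proof -
 have "((\<lambda>x. Re (cis (f x))) has_vector_derivative Re (\<i> * of_real f' * cis (f x))) (at x within A)"
  "((\<lambda>x. Im (cis (f x))) has_vector_derivative Im (\<i> * of_real f' * cis (f x))) (at x within A)"
  using assms unfolding has_real_derivative_iff_has_vector_derivative[symmetric] by (auto intro!: derivative_eq_intros)
 then show ?thesis by (simp only: has_vector_derivative_complex_iff has_real_derivative_iff_has_vector_derivative simp_thms)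
qed

text \<open>Integration by parts: up to sign, \<theta> is the reciprocal of the derivative of 1 /
  (x^2 + y^2) in x. It has a continuous derivative on \<open>{a..b}\<close>, so the integral is of
  order 1 / L for the frequency L.\<close>

lemma cis_oscillation:
 assumes "filterlim \<Lambda> at_top sequentially" "0 < a" "a \<le> b"
 shows "vanishes lborel (\<lambda>n x. cis (\<Lambda> n / (x^2 + y^2))) (indicator {a..b})"
proof -
 define \<theta> where "\<theta> = (\<lambda>x. (x^2 + y^2)^2 / (2 * x))"
 define \<theta>' where "\<theta>' = (\<lambda>x. 2 * (x^2 + y^2) - (x^2 + y^2)^2 / (2 * x^2))"
 have pos: "x^2 + y^2 > 0" if "x > 0" for x using that by (simp add: add_pos_nonneg)
 have d\<theta>: "(\<theta> has_real_derivative \<theta>' x) (at x within A)" if "x > 0" for x A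
  unfolding \<theta>_def \<theta>'_def using that pos[OF that]
  by (auto intro!: derivative_eq_intros simp: field_simps power2_eq_square)
 have \<theta>'c: "continuous_on {a..b} \<theta>'"
  unfolding \<theta>'_def using assms by (intro continuous_intros) auto
 define B where "B = \<bar>\<theta> b\<bar> + \<bar>\<theta> a\<bar> + (LB x. indicator {a..b} x *\<^sub>R \<bar>\<theta>' x\<bar>)"
 have bound: "norm (LB x. indicator {a..b} x *\<^sub>R cis (L / (x^2 + y^2))) \<le> B / L" if L: "L > 0" for L
 proof -
  define e where "e = (\<lambda>x. cis (L / (x^2 + y^2)))"
  have de: "(e has_vector_derivative (\<i> * of_real (- L * 2 * x / (x^2 + y^2)^2)) * e x) (at x within A)" if "x > 0" for x A
   unfolding e_def by (rule cis_vector_derivative) (use pos[OF that] in \<open>auto intro!: derivative_eq_intros simp: field_simps power2_eq_square\<close>)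
  have ec: "continuous_on {a..b} e"
   unfolding e_def using assms pos by (intro continuous_intros) (auto dest: less_le_trans)
  have i1: "integrable lborel (\<lambda>x. indicator {a..b} x *\<^sub>R (of_real (\<theta>' x) * e x))"
   and i2: "integrable lborel (\<lambda>x. indicator {a..b} x *\<^sub>R e x)"
   and i3: "integrable lborel (\<lambda>x. indicator {a..b} x *\<^sub>R \<bar>\<theta>' x\<bar>)"
   using \<theta>'c ec by (intro borel_integrable_compact continuous_intros; simp)+
  have "(LB x. indicator {a..b} x *\<^sub>R (of_real (\<theta>' x) * e x - \<i> * of_real L * e x)) = of_real (\<theta> b) * e b - of_real (\<theta> a) * e a"
  proof (rule integral_FTC_atLeastAtMost[OF assms(3)])
   fix x assume "a \<le> x" "x \<le> b"
   then have x: "x > 0" using assms by simp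
   have "((\<lambda>x. of_real (\<theta> x)) has_vector_derivative (of_real (\<theta>' x) :: complex)) (at x within {a..b})"
    using d\<theta>[OF x] by (intro has_vector_derivative_of_real) (simp add: has_real_derivative_iff_has_vector_derivative)
   from has_vector_derivative_mult[OF this de[OF x]]
   have "((\<lambda>x. of_real (\<theta> x) * e x) has_vector_derivative of_real (\<theta> x) * (\<i> * of_real (- L * 2 * x / (x^2 + y^2)^2) * e x) + of_real (\<theta>' x) * e x) (at x within {a..b})" .
   moreover have "\<theta> x * (- L * 2 * x / (x^2 + y^2)^2) = - L"
    unfolding \<theta>_def using x pos[OF x] by simp
   then have "of_real (\<theta> x) * (\<i> * of_real (- L * 2 * x / (x^2 + y^2)^2) * e x) = - (\<i> * of_real L * e x)"
    by (metis (no_types, lifting) mult.assoc mult.left_commute mult_minus_left mult_minus_right of_real_minus of_real_mult)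
   ultimately show "((\<lambda>x. of_real (\<theta> x) * e x) has_vector_derivative of_real (\<theta>' x) * e x - \<i> * of_real L * e x) (at x within {a..b})"
    by simp
  qed (intro continuous_intros \<theta>'c ec)
  moreover have "(LB x. indicator {a..b} x *\<^sub>R (of_real (\<theta>' x) * e x - \<i> * of_real L * e x))
    = (LB x. indicator {a..b} x *\<^sub>R (of_real (\<theta>' x) * e x) - (\<i> * of_real L) * (indicator {a..b} x *\<^sub>R e x))"
   by (intro Bochner_Integration.integral_cong) (auto split: split_indicator)
  ultimately have "(LB x. indicator {a..b} x *\<^sub>R (of_real (\<theta>' x) * e x)) - \<i> * of_real L * (LB x. indicator {a..b} x *\<^sub>R e x)
    = of_real (\<theta> b) * e b - of_real (\<theta> a) * e a"
   using i1 i2 by (simp del: mult_scaleR_right)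
  from this[symmetric] have eq: "\<i> * of_real L * (LB x. indicator {a..b} x *\<^sub>R e x)
    = (LB x. indicator {a..b} x *\<^sub>R (of_real (\<theta>' x) * e x)) - (of_real (\<theta> b) * e b - of_real (\<theta> a) * e a)"
   by simp
  have ne: "norm (e x) = 1" for x by (simp add: e_def)
  have "L * norm (LB x. indicator {a..b} x *\<^sub>R e x) = norm (\<i> * of_real L * (LB x. indicator {a..b} x *\<^sub>R e x))"
   using L by (simp add: norm_mult)
  also have "\<dots> \<le> norm (LB x. indicator {a..b} x *\<^sub>R (of_real (\<theta>' x) * e x)) + norm (of_real (\<theta> b) * e b - of_real (\<theta> a) * e a)"
   unfolding eq by (rule norm_triangle_ineq4)
  also have "\<dots> \<le> (LB x. indicator {a..b} x *\<^sub>R \<bar>\<theta>' x\<bar>) + (\<bar>\<theta> b\<bar> + \<bar>\<theta> a\<bar>)"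
  proof (rule add_mono)
   show "norm (LB x. indicator {a..b} x *\<^sub>R (of_real (\<theta>' x) * e x)) \<le> (LB x. indicator {a..b} x *\<^sub>R \<bar>\<theta>' x\<bar>)"
    by (rule norm_integral_le[OF i1 i3]) (simp add: norm_mult ne)
   show "norm (of_real (\<theta> b) * e b - of_real (\<theta> a) * e a) \<le> \<bar>\<theta> b\<bar> + \<bar>\<theta> a\<bar>"
    by (rule order_trans[OF norm_triangle_ineq4]) (simp add: norm_mult ne)
  qed
  finally show ?thesis using L by (simp add: B_def e_def field_simps)
 qed
 have "(\<lambda>n. B / \<Lambda> n) ----> 0" by (rule tendsto_divide_0[OF tendsto_const filterlim_at_top_imp_at_infinity[OF assms(1)]])
 moreover have "\<forall>\<^sub>F n in sequentially. norm (LB x. indicator {a..b} x *\<^sub>R cis (\<Lambda> n / (x^2 + y^2))) \<le> B / \<Lambda> n"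
  using assms(1)[unfolded filterlim_at_top_dense, rule_format, of 0] by eventually_elim (rule bound)
 ultimately show ?thesis unfolding vanishes_def by (rule Lim_null_comparison[rotated])
qed

text \<open>By Fubini's theorem the integral splits into lines. On almost every line the
  one-dimensional result applies, and dominated convergence treats the other variable.\<close>

lemma Riemann_Lebesgue_radial:
 assumes \<Lambda>: "filterlim \<Lambda> at_top sequentially" and g: "integrable lborel (g :: complex \<Rightarrow> real)"
 shows "vanishes lborel (\<lambda>n z. cis (\<Lambda> n / (norm z)^2)) g"
proof -
 note [measurable] = borel_measurable_integrable[OF g]
 have C [measurable]: "(\<lambda>(x,y). Complex x y) \<in> borel_measurable (lborel \<Otimes>\<^sub>M lborel)"
  unfolding lborel_prod by (simp add: borel_measurable_continuous_onI case_prod_unfold continuous_intros)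
 define G where "G = (\<lambda>(x, y). g (Complex x y))"
 have Gi: "integrable (lborel \<Otimes>\<^sub>M lborel) G"
  using g unfolding G_def by (subst (asm) lborel_complex, subst (asm) integrable_distr_eq) (auto simp: case_prod_unfold)
 define E where "E = (\<lambda>n x y. cis (\<Lambda> n / (x^2 + y^2)))"
 have cm: "cis \<in> borel_measurable borel" by (intro borel_measurable_continuous_onI continuous_intros)
 have Em: "(\<lambda>p. E n (fst p) (snd p)) \<in> borel_measurable (lborel \<Otimes>\<^sub>M lborel)" for n
  unfolding E_def by (rule measurable_compose[OF _ cm]) measurable
 have osc: "oscillation lborel (\<lambda>n y. E n x y)" for x
  unfolding E_def by unfold_locales (auto intro: measurable_compose[OF _ cm])
 have GE: "integrable (lborel \<Otimes>\<^sub>M lborel) (\<lambda>p. G p *\<^sub>R E n (fst p) (snd p))" for n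
  by (rule Bochner_Integration.integrable_bound[OF Gi]) (use Em borel_measurable_integrable[OF Gi] in \<open>auto simp: E_def\<close>)
 have "(LB z. g z *\<^sub>R cis (\<Lambda> n / (norm z)^2)) = (LB x. LB y. G (x, y) *\<^sub>R E n x y)" for n
 proof -
  have "(\<lambda>z. g z *\<^sub>R cis (\<Lambda> n / (norm z)^2)) \<in> borel_measurable borel"
   by (intro borel_measurable_scaleR measurable_compose[OF _ cm]) (use g in auto)
  then have "(LB z. g z *\<^sub>R cis (\<Lambda> n / (norm z)^2)) = (\<integral>p. G p *\<^sub>R E n (fst p) (snd p) \<partial>(lborel \<Otimes>\<^sub>M lborel))"
   by (subst lborel_complex, subst integral_distr) (auto simp: G_def E_def case_prod_unfold cmod_power2)
  also have "\<dots> = (LB x. LB y. G (x, y) *\<^sub>R E n x y)"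
   using lborel_pair.integral_fst'[OF GE[of n]] by simp
  finally show ?thesis .
 qed
 moreover have "(\<lambda>n. LB x. LB y. G (x, y) *\<^sub>R E n x y) ----> (\<integral>x. 0 \<partial>(lborel :: real measure))"
 proof (rule integral_dominated_convergence[where w = "\<lambda>x. LB y. norm (G (x, y))"])
  show "AE x in lborel. (\<lambda>n. LB y. G (x, y) *\<^sub>R E n x y) ----> 0"
   using lborel_pair.AE_integrable_fst'[OF Gi]
  proof eventually_elim
   case (elim x)
   have "vanishes lborel (\<lambda>n y. E n x y) (\<lambda>y. G (x, y))"
   proof (rule vanishes_even[OF osc _ _ elim])
    show "vanishes lborel (\<lambda>n y. E n x y) (indicator {a..b})" if "0 < a" "a \<le> b" for a b
     using cis_oscillation[OF \<Lambda> that, of x] by (simp add: E_def add.commute)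
   qed (simp add: E_def)
   then show ?case by (simp add: vanishes_def)
  qed
  show "AE x in lborel. norm (LB y. G (x, y) *\<^sub>R E n x y) \<le> (LB y. norm (G (x, y)))" for n
   using lborel_pair.AE_integrable_fst'[OF Gi]
  proof eventually_elim
   case (elim x)
   show ?case
    by (rule norm_integral_le) (use elim oscillation.integrable_E[OF osc elim] in \<open>auto simp: E_def\<close>)
  qed
  show "integrable lborel (\<lambda>x. LB y. norm (G (x, y)))"
   using lborel_pair.integrable_fst'[of "\<lambda>p. norm (G p)"] Gi by simp
  show "(\<lambda>x. LB y. G (x, y) *\<^sub>R E n x y) \<in> borel_measurable lborel" for n
   using borel_measurable_integrable[OF lborel_pair.integrable_fst'[OF GE[of n]]] by simp
 qed auto
 ultimately show ?thesis by (simp add: vanishes_def)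
qed

section \<open>The tangent cone at the origin\<close>

text \<open>The distance divided by r, read in coordinates dilated by 1 / r, so that all rescalings
  live on the same plane.\<close>

definition blow :: "real \<Rightarrow> complex \<Rightarrow> complex \<Rightarrow> real" where
 "blow r x y = om_dist (r *\<^sub>R x) (r *\<^sub>R y) / r"

lemma om_dist_blow: "r > 0 \<Longrightarrow> om_dist x y = r * blow r (x /\<^sub>R r) (y /\<^sub>R r)"
 by (simp add: blow_def)

lemma blow_planar: assumes r: "r > 0" shows "planar (blow r) (\<lambda>z. (om (r *\<^sub>R z))^2) 1 3 1 9"
proof
 fix x y z :: complex
 have n: "norm (r *\<^sub>R x - r *\<^sub>R y) = r * norm (x - y)" using r by (simp flip: scaleR_diff_right)
 show "blow r x y = blow r y x" by (simp add: blow_def X.d_sym)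
 show "blow r x z \<le> blow r x y + blow r y z"
  using r X.d_triangle[of "r *\<^sub>R x" "r *\<^sub>R z" "r *\<^sub>R y"] by (simp add: blow_def divide_right_mono flip: add_divide_distrib)
 show "1 * norm (x - y) \<le> blow r x y" "blow r x y \<le> 3 * norm (x - y)"
  using r X.d_lower[of "r *\<^sub>R x" "r *\<^sub>R y"] X.d_upper[of "r *\<^sub>R x" "r *\<^sub>R y"] unfolding n by (auto simp: blow_def field_simps)
qed (use X.\<rho>_lower X.\<rho>_upper in auto)

lemma (in planar) d_diff: "\<bar>d x y - d x' y'\<bar> \<le> W * (norm (x - x') + norm (y - y'))"
 using d_triangle[of x y x'] d_triangle[of x' y y'] d_triangle[of x' y' x] d_triangle[of x y' y]
  d_upper[of x x'] d_upper[of y y'] d_sym[of x x'] d_sym[of y y']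
 by (simp add: distrib_left)

text \<open>\<open>N\<close> is the limit mass of the unit balls before normalisation. Which limit
  \<open>dY\<close> arises is left open; any subsequential limit will do.\<close>

locale tangent =
 fixes r :: "nat \<Rightarrow> real" and dY :: "complex \<Rightarrow> complex \<Rightarrow> real" and N :: real
 assumes r_pos: "\<And>k. r k > 0" and r_dec: "decseq r" and r_lim: "r ----> 0"
  and blow_lim: "\<And>x y. (\<lambda>k. blow (r k) x y) ----> dY x y"
  and N_lim: "(\<lambda>k. measure X.m (mball_of X.X (iota 0) (r k)) / (r k)^2) ----> N" and N_pos: "N > 0"

text \<open>As in the theorem of Arzela and Ascoli: the rescaled distances are uniformly Lipschitz,
  so convergence on a countable dense set of pairs, found by a diagonal argument, extends to all
  pairs. A second extraction treats the masses.\<close>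

lemma tangent_exists: "\<exists>r dY N. tangent r dY N"
proof -
 define e where "e = (\<lambda>n. invS n)"
 have e: "e n > 0" for n by (simp add: e_def)
 obtain D :: "complex set" where D: "countable D" "\<And>U. open U \<Longrightarrow> U \<noteq> {} \<Longrightarrow> \<exists>d\<in>D. d \<in> U"
  using countable_dense_setE by auto
 \<comment> \<open>The denominator makes the family bounded by 3 uniformly in the pair of
   points.\<close>
 define f where "f = (\<lambda>n p. blow (e n) (fst p) (snd p) / (1 + norm (fst p - snd p)))"
 interpret b: planar "blow (e n)" "\<lambda>z. (om (e n *\<^sub>R z))^2" 1 3 1 9 for n by (rule blow_planar[OF e])
 have den: "1 + norm z > 0" for z :: complex by (simp add: add_pos_nonneg)
 have f3: "norm (f n p) \<le> 3" for n p
  using b.d_upper[of n "fst p" "snd p"] b.d_nonneg[of n "fst p" "snd p"] den[of "fst p - snd p"]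
  by (auto simp: f_def divide_le_eq)
 obtain k where k: "strict_mono k" "\<And>p. p \<in> D \<times> D \<Longrightarrow> \<exists>l. (\<lambda>n. f (k n) p) ----> l"
  by (rule function_convergent_subsequence[of "D \<times> D" f 3]) (auto simp: D(1) f3 simp del: real_norm_def)
 have conv: "\<exists>l. (\<lambda>n. blow (e (k n)) x y) ----> l" for x y
 proof -
  have "Cauchy (\<lambda>n. blow (e (k n)) x y)"
  proof (rule metric_CauchyI)
   fix t :: real assume t: "t > 0"
   \<comment> \<open>With Lipschitz constant 3 in each argument, moving both points by less than t /
     24 changes a distance by less than t / 4; two such changes and t / 2 add up to
     \<open>t\<close>.\<close>
   obtain a b where ab: "a \<in> D" "a \<in> ball x (t / 24)" "b \<in> D" "b \<in> ball y (t / 24)"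
    using D(2)[of "ball x (t / 24)"] D(2)[of "ball y (t / 24)"] t by auto
   obtain l where "(\<lambda>n. f (k n) (a, b)) ----> l" using k(2)[of "(a, b)"] ab by auto
   from tendsto_mult[OF this tendsto_const, of "1 + norm (a - b)"]
   have "(\<lambda>n. blow (e (k n)) a b) ----> l * (1 + norm (a - b))" using den[of "a - b"] by (simp add: f_def)
   then have "Cauchy (\<lambda>n. blow (e (k n)) a b)" by (rule LIMSEQ_imp_Cauchy)
   then obtain M where M: "\<And>m n. m \<ge> M \<Longrightarrow> n \<ge> M \<Longrightarrow> dist (blow (e (k m)) a b) (blow (e (k n)) a b) < t / 2"
    using t metric_CauchyD[of _ "t / 2"] by (metis half_gt_zero)
   have near: "\<bar>blow (e n) x y - blow (e n) a b\<bar> < t / 4" for n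
    using b.d_diff[of n x y a b] ab by (simp add: dist_norm)
   have "dist (blow (e (k m)) x y) (blow (e (k n)) x y) < t" if "m \<ge> M" "n \<ge> M" for m n
    using M[OF that] near[of "k m"] near[of "k n"] unfolding dist_real_def by linarith
   then show "\<exists>M. \<forall>m\<ge>M. \<forall>n\<ge>M. dist (blow (e (k m)) x y) (blow (e (k n)) x y) < t" by auto
  qed
  then show ?thesis by (simp add: Cauchy_convergent_iff convergent_def)
 qed
 then obtain dY where dY: "\<And>x y. (\<lambda>n. blow (e (k n)) x y) ----> dY x y" by metis
 define v where "v = (\<lambda>n. measure X.m (mball_of X.X (iota 0) (e (k n))) / (e (k n))^2)"
 have "v n \<in> {pi / 9..9 * pi}" for n
 proof -
  define B where "B = mball_of X.X (iota 0) (e (k n))"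
  have "ennreal (pi / 9 * (e (k n))^2) \<le> emeasure X.m B" "emeasure X.m B \<le> ennreal (9 * pi * (e (k n))^2)"
   using X.emeasure_mball_bounds[of "e (k n)" 0] e[of "k n"] unfolding B_def by (auto simp: power_divide)
  moreover from this(2) have "emeasure X.m B = ennreal (measure X.m B)"
   by (intro emeasure_eq_ennreal_measure) (auto simp: top_unique)
  ultimately have "pi / 9 * (e (k n))^2 \<le> measure X.m B" "measure X.m B \<le> 9 * pi * (e (k n))^2" by auto
  then show ?thesis using e[of "k n"] by (simp add: v_def B_def[symmetric] le_divide_eq divide_le_eq)
 qed
 then obtain N j where j: "N \<in> {pi / 9..9 * pi}" "strict_mono j" "(v \<circ> j) ----> N"
  using compact_imp_seq_compact[OF compact_Icc[of "pi / 9" "9 * pi"]] seq_compactE by metis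
 have mono: "strict_mono (k \<circ> j)" using k(1) j(2) by (rule strict_mono_o)
 have "e ----> 0" unfolding e_def by (rule LIMSEQ_Suc[OF lim_const_over_n])
 have "tangent (e \<circ> (k \<circ> j)) dY N"
 proof
  show "decseq (e \<circ> (k \<circ> j))"
   unfolding decseq_def e_def using strict_mono_mono[OF mono] by (auto simp: mono_def intro!: divide_left_mono)
  show "(e \<circ> (k \<circ> j)) ----> 0" using \<open>e ----> 0\<close> mono by (rule LIMSEQ_subseq_LIMSEQ)
  show "(\<lambda>i. blow ((e \<circ> (k \<circ> j)) i) x y) ----> dY x y" for x y
   using LIMSEQ_subseq_LIMSEQ[OF dY[of x y] j(2)] by (simp add: comp_def)
  show "(\<lambda>i. measure X.m (mball_of X.X (iota 0) ((e \<circ> (k \<circ> j)) i)) / ((e \<circ> (k \<circ> j)) i)^2) ----> N"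
   using j(3) by (simp add: v_def comp_def)
 qed (use e j(1) in \<open>auto intro: less_le_trans[of 0 "pi / 9"]\<close>)
 then show ?thesis by auto
qed

section \<open>Convergence of the rescaled measures\<close>

lemma lborel_integral_scale:
 fixes f :: "complex \<Rightarrow> real"
 assumes [measurable]: "f \<in> borel_measurable borel" and r: "r > 0"
 shows "(LB z. f z) = r^2 * (LB z. f (r *\<^sub>R z))"
proof -
 have "(LB z. f z) = (\<integral>z. f z \<partial>density (distr lborel borel (\<lambda>x. 0 + r *\<^sub>R x)) (\<lambda>_. ennreal (r^2)))"
  using r by (subst lborel_affine[of r 0]) (auto simp: ennreal_power)
 also have "\<dots> = (LB z. r^2 * f (r *\<^sub>R z))"
  using r by (subst integral_density, simp, simp, simp, subst integral_distr) auto
 finally show ?thesis by simp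
qed

context planar begin

lemma \<rho>_pos: "0 < \<rho> z" using \<rho>_lower[of z] c1_pos by simp

lemma integral_m:
 fixes f :: "_ \<Rightarrow> real"
 assumes f: "f \<in> borel_measurable m"
 shows "(\<integral>x. f x \<partial>m) = (LB z. f (iota z) * \<rho> z)"
proof -
 have [measurable]: "(\<lambda>z. f (iota z)) \<in> borel_measurable borel" using f by simp
 have "(\<integral>x. f x \<partial>m) = (\<integral>z. f (iota z) \<partial>M)"
  unfolding plane_measure_def by (subst embed_measure_eq_distr[OF inj_iota], subst integral_distr)
   (use f iota_measurable in \<open>auto simp: plane_measure_def\<close>)
 also have "\<dots> = (LB z. \<rho> z *\<^sub>R f (iota z))"
  using \<rho>_pos by (intro integral_density) (auto intro: less_imp_le)
 finally show ?thesis by (simp add: mult.commute)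
qed

lemma mball_sets [measurable]: "mball_of X (iota z) t \<in> sets m"
 unfolding mball_X sets_m using ball_borel[of z t] by blast

lemma Cbs_iota:
 assumes "h \<in> Cbs X"
 shows "continuous_on UNIV (\<lambda>z. h (iota z))" "\<exists>C. \<forall>z. \<bar>h (iota z)\<bar> \<le> C" "h \<in> borel_measurable m"
proof -
 have "continuous_map euclidean (mtopology_of X) iota"
  unfolding continuous_map_def openin_X by (auto simp: image_iff)
 from continuous_map_compose[OF this, of euclideanreal h] assms
 show c: "continuous_on UNIV (\<lambda>z. h (iota z))" by (simp add: Cbs_def)
 from assms obtain C where "\<And>x. x \<in> plane \<Longrightarrow> \<bar>h x\<bar> \<le> C" by (auto simp: Cbs_def bounded_iff)
 then show "\<exists>C. \<forall>z. \<bar>h (iota z)\<bar> \<le> C" by force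
 show "h \<in> borel_measurable m"
  unfolding measurable_m_iff comp_def by (rule borel_measurable_continuous_onI[OF c])
qed

end

text \<open>By Fubini's theorem almost every level set of a function is a null set. Applied to the
  distance from the origin, it selects the radii for which the balls of the blow-ups
  converge.\<close>

lemma AE_sphere_null:
 assumes [measurable]: "(f :: complex \<Rightarrow> real) \<in> borel_measurable borel"
 shows "AE R in lborel. AE w in lborel. f w \<noteq> R"
proof -
 have "AE w in lborel. AE R in lborel. f w \<noteq> R"
 proof (rule AE_I2)
  show "AE R in lborel. f w \<noteq> R" for w
   using AE_lborel_not_in_finite[of "{f w}"] by auto
 qed
 moreover have "{p \<in> space (lborel \<Otimes>\<^sub>M lborel). f (snd p) \<noteq> fst p} \<in> sets (lborel \<Otimes>\<^sub>M lborel)" by measurable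
 ultimately show ?thesis by (subst lborel_pair.AE_commute) auto
qed

text \<open>The constant 5/2 is the mean of \<open>om\<close> squared; the other two terms oscillate
  and vanish weakly under blow-up.\<close>

lemma om_sq_expand: "(om z)^2 = 5/2 + 2 * sin (1 / (norm z)^2) - cos (2 * (1 / (norm z)^2)) / 2"
 unfolding om_sq cos_double_sin by (simp add: power2_sum field_simps)

lemma om_sq_average:
 assumes r: "\<And>k. r k > 0" "r ----> 0" and g: "integrable lborel g"
 shows "(\<lambda>k. LB w. g w * ((om (r k *\<^sub>R w))^2 - 5/2)) ----> 0"
proof -
 define \<Lambda> where "\<Lambda> = (\<lambda>k. 1 / (r k)^2)"
 have \<Lambda>: "filterlim \<Lambda> at_top sequentially" "filterlim (\<lambda>k. 2 * \<Lambda> k) at_top sequentially"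
 proof -
  have "(\<lambda>k. (r k)^2) ----> 0" using tendsto_power[OF r(2), of 2] by simp
  then show "filterlim \<Lambda> at_top sequentially"
   unfolding \<Lambda>_def inverse_eq_divide[symmetric]
   by (intro filterlim_inverse_at_top) (simp_all add: r(1) zero_less_power less_imp_neq[OF r(1), symmetric])
  then show "filterlim (\<lambda>k. 2 * \<Lambda> k) at_top sequentially"
   by (intro filterlim_tendsto_pos_mult_at_top[OF tendsto_const]) auto
 qed
 have cm: "cis \<in> borel_measurable borel" by (intro borel_measurable_continuous_onI continuous_intros)
 define E where "E = (\<lambda>L z. g z *\<^sub>R cis (L / (norm z)^2))"
 have osc: "oscillation lborel (\<lambda>n z. cis (L n / (norm (z::complex))^2))" for L
  by unfold_locales (auto intro: measurable_compose[OF _ cm])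
 have Ei: "integrable lborel (E L)" for L
  unfolding E_def using oscillation.integrable_E[OF osc g, of "\<lambda>_. L"] by simp
 have l1: "(\<lambda>k. LB z. E (\<Lambda> k) z) ----> 0" and l2: "(\<lambda>k. LB z. E (2 * \<Lambda> k) z) ----> 0"
  using Riemann_Lebesgue_radial[OF \<Lambda>(1) g] Riemann_Lebesgue_radial[OF \<Lambda>(2) g] by (auto simp: vanishes_def E_def)
 have "(LB w. g w * ((om (r k *\<^sub>R w))^2 - 5/2)) = 2 * Im (LB z. E (\<Lambda> k) z) - Re (LB z. E (2 * \<Lambda> k) z) / 2" for k
 proof -
  have "(om (r k *\<^sub>R w))^2 - 5/2 = 2 * sin (\<Lambda> k / (norm w)^2) - cos (2 * \<Lambda> k / (norm w)^2) / 2" for w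
   unfolding om_sq_expand by (simp add: \<Lambda>_def power_mult_distrib)
  then have "(LB w. g w * ((om (r k *\<^sub>R w))^2 - 5/2)) = (LB w. 2 * Im (E (\<Lambda> k) w) - Re (E (2 * \<Lambda> k) w) / 2)"
   by (intro Bochner_Integration.integral_cong) (simp_all add: E_def right_diff_distrib)
  also have "\<dots> = 2 * (LB w. Im (E (\<Lambda> k) w)) - (LB w. Re (E (2 * \<Lambda> k) w)) / 2"
  proof -
   have "integrable lborel (\<lambda>w. 2 * Im (E (\<Lambda> k) w))" "integrable lborel (\<lambda>w. Re (E (2 * \<Lambda> k) w) / 2)"
    by (intro integrable_mult_right integrable_divide integrable_Im integrable_Re Ei)+
   from Bochner_Integration.integral_diff[OF this] show ?thesis
    by simp
  qed
  finally show ?thesis by (simp only: integral_Im[OF Ei] integral_Re[OF Ei])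
 qed
 moreover have "(\<lambda>k. 2 * Im (LB z. E (\<Lambda> k) z) - Re (LB z. E (2 * \<Lambda> k) z) / 2) ----> 2 * Im 0 - Re 0 / 2"
  by (intro tendsto_intros l1 l2) simp
 ultimately show ?thesis by simp
qed

context tangent begin

interpretation b: planar "blow (r k)" "\<lambda>z. (om (r k *\<^sub>R z))^2" 1 3 1 9 for k by (rule blow_planar[OF r_pos])

text \<open>The density of the limit measure: the mean 5/2 of the area density over the limit
  \<open>N\<close> of the normalising masses.\<close>

definition c where "c = 5 / 2 / N"

lemma c_pos: "c > 0" using N_pos by (simp add: c_def)

lemma dY_planar: "planar dY (\<lambda>_. c) 1 3 c c"
proof
 fix x y z :: complex
 show "dY x y = dY y x"
  using blow_lim[of x y] blow_lim[of y x] by (simp add: b.d_sym[of _ x y] LIMSEQ_unique)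
 show "dY x z \<le> dY x y + dY y z"
  by (rule LIMSEQ_le[OF blow_lim tendsto_add[OF blow_lim blow_lim]]) (auto intro: b.d_triangle)
 show "1 * norm (x - y) \<le> dY x y" by (rule LIMSEQ_le_const[OF blow_lim]) (use b.d_lower in auto)
 show "dY x y \<le> 3 * norm (x - y)" by (rule LIMSEQ_le_const2[OF blow_lim]) (use b.d_upper in auto)
qed (use c_pos in auto)

sublocale Y: planar dY "\<lambda>_. c" 1 3 c c by (rule dY_planar)

lemma blow_uniform:
 assumes e: "e > 0"
 shows "\<forall>\<^sub>F k in sequentially. \<forall>x\<in>cball 0 B. \<forall>y\<in>cball 0 B. \<bar>blow (r k) x y - dY x y\<bar> < e"
proof -
 have "compact (cball (0::complex) B)" by simp
 \<comment> \<open>With Lipschitz constant 3 on both sides, passing to points of the net costs less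
   than 2 * e / 5 for each distance; the remaining e / 5 is the error on the net.\<close>
 then obtain D :: "complex set" where D: "finite D" "D \<subseteq> cball 0 B" "cball 0 B \<subseteq> (\<Union>a\<in>D. ball a (e / 15))"
  by (rule compactE_image[of _ "cball 0 B" "\<lambda>a. ball a (e / 15)"]) (use e in auto)
 have "\<forall>\<^sub>F k in sequentially. \<forall>a\<in>D. \<forall>b\<in>D. \<bar>blow (r k) a b - dY a b\<bar> < e / 5"
  by (intro eventually_ball_finite D(1) ballI) (use e tendstoD[OF blow_lim, of "e / 5"] in \<open>simp add: dist_real_def\<close>)
 then show ?thesis
 proof eventually_elim
  case (elim k)
  show ?case
  proof (intro ballI)
   fix x y :: complex assume "x \<in> cball 0 B" "y \<in> cball 0 B"
   then obtain a b where ab: "a \<in> D" "x \<in> ball a (e / 15)" "b \<in> D" "y \<in> ball b (e / 15)" using D(3) by blast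
   have "\<bar>blow (r k) x y - blow (r k) a b\<bar> \<le> 3 * (norm (x - a) + norm (y - b))" by (rule b.d_diff)
   moreover have "\<bar>dY x y - dY a b\<bar> \<le> 3 * (norm (x - a) + norm (y - b))" by (rule Y.d_diff)
   moreover have "norm (x - a) < e / 15" "norm (y - b) < e / 15" using ab by (auto simp: dist_norm norm_minus_commute)
   moreover have "\<bar>blow (r k) a b - dY a b\<bar> < e / 5" using elim ab by simp
   ultimately show "\<bar>blow (r k) x y - dY x y\<bar> < e"
    unfolding abs_le_iff abs_less_iff by simp
  qed
 qed
qed

lemma om_dist_scale: "om_dist (r k *\<^sub>R x) (r k *\<^sub>R y) = r k * blow (r k) x y"
 using r_pos[of k] by (simp add: blow_def)

lemma mball_X_r: "mball_of X.X (iota 0) (R * r k) = iota ` {z. blow (r k) 0 (z /\<^sub>R r k) < R}"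
 using om_dist_blow[OF r_pos[of k], of 0] r_pos[of k] unfolding X.mball_X by simp

text \<open>Two effects are separated. The balls of the blow-ups converge to the ball of
  \<open>dY\<close> almost everywhere, so exchanging them costs nothing in the limit; then, on the
  fixed ball, the oscillating density is replaced by its mean.\<close>

lemma ball_integral_limit:
 assumes R: "R > 0" "AE w in lborel. dY 0 w \<noteq> R"
  and [measurable]: "H \<in> borel_measurable borel" and C: "\<And>z. \<bar>H z\<bar> \<le> C"
 shows "(\<lambda>k. LB w. indicator {w. blow (r k) 0 w < R} w * H w * (om (r k *\<^sub>R w))^2)
  ----> 5/2 * (LB w. indicator {w. dY 0 w < R} w * H w)"
proof -
 have C0: "0 \<le> C" using C[of 0] by simp
 define U where "U = (\<lambda>w. indicator (cball (0::complex) R) w * C)"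
 have Ui: "integrable lborel U"
  unfolding U_def using emeasure_lborel_cball_finite[of "0::complex" R] by simp
 have iY: "\<bar>indicator {w. dY 0 w < R} w * H w\<bar> \<le> U w" for w
  using Y.d_lower[of 0 w] C[of w] C0 by (auto simp: U_def split: split_indicator)
 have ib: "\<bar>indicator {w. blow (r k) 0 w < R} w * H w\<bar> \<le> U w" for w k
  using b.d_lower[of 0 w k] C[of w] C0 by (auto simp: U_def split: split_indicator)
 have YI: "integrable lborel (\<lambda>w. indicator {w. dY 0 w < R} w * H w)"
  by (rule Bochner_Integration.integrable_bound[OF Ui]) (auto intro!: AE_I2 order_trans[OF iY abs_ge_self])
 have om9: "(om z)^2 \<le> 9" "0 \<le> (om z)^2" for z using X.\<rho>_upper by auto
 have le9: "\<bar>a * (om z)^2\<bar> \<le> 9 * b" if "\<bar>a\<bar> \<le> b" for a b z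
  using mult_mono[OF that om9(1)[of z]] that by (simp add: abs_mult mult.commute)
 have YIo: "integrable lborel (\<lambda>w. indicator {w. dY 0 w < R} w * H w * (om (r k *\<^sub>R w))^2)" for k
  by (rule Bochner_Integration.integrable_bound[OF integrable_mult_right[OF Ui, of 9]])
   (auto intro!: AE_I2 order_trans[OF le9[OF iY] abs_ge_self])
 have bIo: "integrable lborel (\<lambda>w. indicator {w. blow (r k) 0 w < R} w * H w * (om (r k *\<^sub>R w))^2)" for k
  by (rule Bochner_Integration.integrable_bound[OF integrable_mult_right[OF Ui, of 9]])
   (auto intro!: AE_I2 order_trans[OF le9[OF ib] abs_ge_self])
 define D where "D = (\<lambda>k w. indicator {w. blow (r k) 0 w < R} w * H w * (om (r k *\<^sub>R w))^2 - indicator {w. dY 0 w < R} w * H w * (om (r k *\<^sub>R w))^2)"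
 have "(\<lambda>k. LB w. D k w) ----> (\<integral>w. 0 \<partial>(lborel :: complex measure))"
 proof (rule integral_dominated_convergence[where w = "\<lambda>w. 18 * U w"])
  show "AE w in lborel. (\<lambda>k. D k w) ----> 0"
   using R(2)
  proof eventually_elim
   case (elim w)
   have "\<forall>\<^sub>F k in sequentially. blow (r k) 0 w < R \<longleftrightarrow> dY 0 w < R"
   proof (cases "dY 0 w < R")
    case True
    then show ?thesis using order_tendstoD(2)[OF blow_lim[of 0 w] True] by simp
   next
    case False
    then have "R < dY 0 w" using elim by simp
    then show ?thesis using order_tendstoD(1)[OF blow_lim[of 0 w], of R] by (auto elim: eventually_mono)
   qed
   then have "\<forall>\<^sub>F k in sequentially. D k w = 0"
    by eventually_elim (auto simp: D_def split: split_indicator)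
   then show ?case by (rule tendsto_eventually)
  qed
  show "AE w in lborel. norm (D k w) \<le> 18 * U w" for k
  proof (rule AE_I2)
   show "norm (D k w) \<le> 18 * U w" for w
    using le9[OF iY[of w], of "r k *\<^sub>R w"] le9[OF ib[of k w], of "r k *\<^sub>R w"] unfolding D_def real_norm_def by simp
  qed
 qed (use Ui in \<open>auto simp: D_def\<close>)
 moreover have "(\<lambda>k. LB w. indicator {w. dY 0 w < R} w * H w * ((om (r k *\<^sub>R w))^2 - 5/2)) ----> 0"
  by (rule om_sq_average[OF r_pos r_lim YI])
 ultimately have "(\<lambda>k. (LB w. D k w) + (LB w. indicator {w. dY 0 w < R} w * H w * ((om (r k *\<^sub>R w))^2 - 5/2))
   + 5/2 * (LB w. indicator {w. dY 0 w < R} w * H w)) ----> 0 + 0 + 5/2 * (LB w. indicator {w. dY 0 w < R} w * H w)"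
  by (intro tendsto_intros) simp_all
 moreover have "(LB w. D k w) + (LB w. indicator {w. dY 0 w < R} w * H w * ((om (r k *\<^sub>R w))^2 - 5/2))
   + 5/2 * (LB w. indicator {w. dY 0 w < R} w * H w)
  = (LB w. indicator {w. blow (r k) 0 w < R} w * H w * (om (r k *\<^sub>R w))^2)" for k
 proof -
  have "(LB w. D k w) = (LB w. indicator {w. blow (r k) 0 w < R} w * H w * (om (r k *\<^sub>R w))^2)
    - (LB w. indicator {w. dY 0 w < R} w * H w * (om (r k *\<^sub>R w))^2)"
   unfolding D_def using bIo YIo by simp
  moreover have "(LB w. indicator {w. dY 0 w < R} w * H w * ((om (r k *\<^sub>R w))^2 - 5/2))
    = (LB w. indicator {w. dY 0 w < R} w * H w * (om (r k *\<^sub>R w))^2) - (LB w. indicator {w. dY 0 w < R} w * H w * (5/2))"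
   unfolding right_diff_distrib using YIo integrable_mult_left[OF YI, of "5/2"] by simp
  ultimately show ?thesis by simp
 qed
 ultimately show ?thesis by simp
qed

lemma blowup: "blowup_converges X.X X.m (iota 0) r Y.X Y.m (iota 0)"
 unfolding blowup_converges_def
proof (intro allI impI, goal_cases)
 case (1 \<epsilon>)
 then have \<epsilon>: "0 < \<epsilon>" "\<epsilon> < 1" by auto
 \<comment> \<open>The approximating maps are dilations by 1 / r k.\<close>
 define \<psi> where "\<psi> = (\<lambda>k f. iota (kappa f /\<^sub>R r k))"
 have mX: "mball_of X.X (iota 0) t \<in> sets X.m" for t
  by simp
 have pm: "\<psi> k \<in> measurable (restrict_space X.m A) Y.m" for k A
  unfolding \<psi>_def by (intro measurable_restrict_space1) measurable
 have pi: "\<psi> k (iota z) = iota (z /\<^sub>R r k)" for k z by (simp add: \<psi>_def)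
 have "AE R in lborel. AE w in lborel. dY 0 w \<noteq> R" by (rule AE_sphere_null) simp
 then show ?case
 proof eventually_elim
  case (elim R)
  show ?case
  proof (intro impI, goal_cases)
   case R: 1
   let ?U = "\<lambda>k. mball_of X.X (iota 0) (R * r k)" and ?V = "mball_of Y.X (iota 0) R"
   let ?L = "\<lambda>h k. LINT y|distr (restrict_space X.m (?U k)) Y.m (\<psi> k). h y"
   let ?m = "\<lambda>k. measure X.m (mball_of X.X (iota 0) (r k))"
   obtain K where K: "\<And>k x y. k \<ge> K \<Longrightarrow> x \<in> cball 0 R \<Longrightarrow> y \<in> cball 0 R \<Longrightarrow> \<bar>blow (r k) x y - dY x y\<bar> < \<epsilon>"
    using blow_uniform[OF \<epsilon>(1), of R] unfolding eventually_sequentially by blast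
   have inB: "z /\<^sub>R r k \<in> cball 0 R" if "blow (r k) 0 (z /\<^sub>R r k) < R" for z k
    using b.d_lower[of 0 "z /\<^sub>R r k" k] that by simp
   have i: "\<bar>om_dist z w - r k * dY (z /\<^sub>R r k) (w /\<^sub>R r k)\<bar> \<le> \<epsilon> * r k"
    if "k \<ge> K" "blow (r k) 0 (z /\<^sub>R r k) < R" "blow (r k) 0 (w /\<^sub>R r k) < R" for k z w
   proof -
    have "\<bar>om_dist z w - r k * dY (z /\<^sub>R r k) (w /\<^sub>R r k)\<bar> = r k * \<bar>blow (r k) (z /\<^sub>R r k) (w /\<^sub>R r k) - dY (z /\<^sub>R r k) (w /\<^sub>R r k)\<bar>"
     unfolding om_dist_blow[OF r_pos[of k], of z w] right_diff_distrib[symmetric] abs_mult using r_pos[of k] by simp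
    also have "\<dots> \<le> r k * \<epsilon>" using K[OF that(1) inB[OF that(2)] inB[OF that(3)]] r_pos[of k] by simp
    finally show ?thesis by (simp add: mult.commute)
   qed
   have cov: "mball_of Y.X (iota 0) (R - \<epsilon>) \<subseteq> {y \<in> mspace Y.X. \<exists>x\<in>?U k. mdist Y.X y (\<psi> k x) < \<epsilon>}"
    if k: "k \<ge> K" for k
   proof
    fix y assume "y \<in> mball_of Y.X (iota 0) (R - \<epsilon>)"
    then obtain w where w: "y = iota w" "dY 0 w < R - \<epsilon>" unfolding Y.mball_X by auto
    have "w \<in> cball 0 R" using Y.d_lower[of 0 w] w \<epsilon> by simp
    then have "blow (r k) 0 w < R" using K[OF k, of 0 w] w(2) R by simp
    then have "iota (r k *\<^sub>R w) \<in> ?U k"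
     unfolding mball_X_r using r_pos[of k] by simp
    moreover have "mdist Y.X y (\<psi> k (iota (r k *\<^sub>R w))) < \<epsilon>" using w \<epsilon> r_pos[of k] by (simp add: pi)
    ultimately show "y \<in> {y \<in> mspace Y.X. \<exists>x\<in>?U k. mdist Y.X y (\<psi> k x) < \<epsilon>}"
     using w by auto
   qed
   have weak: "(\<lambda>k. ?L h k
    / ?m k) ----> (LINT y:?V|Y.m. h y)" if h: "h \<in> Cbs Y.X" for h
   proof -
    define H where "H = (\<lambda>z. h (iota z))"
    have Hm [measurable]: "H \<in> borel_measurable borel"
     unfolding H_def by (rule borel_measurable_continuous_onI[OF Y.Cbs_iota(1)[OF h]])
    note hm = Y.Cbs_iota(3)[OF h]
    obtain C where C: "\<And>z. \<bar>H z\<bar> \<le> C" using Y.Cbs_iota(2)[OF h] unfolding H_def by auto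
    define I where "I = (\<lambda>k. LB w. indicator {w. blow (r k) 0 w < R} w * H w * (om (r k *\<^sub>R w))^2)"
    let ?J = "(5/2 * (LB w. indicator {w. dY 0 w < R} w * H w)) / N"
    have "?L h k = (r k)^2 * I k" for k
    proof -
     have hp: "(\<lambda>x. h (\<psi> k x)) \<in> borel_measurable X.m"
      unfolding X.measurable_m_iff comp_def pi
      using measurable_compose[OF _ Hm, of "\<lambda>z. z /\<^sub>R r k" borel] by (simp add: H_def)
     have "?L h k = (LINT x|restrict_space X.m (?U k). h (\<psi> k x))"
      by (rule integral_distr[OF pm hm])
     also have "\<dots> = (LINT x|X.m. indicator (?U k) x *\<^sub>R h (\<psi> k x))"
      using sets.Int_space_eq2[OF mX] mX by (intro integral_restrict_space) simp
     also have "\<dots> = (LB z. indicator (?U k) (iota z) *\<^sub>R h (\<psi> k (iota z)) * (om z)^2)"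
      using hp mX by (intro X.integral_m) auto
     also have "\<dots> = (LB z. indicator {w. blow (r k) 0 w < R} (z /\<^sub>R r k) * H (z /\<^sub>R r k) * (om z)^2)"
      by (intro Bochner_Integration.integral_cong) (auto simp: pi H_def mball_X_r split: split_indicator)
     also have "\<dots> = (r k)^2 * I k"
      unfolding I_def using r_pos[of k] by (subst lborel_integral_scale[OF _ r_pos[of k]]) auto
     finally show ?thesis .
    qed
    then have "(\<lambda>k. ?L h k
      / ?m k) = (\<lambda>k. I k / (?m k / (r k)^2))"
     using r_pos by auto
    moreover have "(\<lambda>k. I k / (?m k / (r k)^2)) ----> ?J"
     unfolding I_def using R elim N_pos by (intro tendsto_divide ball_integral_limit[OF _ _ Hm C] N_lim) auto
    moreover have "(LINT y:?V|Y.m. h y) = ?J"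
    proof -
     have "(LINT y:?V|Y.m. h y) = (LB z. indicator ?V (iota z) *\<^sub>R h (iota z) * c)"
      unfolding set_lebesgue_integral_def using hm
      by (intro Y.integral_m borel_measurable_scaleR borel_measurable_indicator Y.mball_sets)
     also have "\<dots> = (LB z. (indicator {w. dY 0 w < R} z * H z) * c)"
      by (intro Bochner_Integration.integral_cong) (auto simp: Y.mball_X H_def split: split_indicator)
     finally show ?thesis by (simp add: c_def)
    qed
    ultimately show ?thesis by simp
   qed
   show ?case
   proof (intro exI[of _ K] exI[of _ \<psi>] conjI allI impI ballI pm cov weak)
    show "\<psi> k (iota 0) = iota 0" for k by (simp add: pi)
    show "\<bar>mdist X.X x y - r k * mdist Y.X (\<psi> k x) (\<psi> k y)\<bar> \<le> \<epsilon> * r k"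
     if "K \<le> k" "x \<in> ?U k" "y \<in> ?U k" for k x y
     using that i unfolding mball_X_r by (auto simp: pi)
   qed
  qed
 qed
qed

lemma Y_in_Tan: "(Y.X, Y.m, iota 0) \<in> Tan X.X X.m (iota 0)"
 unfolding Tan_def pointed_mms_def
 using X.spt_X Y.spt_X Y.metric_measure_space_X r_pos r_dec r_lim blowup by auto

end

section \<open>The geometry of the tangent cone\<close>

text \<open>The phase \<phi> = 1 / R^2 is raised by \<open>c\<close>, at most one period, to a point
  where the sine is - 1, and \<open>q\<close> is the corresponding change of radius. For small
  \<open>R\<close> one period is a small relative change of the phase, whence the bound on 1 -
  q.\<close>

lemma om_one_nearby:
 assumes R: "R > 0"
 obtains q where "0 < q" "q \<le> 1" "1 - q \<le> 2 * pi * R^2" "sin (1 / (q * R)^2) = - 1"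
proof -
 define \<phi> where "\<phi> = 1 / R^2"
 have \<phi>: "\<phi> > 0" using R by (simp add: \<phi>_def)
 define a where "a = (- (pi / 2) - \<phi>) / (2 * pi)"
 define c where "c = 2 * pi * (a - of_int \<lfloor>a\<rfloor>)"
 have "0 \<le> a - of_int \<lfloor>a\<rfloor>" "a - of_int \<lfloor>a\<rfloor> \<le> 1" by linarith+
 then have c: "0 \<le> c" "c \<le> 2 * pi" using mult_left_mono[of "a - of_int \<lfloor>a\<rfloor>" 1 "2 * pi"] by (auto simp: c_def)
 have "2 * pi * a = - (pi / 2) - \<phi>" by (simp add: a_def)
 then have "\<phi> + c = - (pi / 2) - 2 * pi * of_int \<lfloor>a\<rfloor>" by (simp add: c_def right_diff_distrib)
 then have s: "sin (\<phi> + c) = - 1" by (simp add: sin_diff)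
 define q where "q = sqrt (\<phi> / (\<phi> + c))"
 have q2: "q^2 = \<phi> / (\<phi> + c)" using \<phi> c by (simp add: q_def)
 have q: "0 < q" "q \<le> 1" using \<phi> c by (auto simp: q_def)
 have "1 - q \<le> 1 - q^2" using q by (simp add: power2_eq_square)
 also have "\<dots> = c / (\<phi> + c)" using \<phi> c by (simp add: q2 field_simps)
 also have "\<dots> \<le> 2 * pi / \<phi>" using \<phi> c by (intro frac_le) auto
 also have "\<dots> = 2 * pi * R^2" by (simp add: \<phi>_def)
 finally have "1 - q \<le> 2 * pi * R^2" .
 moreover have "1 / (q * R)^2 = \<phi> + c"
  using \<phi> c R q by (simp add: power_mult_distrib q2) (simp add: \<phi>_def)
 ultimately show ?thesis using that q s by simp
qed

definition sig :: "real \<Rightarrow> real" where "sig \<rho> = \<rho> + \<rho> ^ 3 / 2 * cos (1 / \<rho>^2)"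

definition Sig :: "complex \<Rightarrow> complex" where "Sig z = (1 + (norm z)^2 / 2 * cos (1 / (norm z)^2)) *\<^sub>R z"

text \<open>The term \<open>\<rho> ^ 3 / 2 * cos (1 / \<rho>^2)\<close> is negligible under blow-up, but its derivative
 contributes \<open>sin (1 / \<rho>^2)\<close>, so that radial speed in the image is paid for by \<open>om\<close>.\<close>

lemma sig_deriv:
 assumes "\<rho> > 0" shows "(sig has_real_derivative 1 + sin (1 / \<rho>^2) + 3/2 * \<rho>^2 * cos (1 / \<rho>^2)) (at \<rho>)"
 unfolding sig_def[abs_def] using assms
 by (auto intro!: derivative_eq_intros simp: field_simps power2_eq_square power3_eq_cube)

lemma Sig_factor: "norm (z :: complex) < 1 \<Longrightarrow> 1/2 \<le> 1 + (norm z)^2 / 2 * cos (1 / (norm z)^2)"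
proof -
 assume "norm z < 1"
 then have n: "(norm z)^2 \<le> 1" by (simp add: power_le_one)
 have "(norm z)^2 * - 1 \<le> (norm z)^2 * cos (1 / (norm z)^2)" by (intro mult_left_mono) auto
 then show ?thesis using n by simp
qed

lemma norm_Sig: "norm z < 1 \<Longrightarrow> norm (Sig z) = sig (norm z)"
proof -
 assume "norm z < 1"
 then have "norm (Sig z) = (1 + (norm z)^2 / 2 * cos (1 / (norm z)^2)) * norm z"
  using Sig_factor[of z] unfolding Sig_def norm_scaleR by simp
 then show ?thesis by (simp add: sig_def power3_eq_cube power2_eq_square algebra_simps)
qed

lemma sig_bounds:
 assumes "0 \<le> \<rho>" "\<rho> < 1" shows "\<rho> / 2 \<le> sig \<rho>" "sig \<rho> \<le> \<rho> * (1 + \<rho>^2 / 2)"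
proof -
 have "\<rho> * (1/2) \<le> \<rho> * (1 + \<rho>^2 / 2 * cos (1 / \<rho>^2))"
  using Sig_factor[of "of_real \<rho>"] assms by (intro mult_left_mono) auto
 moreover have "\<rho> * (1 + \<rho>^2 / 2 * cos (1 / \<rho>^2)) \<le> \<rho> * (1 + \<rho>^2 / 2 * 1)"
  using assms by (intro mult_left_mono add_left_mono) auto
 moreover have "sig \<rho> = \<rho> * (1 + \<rho>^2 / 2 * cos (1 / \<rho>^2))" by (simp add: sig_def power3_eq_cube power2_eq_square algebra_simps)
 ultimately show "\<rho> / 2 \<le> sig \<rho>" "sig \<rho> \<le> \<rho> * (1 + \<rho>^2 / 2)" by auto
qed

text \<open>\<open>p\<close> is \<open>v\<close> rotated so that its real and imaginary parts are,
  up to sign, the radial and tangential components. The last claim is the Cauchy--Schwarz inequality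
  for the pairs (h, 1) and (|Re p|, |Im p|).\<close>

lemma polar_split:
 assumes z: "z \<noteq> 0"
 shows "\<bar>inner (sgn z) v\<bar> \<le> norm v" "norm z * \<bar>Im (v / z)\<bar> \<le> norm v"
  and "(1 + sin (1 / (norm z)^2)) * \<bar>inner (sgn z) v\<bar> + norm z * \<bar>Im (v / z)\<bar> \<le> om z * norm v"
proof -
 define p where "p = v * cnj z / of_real (norm z)"
 have np: "norm p = norm v" using z by (simp add: p_def norm_mult norm_divide)
 have a: "inner (sgn z) v = Re p"
 proof -
  have "norm z * inverse ((norm z)^2) = inverse (norm z)" using z by (simp add: power2_eq_square)
  then show ?thesis by (simp add: p_def inner_complex_def divide_inverse algebra_simps)
 qed
 have "v / z = p / of_real (norm z)"
  using z by (simp add: p_def complex_div_cnj[of v z] power2_eq_square field_simps)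
 then have b: "norm z * \<bar>Im (v / z)\<bar> = \<bar>Im p\<bar>" using z by simp
 show "\<bar>inner (sgn z) v\<bar> \<le> norm v" "norm z * \<bar>Im (v / z)\<bar> \<le> norm v"
  unfolding a b np[symmetric] by (rule abs_Re_le_cmod, rule abs_Im_le_cmod)
 define h where "h = 1 + sin (1 / (norm z)^2)"
 have "(h * \<bar>Re p\<bar> + \<bar>Im p\<bar>)^2 \<le> (1 + h^2) * ((Re p)^2 + (Im p)^2)"
  using zero_le_power2[of "\<bar>Re p\<bar> - h * \<bar>Im p\<bar>"] by (simp add: power2_sum power2_diff algebra_simps)
 also have "\<dots> = (om z * norm v)^2" unfolding power_mult_distrib om_sq h_def[symmetric] np[symmetric] by (simp add: cmod_power2)
 finally have "h * \<bar>Re p\<bar> + \<bar>Im p\<bar> \<le> om z * norm v"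
  by (rule power2_le_imp_le) (use om_pos[of z] in simp)
 then show "(1 + sin (1 / (norm z)^2)) * \<bar>inner (sgn z) v\<bar> + norm z * \<bar>Im (v / z)\<bar> \<le> om z * norm v"
  by (simp add: a b h_def)
qed

lemma has_derivative_eventually:
 assumes "(f has_derivative f') (at z)" "\<eta> > 0"
 shows "\<forall>\<^sub>F w in at z. norm (f w - f z - f' (w - z)) \<le> \<eta> * norm (w - z)"
 using assms unfolding has_derivative_at_alt eventually_at dist_norm by blast

text \<open>\<open>est\<close> is a Lipschitz condition for the sum of radial and tangential
  displacement. Constancy near 0 keeps the rescaled function continuous at the origin; vanishing far
  out confines its support to the scale of the blow-up.\<close>

locale radial_test =
 fixes u :: "complex \<Rightarrow> real" and \<delta> :: real
 assumes \<delta>: "\<delta> > 0" and near: "\<And>z. norm z \<le> \<delta> \<Longrightarrow> u z = u 0" and far: "\<And>z. norm z \<ge> 2 \<Longrightarrow> u z = 0"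
  and est: "\<And>z w. z \<noteq> 0 \<Longrightarrow> w \<noteq> 0 \<Longrightarrow> \<bar>u w - u z\<bar> \<le> \<bar>norm w - norm z\<bar> + norm z * \<bar>Arg (w / z)\<bar>"
begin

lemma continuous: "isCont u z"
proof (cases "z = 0")
 case True
 have "\<forall>\<^sub>F w in nhds 0. u w = u 0"
  unfolding eventually_nhds_metric by (rule exI[of _ \<delta>]) (auto simp: \<delta> intro: near)
 then show ?thesis using True unfolding isCont_def tendsto_at_iff_tendsto_nhds by (auto intro: tendsto_eventually)
next
 case False
 have "isCont (\<lambda>w. Arg (w / z)) z"
  using False by (intro isCont_o2[of z "\<lambda>w. w / z" Arg] continuous_at_Arg continuous_intros) auto
 then have A: "((\<lambda>w. Arg (w / z)) \<longlongrightarrow> 0) (at z)" using False by (simp add: isCont_def)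
 have "((\<lambda>w. \<bar>norm w - norm z\<bar> + norm z * \<bar>Arg (w / z)\<bar>) \<longlongrightarrow> \<bar>norm z - norm z\<bar> + norm z * \<bar>0\<bar>) (at z)"
  by (intro tendsto_intros A)
 then have l: "((\<lambda>w. \<bar>norm w - norm z\<bar> + norm z * \<bar>Arg (w / z)\<bar>) \<longlongrightarrow> 0) (at z)" by simp
 have "\<forall>\<^sub>F w in at z. w \<noteq> 0" using False by (rule tendsto_imp_eventually_ne[OF tendsto_ident_at])
 then have "\<forall>\<^sub>F w in at z. norm (u w - u z) \<le> \<bar>norm w - norm z\<bar> + norm z * \<bar>Arg (w / z)\<bar>"
  by eventually_elim (use est[OF False] in auto)
 from Lim_null_comparison[OF this l] show ?thesis by (simp add: isCont_def LIM_zero_iff)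
qed

text \<open>\<open>Sig\<close> preserves arguments and acts on norms by \<open>sig\<close>, whose
  derivative is h up to a multiple of \<rho>^2. So \<open>est\<close> at the image points costs h *
  a + b to first order, and \<open>polar_split\<close> applies. The relative error 2 * \<rho>^2
  becomes 32 * \<epsilon>^2 because \<rho> \<le> 4 * \<epsilon>.\<close>

lemma local_estimate:
 assumes \<epsilon>: "\<epsilon> > 0" "4 * \<epsilon> < 1" and z: "z \<noteq> 0" "norm z \<le> 4 * \<epsilon>" and e: "e > 0"
 shows "\<forall>\<^sub>F w in at z. \<epsilon> * \<bar>u (Sig w /\<^sub>R \<epsilon>) - u (Sig z /\<^sub>R \<epsilon>)\<bar> \<le> ((1 + 32 * \<epsilon>^2) * om z + e) * norm (w - z)"
proof -
 define \<rho> where "\<rho> = norm z"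
 have \<rho>: "0 < \<rho>" "\<rho> < 1" "\<rho> \<le> 4 * \<epsilon>" using z \<epsilon> by (auto simp: \<rho>_def)
 define h where "h = 1 + sin (1 / \<rho>^2)"
 define s' where "s' = h + 3/2 * \<rho>^2 * cos (1 / \<rho>^2)"
 have "((\<lambda>w. sig (norm w)) has_derivative (\<lambda>v. s' * inner (sgn z) v)) (at z)"
  using has_derivative_compose[OF has_derivative_norm[OF z(1)], of sig "\<lambda>v. s' * v"] sig_deriv[OF \<rho>(1)]
  by (simp add: has_field_derivative_def s'_def h_def \<rho>_def inner_commute)
 from has_derivative_eventually[OF this, of "e / 3"]
 have ev1: "\<forall>\<^sub>F w in at z. \<bar>sig (norm w) - sig (norm z) - s' * inner (sgn z) (w - z)\<bar> \<le> e / 3 * norm (w - z)" using e by simp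
 \<comment> \<open>At w = z the quotient is 1, away from the branch cut, so the argument has the
   tangential component as its derivative.\<close>
 have "((\<lambda>w. Ln (w / z)) has_field_derivative 1 / z) (at z)"
  using z by (auto intro!: derivative_eq_intros)
 then have "((\<lambda>w. Im (Ln (w / z))) has_derivative (\<lambda>v. Im (v / z))) (at z)"
  unfolding has_field_derivative_def using has_derivative_Im by force
 from has_derivative_eventually[OF this, of "e / 3"]
 have ev2: "\<forall>\<^sub>F w in at z. \<bar>Im (Ln (w / z)) - Im ((w - z) / z)\<bar> \<le> e / 3 * norm (w - z)" using e z by simp
 have ev3: "\<forall>\<^sub>F w in at z. w \<noteq> 0" using z by (intro tendsto_imp_eventually_ne[OF tendsto_ident_at])
 have "\<forall>\<^sub>F w in at z. w \<in> ball 0 1" using \<rho> by (intro eventually_at_in_open') (auto simp: \<rho>_def)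
 with ev1 ev2 ev3 show ?thesis
 proof eventually_elim
  case (elim w)
  define v where "v = w - z"
  define a where "a = \<bar>inner (sgn z) v\<bar>"
  define b where "b = norm z * \<bar>Im (v / z)\<bar>"
  have ab: "a \<le> norm v" "b \<le> norm v" "h * a + b \<le> om z * norm v"
   using polar_split[OF z(1), of v] by (auto simp: a_def b_def h_def \<rho>_def)
  have w: "norm w < 1" "w \<noteq> 0" using elim by auto
  have fz: "1/2 \<le> 1 + (norm z)^2 / 2 * cos (1 / (norm z)^2)" and fw: "1/2 \<le> 1 + (norm w)^2 / 2 * cos (1 / (norm w)^2)"
   using Sig_factor \<rho> w by (auto simp: \<rho>_def)
  have arg: "Arg ((Sig w /\<^sub>R \<epsilon>) / (Sig z /\<^sub>R \<epsilon>)) = Arg (w / z)"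
  proof -
   define p q where "p = 1 + (norm w)^2 / 2 * cos (1 / (norm w)^2)" "q = 1 + (norm z)^2 / 2 * cos (1 / (norm z)^2)"
   have pq: "p > 0" "q > 0" using fz fw by (auto simp: p_q_def)
   have "(Sig w /\<^sub>R \<epsilon>) / (Sig z /\<^sub>R \<epsilon>) = of_real (p / q) * (w / z)"
    using \<epsilon> pq z unfolding Sig_def p_q_def[symmetric] by (simp add: scaleR_conv_of_real)
   moreover have "Arg (of_real (p / q) * (w / z)) = Arg (w / z)" using pq by (intro Arg_times_of_real) simp
   ultimately show ?thesis by simp
  qed
  have "Sig z \<noteq> 0" "Sig w \<noteq> 0" using fz fw z w by (auto simp: Sig_def)
  then have "\<epsilon> * \<bar>u (Sig w /\<^sub>R \<epsilon>) - u (Sig z /\<^sub>R \<epsilon>)\<bar>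
    \<le> \<epsilon> * (\<bar>norm (Sig w /\<^sub>R \<epsilon>) - norm (Sig z /\<^sub>R \<epsilon>)\<bar> + norm (Sig z /\<^sub>R \<epsilon>) * \<bar>Arg (w / z)\<bar>)"
   using \<epsilon> est[of "Sig z /\<^sub>R \<epsilon>" "Sig w /\<^sub>R \<epsilon>"] unfolding arg by simp
  also have "\<dots> = \<bar>norm (Sig w) - norm (Sig z)\<bar> + norm (Sig z) * \<bar>Arg (w / z)\<bar>"
  proof -
   have n: "norm (Sig w /\<^sub>R \<epsilon>) = norm (Sig w) / \<epsilon>" for w
    using \<epsilon> by (simp add: divide_inverse)
   show ?thesis using \<epsilon> unfolding n by (simp add: abs_divide distrib_left flip: diff_divide_distrib)
  qed
  also have "\<dots> = \<bar>sig (norm w) - sig \<rho>\<bar> + sig \<rho> * \<bar>Im (Ln (w / z))\<bar>"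
   using norm_Sig[of w] norm_Sig[of z] w \<rho> z by (simp add: \<rho>_def Arg_eq_Im_Ln)
  also have "\<dots> \<le> (\<bar>s'\<bar> * a + e / 3 * norm v) + \<rho> * (1 + \<rho>^2 / 2) * (\<bar>Im (v / z)\<bar> + e / 3 * norm v)"
  proof (intro add_mono mult_mono)
   show "\<bar>sig (norm w) - sig \<rho>\<bar> \<le> \<bar>s'\<bar> * a + e / 3 * norm v"
    using elim(1) abs_triangle_ineq2[of "sig (norm w) - sig \<rho>" "s' * inner (sgn z) v"] by (simp add: a_def v_def \<rho>_def abs_mult)
   show "\<bar>Im (Ln (w / z))\<bar> \<le> \<bar>Im (v / z)\<bar> + e / 3 * norm v"
    using elim(2) abs_triangle_ineq2[of "Im (Ln (w / z))" "Im (v / z)"] by (simp add: v_def)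
  qed (use sig_bounds[of \<rho>] \<rho> in auto)
  also have "\<dots> \<le> (h * a + b) + (2 * \<rho>^2 + e) * norm v"
  proof -
   have a0: "0 \<le> a" and b0: "0 \<le> b" by (auto simp: a_def b_def)
   have h0: "0 \<le> h" using sin_ge_minus_one[of "1 / \<rho>^2"] unfolding h_def by linarith
   have r2: "\<rho>^2 \<le> 1" using \<rho> by (simp add: power_le_one)
   have "\<bar>3/2 * \<rho>^2 * cos (1 / \<rho>^2)\<bar> \<le> 3/2 * \<rho>^2 * 1" unfolding abs_mult by (intro mult_mono) auto
   then have "\<bar>s'\<bar> \<le> h + 3/2 * \<rho>^2" using h0 unfolding s'_def by simp
   then have "\<bar>s'\<bar> * a \<le> (h + 3/2 * \<rho>^2) * a" using a0 by (rule mult_right_mono)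
   moreover have "3/2 * \<rho>^2 * a \<le> 3/2 * \<rho>^2 * norm v" using ab(1) by (intro mult_left_mono) auto
   ultimately have t1: "\<bar>s'\<bar> * a \<le> h * a + 3/2 * \<rho>^2 * norm v" unfolding distrib_right by linarith
   have t2: "\<rho> * (1 + \<rho>^2 / 2) * \<bar>Im (v / z)\<bar> \<le> b + \<rho>^2 / 2 * norm v"
    using mult_left_mono[OF ab(2), of "\<rho>^2 / 2"] by (simp add: b_def \<rho>_def algebra_simps)
   have "\<rho> * (1 + \<rho>^2 / 2) \<le> 1 * 2" using \<rho> r2 by (intro mult_mono) auto
   then have "\<rho> * (1 + \<rho>^2 / 2) * (e / 3 * norm v) \<le> 2 * (e / 3 * norm v)" using e by (intro mult_right_mono) auto
   then show ?thesis using t1 t2 by (simp add: algebra_simps)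
  qed
  also have "\<dots> \<le> om z * norm v + (32 * \<epsilon>^2 * om z + e) * norm v"
  proof -
   have "\<rho>^2 \<le> (4 * \<epsilon>)^2" using \<rho> by (intro power_mono) auto
   then have "2 * \<rho>^2 \<le> 32 * \<epsilon>^2 * 1" by simp
   also have "\<dots> \<le> 32 * \<epsilon>^2 * om z" using om_bounds(1)[of z] by (intro mult_left_mono) auto
   finally show ?thesis using ab(3) by (intro add_mono mult_right_mono) auto
  qed
  finally show ?case by (simp add: v_def algebra_simps)
 qed
qed

text \<open>Turns a radial test into a test function for \<open>om_dist\<close> at scale \<epsilon>.
  As sig \<rho> \<ge> \<rho> / 2 and \<open>far\<close> starts at 2, it vanishes from norm 4 *
  \<epsilon> on, so the cut at norm 1 creates no jump.\<close>

lemma scaled_om_fun: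
 assumes \<epsilon>: "\<epsilon> > 0" "4 * \<epsilon> < 1"
 shows "(\<lambda>z. if norm z < 1 then \<epsilon> * u (Sig z /\<^sub>R \<epsilon>) / (1 + 32 * \<epsilon>^2) else 0) \<in> om_fun"
proof -
 define K where "K = 1 + 32 * \<epsilon>^2"
 have K: "K \<ge> 1" by (simp add: K_def)
 define U where "U = (\<lambda>z. if norm z < 1 then \<epsilon> * u (Sig z /\<^sub>R \<epsilon>) / K else 0)"
 have U0: "U w = 0" if "norm w \<ge> 4 * \<epsilon>" for w
 proof (cases "norm w < 1")
  case True
  have "norm (Sig w /\<^sub>R \<epsilon>) = sig (norm w) / \<epsilon>" using norm_Sig[OF True] \<epsilon> by (simp add: divide_inverse)
  moreover have "sig (norm w) \<ge> 2 * \<epsilon>" using sig_bounds(1)[of "norm w"] True that by simp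
  ultimately have "norm (Sig w /\<^sub>R \<epsilon>) \<ge> 2" using \<epsilon> by (simp add: le_divide_eq)
  then show ?thesis by (simp add: U_def far)
 qed (simp add: U_def)
 have loc: "\<forall>\<^sub>F w in at z. \<bar>U w - U z\<bar> \<le> (om z + e) * norm (w - z)" if z: "z \<noteq> 0" and e: "e > 0" for z e
 proof (cases "norm z \<le> 4 * \<epsilon>")
  case True
  have "\<forall>\<^sub>F w in at z. w \<in> ball 0 1" using \<epsilon> True by (intro eventually_at_in_open') auto
  with local_estimate[OF \<epsilon> z True e] show ?thesis
  proof eventually_elim
   case (elim w)
   have "\<bar>U w - U z\<bar> = \<epsilon> * \<bar>u (Sig w /\<^sub>R \<epsilon>) - u (Sig z /\<^sub>R \<epsilon>)\<bar> / K"
    using elim True \<epsilon> K by (simp add: U_def abs_mult flip: diff_divide_distrib right_diff_distrib)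
   also have "\<dots> \<le> ((K * om z + e) * norm (w - z)) / K" using elim K by (intro divide_right_mono) (auto simp: K_def)
   also have "\<dots> = (om z + e / K) * norm (w - z)" using K by (simp add: field_simps)
   also have "\<dots> \<le> (om z + e) * norm (w - z)" using K e by (intro mult_right_mono) (auto simp: divide_le_eq)
   finally show ?case .
  qed
 next
  case False
  have "\<forall>\<^sub>F w in at z. w \<in> - cball 0 (4 * \<epsilon>)" using False by (intro eventually_at_in_open') (auto simp: open_Compl)
  then show ?thesis
  proof eventually_elim
   case (elim w)
   then have "U w = 0" "U z = 0" using False by (auto intro!: U0)
   then show ?case using om_pos[of z] e by simp
  qed
 qed
 have "isCont U z" for z
 proof (cases "z = 0")
  case True
  have "U w = U 0" if w: "norm w < min 1 (\<epsilon> * \<delta> / 2)" for w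
  proof -
   have "(norm w)^2 \<le> 1" using w by (simp add: power_le_one)
   then have "sig (norm w) \<le> norm w * 2" using sig_bounds(2)[of "norm w"] w mult_left_mono[of "1 + (norm w)^2 / 2" 2 "norm w"] by simp
   then have "norm (Sig w /\<^sub>R \<epsilon>) \<le> \<delta>" using w norm_Sig[of w] \<epsilon> by (simp add: field_simps)
   then have "u (Sig w /\<^sub>R \<epsilon>) = u 0" by (rule near)
   then show ?thesis using w by (simp add: U_def Sig_def)
  qed
  moreover have "0 < min 1 (\<epsilon> * \<delta> / 2)" using \<epsilon> \<delta> by simp
  ultimately have "\<forall>\<^sub>F w in nhds 0. U w = U 0"
   unfolding eventually_nhds_metric dist_norm diff_0_right by blast
  then have "isCont U 0" unfolding isCont_def tendsto_at_iff_tendsto_nhds by (rule tendsto_eventually)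
  then show ?thesis using True by simp
 next
  case False
  have "((\<lambda>w. (om z + 1) * norm (w - z)) \<longlongrightarrow> (om z + 1) * norm (z - z)) (at z)" by (intro tendsto_intros)
  then have l: "((\<lambda>w. (om z + 1) * norm (w - z)) \<longlongrightarrow> 0) (at z)" by simp
  have "\<forall>\<^sub>F w in at z. norm (U w - U z) \<le> (om z + 1) * norm (w - z)" using loc[OF False, of 1] by simp
  from Lim_null_comparison[OF this l] show ?thesis by (simp add: isCont_def LIM_zero_iff)
 qed
 then have "U \<in> om_fun" unfolding om_fun_def using loc by (auto intro: continuous_at_imp_continuous_on)
 then show ?thesis unfolding U_def K_def .
qed

end

section \<open>An upper and a lower bound for the limit distance\<close>

context tangent begin

text \<open>In the blow-up the path goes radially to a nearby circle with om = 1, along it, and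
  back. By \<open>om_one_nearby\<close> the radial pieces are of third order in r k, hence
  negligible after division by r k.\<close>

lemma dY_arc: assumes t: "t \<ge> 0" shows "dY x (cis t * x) \<le> norm x * t"
proof (cases "x = 0")
 case False
 have "blow (r k) x (cis t * x) \<le> norm x * t + 12 * pi * norm x ^ 3 * (r k)^2" for k
 proof -
  define y where "y = r k *\<^sub>R x"
  have y: "y \<noteq> 0" "norm y = r k * norm x" using False r_pos[of k] by (auto simp: y_def)
  obtain q where q: "0 < q" "q \<le> 1" "1 - q \<le> 2 * pi * (norm y)^2" "sin (1 / (q * norm y)^2) = - 1"
   using om_one_nearby[of "norm y"] y(1) by auto
  have om1: "om (q *\<^sub>R y) = 1" unfolding om_def using q by simp
  have "om_dist y (cis t * y) \<le> om_dist y (q *\<^sub>R y) + (om_dist (q *\<^sub>R y) (cis t * (q *\<^sub>R y)) + om_dist (cis t * (q *\<^sub>R y)) (cis t * y))"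
   by (intro order_trans[OF X.d_triangle[of _ _ "q *\<^sub>R y"]] add_left_mono X.d_triangle)
  also have "\<dots> \<le> 3 * ((1 - q) * norm y) + (norm y * t + 3 * ((1 - q) * norm y))"
  proof (intro add_mono)
   have "y - q *\<^sub>R y = (1 - q) *\<^sub>R y" by (simp add: algebra_simps)
   then have n: "norm (y - q *\<^sub>R y) = (1 - q) * norm y" using q by simp
   show "om_dist y (q *\<^sub>R y) \<le> 3 * ((1 - q) * norm y)" using X.d_upper[of y "q *\<^sub>R y"] by (simp only: n)
   have "norm (cis t * (q *\<^sub>R y) - cis t * y) = (1 - q) * norm y"
    unfolding right_diff_distrib[symmetric] norm_mult norm_minus_commute[of "q *\<^sub>R y"] n by simp
   then show "om_dist (cis t * (q *\<^sub>R y)) (cis t * y) \<le> 3 * ((1 - q) * norm y)"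
    using X.d_upper[of "cis t * (q *\<^sub>R y)" "cis t * y"] by simp
   have "om_dist (q *\<^sub>R y) (cis t * (q *\<^sub>R y)) \<le> 1 * norm (q *\<^sub>R y) * t"
    using om_dist_arc[OF t, of "q *\<^sub>R y"] y q unfolding om1 by simp
   also have "\<dots> \<le> norm y * t" using q t by (intro mult_right_mono) (auto simp: mult_left_le_one_le)
   finally show "om_dist (q *\<^sub>R y) (cis t * (q *\<^sub>R y)) \<le> norm y * t" .
  qed
  also have "\<dots> = norm y * t + 6 * ((1 - q) * norm y)" by simp
  also have "\<dots> \<le> norm y * t + 6 * (2 * pi * (norm y)^2 * norm y)" using q by (intro add_left_mono mult_left_mono mult_right_mono) auto
  also have "\<dots> = r k * (norm x * t + 12 * pi * norm x ^ 3 * (r k)^2)"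
   by (simp add: y(2) power2_eq_square power3_eq_cube algebra_simps)
  finally have "om_dist y (cis t * y) \<le> r k * (norm x * t + 12 * pi * norm x ^ 3 * (r k)^2)" .
  then show ?thesis using r_pos[of k] by (simp add: blow_def y_def divide_le_eq mult.commute)
 qed
 moreover have "(\<lambda>k. norm x * t + 12 * pi * norm x ^ 3 * (r k)^2) ----> norm x * t + 12 * pi * norm x ^ 3 * 0^2"
  by (intro tendsto_intros r_lim)
 ultimately have "dY x (cis t * x) \<le> norm x * t + 12 * pi * norm x ^ 3 * 0^2" by (intro LIMSEQ_le[OF blow_lim]) auto
 then show ?thesis by simp
qed simp

text \<open>The functions of \<open>scaled_om_fun\<close> at scale r k bound the rescaled distances
  from below. Since \<open>Sig\<close> is the identity to first order at the origin, their
  rescalings converge to \<open>u\<close>.\<close>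

lemma radial_test_le: assumes "radial_test u \<delta>" shows "\<bar>u x - u y\<bar> \<le> dY x y"
proof -
 interpret radial_test u \<delta> by fact
 have lim: "(\<lambda>k. u (Sig (r k *\<^sub>R x) /\<^sub>R r k)) ----> u x" for x
 proof -
  have "Sig (r k *\<^sub>R x) /\<^sub>R r k = x + ((r k)^2 * ((norm x)^2 / 2 * cos (1 / (norm (r k *\<^sub>R x))^2))) *\<^sub>R x" for k
   using r_pos[of k] by (simp add: Sig_def scaleR_left.add algebra_simps)
  moreover have "(\<lambda>k. x + ((r k)^2 * ((norm x)^2 / 2 * cos (1 / (norm (r k *\<^sub>R x))^2))) *\<^sub>R x) ----> x + 0 *\<^sub>R x"
  proof (intro tendsto_intros)
   have "(\<lambda>k. (r k)^2 * ((norm x)^2 / 2)) ----> 0^2 * ((norm x)^2 / 2)" by (intro tendsto_intros r_lim)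
   then have "(\<lambda>k. (r k)^2 * ((norm x)^2 / 2)) ----> 0" by simp
   moreover have "norm ((r k)^2 * ((norm x)^2 / 2 * cos (1 / (norm (r k *\<^sub>R x))^2))) \<le> (r k)^2 * ((norm x)^2 / 2)" for k
    unfolding real_norm_def abs_mult by (intro mult_mono) (auto intro: mult_left_le)
   ultimately show "(\<lambda>k. (r k)^2 * ((norm x)^2 / 2 * cos (1 / (norm (r k *\<^sub>R x))^2))) ----> 0"
    by (rule null_comparison)
  qed
  ultimately have "(\<lambda>k. Sig (r k *\<^sub>R x) /\<^sub>R r k) ----> x" by simp
  then show ?thesis by (rule isCont_tendsto_compose[OF continuous])
 qed
 have small: "\<forall>\<^sub>F k in sequentially. norm (r k *\<^sub>R x) < 1" for x :: complex
  using tendsto_norm[OF tendsto_scaleR[OF r_lim tendsto_const[of x]]] by (intro order_tendstoD(2)[of _ 0]) auto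
 have "\<forall>\<^sub>F k in sequentially. r k < 1/4" using r_lim by (rule order_tendstoD(2)) simp
 with small[of x] small[of y]
 have "\<forall>\<^sub>F k in sequentially. \<bar>u (Sig (r k *\<^sub>R x) /\<^sub>R r k) - u (Sig (r k *\<^sub>R y) /\<^sub>R r k)\<bar> \<le> (1 + 32 * (r k)^2) * blow (r k) x y"
 proof eventually_elim
  case (elim k)
  define K where "K = 1 + 32 * (r k)^2"
  have K: "K > 0" by (simp add: K_def add_pos_nonneg)
  have "\<bar>r k * u (Sig (r k *\<^sub>R x) /\<^sub>R r k) / K - r k * u (Sig (r k *\<^sub>R y) /\<^sub>R r k) / K\<bar> \<le> om_dist (r k *\<^sub>R x) (r k *\<^sub>R y)"
   using om_dist_upper[OF scaled_om_fun[OF r_pos[of k]], of "r k *\<^sub>R x" "r k *\<^sub>R y"] elim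
   unfolding K_def by simp
  then have "r k / K * \<bar>u (Sig (r k *\<^sub>R x) /\<^sub>R r k) - u (Sig (r k *\<^sub>R y) /\<^sub>R r k)\<bar> \<le> r k * blow (r k) x y"
   using r_pos[of k] K unfolding om_dist_scale diff_divide_distrib[symmetric] right_diff_distrib[symmetric] by (simp add: abs_mult)
  then have "r k * (\<bar>u (Sig (r k *\<^sub>R x) /\<^sub>R r k) - u (Sig (r k *\<^sub>R y) /\<^sub>R r k)\<bar> / K) \<le> r k * blow (r k) x y" by simp
  then have "\<bar>u (Sig (r k *\<^sub>R x) /\<^sub>R r k) - u (Sig (r k *\<^sub>R y) /\<^sub>R r k)\<bar> / K \<le> blow (r k) x y" using r_pos[of k] by (rule mult_left_le_imp_le)
  then show ?case using K unfolding K_def[symmetric] by (simp only: divide_le_eq if_True mult.commute)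
 qed
 moreover have "(\<lambda>k. (1 + 32 * (r k)^2) * blow (r k) x y) ----> (1 + 32 * 0^2) * dY x y"
  by (intro tendsto_intros r_lim blow_lim)
 moreover have "(\<lambda>k. \<bar>u (Sig (r k *\<^sub>R x) /\<^sub>R r k) - u (Sig (r k *\<^sub>R y) /\<^sub>R r k)\<bar>) ----> \<bar>u x - u y\<bar>"
  by (intro tendsto_intros lim)
 ultimately have "\<bar>u x - u y\<bar> \<le> (1 + 32 * 0^2) * dY x y" by (intro tendsto_le[OF sequentially_bot])
 then show ?thesis by simp
qed

end

section \<open>The tangent cone is not Hilbertian\<close>

lemma L2_dominated:
 assumes g: "g \<in> L2 M" and f: "f \<in> borel_measurable M" and le: "\<And>x. \<bar>f x\<bar> \<le> \<bar>g x\<bar>"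
 shows "f \<in> L2 M" "L2_norm M f \<le> L2_norm M g"
proof -
 have sq: "L2_sqnorm M f \<le> L2_sqnorm M g"
  unfolding L2_sqnorm_def by (intro nn_integral_mono ennreal_leI) (use le in \<open>simp add: abs_le_square_iff\<close>)
 then show "f \<in> L2 M" using f g by (auto simp: L2_def)
 then show "L2_norm M f \<le> L2_norm M g"
  using sq g unfolding L2_norm_def L2_def by (intro real_sqrt_le_mono enn2real_mono) auto
qed

text \<open>\<open>flow_difference_le\<close> treats Lipschitz functions. The weighted difference
  \<open>T\<close> is a bounded operator on L2, so the bound passes to every approximating sequence
  and hence to the relaxation.\<close>

lemma (in planar) Cheeger_flow:
 fixes f :: "complex \<Rightarrow> real" and \<phi> :: "real \<Rightarrow> complex \<Rightarrow> complex"
 assumes f: "f \<in> L2 lborel"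
  and \<phi>_meas [measurable]: "(\<lambda>p. \<phi> (fst p) (snd p)) \<in> borel_measurable (borel \<Otimes>\<^sub>M borel)"
  and \<phi>_pres: "\<And>(f :: complex \<Rightarrow> ennreal) u. f \<in> borel_measurable borel \<Longrightarrow> (NN z. f (\<phi> u z)) = (NN z. f z)"
  and \<phi>_0: "\<And>z. \<phi> 0 z = z"
  and \<kappa> [measurable]: "\<kappa> \<in> borel_measurable borel" and \<kappa>_nonneg: "\<And>z. \<kappa> z \<ge> 0" and \<kappa>_le: "\<And>z. \<kappa> z \<le> B"
  and speed: "\<And>z u v. \<kappa> z * d (\<phi> u z) (\<phi> v z) \<le> \<bar>u - v\<bar>"
  and inv: "\<And>z u. \<kappa> (\<phi> u z) = \<kappa> z" and t: "t > 0"
 shows "ennreal (c1 / t^2) * (NN z. ennreal ((\<kappa> z * (f (\<phi> t z) - f z))^2)) \<le> Cheeger d \<rho> f"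
proof -
 define T where "T = (\<lambda>h z. \<kappa> z * (h (\<phi> t z) - h z))"
 have \<phi>t [measurable]: "\<phi> t \<in> borel_measurable borel"
  using measurable_compose[OF measurable_Pair1' \<phi>_meas, of t] by simp
 have B: "B \<ge> 0" using \<kappa>_nonneg[of 0] \<kappa>_le[of 0] by simp
 have comp: "(\<lambda>z. h (\<phi> t z)) \<in> L2 lborel" "N2 (\<lambda>z. h (\<phi> t z)) = N2 h" if h: "h \<in> L2 lborel" for h
 proof -
  have [measurable]: "h \<in> borel_measurable borel" using h by (simp add: L2_def)
  have "L2_sqnorm lborel (\<lambda>z. h (\<phi> t z)) = L2_sqnorm lborel h"
   unfolding L2_sqnorm_def using \<phi>_pres[of "\<lambda>z. ennreal ((h z)^2)" t] by simp
  then show "(\<lambda>z. h (\<phi> t z)) \<in> L2 lborel" "N2 (\<lambda>z. h (\<phi> t z)) = N2 h"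
   using h by (auto simp: L2_def L2_norm_def)
 qed
 have TL: "T h \<in> L2 lborel" and Tn: "N2 (T h) \<le> 2 * B * N2 h" if h: "h \<in> L2 lborel" for h
 proof -
  have [measurable]: "h \<in> borel_measurable borel" using h by (simp add: L2_def)
  define D where "D = (\<lambda>z. h (\<phi> t z) + (- 1) * h z)"
  have D: "D \<in> L2 lborel" unfolding D_def by (intro L2_add L2_cmult comp h)
  have "N2 D \<le> N2 (\<lambda>z. h (\<phi> t z)) + N2 (\<lambda>z. (- 1) * h z)"
   unfolding D_def by (intro L2_norm_triangle L2_cmult comp h)
  then have Dn: "N2 D \<le> 2 * N2 h"
   unfolding comp(2)[OF h] L2_norm_cmult[OF h] by simp
  have le: "\<bar>T h z\<bar> \<le> \<bar>B * D z\<bar>" for z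
   unfolding T_def D_def abs_mult using \<kappa>_nonneg[of z] \<kappa>_le[of z] B by (intro mult_mono) auto
  have m: "T h \<in> borel_measurable lborel" unfolding T_def by simp
  show "T h \<in> L2 lborel" by (rule L2_dominated(1)[OF L2_cmult[OF D] m le])
  have "N2 (T h) \<le> N2 (\<lambda>z. B * D z)" by (rule L2_dominated(2)[OF L2_cmult[OF D] m le])
  also have "\<dots> \<le> B * (2 * N2 h)" unfolding L2_norm_cmult[OF D] using B Dn by (simp add: mult_left_mono)
  finally show "N2 (T h) \<le> 2 * B * N2 h" by simp
 qed
 have en: "ennreal (c1 / t^2) * L2_sqnorm lborel (T F) \<le> energy d \<rho> F" if F: "F \<in> Lipbs" for F
 proof -
  obtain L where L: "\<And>x y. \<bar>F x - F y\<bar> \<le> L * norm (x - y)" using Lipbs_obtain[OF F] by metis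
  note [measurable] = Lipbs_lipc_measurable[OF F]
  have "L2_sqnorm lborel (T F) \<le> ennreal (t^2) * (NN z. (if \<kappa> z = 0 then 0 else (lipc d F z)^2))"
   unfolding L2_sqnorm_def T_def
   by (rule flow_difference_le[OF L \<phi>_meas \<phi>_pres \<phi>_0 \<kappa> \<kappa>_nonneg speed inv t])
  also have "\<dots> \<le> ennreal (t^2) * (NN z. (lipc d F z)^2)"
   by (intro mult_left_mono nn_integral_mono) auto
  finally have "ennreal (c1 / t^2) * L2_sqnorm lborel (T F) \<le> ennreal (c1 / t^2) * (ennreal (t^2) * (NN z. (lipc d F z)^2))"
   by (rule mult_left_mono) simp
  also have "\<dots> = ennreal c1 * (NN z. (lipc d F z)^2)"
   using t c1_pos by (simp add: mult.assoc[symmetric] ennreal_mult[symmetric])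
  also have "\<dots> = (NN z. (lipc d F z)^2 * ennreal c1)" by (subst mult.commute, subst nn_integral_multc) auto
  also have "\<dots> \<le> energy d \<rho> F" unfolding energy_def by (intro nn_integral_mono mult_left_mono ennreal_leI \<rho>_lower) auto
  finally show ?thesis .
 qed
 have "ennreal (c1 / t^2) * L2_sqnorm lborel (T f) \<le> liminf (\<lambda>n. energy d \<rho> (F n))" if F: "Lipbs_approx \<rho> f F" for F
 proof -
  have FL: "F n \<in> Lipbs" for n using F by (simp add: Lipbs_approx_def)
  note F2 = Lipbs_L2[OF FL]
  have l: "(\<lambda>n. N2 (\<lambda>z. F n z - f z)) ----> 0" using F Lipbs_approx_iff[of F, OF FL f] by simp
  have "(\<lambda>n. N2 (T (F n)) - N2 (T f)) ----> 0"
  proof (rule null_comparison)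
   show "(\<lambda>n. 2 * B * N2 (\<lambda>z. F n z - f z)) ----> 0" using tendsto_mult[OF tendsto_const l] by simp
   show "norm (N2 (T (F n)) - N2 (T f)) \<le> 2 * B * N2 (\<lambda>z. F n z - f z)" for n
   proof -
    have "\<bar>N2 (T (F n)) - N2 (T f)\<bar> \<le> N2 (\<lambda>z. T (F n) z - T f z)"
     by (intro L2_norm_triangle_diff TL F2 f)
    also have "(\<lambda>z. T (F n) z - T f z) = T (\<lambda>z. F n z - f z)" by (simp add: T_def algebra_simps)
    also have "N2 \<dots> \<le> 2 * B * N2 (\<lambda>z. F n z - f z)" by (intro Tn L2_diff F2 f)
    finally show ?thesis by simp
   qed
  qed
  then have "(\<lambda>n. N2 (T (F n))) ----> N2 (T f)" by (simp add: LIM_zero_iff)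
  then have "(\<lambda>n. ennreal (c1 / t^2 * (N2 (T (F n)))^2)) ----> ennreal (c1 / t^2 * (N2 (T f))^2)"
   by (intro tendsto_intros)
  moreover have e: "ennreal (c1 / t^2 * (N2 (T h))^2) = ennreal (c1 / t^2) * L2_sqnorm lborel (T h)" if "h \<in> L2 lborel" for h
  proof -
   have "ennreal (c1 / t^2 * (N2 (T h))^2) = ennreal (c1 / t^2) * ennreal ((N2 (T h))^2)"
    using c1_pos by (intro ennreal_mult) auto
   then show ?thesis by (simp only: ennreal_L2_norm_sq[OF TL[OF that]])
  qed
  ultimately have "(\<lambda>n. ennreal (c1 / t^2) * L2_sqnorm lborel (T (F n))) ----> ennreal (c1 / t^2) * L2_sqnorm lborel (T f)"
   by (simp only: e[OF F2] e[OF f])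
  then have "ennreal (c1 / t^2) * L2_sqnorm lborel (T f) = liminf (\<lambda>n. ennreal (c1 / t^2) * L2_sqnorm lborel (T (F n)))"
   by (intro lim_imp_Liminf[symmetric]) auto
  also have "\<dots> \<le> liminf (\<lambda>n. energy d \<rho> (F n))" by (intro Liminf_mono always_eventually allI en FL)
  finally show ?thesis .
 qed
 then show ?thesis unfolding Cheeger_def L2_sqnorm_def T_def by (intro INF_greatest) auto
qed

section \<open>The two test functions: tent and wave\<close>

lemma Arg_mult_le: "a \<noteq> 0 \<Longrightarrow> b \<noteq> 0 \<Longrightarrow> \<bar>Arg (a * b)\<bar> \<le> \<bar>Arg a\<bar> + \<bar>Arg b\<bar>"
 using Arg_bounded[of a] Arg_bounded[of b] unfolding Arg_times' by auto

lemma Arg_power_le: "a \<noteq> 0 \<Longrightarrow> \<bar>Arg (a ^ n)\<bar> \<le> real n * \<bar>Arg a\<bar>"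
proof (induction n)
 case (Suc n)
 then show ?case using Arg_mult_le[of a "a ^ n"] by (simp add: algebra_simps)
qed simp

text \<open>|Arg (z ^ N)| is the distance of N times the angle from the multiples of 2 pi, hence
  N-Lipschitz in the angle.\<close>

lemma Arg_power_diff:
 assumes "z \<noteq> 0" "w \<noteq> 0"
 shows "\<bar>\<bar>Arg (w ^ N)\<bar> - \<bar>Arg (z ^ N)\<bar>\<bar> \<le> real N * \<bar>Arg (w / z)\<bar>"
proof -
 have "w ^ N = z ^ N * (w / z) ^ N" "z ^ N = w ^ N * (inverse (w / z)) ^ N"
  using assms by (auto simp: power_divide)
 then have "\<bar>Arg (w ^ N)\<bar> \<le> \<bar>Arg (z ^ N)\<bar> + \<bar>Arg ((w / z) ^ N)\<bar>" "\<bar>Arg (z ^ N)\<bar> \<le> \<bar>Arg (w ^ N)\<bar> + \<bar>Arg (inverse (w / z) ^ N)\<bar>"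
  using assms by (metis Arg_mult_le divide_eq_0_iff inverse_nonzero_iff_nonzero power_not_zero)+
 moreover have "\<bar>Arg ((w / z) ^ N)\<bar> \<le> real N * \<bar>Arg (w / z)\<bar>" using assms by (intro Arg_power_le) simp
 moreover have "\<bar>Arg (inverse (w / z) ^ N)\<bar> \<le> real N * \<bar>Arg (w / z)\<bar>"
 proof -
  have "\<bar>Arg (inverse (w / z))\<bar> = \<bar>Arg (w / z)\<bar>" by (simp only: Arg_inverse) simp
  then show ?thesis using Arg_power_le[of "inverse (w / z)" N] assms by simp
 qed
 ultimately show ?thesis by linarith
qed

definition tent :: "complex \<Rightarrow> real" where "tent z = 1 / 2 * max 0 (min 1 (2 - norm z))"

text \<open>A cutoff that falls to 0 at both edges of the annulus with slope \<open>j\<close>. At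
  each \<rho> strictly between 1 and 2 it equals \<rho> once \<open>j\<close> is large, which makes
  the tangential slope of the wave 1 there.\<close>

definition annular :: "real \<Rightarrow> real \<Rightarrow> real" where "annular j \<rho> = max 0 (min \<rho> (min (j * (\<rho> - 1)) (j * (2 - \<rho>))))"

abbreviation ann :: "nat \<Rightarrow> complex \<Rightarrow> real" where "ann j z \<equiv> annular (real j) (norm z)"

text \<open>A triangular wave in the angle with 7 * j periods. As pi \<le> 7 / 2, its second factor
  is at most 1 / (2 * j), so the slope \<open>j\<close> of the cutoff contributes at most 1/2
  radially, the half that the tent leaves over.\<close>

definition wave :: "nat \<Rightarrow> complex \<Rightarrow> real" where
 "wave j z = ann j z * (\<bar>Arg (z ^ (7 * j))\<bar> / (7 * real j))"

lemma annular_Lipschitz: assumes j: "j \<ge> 1" shows "\<bar>annular j a - annular j b\<bar> \<le> j * \<bar>a - b\<bar>"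
proof -
 have m: "\<bar>min x x' - min y y'\<bar> \<le> C" if "\<bar>x - y\<bar> \<le> C" "\<bar>x' - y'\<bar> \<le> C" for x x' y y' C :: real
  using that by simp
 have m0: "\<bar>max 0 x - max 0 y\<bar> \<le> C" if "\<bar>x - y\<bar> \<le> C" for x y C :: real using that by simp
 have "1 * \<bar>a - b\<bar> \<le> j * \<bar>a - b\<bar>" using j by (intro mult_right_mono) auto
 moreover have "\<bar>j * (a - 1) - j * (b - 1)\<bar> = j * \<bar>a - b\<bar>" "\<bar>j * (2 - a) - j * (2 - b)\<bar> = j * \<bar>a - b\<bar>"
  using j by (simp_all add: abs_mult abs_minus_commute flip: right_diff_distrib)
 ultimately show ?thesis unfolding annular_def by (intro m0 m) auto
qed

lemma annular_bounds: "0 \<le> annular j \<rho>" "\<rho> \<ge> 0 \<Longrightarrow> annular j \<rho> \<le> \<rho>" "j \<ge> 0 \<Longrightarrow> \<rho> \<le> 1 \<or> \<rho> \<ge> 2 \<Longrightarrow> annular j \<rho> = 0"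
proof -
 assume "j \<ge> 0" "\<rho> \<le> 1 \<or> \<rho> \<ge> 2"
 then have "j * (\<rho> - 1) \<le> 0 \<or> j * (2 - \<rho>) \<le> 0" by (auto simp: mult_nonneg_nonpos)
 then have "min \<rho> (min (j * (\<rho> - 1)) (j * (2 - \<rho>))) \<le> 0" by auto
 then show "annular j \<rho> = 0" by (simp add: annular_def)
qed (auto simp: annular_def)

text \<open>Radially the tent and the cutoff contribute 1/2 each; tangentially only the wave
  contributes, with slope at most 1.\<close>

lemma radial_test_wave:
 assumes j: "j \<ge> 1" and s: "\<bar>s\<bar> = 1"
 shows "radial_test (\<lambda>z. tent z + s * wave j z) 1"
proof
 have cz: "ann j z = 0" if "norm z \<le> 1 \<or> norm z \<ge> 2" for z :: complex using that by (intro annular_bounds(3)) auto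
 show "tent z + s * wave j z = tent 0 + s * wave j 0" if "norm z \<le> 1" for z
  using that cz[of z] cz[of 0] by (simp add: wave_def tent_def)
 show "tent z + s * wave j z = 0" if "norm z \<ge> 2" for z
  using that cz[of z] by (simp add: wave_def tent_def)
 fix z w :: complex assume zw: "z \<noteq> 0" "w \<noteq> 0"
 define N where "N = 7 * real j"
 have N: "N > 0" using j by (simp add: N_def)
 define A where "A = (\<lambda>z. \<bar>Arg (z ^ (7 * j))\<bar> / N)"
 have "\<bar>tent w - tent z\<bar> \<le> \<bar>norm w - norm z\<bar> / 2" unfolding tent_def by (auto simp: max_def abs_if)
 moreover have "\<bar>wave j w - wave j z\<bar> \<le> \<bar>norm w - norm z\<bar> / 2 + norm z * \<bar>Arg (w / z)\<bar>"
 proof -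
  have "wave j w - wave j z = (ann j w - ann j z) * A w + ann j z * (A w - A z)"
   unfolding wave_def A_def N_def[symmetric] by (simp only: left_diff_distrib right_diff_distrib)
  then have "\<bar>wave j w - wave j z\<bar> \<le> \<bar>ann j w - ann j z\<bar> * \<bar>A w\<bar> + ann j z * \<bar>A w - A z\<bar>"
   using abs_triangle_ineq[of "(ann j w - ann j z) * A w" "ann j z * (A w - A z)"]
    annular_bounds(1)[of "real j" "norm z"] by (simp add: abs_mult)
  also have "\<dots> \<le> (real j * \<bar>norm w - norm z\<bar>) * (1 / (2 * real j)) + norm z * \<bar>Arg (w / z)\<bar>"
  proof (intro add_mono mult_mono)
   show "\<bar>ann j w - ann j z\<bar> \<le> real j * \<bar>norm w - norm z\<bar>" using j by (intro annular_Lipschitz) simp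
   have "\<bar>Arg (w ^ (7 * j))\<bar> \<le> 7 / 2"
    using Arg_bounded[of "w ^ (7 * j)"] pi_approx by auto
   then have "\<bar>A w\<bar> \<le> 7 / 2 / N" using N unfolding A_def abs_divide by (intro frac_le) auto
   also have "\<dots> = 1 / (2 * real j)" by (simp add: N_def)
   finally show "\<bar>A w\<bar> \<le> 1 / (2 * real j)" .
   have "\<bar>A w - A z\<bar> = \<bar>\<bar>Arg (w ^ (7 * j))\<bar> - \<bar>Arg (z ^ (7 * j))\<bar>\<bar> / N"
    using N by (simp add: A_def flip: diff_divide_distrib)
   also have "\<dots> \<le> (real (7 * j) * \<bar>Arg (w / z)\<bar>) / N" using N by (intro divide_right_mono Arg_power_diff[OF zw]) simp
   finally show "\<bar>A w - A z\<bar> \<le> \<bar>Arg (w / z)\<bar>" using j by (simp add: N_def)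
  qed (auto intro: annular_bounds)
  finally show ?thesis using j by simp
 qed
 moreover have "\<bar>s * wave j w - s * wave j z\<bar> = \<bar>wave j w - wave j z\<bar>" using s by (simp add: abs_mult flip: right_diff_distrib)
 moreover have "\<bar>tent w + s * wave j w - (tent z + s * wave j z)\<bar> \<le> \<bar>tent w - tent z\<bar> + \<bar>s * wave j w - s * wave j z\<bar>" by simp
 ultimately show "\<bar>tent w + s * wave j w - (tent z + s * wave j z)\<bar> \<le> \<bar>norm w - norm z\<bar> + norm z * \<bar>Arg (w / z)\<bar>"
  by simp
qed simp

definition annulus :: "complex set" where "annulus = {z. 1 \<le> norm z \<and> norm z \<le> 2}"

lemma annulus_closed: "closed annulus" and annulus_borel [measurable]: "annulus \<in> sets borel"
proof -
 show "closed annulus" unfolding annulus_def by (intro closed_Collect_conj closed_Collect_le continuous_intros)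
 then show "annulus \<in> sets borel" by simp
qed

lemma annulus_finite: "emeasure lborel annulus < \<infinity>"
 using emeasure_lborel_cball_finite[of "0::complex" 2]
 by (intro le_less_trans[OF emeasure_mono[of annulus "cball 0 2"]]) (auto simp: annulus_def)

lemma AE_not_negligible: "closed S \<Longrightarrow> negligible S \<Longrightarrow> AE z in lborel. z \<notin> S"
 by (intro AE_not_in) (simp add: negligible_iff_null_sets null_sets_completion_iff)

lemma annular_limit:
 "(\<lambda>j. LB z. indicator annulus z * (ann j z / norm z)^2) ----> measure lborel annulus"
proof -
 have ai: "integrable lborel (indicator annulus :: complex \<Rightarrow> real)" using annulus_finite by simp
 have cm [measurable]: "annular j \<in> borel_measurable borel" for j unfolding annular_def[abs_def] by simp
 have "(\<lambda>j. LB z. indicator annulus z * (ann j z / norm z)^2) ----> (LB z. indicator annulus z)"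
 proof (rule integral_dominated_convergence[OF _ _ ai])
  have "AE z in lborel. z \<notin> sphere (0::complex) 1" "AE z in lborel. z \<notin> sphere (0::complex) 2"
   by (intro AE_not_negligible closed_sphere negligible_sphere)+
  then show "AE z in lborel. (\<lambda>j. indicator annulus z * (ann j z / norm z)^2) ----> (indicator annulus z :: real)"
  proof eventually_elim
   case (elim z)
   show ?case
   proof (cases "z \<in> annulus")
    case True
    then have n: "1 < norm z" "norm z < 2" using elim by (auto simp: annulus_def)
    define m where "m = min (norm z - 1) (2 - norm z)"
    have m: "m > 0" using n by (simp add: m_def)
    have "\<forall>\<^sub>F j in sequentially. norm z / m \<le> real j"
     by (rule eventually_sequentiallyI[of "nat \<lceil>norm z / m\<rceil>"]) linarith
    then have "\<forall>\<^sub>F j in sequentially. ann j z = norm z"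
    proof eventually_elim
     case (elim j)
     then have "norm z \<le> real j * m" using m by (simp add: divide_le_eq)
     also have "real j * m \<le> real j * (norm z - 1)" "real j * m \<le> real j * (2 - norm z)" by (auto intro!: mult_left_mono simp: m_def)
     then have "real j * m \<le> min (real j * (norm z - 1)) (real j * (2 - norm z))" by simp
     finally show ?case unfolding annular_def by simp
    qed
    then have "\<forall>\<^sub>F j in sequentially. indicator annulus z * (ann j z / norm z)^2 = (indicator annulus z :: real)"
     by eventually_elim (use n in auto)
    then show ?thesis by (rule tendsto_eventually)
   qed simp
  qed
  show "AE z in lborel. norm (indicator annulus z * (ann j z / norm z)^2) \<le> (indicator annulus z :: real)" for j
  proof (rule AE_I2)
   fix z :: complex
   have "ann j z / norm z \<le> 1" using annular_bounds(2)[of "norm z" "real j"] by (simp add: divide_le_eq_1)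
   then have "(ann j z / norm z)^2 \<le> 1" using annular_bounds(1)[of "real j" "norm z"] by (simp add: power_le_one)
   then show "norm (indicator annulus z * (ann j z / norm z)^2) \<le> (indicator annulus z :: real)" by (simp split: split_indicator)
  qed
 qed simp_all
 then show ?thesis using annulus_finite by simp
qed

text \<open>The exceptional set is covered by finitely many lines through the origin, those on which
  z ^ N is real.\<close>

lemma AE_Arg_power:
 assumes "N \<ge> 1" shows "AE z in lborel. z \<noteq> 0 \<and> Arg (z ^ N) \<noteq> 0 \<and> Arg (z ^ N) \<noteq> pi"
proof -
 define a where "a = (\<lambda>k. \<i> * cis (of_int k * pi / real N))"
 have "AE z in lborel. inner (a k) z \<noteq> 0" for k
  using AE_not_negligible[of "{z. inner (a k) z = 0}"] negligible_hyperplane[of "a k" 0] closed_hyperplane[of "a k" 0]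
  by (simp add: a_def)
 then have "AE z in lborel. \<forall>k\<in>{- int N..int N}. inner (a k) z \<noteq> 0" by (simp add: AE_finite_all)
 then show ?thesis
 proof eventually_elim
  case (elim z)
  have z: "z \<noteq> 0" using elim[rule_format, of 0] by auto
  have "Im (z ^ N) \<noteq> 0"
  proof
   assume "Im (z ^ N) = 0"
   moreover have zr: "z = rcis (norm z) (Arg z)" by (simp add: rcis_cmod_Arg)
   then have "z ^ N = rcis (norm z ^ N) (real N * Arg z)" by (metis DeMoivre2)
   ultimately have "sin (real N * Arg z) = 0" using z by simp
   then obtain k :: int where k: "real N * Arg z = of_int k * pi" by (auto simp: sin_zero_iff_int2)
   then have A: "Arg z = of_int k * pi / real N" using assms by (simp add: field_simps)
   have "\<bar>of_int k * pi\<bar> \<le> real N * pi" unfolding k[symmetric] abs_mult using Arg_bounded[of z] by (intro mult_mono) auto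
   then have "\<bar>k\<bar> \<le> int N" by (simp add: abs_mult)
   then have "k \<in> {- int N..int N}" by auto
   then have "inner (a k) z \<noteq> 0" using elim by simp
   moreover have "inner (a k) (rcis (norm z) (Arg z)) = 0" by (simp add: a_def A inner_complex_def)
   ultimately show False using zr by simp
  qed
  then show ?case using z Arg_eq_0[of "z ^ N"] Arg_eq_pi[of "z ^ N"] by (auto simp: complex_is_Real_iff)
 qed
qed

section \<open>Energies of tent and wave in the tangent cone\<close>

context tangent begin

lemma tent_wave_Lipschitz:
 assumes "j \<ge> 1" "\<bar>s\<bar> = 1"
 shows "\<bar>(tent x + s * wave j x) - (tent y + s * wave j y)\<bar> \<le> dY x y"
 by (rule radial_test_le[OF radial_test_wave[OF assms]])

lemma tent_wave_Lipbs: assumes "j \<ge> 1" "\<bar>s\<bar> = 1" shows "(\<lambda>z. tent z + s * wave j z) \<in> Lipbs"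
proof -
 interpret radial_test "\<lambda>z. tent z + s * wave j z" 1 by (rule radial_test_wave[OF assms])
 have "norm z \<le> 2" if "tent z + s * wave j z \<noteq> 0" for z using far[of z] that by force
 then show ?thesis
  unfolding Lipbs_def using order_trans[OF tent_wave_Lipschitz[OF assms] Y.d_upper] by auto
qed

text \<open>By \<open>radial_test_le\<close> the slope is at most 1, and off the annulus the
  function is locally constant.\<close>

lemma Cheeger_tent_wave:
 assumes j: "j \<ge> 1" and s: "\<bar>s\<bar> = 1"
 shows "Cheeger dY (\<lambda>_. c) (\<lambda>z. tent z + s * wave j z) \<le> ennreal (c * measure lborel annulus)"
proof -
 define u where "u = (\<lambda>z. tent z + s * wave j z)"
 interpret radial_test u 1 unfolding u_def by (rule radial_test_wave[OF j s])
 have l1: "lipc dY u z \<le> 1" for z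
  using Y.lipc_le[of u 1 z] tent_wave_Lipschitz[OF j s] by (simp add: u_def)
 have l0: "lipc dY u z = 0" if "z \<notin> annulus" for z
 proof -
  have "\<forall>\<^sub>F y in at z. u y = u z"
  proof (cases "norm z < 1")
   case True
   then have "\<forall>\<^sub>F y in at z. y \<in> ball 0 1" by (intro eventually_at_in_open') auto
   then show ?thesis by eventually_elim (metis True dist_0_norm less_imp_le mem_ball near)
  next
   case False
   then have z2: "norm z > 2" using that by (auto simp: annulus_def)
   then have "\<forall>\<^sub>F y in at z. y \<in> - cball 0 2" by (intro eventually_at_in_open') (auto simp: open_Compl)
   then show ?thesis by eventually_elim (use z2 far in auto)
  qed
  then have "\<forall>\<^sub>F y in at z. ennreal (\<bar>u y - u z\<bar> / dY y z) \<le> 0" by eventually_elim simp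
  then have "lipc dY u z \<le> 0" unfolding lipc_def by (rule Limsup_bounded)
  then show ?thesis by simp
 qed
 have uL: "u \<in> Lipbs" unfolding u_def by (rule tent_wave_Lipbs[OF j s])
 have "Cheeger dY (\<lambda>_. c) u \<le> energy dY (\<lambda>_. c) u" by (rule Y.Cheeger_le_energy[OF uL])
 also have "\<dots> \<le> (NN z. ennreal c * indicator annulus z)"
  unfolding energy_def
 proof (intro nn_integral_mono)
  fix z
  have "(lipc dY u z)^2 \<le> 1" using l1[of z] by (metis power_one power_mono zero_le)
  then show "(lipc dY u z)^2 * ennreal c \<le> ennreal c * indicator annulus z"
   using l0[of z] mult_right_mono[of "(lipc dY u z)^2" 1 "ennreal c"] by force
 qed
 also have "\<dots> = ennreal c * emeasure lborel annulus" by (rule nn_integral_cmult_indicator) simp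
 also have "\<dots> = ennreal (c * measure lborel annulus)"
  using annulus_finite c_pos by (simp add: emeasure_eq_ennreal_measure ennreal_mult)
 finally show ?thesis by (simp add: u_def)
qed

text \<open>Both functions are combinations of the sum and the difference, which are Lipschitz by
  \<open>tent_wave_Lipbs\<close>.\<close>

lemma wave_L2: "j \<ge> 1 \<Longrightarrow> wave j \<in> Lipbs" and tent_L2: "tent \<in> Lipbs"
proof -
 have *: "wave j \<in> Lipbs \<and> tent \<in> Lipbs" if j: "j \<ge> 1" for j
 proof -
  have p: "(\<lambda>z. tent z + 1 * wave j z) \<in> Lipbs" "(\<lambda>z. tent z + (- 1) * wave j z) \<in> Lipbs" by (intro tent_wave_Lipbs j; simp)+
  have "(\<lambda>z. 1/2 * ((tent z + 1 * wave j z) - (tent z + (- 1) * wave j z))) \<in> Lipbs"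
   "(\<lambda>z. 1/2 * ((tent z + 1 * wave j z) + (tent z + (- 1) * wave j z))) \<in> Lipbs"
   by (intro Lipbs_cmult Lipbs_diff Lipbs_add p)+
  then show ?thesis by simp
 qed
 show "j \<ge> 1 \<Longrightarrow> wave j \<in> Lipbs" "tent \<in> Lipbs" using * *[of 1] by auto
qed

text \<open>Any positive lower bound serves. Translation by 4 moves the unit disc, where the tent is
  1/2, out of the support; the weight 1/3 compensates that \<open>dY\<close> is at most 3 times the
  norm. The square of 1/3 * 1/2, the area pi and the factor c / 16 multiply to c * pi / 576.\<close>

lemma Cheeger_tent: "ennreal (c * pi / 576) \<le> Cheeger dY (\<lambda>_. c) tent"
proof -
 have "ennreal (c / 4^2) * (NN z. ennreal ((1 / 3 * (tent (z + of_real 4) - tent z))^2)) \<le> Cheeger dY (\<lambda>_. c) tent"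
 proof (rule Y.Cheeger_flow[where \<phi> = "\<lambda>t z. z + of_real t" and \<kappa> = "\<lambda>_. 1 / 3" and B = 1])
  show "tent \<in> L2 lborel" by (rule Lipbs_L2[OF tent_L2])
  show "(NN z. f (z + of_real u)) = (NN z. f z)" if "f \<in> borel_measurable borel" for f :: "complex \<Rightarrow> ennreal" and u
   using nn_integral_lborel_add[OF that, of "of_real u"] by (simp add: add.commute)
  show "1 / 3 * dY (z + of_real u) (z + of_real v) \<le> \<bar>u - v\<bar>" for z u v
   using Y.d_upper[of "z + of_real u" "z + of_real v"] by (simp flip: of_real_diff)
 qed auto
 moreover have "ennreal (c * pi / 576) \<le> ennreal (c / 4^2) * (NN z. ennreal ((1 / 3 * (tent (z + of_real 4) - tent z))^2))"
 proof -
  have "ennreal (pi / 36) = (NN z. ennreal (1 / 36) * indicator (ball (0::complex) 1) z)"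
   using Y.emeasure_lborel_ball_complex[of 1 0] by (subst nn_integral_cmult_indicator) (auto simp: ennreal_mult[symmetric])
  also have "\<dots> \<le> (NN z. ennreal ((1 / 3 * (tent (z + of_real 4) - tent z))^2))"
  proof (intro nn_integral_mono)
   fix z :: complex
   have "tent (z + of_real 4) = 0" "tent z = 1 / 2" if "norm z < 1"
    using that norm_triangle_ineq4[of "z + of_real 4" z] by (auto simp: tent_def)
   then have "(1 / 3 * (tent (z + of_real 4) - tent z))^2 = 1 / 36" if "norm z < 1"
    using that by (simp only:) (simp add: power2_eq_square)
   then show "ennreal (1 / 36) * indicator (ball 0 1) z \<le> ennreal ((1 / 3 * (tent (z + of_real 4) - tent z))^2)"
    by (cases "norm z < 1") simp_all
  qed
  finally have "ennreal (c / 4^2) * ennreal (pi / 36) \<le> ennreal (c / 4^2) * (NN z. ennreal ((1 / 3 * (tent (z + of_real 4) - tent z))^2))"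
   by (rule mult_left_mono) simp
  then show ?thesis using c_pos by (simp add: ennreal_mult[symmetric])
 qed
 ultimately show ?thesis by simp
qed

text \<open>For rotations smaller than the distance \<open>m\<close> of the angle of z ^ (7 * j)
  from the kinks 0 and pi, the triangular wave is exactly linear, and the cutoff is unchanged by
  rotation.\<close>

lemma wave_rotation:
 assumes j: "j \<ge> 1" and z: "z \<noteq> 0" "Arg (z ^ (7 * j)) \<noteq> 0" "Arg (z ^ (7 * j)) \<noteq> pi"
 shows "\<forall>\<^sub>F n in sequentially. \<bar>wave j (cis (invS n) * z) - wave j z\<bar> = ann j z / real (Suc n)"
proof -
 define N where "N = 7 * j"
 define \<alpha> where "\<alpha> = Arg (z ^ N)"
 have \<alpha>: "\<alpha> \<noteq> 0" "- pi < \<alpha>" "\<alpha> < pi" using z Arg_bounded[of "z ^ N"] by (auto simp: \<alpha>_def N_def)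
 define m where "m = min \<bar>\<alpha>\<bar> (pi - \<bar>\<alpha>\<bar>)"
 have m: "m > 0" using \<alpha> by (auto simp: m_def)
 have "\<forall>\<^sub>F n in sequentially. real N / real (Suc n) < m"
  using LIMSEQ_Suc[OF lim_const_over_n[of "real N"]] m by (rule order_tendstoD(2))
 then show ?thesis
 proof eventually_elim
  case (elim n)
  define t where "t = invS n"
  have Nt: "0 < real N * t" "real N * t < m" using elim j by (auto simp: t_def N_def)
  have zN: "z ^ N = rcis (norm (z ^ N)) \<alpha>" by (simp add: \<alpha>_def rcis_cmod_Arg)
  have "(cis t * z) ^ N = cis (real N * t) * z ^ N" by (simp only: power_mult_distrib Complex.DeMoivre)
  also have "\<dots> = cis (real N * t) * rcis (norm (z ^ N)) \<alpha>" by (rule arg_cong[OF zN])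
  also have "\<dots> = rcis (norm (z ^ N)) (real N * t + \<alpha>)" by (simp add: rcis_def cis_mult[symmetric] mult_ac)
  finally have "(cis t * z) ^ N = rcis (norm (z ^ N)) (real N * t + \<alpha>)" .
  moreover have "real N * t + \<alpha> \<in> {- pi<..pi}" using Nt \<alpha> by (auto simp: m_def)
  ultimately have A: "Arg ((cis t * z) ^ N) = real N * t + \<alpha>" using z by (intro Arg_unique'[of "norm (z ^ N)"]) auto
  have "\<bar>\<bar>real N * t + \<alpha>\<bar> - \<bar>\<alpha>\<bar>\<bar> = real N * t" using Nt by (auto simp: m_def)
  moreover have "wave j (cis t * z) - wave j z = ann j z * ((\<bar>real N * t + \<alpha>\<bar> - \<bar>\<alpha>\<bar>) / real N)"
   unfolding wave_def N_def[symmetric] A \<alpha>_def[symmetric] by (simp add: norm_mult N_def diff_divide_distrib right_diff_distrib)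
  ultimately have "\<bar>wave j (cis t * z) - wave j z\<bar> = ann j z * (real N * t / real N)"
   using annular_bounds(1)[of "real j" "norm z"] by (simp add: abs_mult)
  then show ?case using j by (simp add: N_def t_def)
 qed
qed

text \<open>By \<open>dY_arc\<close> the rotation flow has speed at most norm z, whence the weight 1
  / norm z on the annulus. The bound holds for every rotation by 1 / (n + 1); Fatou's lemma and
  \<open>wave_rotation\<close> evaluate it as n tends to infinity.\<close>

lemma Cheeger_wave:
 assumes j: "j \<ge> 1"
 shows "ennreal (c * (LB z. indicator annulus z * (ann j z / norm z)^2)) \<le> Cheeger dY (\<lambda>_. c) (wave j)"
proof -
 define t where "t = (\<lambda>n. invS n)"
 have t: "t n > 0" for n by (simp add: t_def)
 define \<kappa> where "\<kappa> = (\<lambda>z. indicator annulus z / norm (z::complex))"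
 have \<kappa>m [measurable]: "\<kappa> \<in> borel_measurable borel" unfolding \<kappa>_def by simp
 have wm [measurable]: "wave j \<in> borel_measurable borel" by (rule Lipbs_borel[OF wave_L2[OF j]])
 have cutm [measurable]: "annular i \<in> borel_measurable borel" for i unfolding annular_def[abs_def] by simp
 have arc: "dY (cis u * z) (cis v * z) \<le> norm z * \<bar>u - v\<bar>" for u v z
 proof -
  have *: "dY (cis u * z) (cis v * z) \<le> norm z * \<bar>u - v\<bar>" if "u \<le> v" for u v
   using dY_arc[of "v - u" "cis u * z"] that by (simp add: norm_mult mult.assoc[symmetric] cis_mult)
  show ?thesis using *[of u v] *[of v u] by (cases "u \<le> v") (auto simp: Y.d_sym[of "cis u * z"])
 qed
 have *: "ennreal (c / (t n)^2) * (NN z. ennreal ((\<kappa> z * (wave j (cis (t n) * z) - wave j z))^2)) \<le> Cheeger dY (\<lambda>_. c) (wave j)" for n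
 proof (rule Y.Cheeger_flow[where \<phi> = "\<lambda>t z. cis t * z" and \<kappa> = \<kappa> and B = 1])
  show "wave j \<in> L2 lborel" by (rule Lipbs_L2[OF wave_L2[OF j]])
  show "(\<lambda>p. cis (fst p) * snd p) \<in> borel_measurable (borel \<Otimes>\<^sub>M borel)"
   unfolding borel_prod by (intro borel_measurable_continuous_onI continuous_intros)
  show "\<kappa> z \<le> 1" for z by (auto simp: \<kappa>_def annulus_def divide_le_eq split: split_indicator)
  show "\<kappa> z * dY (cis u * z) (cis v * z) \<le> \<bar>u - v\<bar>" for z u v
  proof (cases "z \<in> annulus")
   case True
   then have "norm z > 0" by (auto simp: annulus_def)
   then show ?thesis using arc[of u z v] True by (simp add: \<kappa>_def divide_le_eq mult.commute)
  qed (simp add: \<kappa>_def)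
  show "\<kappa> (cis u * z) = \<kappa> z" for u z by (simp add: \<kappa>_def annulus_def norm_mult indicator_def)
 qed (auto simp: \<kappa>_def t intro: nn_integral_rotation)
 define G where "G = (\<lambda>n z. ennreal c * ennreal ((\<kappa> z * (wave j (cis (t n) * z) - wave j z) / t n)^2))"
 have Gm [measurable]: "G n \<in> borel_measurable borel" for n unfolding G_def by simp
 have G: "(NN z. G n z) \<le> Cheeger dY (\<lambda>_. c) (wave j)" for n
 proof -
  have "G n z = ennreal (c / (t n)^2) * ennreal ((\<kappa> z * (wave j (cis (t n) * z) - wave j z))^2)" for z
   unfolding G_def using c_pos t[of n] by (simp add: ennreal_mult[symmetric] power_divide)
  then show ?thesis using * by (simp add: nn_integral_cmult)
 qed
 have "ennreal (c * (LB z. indicator annulus z * (ann j z / norm z)^2))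
   = (NN z. ennreal (c * (indicator annulus z * (ann j z / norm z)^2)))"
 proof -
  have i: "integrable lborel (\<lambda>z. indicator annulus z * (ann j z / norm z)^2)"
  proof (rule Bochner_Integration.integrable_bound)
   show "integrable lborel (indicator annulus :: complex \<Rightarrow> real)" using annulus_finite by simp
   have "(ann j z / norm z)^2 \<le> 1" for z :: complex
    using annular_bounds(1)[of "real j" "norm z"] annular_bounds(2)[of "norm z" "real j"] by (intro power_le_one) (auto simp: divide_le_eq_1)
   then show "AE z in lborel. norm (indicator annulus z * (ann j z / norm z)^2) \<le> norm (indicator annulus z :: real)"
    by (intro AE_I2) (auto split: split_indicator)
  qed simp
  show ?thesis using c_pos i by (subst nn_integral_eq_integral) auto
 qed
 also have "\<dots> \<le> (NN z. liminf (\<lambda>n. G n z))"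
 proof (rule nn_integral_mono_AE)
  have "AE z in lborel. z \<noteq> 0 \<and> Arg (z ^ (7 * j)) \<noteq> 0 \<and> Arg (z ^ (7 * j)) \<noteq> pi" using j by (intro AE_Arg_power) simp
  then show "AE z in lborel. ennreal (c * (indicator annulus z * (ann j z / norm z)^2)) \<le> liminf (\<lambda>n. G n z)"
  proof eventually_elim
   case (elim z)
   have "\<forall>\<^sub>F n in sequentially. ennreal (c * (indicator annulus z * (ann j z / norm z)^2)) \<le> G n z"
    using wave_rotation[OF j elim[THEN conjunct1] elim[THEN conjunct2, THEN conjunct1] elim[THEN conjunct2, THEN conjunct2]]
   proof eventually_elim
    case (elim n)
    have "((\<kappa> z * (wave j (cis (t n) * z) - wave j z) / t n)^2) = (\<kappa> z * (\<bar>wave j (cis (t n) * z) - wave j z\<bar> / t n))^2"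
     by (simp add: power_mult_distrib power_divide)
    also have "\<bar>wave j (cis (t n) * z) - wave j z\<bar> / t n = ann j z" using elim by (simp add: t_def)
    also have "(\<kappa> z * ann j z)^2 = indicator annulus z * (ann j z / norm z)^2"
     by (simp add: \<kappa>_def split: split_indicator)
    finally show ?case unfolding G_def using c_pos by (simp add: ennreal_mult)
   qed
   then show ?case by (rule Liminf_bounded)
  qed
 qed
 also have "\<dots> \<le> liminf (\<lambda>n. NN z. G n z)" by (rule nn_integral_liminf) simp
 also have "\<dots> \<le> limsup (\<lambda>n. NN z. G n z)" by (rule Liminf_le_Limsup) simp
 also have "\<dots> \<le> Cheeger dY (\<lambda>_. c) (wave j)" by (intro Limsup_bounded always_eventually allI G)
 finally show ?thesis .
qed

text \<open>The L2 parts satisfy the parallelogram identity, so the Cheeger energies would have to.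
  Sum and difference have energy at most c times the area of the annulus; the wave alone has
  asymptotically this energy, and the tent adds a fixed positive amount.\<close>

lemma not_infinitesimally_Hilbertian_Y: "\<not> infinitesimally_Hilbertian Y.X Y.m"
proof
 assume H: "infinitesimally_Hilbertian Y.X Y.m"
 define I where "I = (\<lambda>j. LB z. indicator annulus z * (ann j z / norm z)^2)"
 have "pi / 576 + I j \<le> measure lborel annulus" if j: "j \<ge> 1" for j
 proof -
  define C where "C = (\<lambda>f. enn2real (Cheeger dY (\<lambda>_. c) f))"
  have L: "tent \<in> Lipbs" "wave j \<in> Lipbs" using tent_L2 wave_L2[OF j] by auto
  have p: "(\<lambda>z. tent z + wave j z) \<in> Lipbs" "(\<lambda>z. tent z - wave j z) \<in> Lipbs" "(\<lambda>z. - wave j z) \<in> Lipbs"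
   using Lipbs_add[OF L] Lipbs_diff[OF L] Lipbs_cmult[OF L(2), of "- 1"] by auto
  note S = Y.Lipbs_Sob
  note L2 = Y.Lipbs_L2_M
  have par: "(Sob_norm dY (\<lambda>_. c) (\<lambda>z. tent z + wave j z))^2 + (Sob_norm dY (\<lambda>_. c) (\<lambda>z. tent z - wave j z))^2
    = 2 * (Sob_norm dY (\<lambda>_. c) tent)^2 + 2 * (Sob_norm dY (\<lambda>_. c) (wave j))^2"
   by (rule Y.infinitesimally_Hilbertian_parallelogram[OF H]) (intro S L p)+
  have "(L2_norm Y.M (\<lambda>z. tent z + wave j z))^2 + (L2_norm Y.M (\<lambda>z. tent z - wave j z))^2
    = (LINT z|Y.M. (tent z + wave j z)^2 + (tent z - wave j z)^2)"
   using L2_integrable[OF L2[OF p(1)]] L2_integrable[OF L2[OF p(2)]] by (simp add: L2_norm_sq L2 p)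
  also have "\<dots> = (LINT z|Y.M. 2 * (tent z)^2 + 2 * (wave j z)^2)"
   by (intro Bochner_Integration.integral_cong) (auto simp: power2_sum power2_diff)
  also have "\<dots> = 2 * (L2_norm Y.M tent)^2 + 2 * (L2_norm Y.M (wave j))^2"
   using L2_integrable[OF L2[OF L(1)]] L2_integrable[OF L2[OF L(2)]] by (simp add: L2_norm_sq L2 L)
  finally have "C (\<lambda>z. tent z + wave j z) + C (\<lambda>z. tent z - wave j z) = 2 * C tent + 2 * C (wave j)"
   using par unfolding C_def by (simp add: Y.Sob_norm_sq S L p)
  moreover have "C (\<lambda>z. tent z + wave j z) \<le> c * measure lborel annulus" "C (\<lambda>z. tent z - wave j z) \<le> c * measure lborel annulus"
   using enn2real_mono[OF Cheeger_tent_wave[OF j, of 1]] enn2real_mono[OF Cheeger_tent_wave[OF j, of "- 1"]] c_pos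
   by (auto simp: C_def)
  moreover have "c * pi / 576 \<le> C tent" "c * I j \<le> C (wave j)"
   using enn2real_mono[OF Cheeger_tent] enn2real_mono[OF Cheeger_wave[OF j]] Y.Cheeger_finite[OF S[OF L(1)]] Y.Cheeger_finite[OF S[OF L(2)]] c_pos
   by (auto simp: C_def I_def)
  ultimately have "c * (pi / 576 + I j) \<le> c * measure lborel annulus" by (simp add: distrib_left)
  then show ?thesis using c_pos by simp
 qed
 then have "\<forall>\<^sub>F j in sequentially. pi / 576 + I j \<le> measure lborel annulus" by (rule eventually_sequentiallyI)
 moreover have "(\<lambda>j. pi / 576 + I j) ----> pi / 576 + measure lborel annulus"
  unfolding I_def by (intro tendsto_intros annular_limit)
 ultimately have "pi / 576 + measure lborel annulus \<le> measure lborel annulus"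
  by (intro tendsto_upperbound[of _ _ sequentially]) auto
 then show False using pi_gt_zero by simp
qed

end

theorem theorem1p2:
  shows "\<exists>(X :: (nat \<Rightarrow> real) metric) (m :: (nat \<Rightarrow> real) measure) (xbar :: nat \<Rightarrow> real).
    metric_measure_space X m \<and>
    infinitesimally_Hilbertian X m \<and>
    rectifiable X m \<and>
    Ahlfors_regular X m \<and>
    PI_space X m \<and>
    xbar \<in> mspace X \<and>
    (\<exists>(Y :: (nat \<Rightarrow> real) metric) \<mu> q.
       (Y, \<mu>, q) \<in> Tan X m xbar \<and> \<not> infinitesimally_Hilbertian Y \<mu>) \<and>
    Riemannian_manifold (submetric X (mspace X - {xbar})) (restrict_space m (mspace X - {xbar}))"
proof -
  obtain r dY N where "tangent r dY N" using tangent_exists by blast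
  then interpret tangent r dY N .
  have "iota 0 \<in> mspace X.X" by simp
  with X.metric_measure_space_X X.infinitesimally_Hilbertian_X X.rectifiable_X X.Ahlfors_X X.PI_space_X
    Y_in_Tan not_infinitesimally_Hilbertian_Y Riemannian_manifold_X
  show ?thesis by blast
qed

end
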